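(* Let $f$ and $g$ be two distinct normalized Hecke-Maass cusp forms of weight zero for $SL_2(\mathbb{Z})$ with Laplacian eigenvalues $\frac14+u^2$ and $\frac14+v^2$ respectively ($u,v>0$), and let $n_{f,g}$ be the smallest positive integer $n$ with $\lambda_f(n)\lambda_g(n)<0$. Then $$n_{f,g}\ll \max\left\{\exp\Big(\tilde c\,\log^2\big(\sqrt{\max\{q(\mathrm{sym}^2 f),q(\mathrm{sym}^2 g)\}}\big)\Big),\ (1+u+v)^{5.34}\right\},$$ where $\tilde c$ is an absolute constant and the implied constant is absolute.
   Context: A Hecke-Maass cusp form $f$ of weight zero for $SL_2(\mathbb{Z})$ with Laplacian eigenvalue $\frac14+u^2$ ($u>0$ real) has a Fourier expansion $f(x+iy)=\sqrt{y}\sum_{n\neq 0}\lambda_f(n)K_{iu}(2\pi|n|y)e^{2\pi i n x}$, where $K_{iu}$ is the MacDonald-Bessel function; it is a Hecke eigenform with real coefficients, normalized by $\lambda_f(1)=1$. The analytic conductors of the symmetric square $L$-functions are $q(\mathrm{sym}^2 f)=3(3+u)^2$ and $q(\mathrm{sym}^2 g)=3(3+v)^2$. *)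

theory Defs
  imports "HOL-Analysis.Analysis"
begin

definition upper_half_plane :: "complex set" where
  "upper_half_plane = {z. Im z > 0}"

definition dir_deriv :: "complex \<Rightarrow> (complex \<Rightarrow> complex) \<Rightarrow> complex \<Rightarrow> complex" where
  "dir_deriv w f z = vector_derivative (\<lambda>t::real. f (z + of_real t * w)) (at 0)"

text \<open>Real smoothness: every iterated partial derivative in the directions \<open>x\<close> (that is, \<open>1\<close>)
  and \<open>y\<close> (that is, \<open>\<i>\<close>) is (real) Frechet differentiable on the open set \<open>S\<close>.\<close>

definition smooth_on_open :: "complex set \<Rightarrow> (complex \<Rightarrow> complex) \<Rightarrow> bool" where
  "smooth_on_open S f \<longleftrightarrow>
     open S \<and> (\<forall>ws. set ws \<subseteq> {1, \<i>} \<longrightarrow> foldr dir_deriv ws f differentiable_on S)"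

definition hyperbolic_laplacian :: "(complex \<Rightarrow> complex) \<Rightarrow> complex \<Rightarrow> complex" where
  "hyperbolic_laplacian f z =
     - of_real ((Im z)\<^sup>2) * (dir_deriv 1 (dir_deriv 1 f) z + dir_deriv \<i> (dir_deriv \<i> f) z)"

text \<open>The MacDonald--Bessel function \<open>K\<^sub>\<nu>(y)\<close>, \<open>y > 0\<close>, by its standard integral representation.\<close>

definition macdonald_K :: "complex \<Rightarrow> real \<Rightarrow> complex" where
  "macdonald_K \<nu> y = (LBINT t:{0..}. of_real (exp (- y * cosh t)) * cosh (\<nu> * of_real t))"

text \<open>The weight-zero Hecke operator \<open>T\<^sub>n\<close> for \<open>n \<ge> 1\<close>, with the scaling for which its
  eigenvalue on a form with first coefficient \<open>1\<close> is the \<open>n\<close>-th coefficient.\<close>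

definition hecke_op :: "nat \<Rightarrow> (complex \<Rightarrow> complex) \<Rightarrow> complex \<Rightarrow> complex" where
  "hecke_op n f z =
     (\<Sum>d | d dvd n. \<Sum>b<d. f ((of_nat (n div d) * z + of_nat b) / of_nat d)) / of_real (sqrt (real n))"

text \<open>Only the values of \<open>f\<close> on the upper half plane matter. The spectral parameter is \<open>u\<close>,
  the Laplacian eigenvalue is \<open>1/4 + u\<^sup>2\<close>.\<close>

locale maass_cusp_form =
  fixes u :: real and f :: "complex \<Rightarrow> complex"
  assumes smooth: "smooth_on_open upper_half_plane f"
    and modular: "\<And>(a::int) b c d z. a * d - b * c = 1 \<Longrightarrow> z \<in> upper_half_plane \<Longrightarrow>
      f ((of_int a * z + of_int b) / (of_int c * z + of_int d)) = f z"
    and eigenfunction: "\<And>z. z \<in> upper_half_plane \<Longrightarrow>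
      hyperbolic_laplacian f z = of_real (1 / 4 + u\<^sup>2) * f z"
    and moderate_growth: "\<exists>A (N::nat). \<forall>z. Im z \<ge> 1 \<longrightarrow> norm (f z) \<le> A * Im z ^ N"
    and cuspidal: "\<And>y. y > 0 \<Longrightarrow> integral {0..1} (\<lambda>x. f (Complex x y)) = 0"

text \<open>The coefficients \<open>lam n\<close>, \<open>n \<noteq> 0\<close>, are determined by \<open>f\<close> and \<open>u\<close> through the Fourier
  expansion; \<open>lam 0\<close> is irrelevant.\<close>

locale normalized_hecke_maass_cusp_form = maass_cusp_form +
  fixes lam :: "int \<Rightarrow> real"
  assumes fourier: "\<And>x y. y > 0 \<Longrightarrow>
      ((\<lambda>n::int. of_real (sqrt y) * of_real (lam n)
                  * macdonald_K (\<i> * of_real u) (2 * pi * \<bar>of_int n\<bar> * y)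
                  * exp (2 * of_real pi * \<i> * of_int n * of_real x))
        has_sum f (Complex x y)) (UNIV - {0})"
    and hecke_eigenform: "\<And>n. n \<ge> 1 \<Longrightarrow>
      \<exists>\<mu>. \<forall>z\<in>upper_half_plane. hecke_op n f z = \<mu> * f z"
    and normalized: "lam 1 = 1"

definition sym2_conductor :: "real \<Rightarrow> real" where
  "sym2_conductor u = 3 * (3 + u)\<^sup>2"

definition first_opposite_sign :: "(int \<Rightarrow> real) \<Rightarrow> (int \<Rightarrow> real) \<Rightarrow> nat" where
  "first_opposite_sign lam_f lam_g = (LEAST n. n > 0 \<and> lam_f (int n) * lam_g (int n) < 0)"

end

theory Submission
  imports Defs "HOL-Probability.Probability" "HOL-Real_Asymp.Real_Asymp"
begin

text \<open>The product \<open>lam_f lam_g\<close> is studied through the Rankin--Selberg series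
 \<open>S(t) = \<Sum> lam_f(n) lam_g(n) V(t m\<^sup>2 n)\<close>, obtained by unfolding a product of the two forms (or a weight-two
 differential built from them) against the theta function of the lattice generated by \<open>z\<close> and \<open>1\<close>. Poisson
 summation gives \<open>S(t) = S(1/t) / t^w\<close>; the pole of the Eisenstein series does not contribute: for forms of
 opposite parity or different eigenvalue because the differential is used, otherwise because distinct Hecke
 eigenforms are orthogonal. Since \<open>V\<close> solves a linear differential equation with right side a constant times
 \<open>a\<^sup>2 V(a)\<close>, applying the corresponding operators turns \<open>V(a)\<close> into \<open>a^(2k) V(a)\<close> on one side, while the dual side
 remains exponentially small. As \<open>V\<close> is positive at large arguments, the coefficients cannot all be
 nonnegative up to a fixed power of \<open>1 + u + v\<close>, which the exponential term of the bound dominates.\<close>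

text \<open>The obstacle is the sign of V: the Bessel functions oscillate below the size of the
  spectral parameters, so V is known to be positive only for sqrt a >= j with j of order (1 + u +
  v)^2. The weight a^(2k) overcomes the range below: a term with a = 4 j^2 outweighs those with a <=
  j^2 by a factor 16^k, while V loses only exp (O(j)) there, so k = 100 j is enough. The price is
  paid on the dual side, where an operator of order 4k costs about (4k)!; with t = 1 / k^4 the decay
  exp (- pi k^2) wins. Signs therefore matter only for n <= k^8, of order (1 + u + v)^16. For
  absolute constants the bounds in the final comparison must not depend on the forms: the
  coefficient bound n^2 results from comparing T_n f with the exact supremum of |f|, and V is
  bounded above uniformly in u and v. No L-function is continued: a partition of unity
  \<open>rho\<close> replaces the fundamental domain, the sum over m is the factor zeta (2 s), and
  the differential equation of V is the recursion of its four Gamma factors under s -> s + 2,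
  expressed without them.\<close>

section \<open>Differentiation under the integral sign, interchange of sums and integrals\<close>

text \<open>Dominated convergence along an arbitrary sequence tending to \<open>s0\<close>: the mean
  value theorem bounds all difference quotients by \<open>g\<close>. Measurability of the derivative
  is inherited from the quotients, which also yields the second conclusion.\<close>

lemma has_real_derivative_integral:
 fixes f f' :: "'a => real => real"
 assumes e: "e > 0"
 and int: "!!s. \<bar>s - s0\<bar> < e ==> integrable M (%x. f x s)"
 and der: "!!x s. x \<in> space M ==> \<bar>s - s0\<bar> < e ==> (f x has_real_derivative f' x s) (at s)"
 and bd: "!!x s. x \<in> space M ==> \<bar>s - s0\<bar> < e ==> \<bar>f' x s\<bar> <= g x"
 and g: "integrable M g"
 shows "((%s. \<integral>x. f x s \<partial>M) has_real_derivative (\<integral>x. f' x s0 \<partial>M)) (at s0)"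
 and "integrable M (%x. f' x s0)"
proof -
 have lim: "(%n. (\<integral>x. f x (X n) \<partial>M - \<integral>x. f x s0 \<partial>M) / (X n - s0)) \<longlonglongrightarrow> (\<integral>x. f' x s0 \<partial>M)
 \<and> integrable M (%x. f' x s0)"
 if X: "X \<longlonglongrightarrow> s0" "!!n. X n ~= s0" "!!n. \<bar>X n - s0\<bar> < e" for X :: "nat => real"
 proof -
 have i0: "integrable M (%x. f x s0)" using int[of s0] e by simp
 have eq: "(\<integral>x. f x (X n) \<partial>M - \<integral>x. f x s0 \<partial>M) / (X n - s0) = (\<integral>x. (f x (X n) - f x s0) / (X n - s0) \<partial>M)" for n
 using int[OF X(3)] i0 by simp
 have ptw: "(%n. (f x (X n) - f x s0) / (X n - s0)) \<longlonglongrightarrow> f' x s0" if "x \<in> space M" for x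
 proof -
 have "((%s. (f x s - f x s0) / (s - s0)) \<longlongrightarrow> f' x s0) (at s0)"
 using der[OF that, of s0] e by (simp add: has_field_derivative_iff)
 moreover have "filterlim X (at s0) sequentially"
 using X by (auto simp: filterlim_at)
 ultimately show ?thesis by (rule filterlim_compose)
 qed
 have bound: "\<bar>(f x (X n) - f x s0) / (X n - s0)\<bar> <= g x" if "x \<in> space M" for x n
 proof -
 have "\<bar>f x (X n) - f x s0\<bar> <= g x * \<bar>X n - s0\<bar>"
 proof -
 have "norm (f x (X n) - f x s0) <= g x * norm (X n - s0)"
 proof (rule field_differentiable_bound[where S = "ball s0 e" and f' = "f' x"])
 show "(f x has_field_derivative f' x z) (at z within ball s0 e)" if "z \<in> ball s0 e" for z
 using that der[OF \<open>x \<in> space M\<close>, of z] by (auto simp: dist_real_def abs_minus_commute intro: DERIV_subset)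
 show "norm (f' x z) <= g x" if "z \<in> ball s0 e" for z
 using that bd[OF \<open>x \<in> space M\<close>, of z] by (auto simp: dist_real_def abs_minus_commute)
 qed (use X(3)[of n] e in \<open>auto simp: dist_real_def abs_minus_commute\<close>)
 thus ?thesis by simp
 qed
 thus ?thesis using X(2)[of n] by (simp add: abs_divide field_simps)
 qed
 have m: "(%x. (f x (X n) - f x s0) / (X n - s0)) \<in> borel_measurable M" for n
 using int[OF X(3)] i0 by (intro borel_measurable_integrable integrable_divide Bochner_Integration.integrable_diff)
 have m': "(%x. f' x s0) \<in> borel_measurable M"
 by (rule borel_measurable_LIMSEQ_real[OF ptw m]) auto
 have "integrable M (%x. f' x s0)"
 proof (rule Bochner_Integration.integrable_bound[OF g m'])
 show "AE x in M. norm (f' x s0) <= norm (g x)"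
 proof (rule AE_I2)
 fix x assume "x \<in> space M"
 from bd[OF this, of s0] e show "norm (f' x s0) <= norm (g x)" by simp
 qed
 qed
 moreover have "(%n. \<integral>x. (f x (X n) - f x s0) / (X n - s0) \<partial>M) \<longlonglongrightarrow> (\<integral>x. f' x s0 \<partial>M)"
 by (rule integral_dominated_convergence[OF m' m g]) (use ptw bound in auto)
 ultimately show ?thesis unfolding eq by simp
 qed
 have "((%s. (\<integral>x. f x s \<partial>M - \<integral>x. f x s0 \<partial>M) / (s - s0)) \<longlongrightarrow> (\<integral>x. f' x s0 \<partial>M)) (at s0)"
 unfolding tendsto_at_iff_sequentially comp_def
 proof (intro allI impI)
 fix X :: "nat => real" assume X: "\<forall>i. X i \<in> UNIV - {s0}" "X \<longlonglongrightarrow> s0"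
 then obtain N where N: "!!n. n >= N ==> \<bar>X n - s0\<bar> < e"
 using e unfolding LIMSEQ_iff by fastforce
 have "(%n. (\<integral>x. f x (X (n + N)) \<partial>M - \<integral>x. f x s0 \<partial>M) / (X (n + N) - s0)) \<longlonglongrightarrow> (\<integral>x. f' x s0 \<partial>M)"
 using lim[of "%n. X (n + N)"] X N by (auto intro: LIMSEQ_ignore_initial_segment)
 thus "(%n. (\<integral>x. f x (X n) \<partial>M - \<integral>x. f x s0 \<partial>M) / (X n - s0)) \<longlonglongrightarrow> (\<integral>x. f' x s0 \<partial>M)"
 by (rule LIMSEQ_offset)
 qed
 thus "((%s. \<integral>x. f x s \<partial>M) has_real_derivative (\<integral>x. f' x s0 \<partial>M)) (at s0)"
 by (simp add: has_field_derivative_iff)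
 \<comment> \<open>The integrability claim needs one concrete sequence that stays inside the
   interval and avoids \<open>s0\<close>.\<close>
 have "(%n. s0 + e / 2 * inverse (real (Suc n))) \<longlonglongrightarrow> s0 + e / 2 * 0"
 by (intro tendsto_intros LIMSEQ_inverse_real_of_nat)
 moreover have "\<bar>e / 2 * inverse (real (Suc n))\<bar> < e" for n
 proof -
 have "e / 2 * inverse (real (Suc n)) <= e / 2 * 1"
 using e by (intro mult_left_mono) (auto simp: field_simps)
 thus ?thesis using e by (simp add: abs_mult)
 qed
 ultimately show "integrable M (%x. f' x s0)"
 using lim[of "%n. s0 + e / 2 * inverse (real (Suc n))"] e by simp
qed

text \<open>Series are treated throughout as integrals over \<open>count_space\<close>, so
  interchanging a sum with an integral becomes an instance of Fubini; countability of
  \<open>I\<close> supplies joint measurability and sigma-finiteness.\<close>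

lemma integral_count_space_swap:
 fixes f :: "'i => 'a => 'b::{banach,second_countable_topology}"
 assumes M: "sigma_finite_measure M" and I: "countable I"
 and [measurable]: "!!i. i \<in> I ==> f i \<in> borel_measurable M"
 and fin: "(\<integral>\<^sup>+i. \<integral>\<^sup>+x. norm (f i x) \<partial>M \<partial>count_space I) < \<infinity>"
 shows "integrable M (%x. \<integral>i. f i x \<partial>count_space I)"
 and "integrable (count_space I) (%i. \<integral>x. f i x \<partial>M)"
 and "(\<integral>x. \<integral>i. f i x \<partial>count_space I \<partial>M) = (\<integral>i. \<integral>x. f i x \<partial>M \<partial>count_space I)"
 and "AE x in M. integrable (count_space I) (%i. f i x)"
proof -
 interpret M: sigma_finite_measure M by fact
 interpret C: sigma_finite_measure "count_space I"
 using I by (rule sigma_finite_measure_count_space_countable)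
 interpret P: pair_sigma_finite "count_space I" M ..
 have [measurable]: "case_prod f \<in> borel_measurable (count_space I \<Otimes>\<^sub>M M)"
 using I by (intro measurable_pair_measure_countable1) auto
 have int: "integrable (count_space I \<Otimes>\<^sub>M M) (case_prod f)"
 unfolding integrable_iff_bounded
 using fin by (auto simp: M.nn_integral_fst[symmetric] split_beta')
 show "integrable M (%x. \<integral>i. f i x \<partial>count_space I)"
 using P.integrable_snd[OF int] .
 show "integrable (count_space I) (%i. \<integral>x. f i x \<partial>M)"
 using P.integrable_fst[OF int] .
 show "(\<integral>x. \<integral>i. f i x \<partial>count_space I \<partial>M) = (\<integral>i. \<integral>x. f i x \<partial>M \<partial>count_space I)"
 using P.Fubini_integral[OF int] .
 show "AE x in M. integrable (count_space I) (%i. f i x)"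
 using P.AE_integrable_snd[OF int] .
qed

lemma integrable_exp_abs_int:
 assumes "a > 0"
 shows "integrable (count_space UNIV) (%d::int. exp (- a * \<bar>real_of_int d\<bar>))"
proof -
 \<comment> \<open>\<open>int_decode\<close> enumerates 0, -1, 1, -2, ..., so \<open>n\<close> is 2
   |d| or 2 |d| - 1 for its value d, and a geometric series in \<open>n\<close> dominates.\<close>
 have le: "exp (- a * \<bar>real_of_int (int_decode n)\<bar>) <= exp a * exp (- a / 2) ^ n" for n
 proof -
 have "real n <= 2 * \<bar>real_of_int (int_decode n)\<bar> + 1"
 by (auto simp: int_decode_def sum_decode_def elim!: oddE evenE)
 hence "a * real n <= a * (2 * \<bar>real_of_int (int_decode n)\<bar> + 1)"
 using assms by (intro mult_left_mono) auto
 hence "- a * \<bar>real_of_int (int_decode n)\<bar> <= a + real n * (- a / 2)"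
 using assms by (simp add: algebra_simps)
 thus ?thesis by (simp flip: exp_of_nat_mult exp_add)
 qed
 have "summable (%n. exp a * exp (- a / 2) ^ n)"
 using assms by (intro summable_mult summable_geometric) auto
 hence "summable (%n. norm (exp (- a * \<bar>real_of_int (int_decode n)\<bar>)))"
 by (rule summable_comparison_test') (use le in auto)
 hence "integrable (count_space UNIV) (%n. exp (- a * \<bar>real_of_int (int_decode n)\<bar>))"
 by (simp add: integrable_count_space_nat_iff)
 thus ?thesis
 using integrable_bij_count_space[OF bij_int_decode, of "%d. exp (- a * \<bar>real_of_int d\<bar>)"] by simp
qed

lemma sigma_finite_count_space_countable_UNIV [simp]:
 "sigma_finite_measure (count_space (UNIV :: 'a::countable set))"
 by (rule sigma_finite_measure_count_space_countable) auto

lemma integrable_count_space_prod: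
 fixes f :: "'a::countable => real" and g :: "'b::countable => real"
 assumes "integrable (count_space UNIV) f" "integrable (count_space UNIV) g"
 shows "integrable (count_space UNIV) (%(c, d). f c * g d)"
proof -
 have "(\<integral>\<^sup>+p. ennreal (norm (case p of (c, d) => f c * g d)) \<partial>count_space UNIV)
 = (\<integral>\<^sup>+c. \<integral>\<^sup>+d. ennreal (norm (f c)) * ennreal (norm (g d)) \<partial>count_space UNIV \<partial>count_space UNIV)"
 by (subst nn_integral_fst_count_space[symmetric]) (simp add: abs_mult ennreal_mult')
 also have "... = (\<integral>\<^sup>+c. ennreal (norm (f c)) \<partial>count_space UNIV) * (\<integral>\<^sup>+d. ennreal (norm (g d)) \<partial>count_space UNIV)"
 by (simp add: nn_integral_cmult nn_integral_multc)
 also have "... < \<infinity>"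
 using assms by (simp add: integrable_iff_bounded ennreal_mult_less_top)
 finally show ?thesis by (simp add: integrable_iff_bounded)
qed

lemma continuous_on_integral_dominated:
 fixes f :: "'a => 's::metric_space => 'b::{banach,second_countable_topology}"
 assumes m: "!!s. s \<in> S ==> (%x. f x s) \<in> borel_measurable M"
 and c: "!!x. x \<in> space M ==> continuous_on S (f x)"
 and b: "!!x s. x \<in> space M ==> s \<in> S ==> norm (f x s) <= g x"
 and g: "integrable M g"
 shows "continuous_on S (%s. \<integral>x. f x s \<partial>M)"
unfolding continuous_on_sequentially comp_def
proof (intro allI ballI impI, elim conjE)
 fix X a assume X: "a \<in> S" "\<forall>n. X n \<in> S" "X \<longlonglongrightarrow> a"
 show "(%n. \<integral>x. f x (X n) \<partial>M) \<longlonglongrightarrow> (\<integral>x. f x a \<partial>M)"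
 proof (rule integral_dominated_convergence[OF _ _ g])
 show "AE x in M. (%n. f x (X n)) \<longlonglongrightarrow> f x a"
 using c X by (auto simp: continuous_on_sequentially comp_def)
 qed (use m b X in auto)
qed

section \<open>Uniqueness of Fourier coefficients at a point\<close>

text \<open>The classical peak argument: were the function positive at 1/2, the powers of
  \<open>b - cos (2 * pi * x)\<close> for a suitable \<open>b\<close> would grow geometrically near
  1/2 and stay bounded by 1 away from it, so their integrals against the function could not all
  vanish.\<close>

lemma trig_moment_zero:
 fixes \<psi> :: "real => real"
 assumes cont: "continuous_on {0..1} \<psi>"
 and zero: "!!b n. integral {0..1} (%x. \<psi> x * (b - cos (2 * pi * x)) ^ n) = 0"
 shows "\<psi> (1/2) <= 0"
proof (rule ccontr)
 assume "\<not> \<psi> (1/2) <= 0"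
 define \<epsilon> where "\<epsilon> = \<psi> (1/2) / 2"
 have \<epsilon>: "\<epsilon> > 0" "\<psi> (1/2) > \<epsilon>" using \<open>\<not> \<psi> (1/2) <= 0\<close> by (auto simp: \<epsilon>_def)
 obtain B where B: "!!x. x \<in> {0..1} ==> \<bar>\<psi> x\<bar> <= B"
 using compact_imp_bounded[OF compact_continuous_image[OF cont]] unfolding bounded_iff by fastforce
 obtain \<delta>0 where \<delta>0: "\<delta>0 > 0" "!!x. x \<in> {0..1} ==> dist x (1/2) < \<delta>0 ==> dist (\<psi> x) (\<psi> (1/2)) < \<psi> (1/2) - \<epsilon>"
 using cont[unfolded continuous_on_iff, rule_format, of "1/2" "\<psi> (1/2) - \<epsilon>"] \<epsilon> by auto
 define \<delta> where "\<delta> = min (\<delta>0 / 2) (1/4)"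
 have \<delta>: "\<delta> > 0" "\<delta> <= 1/4" "\<delta> < \<delta>0" using \<delta>0 by (auto simp: \<delta>_def)
 have big: "\<psi> x > \<epsilon>" if "\<bar>x - 1/2\<bar> <= \<delta>" for x
 proof -
 have "x \<in> {0..1}" using that \<delta> by auto
 thus ?thesis using \<delta>0(2)[of x] that \<delta> by (auto simp: dist_real_def abs_if split: if_splits)
 qed
 \<comment> \<open>With this \<open>b\<close> the function \<open>p\<close> equals 1 at distance
   \<delta> from 1/2, exceeds 1 inside that distance and lies in [-1, 1] outside.\<close>
 define b where "b = 1 - cos (2 * pi * \<delta>)"
 define p where "p = (%x. b - cos (2 * pi * x))"
 define c where "c = cos (pi * \<delta>) - cos (2 * pi * \<delta>)"
 have p_alt: "p x = 1 - cos (2 * pi * \<delta>) + cos (2 * pi * \<bar>x - 1/2\<bar>)" for x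
 proof -
 have "cos (2 * pi * \<bar>x - 1/2\<bar>) = cos (2 * pi * (x - 1/2))"
 by (cases "x >= 1/2") (auto simp: abs_if right_diff_distrib cos_diff)
 also have "... = - cos (2 * pi * x)"
 by (simp add: right_diff_distrib cos_diff)
 finally show ?thesis by (simp add: p_def b_def)
 qed
 have c: "c > 0" unfolding c_def
 using \<delta> cos_monotone_0_pi[of "pi * \<delta>" "2 * pi * \<delta>"] by (auto simp: mult_le_cancel_left)
 have p1: "p x >= 1" if "\<bar>x - 1/2\<bar> <= \<delta>" for x
 using cos_monotone_0_pi_le[of "2 * pi * \<bar>x - 1/2\<bar>" "2 * pi * \<delta>"] that \<delta>
 unfolding p_alt by auto
 have p2: "p x >= 1 + c" if "\<bar>x - 1/2\<bar> <= \<delta> / 2" for x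
 using cos_monotone_0_pi_le[of "2 * pi * \<bar>x - 1/2\<bar>" "pi * \<delta>"] that \<delta>
 unfolding p_alt c_def by auto
 have p3: "\<bar>p x\<bar> <= 1" if "\<bar>x - 1/2\<bar> > \<delta>" "x \<in> {0..1}" for x
 proof -
 have "cos (2 * pi * \<bar>x - 1/2\<bar>) <= cos (2 * pi * \<delta>)"
 using that \<delta> by (intro cos_monotone_0_pi_le) (auto simp: abs_if)
 moreover have "cos (2 * pi * \<bar>x - 1/2\<bar>) >= -1" "cos (2 * pi * \<delta>) <= 1" by auto
 ultimately show ?thesis unfolding p_alt by linarith
 qed
 have B0: "B >= 0" using B[of 0] by auto
 have lower: "\<psi> x * p x ^ n + B >= 0" if "x \<in> {0..1}" for x n
 proof (cases "\<bar>x - 1/2\<bar> <= \<delta>")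
 case True
 thus ?thesis using big[OF True] p1[OF True] \<epsilon> B0 by simp
 next
 case False
 hence "\<bar>p x ^ n\<bar> <= 1" using p3[of x] that by (simp add: power_abs power_le_one)
 hence "\<bar>\<psi> x * p x ^ n\<bar> <= B * 1" unfolding abs_mult using B[OF that] by (intro mult_mono) auto
 thus ?thesis by linarith
 qed
 have contp: "continuous_on A (%x. p x ^ n)" for A n unfolding p_def by (intro continuous_intros)
 have main: "\<delta> * (\<epsilon> * (1 + c) ^ n) <= B" for n
 proof -
 let ?J = "{1/2 - \<delta>/2..1/2 + \<delta>/2}"
 have J: "?J \<subseteq> {0..1}" using \<delta> by auto
 have i1: "(%x. \<psi> x * p x ^ n + B) integrable_on {0..1}"
 by (intro integrable_continuous_interval continuous_intros cont contp)
 have i2: "(%x. \<psi> x * p x ^ n + B) integrable_on ?J"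
 by (intro integrable_continuous_interval continuous_intros continuous_on_subset[OF cont J] contp)
 have "\<delta> * (\<epsilon> * (1 + c) ^ n) = integral ?J (%x. \<epsilon> * (1 + c) ^ n)" using \<delta> by simp
 also have "... <= integral ?J (%x. \<psi> x * p x ^ n + B)"
 proof (rule integral_le)
 fix x assume x: "x \<in> ?J"
 hence x': "\<bar>x - 1/2\<bar> <= \<delta>/2" unfolding abs_le_iff by (auto simp: algebra_simps)
 have "\<epsilon> * (1 + c) ^ n <= \<psi> x * p x ^ n"
 using big[of x] p2[OF x'] c x' \<delta> \<epsilon> by (intro mult_mono power_mono) auto
 thus "\<epsilon> * (1 + c) ^ n <= \<psi> x * p x ^ n + B" using B0 by simp
 qed (use i2 in auto)
 also have "... <= integral {0..1} (%x. \<psi> x * p x ^ n + B)"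
 by (rule integral_subset_le[OF J i2 i1]) (use lower in auto)
 also have "... = integral {0..1} (%x. \<psi> x * p x ^ n) + integral {0..1} (%x::real. B)"
 proof (rule integral_unique[OF has_integral_add])
 have "(%x. \<psi> x * p x ^ n) integrable_on {0..1}"
 by (intro integrable_continuous_interval continuous_intros cont contp)
 thus "((%x. \<psi> x * p x ^ n) has_integral integral {0..1} (%x. \<psi> x * p x ^ n)) {0..1}"
 by (rule integrable_integral)
 show "((%x::real. B) has_integral integral {0..1} (%x::real. B)) {0..1}"
 using has_integral_const_real[of B 0 1] by simp
 qed
 also have "... = B" using zero[of b n] by (simp add: p_def)
 finally show ?thesis .
 qed
 obtain n where "B / (\<delta> * \<epsilon>) < (1 + c) ^ n"
 using real_arch_pow[of "1 + c"] c by auto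
 hence "B < \<delta> * (\<epsilon> * (1 + c) ^ n)" using \<delta> \<epsilon> by (simp add: field_simps)
 thus False using main[of n] by simp
qed

text \<open>Multiplication by \<open>b - cos\<close> only mixes neighbouring frequencies, which
  reduces the claim to \<open>trig_moment_zero\<close> for plus and minus the real and imaginary
  parts. Evaluation at the midpoint alone avoids matching the values at 0 and 1;
  \<open>gaussian_poisson\<close> translates its point there.\<close>

lemma fourier_coeffs_zero:
 fixes \<phi> :: "real => complex"
 assumes cont: "continuous_on {0..1} \<phi>"
 and zero: "!!k::int. integral {0..1} (%x. \<phi> x * cis (2 * pi * k * x)) = 0"
 shows "\<phi> (1/2) = 0"
proof -
 have step: "integral {0..1} (%x. \<phi> x * of_real ((b - cos (2 * pi * x)) ^ n) * cis (2 * pi * k * x)) = 0" for b n and k :: int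
 proof (induction n arbitrary: k)
 case 0 thus ?case using zero by simp
 next
 case (Suc n)
 let ?g = "%(k::int) x. \<phi> x * of_real ((b - cos (2 * pi * x)) ^ n) * cis (2 * pi * k * x)"
 have i: "?g k integrable_on {0..1}" for k
 by (intro integrable_continuous_interval continuous_intros cont)
 have h: "(?g k has_integral 0) {0..1}" for k
 using integrable_integral[OF i[of k]] unfolding Suc.IH[of k] .
 have eq: "\<phi> x * of_real ((b - cos (2 * pi * x)) ^ Suc n) * cis (2 * pi * k * x)
 = of_real b * ?g k x - (1/2) * ?g (k + 1) x - (1/2) * ?g (k - 1) x" for x
 proof -
 have "complex_of_real (cos (2 * pi * x)) = (cis (2 * pi * x) + cis (- (2 * pi * x))) / 2"
 by (simp add: complex_eq_iff)
 moreover have "cis (2 * pi * (k + 1) * x) = cis (2 * pi * k * x) * cis (2 * pi * x)"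
 "cis (2 * pi * (k - 1) * x) = cis (2 * pi * k * x) * cis (- (2 * pi * x))"
 by (simp_all add: cis_mult algebra_simps)
 ultimately show ?thesis by (simp add: algebra_simps add_divide_distrib)
 qed
 have "((%x. of_real b * ?g k x - (1/2) * ?g (k + 1) x - (1/2) * ?g (k - 1) x) has_integral
 of_real b * 0 - (1/2) * 0 - (1/2) * 0) {0..1}"
 by (intro has_integral_diff has_integral_mult_right h)
 thus ?case unfolding eq by (simp add: integral_unique)
 qed
 have Z: "integral {0..1} (%x. \<phi> x * of_real ((b - cos (2 * pi * x)) ^ n)) = 0" for b n
 using step[of b n 0] by simp
 have I: "(%x. \<phi> x * of_real ((b - cos (2 * pi * x)) ^ n)) integrable_on {0..1}" for b n
 by (intro integrable_continuous_interval continuous_intros cont)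
 have Re: "integral {0..1} (%x. Re (\<phi> x) * (b - cos (2 * pi * x)) ^ n) = 0" for b n
 using integral_linear[OF I[of b n] bounded_linear_Re] Z by (simp add: comp_def)
 have Im: "integral {0..1} (%x. Im (\<phi> x) * (b - cos (2 * pi * x)) ^ n) = 0" for b n
 using integral_linear[OF I[of b n] bounded_linear_Im] Z by (simp add: comp_def)
 have "Re (\<phi> (1/2)) <= 0" "Im (\<phi> (1/2)) <= 0" "- Re (\<phi> (1/2)) <= 0" "- Im (\<phi> (1/2)) <= 0"
 using trig_moment_zero[of "%x. Re (\<phi> x)"] trig_moment_zero[of "%x. Im (\<phi> x)"]
 trig_moment_zero[of "%x. - Re (\<phi> x)"] trig_moment_zero[of "%x. - Im (\<phi> x)"] Re Im cont
 by (simp_all add: continuous_on_Re continuous_on_Im continuous_on_minus)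
 thus ?thesis by (simp add: complex_eq_iff)
qed

section \<open>Gaussians and Poisson summation\<close>

lemma borel_measurable_cis [measurable]: "cis \<in> borel_measurable borel"
 by (intro borel_measurable_continuous_onI continuous_intros)

text \<open>This is the characteristic function of the standard normal law, rescaled by c = sqrt (2
  pi s).\<close>

lemma gaussian_fourier:
 assumes s: "s > 0"
 shows "integrable lborel (%x::real. complex_of_real (exp (- pi * s * x^2)) * cis (2 * pi * k * x))"
 and "(\<integral>x. complex_of_real (exp (- pi * s * x^2)) * cis (2 * pi * k * x) \<partial>lborel)
 = of_real (exp (- pi * k^2 / s) / sqrt s)"
proof -
 define c where "c = sqrt (2 * pi * s)"
 have c: "c > 0" "c^2 = 2 * pi * s" "c = sqrt (2 * pi) * sqrt s" using s by (auto simp: c_def real_sqrt_mult power_mult_distrib)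
 define t where "t = 2 * pi * k / c"
 let ?g = "%x. complex_of_real (std_normal_density x) * cis (t * x)"
 have "char std_normal_distribution t = (\<integral>x. ?g x \<partial>lborel)"
 unfolding char_def by (subst integral_density) (auto simp: scaleR_conv_of_real cis_conv_exp mult_ac)
 hence val: "(\<integral>x. ?g x \<partial>lborel) = of_real (exp (- (t^2) / 2))"
 by (simp add: char_std_normal_distribution)
 have ig: "integrable lborel ?g"
 proof (rule Bochner_Integration.integrable_bound)
 show "integrable lborel std_normal_density" using integrable_std_normal_moment[of 0] by simp
 qed (auto simp: norm_mult)
 have geq: "?g (0 + c * x) = of_real (1 / sqrt (2 * pi)) * (complex_of_real (exp (- pi * s * x^2)) * cis (2 * pi * k * x))" for x
 using c(1,2) by (simp add: std_normal_density_def t_def power_mult_distrib mult.assoc)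
 have "integrable lborel (%x. ?g (0 + c * x))"
 using lborel_integrable_real_affine[OF ig, of c 0] c(1) by simp
 hence i1: "integrable lborel (%x. of_real (1 / sqrt (2 * pi)) * (complex_of_real (exp (- pi * s * x^2)) * cis (2 * pi * k * x)))"
 unfolding geq .
 thus i: "integrable lborel (%x::real. complex_of_real (exp (- pi * s * x^2)) * cis (2 * pi * k * x))"
 using integrable_mult_right[of "complex_of_real (sqrt (2 * pi))"] by fastforce
 have "of_real (exp (- (t^2) / 2)) = of_real c * (\<integral>x. ?g (0 + c * x) \<partial>lborel)"
 using lborel_integral_real_affine[of c ?g 0] c(1) val by (simp add: scaleR_conv_of_real)
 also have "... = of_real (c / sqrt (2 * pi)) * (\<integral>x. complex_of_real (exp (- pi * s * x^2)) * cis (2 * pi * k * x) \<partial>lborel)"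
 unfolding geq using i by simp
 also have "c / sqrt (2 * pi) = sqrt s" using c by simp
 finally have "(\<integral>x. complex_of_real (exp (- pi * s * x^2)) * cis (2 * pi * k * x) \<partial>lborel)
 = of_real (exp (- (t^2) / 2) / sqrt s)"
 using s by (simp add: field_simps)
 also have "- (t^2) / 2 = - pi * k^2 / s"
 using c s by (simp add: t_def power_divide power_mult_distrib power2_eq_square)
 finally show "(\<integral>x. complex_of_real (exp (- pi * s * x^2)) * cis (2 * pi * k * x) \<partial>lborel)
 = of_real (exp (- pi * k^2 / s) / sqrt s)" .
qed

lemma nn_integral_int_translates:
 fixes x :: real
 shows "(\<integral>\<^sup>+d. ennreal (indicator {0..<1} (x - real_of_int d)) \<partial>count_space UNIV) = 1"
proof -
 have "(%d::int. ennreal (indicator {0..<1} (x - real_of_int d))) = indicator {\<lfloor>x\<rfloor>}"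
 by (auto simp: fun_eq_iff indicator_def floor_eq_iff) linarith+
 thus ?thesis by (simp add: one_ennreal_def[symmetric])
qed

text \<open>Each real number lies in exactly one integer translate of [0, 1); the pieces are shifted
  back one at a time.\<close>

lemma integral_periodize:
 fixes h :: "real => 'b::{banach,second_countable_topology}"
 assumes h: "integrable lborel h"
 shows "(\<integral>x. indicator {0..<1} x *\<^sub>R (\<integral>d. h (x + real_of_int d) \<partial>count_space UNIV) \<partial>lborel) = (\<integral>x. h x \<partial>lborel)"
proof -
 have [measurable]: "h \<in> borel_measurable borel" using borel_measurable_integrable[OF h] by simp
 let ?f = "%(d::int) x. indicator {0..<1} x *\<^sub>R h (x + real_of_int d)"
 let ?g = "%(d::int) x. indicator {0..<1} (x - real_of_int d) *\<^sub>R h x"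
 have gf: "?g d (real_of_int d + 1 * x) = ?f d x" for d x by (simp add: add.commute)
 have n1: "(\<integral>\<^sup>+x. norm (?f d x) \<partial>lborel) = (\<integral>\<^sup>+x. norm (?g d x) \<partial>lborel)" for d
 by (subst (2) nn_integral_real_affine[where c = 1 and t = "real_of_int d"]) (auto simp: add.commute)
 have "(\<integral>\<^sup>+d. \<integral>\<^sup>+x. norm (?g d x) \<partial>lborel \<partial>count_space UNIV)
 = (\<integral>\<^sup>+x. \<integral>\<^sup>+d. norm (?g d x) \<partial>count_space UNIV \<partial>lborel)"
 by (subst nn_integral_count_space_nn_integral) auto
 also have "... = (\<integral>\<^sup>+x. norm (h x) \<partial>lborel)"
 proof (rule nn_integral_cong)
 fix x :: real
 have "(\<integral>\<^sup>+d. norm (?g d x) \<partial>count_space UNIV) = (\<integral>\<^sup>+d. ennreal (indicator {0..<1} (x - real_of_int d)) * norm (h x) \<partial>count_space UNIV)"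
 by (intro nn_integral_cong) (auto simp: indicator_def)
 also have "... = norm (h x)"
 by (subst nn_integral_multc) (auto simp: nn_integral_int_translates)
 finally show "(\<integral>\<^sup>+d. norm (?g d x) \<partial>count_space UNIV) = norm (h x)" .
 qed
 also have "... < \<infinity>" using h by (simp add: integrable_iff_bounded)
 finally have fin: "(\<integral>\<^sup>+d. \<integral>\<^sup>+x. norm (?g d x) \<partial>lborel \<partial>count_space UNIV) < \<infinity>" .
 have "(\<integral>x. indicator {0..<1} x *\<^sub>R (\<integral>d. h (x + real_of_int d) \<partial>count_space UNIV) \<partial>lborel)
 = (\<integral>x. \<integral>d. ?f d x \<partial>count_space UNIV \<partial>lborel)"
 by (intro Bochner_Integration.integral_cong) (auto simp: indicator_def)
 also have "... = (\<integral>d. \<integral>x. ?f d x \<partial>lborel \<partial>count_space UNIV)"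
 by (rule integral_count_space_swap(3)[OF lborel.sigma_finite_measure_axioms]) (use fin n1 in auto)
 also have "(%d. \<integral>x. ?f d x \<partial>lborel) = (%d. \<integral>x. ?g d x \<partial>lborel)"
 proof
 fix d
 show "(\<integral>x. ?f d x \<partial>lborel) = (\<integral>x. ?g d x \<partial>lborel)"
 using lborel_integral_real_affine[of 1 "?g d" "real_of_int d"] by (simp add: add.commute)
 qed
 also have "(\<integral>d. \<integral>x. ?g d x \<partial>lborel \<partial>count_space UNIV) = (\<integral>x. \<integral>d. ?g d x \<partial>count_space UNIV \<partial>lborel)"
 by (rule integral_count_space_swap(3)[OF lborel.sigma_finite_measure_axioms, symmetric]) (use fin in auto)
 also have "... = (\<integral>x. h x \<partial>lborel)"
 proof (rule Bochner_Integration.integral_cong[OF refl])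
 fix x :: real
 have "(%d. ?g d x) = (%d. indicator {\<lfloor>x\<rfloor>} d *\<^sub>R h x)"
 by (auto simp: fun_eq_iff indicator_def floor_eq_iff) linarith+
 thus "(\<integral>d. ?g d x \<partial>count_space UNIV) = h x" by simp
 qed
 finally show ?thesis .
qed

lemma integral_unit_interval:
 fixes g :: "real => 'a::euclidean_space"
 assumes "continuous_on {0..1} g"
 shows "integral {0..1} g = (\<integral>x. indicator {0..<1} x *\<^sub>R g x \<partial>lborel)"
 and "integrable lborel (%x. indicator {0..<1} x *\<^sub>R g x)"
proof -
 have i: "integrable lborel (%x. indicator {0..1} x *\<^sub>R g x)"
 using borel_integrable_atLeastAtMost'[OF assms] by (simp add: set_integrable_def)
 have "integral {0..1} g = (\<integral>x. indicator {0..1} x *\<^sub>R g x \<partial>lborel)"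
 using set_borel_integral_eq_integral(2)[OF borel_integrable_atLeastAtMost'[OF assms]]
 by (simp add: set_lebesgue_integral_def)
 have eq: "indicator {0..<1} x *\<^sub>R g x = indicator {0..<1} x *\<^sub>R (indicator {0..1} x *\<^sub>R g x)" for x
 by (auto simp: indicator_def)
 have m: "(%x. indicator {0..<1} x *\<^sub>R g x) \<in> borel_measurable lborel"
 by (subst eq) (use borel_measurable_integrable[OF i] in measurable)
 have ae: "AE x in lborel. indicator {0..<1} x *\<^sub>R g x = indicator {0..1} x *\<^sub>R g x"
 using AE_lborel_singleton[of 1] by eventually_elim (auto simp: indicator_def)
 show "integrable lborel (%x. indicator {0..<1} x *\<^sub>R g x)"
 using i m ae borel_measurable_integrable[OF i] by (subst integrable_cong_AE) auto
 have "(\<integral>x. indicator {0..<1} x *\<^sub>R g x \<partial>lborel) = (\<integral>x. indicator {0..1} x *\<^sub>R g x \<partial>lborel)"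
 by (rule integral_cong_AE[OF m borel_measurable_integrable[OF i] ae])
 thus "integral {0..1} g = (\<integral>x. indicator {0..<1} x *\<^sub>R g x \<partial>lborel)"
 using \<open>integral {0..1} g = _\<close> by simp
qed

lemma integral_cis_period:
 "integral {0..1} (%x. cis (2 * pi * real_of_int n * x)) = (if n = 0 then 1 else 0)"
proof (cases "n = 0")
 case False
 define a where "a = 2 * pi * real_of_int n"
 have a: "a ~= 0" using False by (simp add: a_def)
 have "((%x. cis (a * x)) has_integral (- \<i> / a * cis (a * 1) - - \<i> / a * cis (a * 0))) {0..1}"
 proof (rule fundamental_theorem_of_calculus)
 fix x :: real
 have "((%z. - \<i> / a * exp (\<i> * (a * z))) has_field_derivative exp (\<i> * (a * of_real x))) (at (of_real x))"
 using a by (auto intro!: derivative_eq_intros simp: field_simps)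
 from has_vector_derivative_real_field[OF this, of "{0..1}"]
 show "((%x. - \<i> / a * cis (a * x)) has_vector_derivative cis (a * x)) (at x within {0..1})"
 by (simp add: cis_conv_exp)
 qed simp
 moreover have "cis (a * 1) = 1" unfolding a_def
 using cis_multiple_2pi[of "real_of_int n"] by (simp add: mult.assoc)
 ultimately show ?thesis using False by (auto dest: integral_unique simp: a_def)
qed auto

text \<open>Since x^2 >= |x| - 1/4, a Gaussian lies below a two-sided exponential, so
  \<open>integrable_exp_abs_int\<close> covers it as well; \<open>W\<close> makes the bound uniform
  in the shift.\<close>

lemma exp_quadratic_bound:
 assumes "s > 0" "\<bar>w\<bar> <= W"
 shows "exp (- pi * s * (real_of_int d + w)^2) <= exp (pi * s * (W + 1)) * exp (- (pi * s) * \<bar>real_of_int d\<bar>)"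
proof -
 have "(\<bar>real_of_int d + w\<bar> - 1/2)^2 >= 0" by simp
 hence "(real_of_int d + w)^2 >= \<bar>real_of_int d + w\<bar> - 1/4" by (simp add: power2_eq_square algebra_simps)
 hence "(real_of_int d + w)^2 >= \<bar>real_of_int d\<bar> - (W + 1)" using assms by linarith
 hence "pi * s * (real_of_int d + w)^2 >= pi * s * (\<bar>real_of_int d\<bar> - (W + 1))"
 using assms by (intro mult_left_mono) auto
 thus ?thesis by (simp add: algebra_simps flip: exp_add)
qed

text \<open>\<open>g\<close> is the periodised Gaussian and \<open>r\<close> its candidate Fourier
  series. Both are continuous with the same coefficients, so they agree at 1/2, and the shift b = c
  - 1/2 places the wanted point there.\<close>

lemma gaussian_poisson:
 assumes s: "s > 0"
 shows "(\<integral>d. exp (- pi * s * (real_of_int d + c)^2) \<partial>count_space UNIV)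
 = (\<integral>k. exp (- pi * (real_of_int k)^2 / s) * cos (2 * pi * real_of_int k * c) \<partial>count_space UNIV) / sqrt s"
proof -
 define b where "b = c - 1/2"
 let ?E = "%(d::int) x. complex_of_real (exp (- pi * s * (real_of_int d + (x + b))^2))"
 define a where "a = (%k::int. exp (- pi * (real_of_int k)^2 / s) / sqrt s)"
 define g where "g = (%x. \<integral>d. ?E d x \<partial>count_space UNIV)"
 define r where "r = (%x. \<integral>k. a k * cis (2 * pi * real_of_int k * (x + b)) \<partial>count_space UNIV)"
 have ia: "integrable (count_space UNIV) a"
 proof -
 have "integrable (count_space UNIV) (%k. exp (pi * (1 / s) * (0 + 1)) * exp (- (pi * (1 / s)) * \<bar>real_of_int k\<bar>) / sqrt s)"
 using s integrable_exp_abs_int[of "pi * (1 / s)"] by (intro integrable_divide integrable_mult_right) simp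
 thus ?thesis
 by (rule Bochner_Integration.integrable_bound)
 (use s exp_quadratic_bound[of "1 / s" 0 0] in \<open>auto simp: a_def divide_right_mono\<close>)
 qed
 have ig: "integrable (count_space UNIV) (%d. exp (pi * s * (\<bar>b\<bar> + 1 + 1)) * exp (- (pi * s) * \<bar>real_of_int d\<bar>))"
 using s integrable_exp_abs_int[of "pi * s"] by (intro integrable_mult_right) simp
 have Eb: "norm (?E d x) <= exp (pi * s * (\<bar>b\<bar> + 1 + 1)) * exp (- (pi * s) * \<bar>real_of_int d\<bar>)" if "x \<in> {0..1}" for d x
 unfolding norm_of_real abs_exp_cancel using that by (intro exp_quadratic_bound s) auto
 have cg: "continuous_on {0..1} g" unfolding g_def
 by (rule continuous_on_integral_dominated[OF _ _ _ ig]) (use Eb in \<open>auto intro!: continuous_intros\<close>)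
 have cr: "continuous_on {0..1} r" unfolding r_def
 by (rule continuous_on_integral_dominated[OF _ _ _ ia]) (use s in \<open>auto intro!: continuous_intros simp: norm_mult norm_divide a_def\<close>)
 have "g x - r x = 0" if "x = 1/2" for x
 unfolding that
 proof (rule fourier_coeffs_zero[of "%x. g x - r x"])
 show "continuous_on {0..1} (%x. g x - r x)" by (intro continuous_intros cg cr)
 fix j :: int
 let ?c = "%x. cis (2 * pi * real_of_int j * x)"
 let ?v = "of_real (a j) * cis (- 2 * pi * real_of_int j * b)"
 let ?h = "%x. complex_of_real (exp (- pi * s * (x + b)^2)) * ?c x"
 have heq: "?h x = cis (- 2 * pi * real_of_int j * b) * (complex_of_real (exp (- pi * s * (b + 1 * x)^2)) * cis (2 * pi * real_of_int j * (b + 1 * x)))" for x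
 by (simp add: cis_mult mult_ac add_ac) (simp add: algebra_simps)
 have ih: "integrable lborel ?h" unfolding heq
 using lborel_integrable_real_affine[OF gaussian_fourier(1)[OF s, of "real_of_int j"], of 1 b]
 by (intro integrable_mult_right) simp
 have vh: "(\<integral>x. ?h x \<partial>lborel) = ?v" unfolding heq
 using lborel_integral_real_affine[of 1 "%x. complex_of_real (exp (- pi * s * x^2)) * cis (2 * pi * real_of_int j * x)" b]
 gaussian_fourier(2)[OF s, of "real_of_int j"] by (simp add: a_def)
 have per: "?h (x + real_of_int d) = ?E d x * ?c x" for x and d :: int
 proof -
 have "cis (2 * pi * real_of_int j * (x + real_of_int d)) = ?c x * cis (2 * pi * real_of_int (j * d))"
 by (simp add: cis_mult algebra_simps)
 also have "cis (2 * pi * real_of_int (j * d)) = 1" by (rule cis_multiple_2pi) auto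
 finally show ?thesis by (simp add: add_ac)
 qed
 have "integral {0..1} (%x. g x * ?c x) = (\<integral>x. indicator {0..<1} x *\<^sub>R (g x * ?c x) \<partial>lborel)"
 by (rule integral_unit_interval) (intro continuous_intros cg)
 also have "... = (\<integral>x. indicator {0..<1} x *\<^sub>R (\<integral>d. ?h (x + real_of_int d) \<partial>count_space UNIV) \<partial>lborel)"
 unfolding per g_def by simp
 also have "... = ?v" by (subst integral_periodize[OF ih]) (rule vh)
 finally have G: "integral {0..1} (%x. g x * ?c x) = ?v" .
 let ?q = "%k x. of_real (a k) * cis (2 * pi * real_of_int k * (x + b)) * ?c x"
 have cq: "continuous_on {0..1} (?q k)" for k by (intro continuous_intros)
 have nq: "(\<integral>\<^sup>+x. norm (indicator {0..<1} x *\<^sub>R ?q k x) \<partial>lborel) = ennreal (a k)" for k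
 proof -
 have "(\<integral>\<^sup>+x. norm (indicator {0..<1} x *\<^sub>R ?q k x) \<partial>lborel) = (\<integral>\<^sup>+x. ennreal (a k) * indicator {0..<1::real} x \<partial>lborel)"
 using s by (intro nn_integral_cong) (auto simp: norm_mult norm_divide a_def indicator_def)
 also have "... = ennreal (a k) * emeasure lborel {0..<1::real}" by (subst nn_integral_cmult_indicator) auto
 finally show ?thesis by simp
 qed
 have "integral {0..1} (%x. r x * ?c x) = (\<integral>x. indicator {0..<1} x *\<^sub>R (r x * ?c x) \<partial>lborel)"
 by (rule integral_unit_interval) (intro continuous_intros cr)
 also have "... = (\<integral>x. \<integral>k. indicator {0..<1} x *\<^sub>R ?q k x \<partial>count_space UNIV \<partial>lborel)"
 unfolding r_def by (intro Bochner_Integration.integral_cong) simp_all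
 also have "... = (\<integral>k. \<integral>x. indicator {0..<1} x *\<^sub>R ?q k x \<partial>lborel \<partial>count_space UNIV)"
 proof (rule integral_count_space_swap(3)[OF lborel.sigma_finite_measure_axioms])
 show "(\<integral>\<^sup>+k. \<integral>\<^sup>+x. norm (indicator {0..<1} x *\<^sub>R ?q k x) \<partial>lborel \<partial>count_space UNIV) < \<infinity>"
 unfolding nq using ia s unfolding integrable_iff_bounded by (simp add: a_def)
 qed auto
 also have "(%k. \<integral>x. indicator {0..<1} x *\<^sub>R ?q k x \<partial>lborel) = (%k. indicator {- j} k *\<^sub>R ?v)"
 proof
 fix k
 have qeq: "?q k x = (of_real (a k) * cis (2 * pi * real_of_int k * b)) * cis (2 * pi * real_of_int (k + j) * x)" for x
 by (simp add: cis_mult mult.assoc) (simp add: algebra_simps)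
 have "(\<integral>x. indicator {0..<1} x *\<^sub>R ?q k x \<partial>lborel)
 = integral {0..1} (%x. (of_real (a k) * cis (2 * pi * real_of_int k * b)) * cis (2 * pi * real_of_int (k + j) * x))"
 using integral_unit_interval(1)[OF cq[of k], symmetric] unfolding qeq .
 also have "... = (of_real (a k) * cis (2 * pi * real_of_int k * b)) * (if k + j = 0 then 1 else 0)"
 by (simp only: integral_mult_right integral_cis_period)
 also have "... = indicator {- j} k *\<^sub>R ?v"
 by (auto simp: indicator_def a_def add_eq_0_iff)
 finally show "(\<integral>x. indicator {0..<1} x *\<^sub>R ?q k x \<partial>lborel) = indicator {- j} k *\<^sub>R ?v" .
 qed
 finally have R: "integral {0..1} (%x. r x * ?c x) = ?v" by simp
 have "integral {0..1} (%x. (g x - r x) * ?c x) = integral {0..1} (%x. g x * ?c x) - integral {0..1} (%x. r x * ?c x)"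
 unfolding left_diff_distrib
 by (intro Henstock_Kurzweil_Integration.integral_diff integrable_continuous_interval continuous_intros cg cr)
 thus "integral {0..1} (%x. (g x - r x) * ?c x) = 0" using G R by simp
 qed
 hence eq: "g (1/2) = r (1/2)" by simp
 have "g (1/2) = of_real (\<integral>d. exp (- pi * s * (real_of_int d + c)^2) \<partial>count_space UNIV)"
 unfolding g_def by (simp add: b_def)
 moreover have "Re (r (1/2)) = (\<integral>k. a k * cos (2 * pi * real_of_int k * c) \<partial>count_space UNIV)"
 proof -
 have "integrable (count_space UNIV) (%k. a k * cis (2 * pi * real_of_int k * (1/2 + b)))"
 by (rule Bochner_Integration.integrable_bound[OF ia]) (use s in \<open>auto simp: norm_mult norm_divide a_def\<close>)
 from integral_Re[OF this] show ?thesis unfolding r_def by (simp add: b_def)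
 qed
 ultimately show ?thesis using eq s by (simp add: a_def complex_eq_iff)
qed

lemma integral_count_space_prod:
 fixes f :: "'a::countable \<times> 'b::countable => 'c::{banach,second_countable_topology}"
 assumes "integrable (count_space UNIV) f"
 shows "(\<integral>c. \<integral>d. f (c, d) \<partial>count_space UNIV \<partial>count_space UNIV) = (\<integral>p. f p \<partial>count_space UNIV)"
 and "(\<integral>d. \<integral>c. f (c, d) \<partial>count_space UNIV \<partial>count_space UNIV) = (\<integral>p. f p \<partial>count_space UNIV)"
 and "integrable (count_space UNIV) (%d. f (c, d))"
proof -
 interpret pair_sigma_finite "count_space (UNIV :: 'a set)" "count_space (UNIV :: 'b set)"
 by (simp add: pair_sigma_finite_def)
 have eq: "count_space (UNIV :: 'a set) \<Otimes>\<^sub>M count_space (UNIV :: 'b set) = count_space UNIV"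
 by (subst pair_measure_countable) auto
 have i: "integrable (count_space (UNIV :: 'a set) \<Otimes>\<^sub>M count_space (UNIV :: 'b set)) (%(c, d). f (c, d))"
 using assms by (simp add: eq)
 show "(\<integral>c. \<integral>d. f (c, d) \<partial>count_space UNIV \<partial>count_space UNIV) = (\<integral>p. f p \<partial>count_space UNIV)"
 using integral_fst[OF i] by (simp add: eq)
 show "(\<integral>d. \<integral>c. f (c, d) \<partial>count_space UNIV \<partial>count_space UNIV) = (\<integral>p. f p \<partial>count_space UNIV)"
 using integral_snd[OF i] by (simp add: eq)
 show "integrable (count_space UNIV) (%d. f (c, d))"
 using AE_integrable_fst[OF i] by (simp add: AE_count_space)
qed

section \<open>Theta series of the lattice generated by z and 1\<close>

text \<open>The norm form of the lattice, scaled to determinant one for every \<open>z\<close>. At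
  the bottom row of a unimodular M it equals 1 / Im (M z), which links lattice sums to sums over the
  modular group.\<close>

definition qform :: "complex => int \<times> int => real" where
 "qform z p = (cmod (of_int (fst p) * z + of_int (snd p)))^2 / Im z"

lemma qform_Complex:
 assumes "y > 0"
 shows "qform (Complex x y) (c, d) = (real_of_int d + real_of_int c * x)^2 / y + (real_of_int c)^2 * y"
 using assms by (simp add: qform_def cmod_power2 add_divide_distrib power_mult_distrib add.commute) (simp add: power2_eq_square)

lemma qform_nonneg: "Im z > 0 ==> qform z p >= 0"
 by (simp add: qform_def)

lemma abs_le_square_int: "\<bar>real_of_int c\<bar> <= (real_of_int c)^2"
proof -
 have "\<bar>c\<bar> <= \<bar>c\<bar> * \<bar>c\<bar>" using mult_left_mono[of 1 "\<bar>c\<bar>" "\<bar>c\<bar>"] by (cases "c = 0") auto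
 hence "\<bar>c\<bar> <= c^2" by (simp add: power2_eq_square)
 thus ?thesis by (metis of_int_abs of_int_le_iff of_int_power)
qed

text \<open>Integers satisfy |c| <= c^2, so the form dominates |c| + |d|, with a constant uniform
  for \<open>z\<close> in a box. The linear lower bound is the one that exponential majorants call
  for.\<close>

lemma qform_lower:
 assumes z: "0 < y0" "y0 <= Im z" "Im z <= y1" "\<bar>Re z\<bar> <= A"
 shows "\<bar>real_of_int (fst p)\<bar> + \<bar>real_of_int (snd p)\<bar> <= ((1 + 2 * A^2) / y0 + 2 * y1) * qform z p"
proof -
 obtain c d where p: "p = (c, d)" by (cases p)
 define x y where "x = Re z" and "y = Im z"
 have y: "y > 0" using z by (simp add: y_def)
 define q where "q = qform z p"
 have q: "q = (d + c * x)^2 / y + (real_of_int c)^2 * y"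
 using qform_Complex[OF y, of x c d] by (simp add: q_def p x_def y_def)
 have "(real_of_int c)^2 * y <= q" using y by (simp add: q)
 hence "(real_of_int c)^2 * y0 <= q" using z mult_left_mono[of y0 y "(real_of_int c)^2"] by (simp add: y_def)
 hence c: "(real_of_int c)^2 <= q / y0" using z by (simp add: field_simps)
 have q0: "q >= 0" using y by (simp add: q)
 have "(d + c * x)^2 / y <= q" using y by (simp add: q)
 hence e: "(d + c * x)^2 <= q * y1"
 using y z q0 mult_left_mono[of y y1 q] by (simp add: field_simps y_def)
 have xA: "x^2 <= A^2" using z by (metis abs_le_square_iff abs_ge_zero abs_of_nonneg order_trans x_def)
 have "(real_of_int d)^2 <= 2 * (d + c * x)^2 + 2 * ((real_of_int c)^2 * x^2)"
 proof -
 have "0 <= (d + 2 * (c * x))^2" by simp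
 thus ?thesis by (simp add: power2_eq_square algebra_simps)
 qed
 also have "(real_of_int c)^2 * x^2 <= (q / y0) * A^2"
 using c xA z q0 by (intro mult_mono) auto
 finally have "(real_of_int d)^2 <= 2 * (q * y1) + 2 * ((q / y0) * A^2)" using e by linarith
 hence "(real_of_int c)^2 + (real_of_int d)^2 <= ((1 + 2 * A^2) / y0 + 2 * y1) * q"
 using c by (simp add: algebra_simps add_divide_distrib)
 thus ?thesis using abs_le_square_int[of c] abs_le_square_int[of d] by (simp add: p q_def)
qed

text \<open>A single summable majorant valid for all \<open>z\<close> in a box, as required for
  differentiating theta series termwise in x and in y.\<close>

lemma qform_exp_bound:
 assumes z: "0 < y0" "y0 <= y1" and s: "s > 0"
 obtains g :: "int \<times> int => real" where "integrable (count_space UNIV) g"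
 "!!z p. y0 <= Im z ==> Im z <= y1 ==> \<bar>Re z\<bar> <= A ==> exp (- s * qform z p) <= g p"
proof
 define C where "C = (1 + 2 * A^2) / y0 + 2 * y1"
 have C: "C > 0" using z by (auto simp: C_def intro!: add_nonneg_pos)
 let ?g = "%p. case p of (c, d) => exp (- (s / C) * \<bar>real_of_int c\<bar>) * exp (- (s / C) * \<bar>real_of_int d\<bar>)"
 show "integrable (count_space UNIV) ?g"
 using C s by (intro integrable_count_space_prod integrable_exp_abs_int) auto
 fix z p assume "y0 <= Im z" "Im z <= y1" "\<bar>Re z\<bar> <= A"
 from qform_lower[OF z(1) this, of p] have "(\<bar>real_of_int (fst p)\<bar> + \<bar>real_of_int (snd p)\<bar>) * s <= C * qform z p * s"
 using s by (intro mult_right_mono) (auto simp: C_def)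
 hence "(s / C) * (\<bar>real_of_int (fst p)\<bar> + \<bar>real_of_int (snd p)\<bar>) <= s * qform z p"
 using C by (simp add: field_simps)
 thus "exp (- s * qform z p) <= ?g p"
 by (cases p) (simp add: algebra_simps flip: exp_add)
qed

definition theta :: "real => complex => real" where
 "theta t z = (\<integral>p. exp (- (pi * t) * qform z p) \<partial>count_space UNIV)"

text \<open>The theta series with the harmonic polynomial (c z + d)^2. It is the gradient of
  \<open>theta\<close> in disguise, and the pair (0, 0) contributes nothing to it.\<close>

definition theta2 :: "real => complex => complex" where
 "theta2 t z = (\<integral>p. (of_int (fst p) * z + of_int (snd p))\<^sup>2 * of_real (exp (- (pi * t) * qform z p)) \<partial>count_space UNIV)"

lemma integrable_exp_qform:
 assumes "Im z > 0" "s > 0"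
 shows "integrable (count_space UNIV) (%p. exp (- s * qform z p))"
proof -
 obtain g where "integrable (count_space UNIV) g" "!!p. exp (- s * qform z p) <= g p"
 using qform_exp_bound[of "Im z" "Im z" s "\<bar>Re z\<bar>"] assms by (metis order_refl)
 thus ?thesis by (elim Bochner_Integration.integrable_bound) (auto intro!: AE_I2 intro: order_trans[OF _ abs_ge_self])
qed

text \<open>Poisson summation in \<open>d\<close> alone suffices: it leads to the double sum
  \<open>S t\<close>, which is carried into \<open>S (1 / t)\<close> by swapping the two
  integers.\<close>

lemma theta_functional_equation:
 assumes z: "Im z > 0" and t: "t > 0"
 shows "theta t z = theta (1 / t) z / t"
proof -
 obtain x y where zxy: "z = Complex x y" by (cases z)
 have y: "y > 0" using z by (simp add: zxy)
 define S where "S = (%t (p :: int \<times> int). exp (- pi * t * y * (real_of_int (fst p))^2) * exp (- pi * (1 / t) * y * (real_of_int (snd p))^2)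
 * cos (2 * pi * real_of_int (snd p) * (real_of_int (fst p) * x)))"
 have iS: "integrable (count_space UNIV) (S t)" if t: "t > 0" for t
 proof -
 have "integrable (count_space UNIV) (%(c :: int, d :: int). exp (- (pi * t * y) * \<bar>real_of_int c\<bar>) * exp (- (pi * (1 / t) * y) * \<bar>real_of_int d\<bar>))"
 using t y by (intro integrable_count_space_prod integrable_exp_abs_int) auto
 thus ?thesis
 proof (rule Bochner_Integration.integrable_bound)
 show "AE p in count_space UNIV. norm (S t p) <= norm (case p of (c :: int, d :: int) => exp (- (pi * t * y) * \<bar>real_of_int c\<bar>) * exp (- (pi * (1 / t) * y) * \<bar>real_of_int d\<bar>))"
 proof (intro AE_I2, safe)
 fix c d :: int
 have "norm (S t (c, d)) <= exp (- pi * t * y * (real_of_int c)^2) * exp (- pi * (1 / t) * y * (real_of_int d)^2) * 1"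
 unfolding S_def by (auto simp: abs_mult intro!: mult_left_le)
 also have "... <= exp (- (pi * t * y) * \<bar>real_of_int c\<bar>) * exp (- (pi * (1 / t) * y) * \<bar>real_of_int d\<bar>)"
 using t y abs_le_square_int[of c] abs_le_square_int[of d]
 unfolding mult_1_right by (intro mult_mono) (auto intro!: mult_left_mono divide_right_mono)
 finally show "norm (S t (c, d)) <= norm (exp (- (pi * t * y) * \<bar>real_of_int c\<bar>) * exp (- (pi * (1 / t) * y) * \<bar>real_of_int d\<bar>))"
 by simp
 qed
 qed simp
 qed
 have main: "theta t z = sqrt (y / t) * (\<integral>p. S t p \<partial>count_space UNIV)" if t: "t > 0" for t
 proof -
 have "theta t z = (\<integral>c. \<integral>d. exp (- (pi * t) * qform z (c, d)) \<partial>count_space UNIV \<partial>count_space UNIV)"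
 unfolding theta_def using z t by (intro integral_count_space_prod(1)[symmetric] integrable_exp_qform) auto
 also have "... = (\<integral>c. exp (- pi * t * y * (real_of_int c)^2) * (\<integral>d. exp (- pi * (t / y) * (real_of_int d + real_of_int c * x)^2) \<partial>count_space UNIV) \<partial>count_space UNIV)"
 using y unfolding zxy qform_Complex[OF y]
 by (intro Bochner_Integration.integral_cong) (auto simp: exp_add[symmetric] algebra_simps simp flip: integral_mult_right_zero)
 also have "... = (\<integral>c. \<integral>k. sqrt (y / t) * S t (c, k) \<partial>count_space UNIV \<partial>count_space UNIV)"
 using t y by (subst gaussian_poisson) (auto simp: S_def real_sqrt_divide mult_ac intro!: Bochner_Integration.integral_cong simp flip: integral_mult_right_zero integral_divide_zero)
 also have "... = sqrt (y / t) * (\<integral>p. S t p \<partial>count_space UNIV)"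
 using integral_count_space_prod(1)[OF iS[OF t]] by simp
 finally show ?thesis .
 qed
 have "(\<integral>p. S (1 / t) p \<partial>count_space UNIV) = (\<integral>p. S t p \<partial>count_space UNIV)"
 proof -
 have "S (1 / t) (c, d) = S t (d, c)" for c d using t by (simp add: S_def mult_ac)
 thus ?thesis
 using integral_count_space_prod(1)[OF iS[of "1 / t"]] integral_count_space_prod(2)[OF iS[of t]] t by simp
 qed
 moreover have "sqrt (y / t) = sqrt (y / (1 / t)) / t"
 using t y by (simp add: real_sqrt_divide real_sqrt_mult field_simps)
 ultimately show ?thesis using main[of t] main[of "1 / t"] t by simp
qed

lemma mult_exp_neg_le: "X >= 0 ==> X * exp (- X) <= exp (- (X / 2))" for X :: real
proof -
 assume "X >= 0"
 moreover have "0 <= (X / 2 - 1)^2" by simp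
 ultimately have "X <= exp (X / 2)" using exp_lower_Taylor_quadratic[of "X / 2"]
 by (simp add: power2_eq_square algebra_simps)
 hence "X * exp (- X) <= exp (X / 2) * exp (- X)" by (intro mult_right_mono) auto
 thus ?thesis by (simp flip: exp_add)
qed

lemma integrable_theta2:
 assumes z: "Im z > 0" and t: "t > 0"
 shows "integrable (count_space UNIV) (%p. (of_int (fst p) * z + of_int (snd p))\<^sup>2 * complex_of_real (exp (- (pi * t) * qform z p)))"
proof (rule Bochner_Integration.integrable_bound)
 show "integrable (count_space UNIV) (%p. Im z / (pi * t) * exp (- (pi * t / 2) * qform z p))"
 using z t by (intro integrable_mult_right integrable_exp_qform) auto
 show "AE p in count_space UNIV. norm ((of_int (fst p) * z + of_int (snd p))^2 * complex_of_real (exp (- (pi * t) * qform z p))) <= norm (Im z / (pi * t) * exp (- (pi * t / 2) * qform z p))"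
 proof (rule AE_I2)
 fix p :: "int \<times> int"
 have "norm ((of_int (fst p) * z + of_int (snd p))^2 * complex_of_real (exp (- (pi * t) * qform z p)))
 = Im z / (pi * t) * ((pi * t * qform z p) * exp (- (pi * t * qform z p)))"
 using z t by (simp add: norm_mult norm_power qform_def)
 also have "... <= Im z / (pi * t) * exp (- ((pi * t * qform z p) / 2))"
 using z t qform_nonneg[OF z, of p] by (intro mult_left_mono mult_exp_neg_le) auto
 finally show "norm ((of_int (fst p) * z + of_int (snd p))^2 * complex_of_real (exp (- (pi * t) * qform z p))) <= norm (Im z / (pi * t) * exp (- (pi * t / 2) * qform z p))"
 using z t by (simp add: mult_ac)
 qed
qed simp

text \<open>The derivative of |c z + d|^2 / y in x is Im ((c z + d)^2) / y^2; the derivative in y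
  yields the real part with the opposite sign.\<close>

lemma theta_has_derivative_x:
 assumes y: "y > 0" and t: "t > 0"
 shows "((%x. theta t (Complex x y)) has_real_derivative (- (pi * t) * Im (theta2 t (Complex x y)) / y^2)) (at x)"
proof -
 \<comment> \<open>The majorant keeps half of the exponent; the other half absorbs the factor pi t q
   produced by differentiation.\<close>
 obtain g where g: "integrable (count_space UNIV) g"
 "!!z p. y <= Im z ==> Im z <= y ==> \<bar>Re z\<bar> <= \<bar>x\<bar> + 1 ==> exp (- (pi * t / 2) * qform z p) <= g p"
 using qform_exp_bound[of y y "pi * t / 2" "\<bar>x\<bar> + 1"] y t by (metis order_refl divide_pos_pos mult_pos_pos pi_gt_zero zero_less_numeral)
 let ?f' = "%p s. - (pi * t) * (Im ((of_int (fst p) * Complex s y + of_int (snd p))^2) / y^2) * exp (- (pi * t) * qform (Complex s y) p)"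
 have "((%s. \<integral>p. exp (- (pi * t) * qform (Complex s y) p) \<partial>count_space UNIV) has_real_derivative (\<integral>p. ?f' p x \<partial>count_space UNIV)) (at x)"
 proof (rule has_real_derivative_integral(1)[where e = 1 and g = "%p. 1 / y * g p"])
 show "integrable (count_space UNIV) (%p. 1 / y * g p)" using g by simp
 fix s assume s: "\<bar>s - x\<bar> < 1"
 show "integrable (count_space UNIV) (%p. exp (- (pi * t) * qform (Complex s y) p))"
 using y t by (intro integrable_exp_qform) auto
 fix p :: "int \<times> int"
 obtain c d where p: "p = (c, d)" by (cases p)
 show "((%s. exp (- (pi * t) * qform (Complex s y) p)) has_real_derivative ?f' p s) (at s)"
 unfolding p qform_Complex[OF y] using y
 by (auto intro!: derivative_eq_intros simp: power2_eq_square field_simps)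
 let ?q = "qform (Complex s y) p"
 have "\<bar>Im ((of_int (fst p) * Complex s y + of_int (snd p))^2)\<bar> <= cmod (of_int (fst p) * Complex s y + of_int (snd p)) ^ 2"
 by (metis abs_Im_le_cmod norm_power)
 also have "... = ?q * y" using y by (simp add: qform_def)
 finally have "\<bar>Im ((of_int (fst p) * Complex s y + of_int (snd p))^2)\<bar> / y^2 <= ?q / y"
 using y by (simp add: field_simps power2_eq_square)
 hence "\<bar>?f' p s\<bar> <= pi * t * (?q / y) * exp (- (pi * t) * ?q)"
 unfolding abs_mult abs_divide using t y qform_nonneg[of "Complex s y" p] by (intro mult_right_mono mult_mono) auto
 also have "... = 1 / y * ((pi * t * ?q) * exp (- (pi * t * ?q)))" by simp
 also have "... <= 1 / y * exp (- ((pi * t * ?q) / 2))"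
 using y t qform_nonneg[of "Complex s y" p] by (intro mult_left_mono mult_exp_neg_le) auto
 also have "exp (- ((pi * t * ?q) / 2)) <= g p" using g(2)[of "Complex s y" p] s by auto
 finally show "\<bar>?f' p s\<bar> <= 1 / y * g p" using y by (simp add: divide_right_mono)
 qed auto
 also have "(\<integral>p. ?f' p x \<partial>count_space UNIV) = - (pi * t) * Im (theta2 t (Complex x y)) / y^2"
 proof -
 have "(\<integral>p. ?f' p x \<partial>count_space UNIV) = (\<integral>p. - (pi * t) / y^2 * Im ((of_int (fst p) * Complex x y + of_int (snd p))^2 * complex_of_real (exp (- (pi * t) * qform (Complex x y) p))) \<partial>count_space UNIV)"
 by (intro Bochner_Integration.integral_cong) auto
 also have "... = - (pi * t) / y^2 * Im (theta2 t (Complex x y))"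
 unfolding theta2_def using integral_Im[OF integrable_theta2[of "Complex x y" t]] y t
 by (simp only: integral_mult_right_zero) simp
 finally show ?thesis by simp
 qed
 finally show ?thesis by (simp add: theta_def)
qed

lemma theta_has_derivative_y:
 assumes y: "y > 0" and t: "t > 0"
 shows "((%y. theta t (Complex x y)) has_real_derivative ((pi * t) * Re (theta2 t (Complex x y)) / y^2)) (at y)"
proof -
 obtain g where g: "integrable (count_space UNIV) g"
 "!!z p. y / 2 <= Im z ==> Im z <= 2 * y ==> \<bar>Re z\<bar> <= \<bar>x\<bar> ==> exp (- (pi * t / 2) * qform z p) <= g p"
 using qform_exp_bound[of "y / 2" "2 * y" "pi * t / 2" "\<bar>x\<bar>"] y t by auto
 let ?f' = "%p s. (pi * t) * (Re ((of_int (fst p) * Complex x s + of_int (snd p))^2) / s^2) * exp (- (pi * t) * qform (Complex x s) p)"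
 have "((%s. \<integral>p. exp (- (pi * t) * qform (Complex x s) p) \<partial>count_space UNIV) has_real_derivative (\<integral>p. ?f' p y \<partial>count_space UNIV)) (at y)"
 proof (rule has_real_derivative_integral(1)[where e = "y / 2" and g = "%p. 2 / y * g p"])
 show "integrable (count_space UNIV) (%p. 2 / y * g p)" using g by simp
 show "y / 2 > 0" using y by simp
 fix s assume s: "\<bar>s - y\<bar> < y / 2"
 hence s': "s > 0" "y / 2 <= s" "s <= 2 * y" using y by (auto simp: abs_if split: if_splits)
 show "integrable (count_space UNIV) (%p. exp (- (pi * t) * qform (Complex x s) p))"
 using s' t by (intro integrable_exp_qform) auto
 fix p :: "int \<times> int"
 obtain c d where p: "p = (c, d)" by (cases p)
 have "((%s. exp (- (pi * t) * ((real_of_int d + real_of_int c * x)^2 / s + (real_of_int c)^2 * s))) has_real_derivative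
 exp (- (pi * t) * ((real_of_int d + real_of_int c * x)^2 / s + (real_of_int c)^2 * s)) * (- (pi * t) * (- (real_of_int d + real_of_int c * x)\<^sup>2 / s^2 + (real_of_int c)^2))) (at s)"
 using s' by (auto intro!: derivative_eq_intros simp: power2_eq_square)
 also have "(- (pi * t) * (- (real_of_int d + real_of_int c * x)\<^sup>2 / s^2 + (real_of_int c)^2)) = (pi * t) * (Re ((of_int (fst p) * Complex x s + of_int (snd p))^2) / s^2)"
 using s' by (simp add: p power2_eq_square field_simps)
 finally have "((%s. exp (- (pi * t) * ((real_of_int d + real_of_int c * x)^2 / s + (real_of_int c)^2 * s))) has_real_derivative ?f' p s) (at s)"
 using s' by (simp add: p qform_Complex mult_ac)
 thus "((%s. exp (- (pi * t) * qform (Complex x s) p)) has_real_derivative ?f' p s) (at s)"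
 proof (rule has_field_derivative_transform_within_open[where S = "{0<..}"])
 fix s' :: real assume "s' \<in> {0<..}"
 thus "exp (- (pi * t) * ((real_of_int d + real_of_int c * x)^2 / s' + (real_of_int c)^2 * s')) = exp (- (pi * t) * qform (Complex x s') p)"
 by (simp add: p qform_Complex)
 qed (use s' in auto)
 let ?q = "qform (Complex x s) p"
 have q0: "?q >= 0" using s' qform_nonneg[of "Complex x s" p] by auto
 have "\<bar>Re ((of_int (fst p) * Complex x s + of_int (snd p))^2)\<bar> <= cmod (of_int (fst p) * Complex x s + of_int (snd p)) ^ 2"
 by (metis abs_Re_le_cmod norm_power)
 also have "... = ?q * s" using s' by (simp add: qform_def)
 finally have "\<bar>Re ((of_int (fst p) * Complex x s + of_int (snd p))^2)\<bar> / s^2 <= ?q / s"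
 using s' by (simp add: field_simps power2_eq_square)
 also have "... <= ?q / (y / 2)" using s' y q0 by (intro divide_left_mono) auto
 finally have "\<bar>?f' p s\<bar> <= pi * t * (?q / (y / 2)) * exp (- (pi * t) * ?q)"
 unfolding abs_mult abs_divide using t y q0 by (intro mult_right_mono mult_mono) auto
 also have "... = 2 / y * ((pi * t * ?q) * exp (- (pi * t * ?q)))" by simp
 also have "... <= 2 / y * exp (- ((pi * t * ?q) / 2))"
 using y t q0 by (intro mult_left_mono mult_exp_neg_le) auto
 also have "exp (- ((pi * t * ?q) / 2)) <= g p" using g(2)[of "Complex x s" p] s' by auto
 finally show "\<bar>?f' p s\<bar> <= 2 / y * g p" using y by (simp add: divide_right_mono)
 qed
 also have "(\<integral>p. ?f' p y \<partial>count_space UNIV) = (pi * t) * Re (theta2 t (Complex x y)) / y^2"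
 proof -
 have "(\<integral>p. ?f' p y \<partial>count_space UNIV) = (\<integral>p. (pi * t) / y^2 * Re ((of_int (fst p) * Complex x y + of_int (snd p))^2 * complex_of_real (exp (- (pi * t) * qform (Complex x y) p))) \<partial>count_space UNIV)"
 by (intro Bochner_Integration.integral_cong) auto
 also have "... = (pi * t) / y^2 * Re (theta2 t (Complex x y))"
 unfolding theta2_def using integral_Re[OF integrable_theta2[of "Complex x y" t]] y t
 by (simp only: integral_mult_right_zero) simp
 finally show ?thesis by simp
 qed
 finally show ?thesis by (simp add: theta_def)
qed

text \<open>Differentiating the equation of \<open>theta\<close> in x and y gives the imaginary and
  the real part. The prefactor is pi t on one side and pi / t on the other, which turns 1 / t into 1
  / t^3.\<close>

lemma theta2_functional_equation:
 assumes z: "Im z > 0" and t: "t > 0"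
 shows "theta2 t z = theta2 (1 / t) z / of_real (t ^ 3)"
proof -
 obtain x y where zxy: "z = Complex x y" by (cases z)
 have y: "y > 0" using z by (simp add: zxy)
 have "((%x. theta (1 / t) (Complex x y) / t) has_real_derivative (- (pi * (1 / t)) * Im (theta2 (1 / t) (Complex x y)) / y^2) / t) (at x)"
 using y t by (intro DERIV_cdivide theta_has_derivative_x) auto
 moreover have "(%x. theta (1 / t) (Complex x y) / t) = (%x. theta t (Complex x y))"
 using theta_functional_equation[of "Complex _ y" t] y t by auto
 ultimately have "- (pi * t) * Im (theta2 t (Complex x y)) / y^2 = (- (pi * (1 / t)) * Im (theta2 (1 / t) (Complex x y)) / y^2) / t"
 using DERIV_unique[OF theta_has_derivative_x[OF y t]] by auto
 hence I: "Im (theta2 t z) = Im (theta2 (1 / t) z) / t ^ 3"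
 using y t by (simp add: zxy field_simps power3_eq_cube)
 have "((%y. theta (1 / t) (Complex x y) / t) has_real_derivative ((pi * (1 / t)) * Re (theta2 (1 / t) (Complex x y)) / y^2) / t) (at y)"
 using y t by (intro DERIV_cdivide theta_has_derivative_y) auto
 hence "((%y. theta t (Complex x y)) has_real_derivative ((pi * (1 / t)) * Re (theta2 (1 / t) (Complex x y)) / y^2) / t) (at y)"
 by (rule has_field_derivative_transform_within_open[where S = "{0<..}"])
 (use y t theta_functional_equation[of "Complex x _" t] in auto)
 hence "(pi * t) * Re (theta2 t (Complex x y)) / y^2 = ((pi * (1 / t)) * Re (theta2 (1 / t) (Complex x y)) / y^2) / t"
 using DERIV_unique[OF theta_has_derivative_y[OF y t]] by auto
 hence R: "Re (theta2 t z) = Re (theta2 (1 / t) z) / t ^ 3"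
 using y t by (simp add: zxy field_simps power3_eq_cube)
 show ?thesis using I R by (simp add: complex_eq_iff)
qed

section \<open>Integrals of derivatives over unbounded intervals; the MacDonald-Bessel
  function\<close>

lemma integral_FTC_whole_line:
 fixes F f :: "real => real"
 assumes F: "!!x. (F has_real_derivative f x) (at x)" and f: "continuous_on UNIV f" "integrable lborel f"
 and lim: "(F \<longlongrightarrow> 0) at_bot" "(F \<longlongrightarrow> 0) at_top"
 shows "(\<integral>x. f x \<partial>lborel) = 0"
proof -
 have "(LBINT x=-\<infinity>..\<infinity>. f x) = 0 - 0"
 proof (rule interval_integral_FTC_integrable[where F = F])
 show "(F has_vector_derivative f x) (at x)" for x
 using F by (simp add: has_real_derivative_iff_has_vector_derivative)
 show "isCont f x" for x using f by (simp add: continuous_on_eq_continuous_at)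
 show "set_integrable lborel (einterval (- \<infinity>) \<infinity>) f" using f by (simp add: set_integrable_def)
 show "((F \<circ> real_of_ereal) \<longlongrightarrow> 0) (at_right (- \<infinity>))"
 using lim by (simp add: ereal_tendsto_simps)
 show "((F \<circ> real_of_ereal) \<longlongrightarrow> 0) (at_left \<infinity>)"
 using lim by (simp add: ereal_tendsto_simps)
 qed simp
 thus ?thesis by (simp add: interval_lebesgue_integral_def set_lebesgue_integral_def)
qed

lemma integral_FTC_half_line:
 fixes F f :: "real => real"
 assumes F: "!!x. (F has_real_derivative f x) (at x)" and f: "continuous_on UNIV f" 
 "integrable lborel (%x. indicator {0..} x * f x)"
 and lim: "F 0 = 0" "(F \<longlongrightarrow> 0) at_top"
 shows "(\<integral>x. indicator {0..} x * f x \<partial>lborel) = 0"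
proof -
 have ae: "AE x in lborel. indicator {0..} x * f x = indicator (einterval 0 \<infinity>) x * f x"
 using AE_lborel_singleton[of 0] by eventually_elim (auto simp: indicator_def einterval_def zero_ereal_def)
 have m: "f \<in> borel_measurable borel" using f by (intro borel_measurable_continuous_onI)
 have "integrable lborel (%x. indicator (einterval 0 \<infinity>) x * f x)"
 using f(2) m by (subst integrable_cong_AE[OF _ _ ae, symmetric]) auto
 moreover have "isCont F 0" using F DERIV_isCont by blast
 hence "(F \<longlongrightarrow> 0) (at_right 0)" using lim(1) unfolding isCont_def by (metis filterlim_at_split)
 ultimately have "(LBINT x=0..\<infinity>. f x) = 0 - 0"
 using F f(1) lim(2)
 by (intro interval_integral_FTC_integrable[where F = F])
 (auto simp: has_real_derivative_iff_has_vector_derivative continuous_on_eq_continuous_at set_integrable_def ereal_tendsto_simps zero_ereal_def)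
 hence "(\<integral>x. indicator (einterval 0 \<infinity>) x * f x \<partial>lborel) = 0"
 by (simp add: interval_lebesgue_integral_def set_lebesgue_integral_def)
 thus ?thesis using m by (subst integral_cong_AE[OF _ _ ae]) auto
qed

lemma cosh_ge_quadratic: "cosh t >= 1 + t^2 / 2" for t :: real
proof -
 have "cosh \<bar>t\<bar> >= 1 + \<bar>t\<bar>\<^sup>2 / 2"
 proof -
 have "\<bar>t\<bar> / 2 <= sinh (\<bar>t\<bar> / 2)"
 using real_le_x_sinh[of "\<bar>t\<bar> / 2"] by (simp add: sinh_field_def exp_minus)
 hence "(\<bar>t\<bar> / 2)^2 <= (sinh (\<bar>t\<bar> / 2))^2" by (intro power_mono) auto
 moreover have "cosh \<bar>t\<bar> = 1 + 2 * (sinh (\<bar>t\<bar> / 2))^2"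
 using cosh_double[of "\<bar>t\<bar> / 2"] cosh_square_eq[of "\<bar>t\<bar> / 2"] by simp
 ultimately show ?thesis by (simp add: power_divide)
 qed
 thus ?thesis by simp
qed

lemma sinh_ge_self: "t >= 0 ==> t <= sinh t" for t :: real
 using real_le_x_sinh[of t] by (simp add: sinh_field_def exp_minus)

lemma power_exp_le: "X >= 0 ==> X ^ j * exp (- (a * X)) <= fact j * (2 / a) ^ j * exp (- (a / 2 * X))" if "a > 0" for X a :: real
proof -
 assume X: "X >= 0"
 have "(a / 2 * X) ^ j / fact j <= exp (a / 2 * X)"
 proof -
 have "(\<Sum>i\<in>{j}. (a / 2 * X) ^ i /\<^sub>R fact i) <= exp (a / 2 * X)"
 unfolding exp_def using that X
 by (intro sum_le_suminf summable_exp_generic) (auto intro!: divide_nonneg_nonneg)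
 thus ?thesis by (simp add: field_simps)
 qed
 hence "X ^ j <= fact j * (2 / a) ^ j * exp (a / 2 * X)"
 using that by (simp add: field_simps power_mult_distrib power_divide)
 hence "X ^ j * exp (- (a * X)) <= fact j * (2 / a) ^ j * exp (a / 2 * X) * exp (- (a * X))"
 by (intro mult_right_mono) auto
 moreover have "exp (a / 2 * X) * exp (- (a * X)) = exp (- (a / 2 * X))" by (simp flip: exp_add)
 ultimately show ?thesis by (simp only: mult.assoc)
qed

text \<open>For imaginary index the Bessel function is real. Up to sign, \<open>Kint j\<close> is
  its j-th derivative in \<open>y\<close>, each differentiation producing one factor cosh t.\<close>

definition Kint :: "nat => real => real => real" where
 "Kint j u y = (\<integral>t. indicator {0..} t * (cosh t ^ j * exp (- (y * cosh t)) * cos (u * t)) \<partial>lborel)"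

abbreviation "Kb \<equiv> Kint 0"

lemma macdonald_K_eq: "macdonald_K (\<i> * of_real u) y = of_real (Kb u y)"
proof -
 have c: "cosh (\<i> * of_real u * of_real t) = complex_of_real (cos (u * t))" for t
 by (simp add: cosh_field_def cos_exp_eq mult.assoc flip: cos_of_real)
 have "indicator {0..} t *\<^sub>R (complex_of_real (exp (- y * cosh t)) * cosh (\<i> * of_real u * of_real t))
 = complex_of_real (indicator {0..} t * (cosh t ^ 0 * exp (- (y * cosh t)) * cos (u * t)))" for t
 by (simp add: c scaleR_conv_of_real)
 thus ?thesis
 unfolding macdonald_K_def Kint_def set_lebesgue_integral_def by (simp only: integral_complex_of_real)
qed

lemma exp_cosh_gaussian:
 assumes y: "y > 0"
 shows "integrable lborel (%t::real. exp (- y) * exp (- (y / 2) * t^2))"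
 and "(\<integral>t. exp (- y) * exp (- (y / 2) * t^2) \<partial>lborel) = sqrt (2 * pi / y) * exp (- y)"
 and "exp (- (y * cosh t)) <= exp (- y) * exp (- (y / 2) * t^2)"
proof -
 have eq: "complex_of_real (exp (- pi * (y / (2 * pi)) * t^2)) * cis (2 * pi * 0 * t) = complex_of_real (exp (- (y / 2) * t^2))" for t
 by simp
 have i: "integrable lborel (%t::real. complex_of_real (exp (- (y / 2) * t^2)))"
 using gaussian_fourier(1)[of "y / (2 * pi)" 0] y unfolding eq by simp
 thus "integrable lborel (%t::real. exp (- y) * exp (- (y / 2) * t^2))"
 by (intro integrable_mult_right) (simp only: complex_of_real_integrable_eq)
 have "complex_of_real (\<integral>t. exp (- (y / 2) * t^2) \<partial>lborel) = of_real (1 / sqrt (y / (2 * pi)))"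
 using gaussian_fourier(2)[of "y / (2 * pi)" 0] y unfolding eq by simp
 hence "(\<integral>t. exp (- (y / 2) * t^2) \<partial>lborel) = 1 / sqrt (y / (2 * pi))"
 by (simp only: of_real_eq_iff)
 thus "(\<integral>t. exp (- y) * exp (- (y / 2) * t^2) \<partial>lborel) = sqrt (2 * pi / y) * exp (- y)"
 by (simp add: real_sqrt_divide)
 have "y * (1 + t^2 / 2) <= y * cosh t" using y cosh_ge_quadratic[of t] by (intro mult_left_mono) auto
 thus "exp (- (y * cosh t)) <= exp (- y) * exp (- (y / 2) * t^2)"
 by (simp add: algebra_simps flip: exp_add)
qed

lemma integrable_Kint_majorant:
 assumes y: "y > 0"
 shows "integrable lborel (%t::real. cosh t ^ j * exp (- (y * cosh t)))"
proof (rule Bochner_Integration.integrable_bound)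
 show "integrable lborel (%t. fact j * (2 / y) ^ j * (exp (- (y/2)) * exp (- (y / 2 / 2) * t^2)))"
 using exp_cosh_gaussian(1)[of "y / 2"] y by (intro integrable_mult_right) auto
 show "AE t in lborel. norm (cosh t ^ j * exp (- (y * cosh t))) <= norm (fact j * (2 / y) ^ j * (exp (- (y/2)) * exp (- (y / 2 / 2) * t^2)))"
 proof (rule AE_I2)
 fix t :: real
 have "cosh t ^ j * exp (- (y * cosh t)) <= fact j * (2 / y) ^ j * exp (- (y / 2 * cosh t))"
 using y by (intro power_exp_le) (auto simp: cosh_real_nonneg)
 also have "... <= fact j * (2 / y) ^ j * (exp (- (y/2)) * exp (- (y / 2 / 2) * t^2))"
 using y exp_cosh_gaussian(3)[of "y / 2" t] by (intro mult_left_mono) auto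
 finally show "norm (cosh t ^ j * exp (- (y * cosh t))) <= norm (fact j * (2 / y) ^ j * (exp (- (y/2)) * exp (- (y / 2 / 2) * t^2)))"
 using y by (simp add: abs_mult)
 qed
qed (auto intro!: borel_measurable_continuous_onI continuous_intros)

lemma borel_measurable_cosh_sinh [measurable]:
 "(cosh :: real => real) \<in> borel_measurable borel" "(sinh :: real => real) \<in> borel_measurable borel"
 by (auto intro!: borel_measurable_continuous_onI continuous_intros)

lemma integrable_Kint:
 fixes y :: real
 assumes y: "y > 0"
 shows "integrable lborel (%t. indicator {0..} t * (cosh t ^ j * exp (- (y * cosh t)) * cos (u * t)))"
 by (rule Bochner_Integration.integrable_bound[OF integrable_Kint_majorant[OF y, of j]])
 (auto simp: abs_mult indicator_def mult_left_le)

text \<open>Half of the exponent absorbs cosh^j, the other half becomes a Gaussian through cosh t >=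
  1 + t^2 / 2. The oscillating cosine is bounded by 1, so nothing depends on
  \<open>u\<close>.\<close>

lemma Kint_bound:
 assumes y: "y > 0"
 shows "\<bar>Kint j u y\<bar> <= fact j * (2 / y) ^ j * (sqrt (4 * pi / y) * exp (- (y / 2)))"
proof -
 have "\<bar>Kint j u y\<bar> <= (\<integral>t. \<bar>indicator {0..} t * (cosh t ^ j * exp (- (y * cosh t)) * cos (u * t))\<bar> \<partial>lborel)"
 unfolding Kint_def by (rule integral_abs_bound)
 also have "... <= (\<integral>t. fact j * (2 / y) ^ j * (exp (- (y/2)) * exp (- (y / 2 / 2) * t^2)) \<partial>lborel)"
 proof (rule integral_mono)
 show "integrable lborel (%t. \<bar>indicator {0..} t * (cosh t ^ j * exp (- (y * cosh t)) * cos (u * t))\<bar>)"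
 using integrable_Kint[OF y] by (rule integrable_abs)
 show "integrable lborel (%t. fact j * (2 / y) ^ j * (exp (- (y/2)) * exp (- (y / 2 / 2) * t^2)))"
 using exp_cosh_gaussian(1)[of "y / 2"] y by (intro integrable_mult_right) auto
 fix t :: real
 have "\<bar>indicator {0..} t * (cosh t ^ j * exp (- (y * cosh t)) * cos (u * t))\<bar> <= cosh t ^ j * exp (- (y * cosh t))"
 by (auto simp: abs_mult indicator_def mult_left_le)
 also have "cosh t ^ j * exp (- (y * cosh t)) <= fact j * (2 / y) ^ j * exp (- (y / 2 * cosh t))"
 using y by (intro power_exp_le) (auto simp: cosh_real_nonneg)
 also have "... <= fact j * (2 / y) ^ j * (exp (- (y/2)) * exp (- (y / 2 / 2) * t^2))"
 using y exp_cosh_gaussian(3)[of "y / 2" t] by (intro mult_left_mono) auto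
 finally show "\<bar>indicator {0..} t * (cosh t ^ j * exp (- (y * cosh t)) * cos (u * t))\<bar> <= fact j * (2 / y) ^ j * (exp (- (y/2)) * exp (- (y / 2 / 2) * t^2))" .
 qed
 also have "... = fact j * (2 / y) ^ j * (sqrt (4 * pi / y) * exp (- (y / 2)))"
 using exp_cosh_gaussian(2)[of "y / 2"] y by simp
 finally show ?thesis .
qed

lemma Kb_bound:
 assumes y: "y > 0"
 shows "\<bar>Kb u y\<bar> <= sqrt (2 * pi / y) * exp (- y)"
proof -
 have "\<bar>Kb u y\<bar> <= (\<integral>t. \<bar>indicator {0..} t * (cosh t ^ 0 * exp (- (y * cosh t)) * cos (u * t))\<bar> \<partial>lborel)"
 unfolding Kint_def by (rule integral_abs_bound)
 also have "... <= (\<integral>t. exp (- y) * exp (- (y / 2) * t^2) \<partial>lborel)"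
 proof (rule integral_mono)
 show "integrable lborel (%t. \<bar>indicator {0..} t * (cosh t ^ 0 * exp (- (y * cosh t)) * cos (u * t))\<bar>)"
 using integrable_Kint[OF y] by (rule integrable_abs)
 show "integrable lborel (%t. exp (- y) * exp (- (y / 2) * t^2))"
 using exp_cosh_gaussian(1)[OF y] .
 fix t :: real
 have "\<bar>indicator {0..} t * (cosh t ^ 0 * exp (- (y * cosh t)) * cos (u * t))\<bar> <= exp (- (y * cosh t))"
 by (auto simp: abs_mult indicator_def mult_left_le)
 also have "... <= exp (- y) * exp (- (y / 2) * t^2)"
 by (rule exp_cosh_gaussian(3)[OF y])
 finally show "\<bar>indicator {0..} t * (cosh t ^ 0 * exp (- (y * cosh t)) * cos (u * t))\<bar> <= exp (- y) * exp (- (y / 2) * t^2)" .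
 qed
 also have "... = sqrt (2 * pi / y) * exp (- y)"
 using exp_cosh_gaussian(2)[OF y] by simp
 finally show ?thesis .
qed

lemma Kint_has_derivative:
 assumes y: "y > 0"
 shows "(Kint j u has_real_derivative - Kint (Suc j) u y) (at y)"
proof -
 let ?f' = "%t s. - (indicator {0..} t * (cosh t ^ Suc j * exp (- (s * cosh t)) * cos (u * t)))"
 have "((%s. \<integral>t. indicator {0..} t * (cosh t ^ j * exp (- (s * cosh t)) * cos (u * t)) \<partial>lborel) has_real_derivative
 (\<integral>t. ?f' t y \<partial>lborel)) (at y)"
 proof (rule has_real_derivative_integral(1)[where e = "y / 2" and g = "%t. cosh t ^ Suc j * exp (- (y / 2 * cosh t))"])
 show "integrable lborel (%t. cosh t ^ Suc j * exp (- (y / 2 * cosh t)))"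
 using y by (intro integrable_Kint_majorant) auto
 fix s assume s: "\<bar>s - y\<bar> < y / 2"
 hence s': "s > 0" "y / 2 <= s" using y by (auto simp: abs_if split: if_splits)
 show "integrable lborel (%t. indicator {0..} t * (cosh t ^ j * exp (- (s * cosh t)) * cos (u * t)))"
 by (rule integrable_Kint) fact
 fix t :: real
 show "((%s. indicator {0..} t * (cosh t ^ j * exp (- (s * cosh t)) * cos (u * t))) has_real_derivative ?f' t s) (at s)"
 by (auto intro!: derivative_eq_intros)
 have "\<bar>?f' t s\<bar> <= cosh t ^ Suc j * exp (- (s * cosh t))"
 by (auto simp: abs_mult indicator_def mult_left_le)
 also have "... <= cosh t ^ Suc j * exp (- (y / 2 * cosh t))"
 using s' y by (intro mult_left_mono) (auto intro!: mult_right_mono simp: cosh_real_nonneg)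
 finally show "\<bar>?f' t s\<bar> <= cosh t ^ Suc j * exp (- (y / 2 * cosh t))" .
 qed (use y in auto)
 thus ?thesis by (simp add: Kint_def[abs_def])
qed

lemma tendsto_exp_cosh:
 fixes y :: real
 assumes y: "y > 0"
 shows "((%t. cosh t ^ j * exp (- (y * cosh t))) \<longlongrightarrow> 0) at_top"
proof (rule tendsto_sandwich[OF _ _ tendsto_const])
 show "((%t. fact j * (2 / y) ^ j * (exp (- (y/2)) * exp (- (y / 2 / 2) * t^2))) \<longlongrightarrow> 0) at_top"
 using y by (intro tendsto_mult_right_zero) real_asymp
 show "\<forall>\<^sub>F t in at_top. cosh t ^ j * exp (- (y * cosh t)) <= fact j * (2 / y) ^ j * (exp (- (y/2)) * exp (- (y / 2 / 2) * t^2))"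
 proof (rule always_eventually, rule allI)
 fix t :: real
 have "cosh t ^ j * exp (- (y * cosh t)) <= fact j * (2 / y) ^ j * exp (- (y / 2 * cosh t))"
 using y by (intro power_exp_le) (auto simp: cosh_real_nonneg)
 also have "... <= fact j * (2 / y) ^ j * (exp (- (y/2)) * exp (- (y / 2 / 2) * t^2))"
 using y exp_cosh_gaussian(3)[of "y / 2" t] by (intro mult_left_mono) auto
 finally show "cosh t ^ j * exp (- (y * cosh t)) <= fact j * (2 / y) ^ j * (exp (- (y/2)) * exp (- (y / 2 / 2) * t^2))" .
 qed
qed (auto intro!: always_eventually mult_nonneg_nonneg zero_le_power simp: cosh_real_nonneg)

text \<open>The modified Bessel equation of index i u, with K' = - \<open>Kint 1\<close> and K'' =
  \<open>Kint 2\<close>: the difference of the two sides is the integral of the derivative of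
  \<open>?F\<close>, which vanishes at both ends of the half line.\<close>

lemma Kint_ode:
 assumes y: "y > 0"
 shows "y^2 * Kint 2 u y - y * Kint 1 u y = (y^2 - u\<^sup>2) * Kb u y"
proof -
 let ?e = "%t. exp (- (y * cosh t))"
 let ?F = "%t. (- y * sinh t * ?e t) * cos (u * t) + u * ?e t * sin (u * t)"
 let ?f = "%t. (y^2 * (sinh t)^2 - y * cosh t + u^2) * ?e t * cos (u * t)"
 let ?k = "%j t. indicator {0..} t * (cosh t ^ j * ?e t * cos (u * t))"
 have eq: "indicator {0..} t * ?f t = y^2 * ?k 2 t - y * ?k 1 t - (y^2 - u\<^sup>2) * ?k 0 t" for t
 by (simp add: sinh_square_eq algebra_simps)
 have i: "integrable lborel (?k j)" for j by (rule integrable_Kint[OF y])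
 have "(\<integral>t. indicator {0..} t * ?f t \<partial>lborel) = 0"
 proof (rule integral_FTC_half_line[where F = ?F])
 show "(?F has_real_derivative ?f t) (at t)" for t
 by (auto intro!: derivative_eq_intros simp: power2_eq_square algebra_simps)
 show "continuous_on UNIV ?f" by (intro continuous_intros)
 show "integrable lborel (%t. indicator {0..} t * ?f t)" unfolding eq
 by (intro Bochner_Integration.integrable_diff integrable_mult_right i)
 have g: "((%t. y * (cosh t ^ 1 * ?e t) + \<bar>u\<bar> * (cosh t ^ 0 * ?e t)) \<longlongrightarrow> y * 0 + \<bar>u\<bar> * 0) at_top"
 by (intro tendsto_add tendsto_mult_left tendsto_exp_cosh y)
 have b: "norm (?F t) <= y * (cosh t ^ 1 * ?e t) + \<bar>u\<bar> * (cosh t ^ 0 * ?e t)" for t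
 proof -
 have "\<bar>sinh t\<bar> <= cosh t" using sinh_le_cosh_real[of "\<bar>t\<bar>"] by simp
 hence "\<bar>(- y * sinh t * ?e t) * cos (u * t)\<bar> <= (y * cosh t * ?e t) * 1"
 unfolding abs_mult using y by (intro mult_mono) auto
 moreover have "\<bar>u * ?e t * sin (u * t)\<bar> <= \<bar>u\<bar> * ?e t * 1"
 unfolding abs_mult by (intro mult_mono) auto
 ultimately show ?thesis using abs_triangle_ineq[of "(- y * sinh t * ?e t) * cos (u * t)" "u * ?e t * sin (u * t)"] by simp
 qed
 show "(?F \<longlongrightarrow> 0) at_top"
 by (rule Lim_null_comparison[OF always_eventually[OF allI[OF b]]]) (use g in simp)
 qed simp
 hence "y^2 * Kint 2 u y - y * Kint 1 u y - (y^2 - u\<^sup>2) * Kb u y = 0"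
 unfolding eq Kint_def
 by (simp only: Bochner_Integration.integral_diff Bochner_Integration.integrable_diff integrable_mult_right i integral_mult_right_zero)
 thus ?thesis by simp
qed

text \<open>The oscillation is harmless once u^2 <= y: 1 - cos (u t) <= u^2 t^2 / 2 <= (u^2 / 2) t
  sinh t, and integration by parts evaluates the integral of t sinh t exp (- y cosh t) as E / y, so
  at most half of E is lost. E itself is bounded below through cosh <= 2 on [0, 1].\<close>

lemma Kb_lower:
 assumes y: "y > 0" "u^2 <= y"
 shows "Kb u y >= exp (- 2 * y) / 2"
proof -
 let ?e = "%t. exp (- (y * cosh t))"
 let ?i = "%t. indicator {0..} t :: real"
 have i0: "integrable lborel (%t. ?i t * ?e t)" using integrable_Kint[OF y(1), of 0 0] by simp
 have i2: "integrable lborel (%t. ?i t * (cosh t ^ 2 * ?e t))" using integrable_Kint[OF y(1), of 2 0] by simp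
 have ts: "\<bar>t * sinh t\<bar> <= cosh t ^ 2" for t :: real
 proof -
 have "\<bar>t\<bar> <= cosh t" using sinh_ge_self[of "\<bar>t\<bar>"] sinh_le_cosh_real[of "\<bar>t\<bar>"] by simp
 moreover have "\<bar>sinh t\<bar> <= cosh t" using sinh_le_cosh_real[of "\<bar>t\<bar>"] by simp
 ultimately show ?thesis unfolding abs_mult power2_eq_square by (intro mult_mono) auto
 qed
 have its: "integrable lborel (%t. ?i t * (t * sinh t * ?e t))"
 by (rule Bochner_Integration.integrable_bound[OF i2])
 (use order_trans[OF abs_ge_self ts] in \<open>auto intro!: AE_I2 simp: abs_mult indicator_def intro!: mult_right_mono\<close>)
 have "(\<integral>t. ?i t * (?e t - y * (t * sinh t * ?e t)) \<partial>lborel) = 0"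
 proof (rule integral_FTC_half_line[where F = "%t. t * ?e t"])
 show "((%t. t * ?e t) has_real_derivative ?e t - y * (t * sinh t * ?e t)) (at t)" for t
 by (auto intro!: derivative_eq_intros simp: algebra_simps)
 show "continuous_on UNIV (%t. ?e t - y * (t * sinh t * ?e t))" by (intro continuous_intros)
 have "integrable lborel (%t. ?i t * ?e t - y * (?i t * (t * sinh t * ?e t)))"
 using i0 its by (intro Bochner_Integration.integrable_diff integrable_mult_right)
 thus "integrable lborel (%t. ?i t * (?e t - y * (t * sinh t * ?e t)))" by (simp add: algebra_simps)
 have g: "((%t. cosh t ^ 1 * ?e t) \<longlongrightarrow> 0) at_top" by (intro tendsto_exp_cosh y)
 have b: "norm (t * ?e t) <= cosh t ^ 1 * ?e t" for t
 using sinh_ge_self[of "\<bar>t\<bar>"] sinh_le_cosh_real[of "\<bar>t\<bar>"] by (auto simp: abs_mult intro!: mult_right_mono)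
 show "((%t. t * ?e t) \<longlongrightarrow> 0) at_top"
 by (rule Lim_null_comparison[OF always_eventually[OF allI[OF b]] g])
 qed simp
 hence parts: "(\<integral>t. ?i t * ?e t \<partial>lborel) = y * (\<integral>t. ?i t * (t * sinh t * ?e t) \<partial>lborel)"
 proof -
 have "(\<integral>t. ?i t * (?e t - y * (t * sinh t * ?e t)) \<partial>lborel) = (\<integral>t. ?i t * ?e t - y * (?i t * (t * sinh t * ?e t)) \<partial>lborel)"
 by (intro Bochner_Integration.integral_cong) (auto simp: algebra_simps)
 also have "... = (\<integral>t. ?i t * ?e t \<partial>lborel) - (\<integral>t. y * (?i t * (t * sinh t * ?e t)) \<partial>lborel)"
 using i0 its by (intro Bochner_Integration.integral_diff integrable_mult_right)
 finally show ?thesis using \<open>_ = 0\<close> by simp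
 qed
 define E where "E = (\<integral>t. ?i t * ?e t \<partial>lborel)"
 have E0: "E >= 0" unfolding E_def by (intro integral_nonneg_AE) auto
 have "E - u\<^sup>2 / 2 * (\<integral>t. ?i t * (t * sinh t * ?e t) \<partial>lborel) = (\<integral>t. ?i t * ?e t - u\<^sup>2 / 2 * (?i t * (t * sinh t * ?e t)) \<partial>lborel)"
 unfolding E_def using i0 its by simp
 also have "... <= Kb u y"
 unfolding Kint_def
 proof (rule integral_mono)
 show "integrable lborel (%t. ?i t * ?e t - u\<^sup>2 / 2 * (?i t * (t * sinh t * ?e t)))"
 using i0 its by (intro Bochner_Integration.integrable_diff integrable_mult_right)
 show "integrable lborel (%t. ?i t * (cosh t ^ 0 * ?e t * cos (u * t)))" by (rule integrable_Kint[OF y(1)])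
 fix t :: real
 show "?i t * ?e t - u\<^sup>2 / 2 * (?i t * (t * sinh t * ?e t)) <= ?i t * (cosh t ^ 0 * ?e t * cos (u * t))"
 proof (cases "t >= 0")
 case True
 have "cos (u * t) >= 1 - (u * t)\<^sup>2 / 2"
 proof -
 have "(sin (u * t / 2))^2 <= (u * t / 2)^2"
 using abs_sin_x_le_abs_x[of "u * t / 2"] by (metis abs_le_square_iff)
 moreover have "cos (u * t) = 1 - 2 * (sin (u * t / 2))^2"
 using cos_double_sin[of "u * t / 2"] by simp
 ultimately show ?thesis by (simp add: power_divide)
 qed
 moreover have "t * t <= t * sinh t" using True sinh_ge_self[of t] by (intro mult_left_mono) auto
 hence "u^2 / 2 * (t * t) <= u^2 / 2 * (t * sinh t)" by (rule mult_left_mono) simp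
 ultimately have "1 - u\<^sup>2 / 2 * (t * sinh t) <= cos (u * t)" by (simp add: power2_eq_square algebra_simps)
 hence "?e t * (1 - u\<^sup>2 / 2 * (t * sinh t)) <= ?e t * cos (u * t)" by (intro mult_left_mono) auto
 thus ?thesis using True by (simp add: algebra_simps)
 qed auto
 qed
 finally have "E - u\<^sup>2 / 2 * (E / y) <= Kb u y" using parts y unfolding E_def by simp
 moreover have "u^2 * E <= y * E" using E0 y by (intro mult_right_mono)
 hence "u^2 / 2 * (E / y) <= E / 2" using y by (simp add: field_simps)
 ultimately have "E / 2 <= Kb u y" by linarith
 moreover have "exp (- 2 * y) <= E"
 proof -
 have "exp (- 2 * y) = (\<integral>t. indicator {0..1::real} t * exp (- 2 * y) \<partial>lborel)" by simp
 also have "... <= E" unfolding E_def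
 proof (rule integral_mono[OF _ i0])
 fix t :: real
 have "cosh t <= 2" if "0 <= t" "t <= 1"
 proof -
 have "cosh t <= cosh 1" using that cosh_real_nonneg_le_iff[of t 1] by simp
 also have "cosh (1::real) = (exp 1 + exp (- 1)) / 2" by (simp add: cosh_field_def)
 also have "... <= (3 + 1) / 2" using exp_le by (intro divide_right_mono add_mono) auto
 finally show ?thesis by simp
 qed
 hence "exp (- 2 * y) <= ?e t" if "0 <= t" "t <= 1" using that y by (simp add: mult.commute)
 thus "indicator {0..1} t * exp (- 2 * y) <= ?i t * ?e t" by (auto simp: indicator_def)
 qed simp
 finally show ?thesis .
 qed
 ultimately show ?thesis by linarith
qed

lemma borel_measurable_integral_count_space:
 fixes f :: "'i => 'a => 'b::{banach,second_countable_topology}"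
 assumes I: "countable I" and "!!i. i \<in> I ==> f i \<in> borel_measurable N"
 shows "(%x. \<integral>i. f i x \<partial>count_space I) \<in> borel_measurable N"
proof -
 interpret C: sigma_finite_measure "count_space I"
 using I by (rule sigma_finite_measure_count_space_countable)
 have "case_prod f \<in> borel_measurable (count_space I \<Otimes>\<^sub>M N)"
 using assms by (intro measurable_pair_measure_countable1) auto
 hence "(%(x, i). f i x) \<in> borel_measurable (N \<Otimes>\<^sub>M count_space I)"
 using measurable_pair_swap[of "case_prod f" "count_space I" N borel] by (simp add: split_beta' case_prod_unfold)
 thus ?thesis by (rule C.borel_measurable_lebesgue_integral)
qed

lemma integral_count_space_Times:
 fixes f :: "'a \<times> 'b => 'c::{banach,second_countable_topology}"
 assumes AB: "countable A" "countable B" and f: "integrable (count_space (A \<times> B)) f"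
 shows "(\<integral>c. \<integral>d. f (c, d) \<partial>count_space B \<partial>count_space A) = (\<integral>p. f p \<partial>count_space (A \<times> B))"
proof -
 interpret A: sigma_finite_measure "count_space A" using AB by (intro sigma_finite_measure_count_space_countable)
 interpret B: sigma_finite_measure "count_space B" using AB by (intro sigma_finite_measure_count_space_countable)
 interpret pair_sigma_finite "count_space A" "count_space B" ..
 have eq: "count_space A \<Otimes>\<^sub>M count_space B = count_space (A \<times> B)"
 using AB by (subst pair_measure_countable) auto
 have "integrable (count_space A \<Otimes>\<^sub>M count_space B) (%(c, d). f (c, d))"
 using f by (simp add: eq)
 from integral_fst[OF this] show ?thesis by (simp add: eq)
qed

lemma integral_count_space_indicator:
 fixes f :: "'a => 'c::{banach,second_countable_topology}"
 assumes "B \<subseteq> A"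
 shows "(\<integral>x. indicator B x *\<^sub>R f x \<partial>count_space A) = (\<integral>x. f x \<partial>count_space B)"
 and "integrable (count_space A) (%x. indicator B x *\<^sub>R f x) \<longleftrightarrow> integrable (count_space B) f"
proof -
 have *: "restrict_space (count_space A) B = count_space B"
 using assms by (simp add: restrict_count_space Int_absorb2)
 show "(\<integral>x. indicator B x *\<^sub>R f x \<partial>count_space A) = (\<integral>x. f x \<partial>count_space B)"
 using integral_restrict_space[of B "count_space A" f] assms by (simp add: * Int_absorb2)
 show "integrable (count_space A) (%x. indicator B x *\<^sub>R f x) \<longleftrightarrow> integrable (count_space B) f"
 using integrable_restrict_space[of B "count_space A" f] assms by (simp add: * Int_absorb2)
qed

section \<open>The invariant measure on the upper half plane\<close>

text \<open>In the coordinates \<open>z = exp et (s + \<i>)\<close> the measure \<open>dx dy / y^2\<close> is Lebesgue measure \<open>ds d(et)\<close>,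
 and the generating Moebius maps act by shears and translations.\<close>

definition hpt :: "real => real => complex" where
 "hpt s et = Complex (s * exp et) (exp et)"

definition hyp :: "complex measure" where
 "hyp = distr lborel borel (%(s, et). hpt s et)"

lemma Re_hpt [simp]: "Re (hpt s et) = s * exp et" and Im_hpt [simp]: "Im (hpt s et) = exp et"
 by (simp_all add: hpt_def)

lemma measurable_hpt [measurable]: "(%(s, et). hpt s et) \<in> borel_measurable (borel \<Otimes>\<^sub>M borel)"
proof -
 have "continuous_on UNIV (%p :: real \<times> real. hpt (fst p) (snd p))"
 unfolding hpt_def Complex_eq by (intro continuous_intros)
 thus ?thesis by (simp add: split_beta' borel_prod borel_measurable_continuous_onI)
qed

lemma sets_hyp [simp, measurable_cong]: "sets hyp = sets borel" and space_hyp [simp]: "space hyp = UNIV"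
 by (simp_all add: hyp_def)

lemma nn_integral_hyp:
 assumes [measurable]: "f \<in> borel_measurable borel"
 shows "(\<integral>\<^sup>+z. f z \<partial>hyp) = (\<integral>\<^sup>+et. \<integral>\<^sup>+s. f (hpt s et) \<partial>lborel \<partial>lborel)"
 and "(\<integral>\<^sup>+z. f z \<partial>hyp) = (\<integral>\<^sup>+s. \<integral>\<^sup>+et. f (hpt s et) \<partial>lborel \<partial>lborel)"
proof -
 have "(\<integral>\<^sup>+z. f z \<partial>hyp) = (\<integral>\<^sup>+p. f (case p of (s, et) => hpt s et) \<partial>(lborel \<Otimes>\<^sub>M lborel))"
 unfolding hyp_def by (subst nn_integral_distr) (auto simp: lborel_prod borel_prod[symmetric])
 also have "... = (\<integral>\<^sup>+p. (case p of (s, et) => f (hpt s et)) \<partial>(lborel \<Otimes>\<^sub>M lborel))"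
 by (intro nn_integral_cong) auto
 finally have *: "(\<integral>\<^sup>+z. f z \<partial>hyp) = (\<integral>\<^sup>+p. (case p of (s, et) => f (hpt s et)) \<partial>(lborel \<Otimes>\<^sub>M lborel))" .
 show "(\<integral>\<^sup>+z. f z \<partial>hyp) = (\<integral>\<^sup>+et. \<integral>\<^sup>+s. f (hpt s et) \<partial>lborel \<partial>lborel)"
 unfolding * by (subst lborel_pair.nn_integral_snd[symmetric]) auto
 show "(\<integral>\<^sup>+z. f z \<partial>hyp) = (\<integral>\<^sup>+s. \<integral>\<^sup>+et. f (hpt s et) \<partial>lborel \<partial>lborel)"
 unfolding * by (subst lborel.nn_integral_fst[symmetric]) auto
qed

lemma AE_hyp: "AE z in hyp. Im z > 0"
 unfolding hyp_def by (subst AE_distr_iff) (auto simp: lborel_prod borel_prod[symmetric])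

lemma measurable_hpt1 [measurable]: "(%s. hpt s et) \<in> borel_measurable borel" "hpt s \<in> borel_measurable borel"
 unfolding hpt_def Complex_eq by (auto intro!: borel_measurable_continuous_onI continuous_intros)

lemma sigma_finite_hyp: "sigma_finite_measure hyp"
proof
 \<comment> \<open>The null set Im z <= 0 is added to every \<open>B k\<close> so that their union
   is the whole type.\<close>
 define B where "B = (%k::nat. {z. \<bar>Re z\<bar> <= k * Im z \<and> exp (- real k) <= Im z \<and> Im z <= exp (real k)} \<union> {z. Im z <= 0})"
 have m [measurable]: "B k \<in> sets borel" for k
 unfolding B_def by measurable
 have "emeasure hyp (B k) ~= \<infinity>" for k
 proof -
 have "emeasure hyp (B k) = (\<integral>\<^sup>+et. \<integral>\<^sup>+s. indicator (B k) (hpt s et) \<partial>lborel \<partial>lborel)"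
 by (subst nn_integral_hyp(1)[symmetric]) auto
 also have "... = (\<integral>\<^sup>+et. \<integral>\<^sup>+s. indicator {- real k..real k} s * indicator {- real k..real k} et \<partial>lborel \<partial>lborel)"
 proof (intro nn_integral_cong)
 fix s et :: real
 have "hpt s et \<in> B k \<longleftrightarrow> \<bar>s\<bar> <= real k \<and> - real k <= et \<and> et <= real k" by (simp add: B_def abs_mult not_le)
 thus "indicator (B k) (hpt s et) = indicator {- real k..real k} s * (indicator {- real k..real k} et :: ennreal)"
 by (auto simp: indicator_def abs_le_iff)
 qed
 also have "... = (\<integral>\<^sup>+et. ennreal (2 * k) * indicator {- real k..real k} et \<partial>lborel)"
 by (intro nn_integral_cong, subst nn_integral_multc) auto
 also have "... < \<infinity>" by (subst nn_integral_cmult_indicator) (auto simp: ennreal_mult_less_top)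
 finally show ?thesis by simp
 qed
 moreover have "(\<Union>k. B k) = UNIV"
 proof (safe; simp)
 fix z :: complex
 show "\<exists>k. z \<in> B k"
 proof (cases "Im z > 0")
 case True
 obtain k :: nat where k: "real k >= \<bar>Re z\<bar> / Im z + \<bar>ln (Im z)\<bar>" using real_arch_simple by blast
 have 1: "\<bar>Re z\<bar> / Im z <= k" "\<bar>ln (Im z)\<bar> <= k" using k True divide_nonneg_pos[of "\<bar>Re z\<bar>" "Im z"] by linarith+
 have "exp (- real k) <= exp (ln (Im z))" "exp (ln (Im z)) <= exp (real k)" using 1 by auto
 hence "z \<in> B k" using 1 True by (auto simp: B_def field_simps)
 thus ?thesis ..
 qed (auto simp: B_def)
 qed
 ultimately show "\<exists>A. countable A \<and> A \<subseteq> sets hyp \<and> \<Union> A = space hyp \<and> (\<forall>a\<in>A. emeasure hyp a ~= \<infinity>)"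
 by (intro exI[of _ "range B"]) auto
qed

section \<open>Integral matrices acting on the half plane\<close>

definition mats :: "int => (int \<times> int \<times> int \<times> int) set" where
 "mats n = {(a, b, c, d). a * d - b * c = n}"

definition mob :: "int \<times> int \<times> int \<times> int => complex => complex" where
 "mob = (%(a, b, c, d) z. (of_int a * z + of_int b) / (of_int c * z + of_int d))"

text \<open>The adjugate stays integral and, as a Moebius map, inverts \<open>mob M\<close> for
  every positive determinant, so it permutes \<open>mats n\<close> for each n.\<close>

definition adj :: "int \<times> int \<times> int \<times> int => int \<times> int \<times> int \<times> int" where
 "adj = (%(a, b, c, d). (d, - b, - c, a))"

lemma mob_simp [simp]: "mob (a, b, c, d) z = (of_int a * z + of_int b) / (of_int c * z + of_int d)"
 by (simp add: mob_def)

lemma adj_simp [simp]: "adj (a, b, c, d) = (d, - b, - c, a)"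
 by (simp add: adj_def)

lemma adj_adj [simp]: "adj (adj M) = M"
 by (cases M) simp

lemma bij_betw_adj: "bij_betw adj (mats n) (mats n)"
 by (rule bij_betwI[where g = adj]) (auto simp: mats_def algebra_simps)

lemma measurable_mob [measurable]: "mob M \<in> borel_measurable borel"
 by (cases M) (simp add: mob_def)

lemma mob_denom_nonzero:
 assumes "Im z > 0" "(c, d) ~= (0, 0)"
 shows "of_int c * z + of_int d ~= (0 :: complex)"
 using assms by (auto simp: complex_eq_iff)

lemma bottom_row_nonzero: "(a, b, c, d) \<in> mats n ==> n ~= 0 ==> (c, d) ~= (0, 0)"
 by (auto simp: mats_def)

lemma Im_mob:
 assumes M: "(a, b, c, d) \<in> mats n" and n: "n ~= 0" and z: "Im z > 0"
 shows "Im (mob (a, b, c, d) z) = n * Im z / (cmod (of_int c * z + of_int d))^2"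
proof -
 have e: "Im ((of_int a * z + of_int b) * cnj (of_int c * z + of_int d)) = n * Im z"
 proof -
 have r: "real_of_int n = real_of_int a * real_of_int d - real_of_int b * real_of_int c"
 using M by (auto simp: mats_def)
 show ?thesis unfolding r by (simp add: algebra_simps)
 qed
 show ?thesis
 using e by (simp add: complex_div_cnj[of "of_int a * z + of_int b"] del: complex_cnj_add complex_cnj_mult)
qed

lemma Im_mob_pos:
 assumes "M \<in> mats n" "n > 0" "Im z > 0"
 shows "Im (mob M z) > 0"
proof -
 obtain a b c d where M: "M = (a, b, c, d)" by (cases M)
 show ?thesis
 using assms Im_mob[of a b c d n z] mob_denom_nonzero[of z c d] bottom_row_nonzero[of a b c d n] unfolding M
 by (auto simp del: mob_simp intro!: divide_pos_pos)
qed

lemma mob_adj: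
 assumes "M \<in> mats n" "n > 0" "Im z > 0"
 shows "mob (adj M) (mob M z) = z"
proof -
 obtain a b c d where M: "M = (a, b, c, d)" by (cases M)
 have nz: "of_int c * z + of_int d ~= 0"
 using assms mob_denom_nonzero[of z c d] bottom_row_nonzero[of a b c d n] unfolding M by auto
 have n: "of_int a * of_int d - of_int b * of_int c = (of_int n :: complex)"
 using assms(1) unfolding M mats_def by (auto simp flip: of_int_mult of_int_diff)
 have "mob (adj M) (mob M z) = (of_int d * (of_int a * z + of_int b) - of_int b * (of_int c * z + of_int d)) /
 (of_int a * (of_int c * z + of_int d) - of_int c * (of_int a * z + of_int b))"
 using nz by (simp add: M divide_simps)
 also have "... = ((of_int a * of_int d - of_int b * of_int c) * z) / (of_int a * of_int d - of_int b * of_int c)"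
 by (simp add: algebra_simps)
 also have "... = z" unfolding n using assms by simp
 finally show ?thesis .
qed

lemma nn_integral_hyp_translate:
 assumes [measurable]: "f \<in> borel_measurable borel"
 shows "(\<integral>\<^sup>+z. f (z + of_real b) \<partial>hyp) = (\<integral>\<^sup>+z. f z \<partial>hyp)"
proof -
 have "(\<integral>\<^sup>+s. f (hpt s et) \<partial>lborel) = (\<integral>\<^sup>+s. f (hpt s et + of_real b) \<partial>lborel)" for et
 proof -
 have "hpt (b * exp (- et) + 1 * s) et = hpt s et + of_real b" for s
 by (simp add: complex_eq_iff distrib_right exp_minus)
 thus ?thesis by (subst nn_integral_real_affine[where c = 1 and t = "b * exp (- et)"]) auto
 qed
 thus ?thesis by (simp add: nn_integral_hyp(1))
qed

lemma nn_integral_hyp_scale: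
 assumes [measurable]: "f \<in> borel_measurable borel" and r: "r > 0"
 shows "(\<integral>\<^sup>+z. f (of_real r * z) \<partial>hyp) = (\<integral>\<^sup>+z. f z \<partial>hyp)"
proof -
 have "(\<integral>\<^sup>+et. f (hpt s et) \<partial>lborel) = (\<integral>\<^sup>+et. f (of_real r * hpt s et) \<partial>lborel)" for s
 proof -
 have "hpt s (ln r + 1 * et) = of_real r * hpt s et" for et
 using r by (simp add: complex_eq_iff exp_add)
 thus ?thesis by (subst nn_integral_real_affine[where c = 1 and t = "ln r"]) auto
 qed
 thus ?thesis by (simp add: nn_integral_hyp(2))
qed

lemma nn_integral_hyp_inverse:
 assumes [measurable]: "f \<in> borel_measurable borel"
 shows "(\<integral>\<^sup>+z. f (- 1 / z) \<partial>hyp) = (\<integral>\<^sup>+z. f z \<partial>hyp)"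
proof -
 have "(\<integral>\<^sup>+et. f (hpt (- s) et) \<partial>lborel) = (\<integral>\<^sup>+et. f (- 1 / hpt s et) \<partial>lborel)" for s
 proof -
 have s: "1 + s^2 > 0" by (simp add: add_pos_nonneg)
 \<comment> \<open>For z = exp et (s + i) one has -1 / z = exp (- et) (- s + i) / (1 + s^2): both
   coordinates are reflected, and \<open>et\<close> is shifted by a function of \<open>s\<close>
   alone.\<close>
 have "hpt (- s) (- ln (1 + s^2) + (- 1) * et) = - 1 / hpt s et" for et
 proof -
 have nz: "hpt s et ~= 0" by (simp add: complex_eq_iff)
 have e: "exp (- ln (1 + s^2) + (- 1) * et) = 1 / ((1 + s^2) * exp et)"
 proof -
 have "exp (- ln (1 + s^2) + (- 1) * et) = exp (- ln (1 + s^2)) * exp (- et)" by (simp flip: exp_add)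
 thus ?thesis using s by (simp add: exp_minus field_simps)
 qed
 have "hpt (- s) (- ln (1 + s^2) + (- 1) * et) * hpt s et = - 1"
 unfolding hpt_def e using s by (simp add: complex_eq_iff divide_simps) (simp add: algebra_simps power2_eq_square)
 thus ?thesis using nz by (simp add: field_simps)
 qed
 thus ?thesis by (subst nn_integral_real_affine[where c = "-1" and t = "- ln (1 + s^2)"]) auto
 qed
 hence "(\<integral>\<^sup>+z. f (- 1 / z) \<partial>hyp) = (\<integral>\<^sup>+s. \<integral>\<^sup>+et. f (hpt (- s) et) \<partial>lborel \<partial>lborel)"
 by (simp add: nn_integral_hyp(2))
 also have "... = (\<integral>\<^sup>+s. \<integral>\<^sup>+et. f (hpt s et) \<partial>lborel \<partial>lborel)"
 by (subst (2) nn_integral_real_affine[where c = "-1" and t = 0]) auto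
 finally show ?thesis by (simp add: nn_integral_hyp(2))
qed

text \<open>For c = 0 the map is affine. Otherwise M z = a / c - (n / c^2) / (z + d / c), a
  composition of translations, a dilation and -1 / z, each of which preserves the measure.\<close>

lemma nn_integral_hyp_mob:
 assumes f [measurable]: "f \<in> borel_measurable borel" and M: "M \<in> mats n" and n: "n > 0"
 shows "(\<integral>\<^sup>+z. f (mob M z) \<partial>hyp) = (\<integral>\<^sup>+z. f z \<partial>hyp)"
proof -
 obtain a b c d where Md: "M = (a, b, c, d)" by (cases M)
 have det: "a * d - b * c = n" using M by (simp add: Md mats_def)
 show ?thesis
 proof (cases "c = 0")
 case True
 hence ad: "a * d = n" using det by simp
 hence d0: "d ~= 0" using n by auto
 have pos: "real_of_int a / real_of_int d > 0"
 using ad n by (auto simp: zero_less_divide_iff zero_less_mult_iff)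
 have "mob M z = of_real (real_of_int a / real_of_int d) * z + of_real (real_of_int b / real_of_int d)" for z
 using True d0 by (simp add: Md add_divide_distrib)
 thus ?thesis
 using nn_integral_hyp_scale[OF _ pos, of "%z. f (z + of_real (real_of_int b / real_of_int d))"]
 nn_integral_hyp_translate[OF f, of "real_of_int b / real_of_int d"] by simp
 next
 case False
 have pos: "real_of_int n / (real_of_int c)^2 > 0" using n False by simp
 let ?f1 = "%z. f (z + of_real (real_of_int a / real_of_int c))"
 let ?f2 = "%z. ?f1 (of_real (real_of_int n / (real_of_int c)^2) * z)"
 let ?f3 = "%z. ?f2 (- 1 / z)"
 have "(\<integral>\<^sup>+z. f (mob M z) \<partial>hyp) = (\<integral>\<^sup>+z. ?f3 (z + of_real (real_of_int d / real_of_int c)) \<partial>hyp)"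
 proof (rule nn_integral_cong_AE)
 show "AE z in hyp. f (mob M z) = ?f3 (z + of_real (real_of_int d / real_of_int c))"
 using AE_hyp
 proof eventually_elim
 case (elim z)
 have nz: "of_int c * z + of_int d ~= 0" using elim False mob_denom_nonzero[of z c d] by simp
 have z': "z + of_int d / of_int c = (of_int c * z + of_int d) / of_int c"
 using False by (simp add: field_simps)
 have det': "of_int n = (of_int a * of_int d - of_int b * of_int c :: complex)"
 using det by (auto simp flip: of_int_mult of_int_diff)
 have "of_real (real_of_int n / (real_of_int c)^2) * (- 1 / (z + of_real (real_of_int d / real_of_int c))) + of_real (real_of_int a / real_of_int c) = mob M z"
 proof -
 define D where "D = of_int c * z + of_int d"
 have "of_real (real_of_int n / (real_of_int c)^2) * (- 1 / (z + of_real (real_of_int d / real_of_int c))) + of_real (real_of_int a / real_of_int c)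
 = (of_int a * D - of_int n) / (of_int c * D)"
 using nz False by (simp add: z' flip: D_def) (simp add: divide_simps power2_eq_square)
 also have "of_int a * D - of_int n = of_int c * (of_int a * z + of_int b)"
 by (simp add: D_def det' algebra_simps)
 finally show ?thesis using False by (simp add: Md D_def)
 qed
 thus ?case by simp
 qed
 qed
 also have "... = (\<integral>\<^sup>+z. ?f3 z \<partial>hyp)" by (rule nn_integral_hyp_translate) measurable
 also have "... = (\<integral>\<^sup>+z. ?f2 z \<partial>hyp)" by (rule nn_integral_hyp_inverse) measurable
 also have "... = (\<integral>\<^sup>+z. ?f1 z \<partial>hyp)" by (rule nn_integral_hyp_scale[OF _ pos]) measurable
 also have "... = (\<integral>\<^sup>+z. f z \<partial>hyp)" by (rule nn_integral_hyp_translate) measurable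
 finally show ?thesis .
 qed
qed

lemma distr_hyp_mob:
 assumes "M \<in> mats n" "n > 0"
 shows "distr hyp borel (mob M) = hyp"
proof (rule measure_eqI)
 fix A assume "A \<in> sets (distr hyp borel (mob M))"
 hence [measurable]: "A \<in> sets borel" by simp
 have "emeasure (distr hyp borel (mob M)) A = (\<integral>\<^sup>+z. indicator A z \<partial>distr hyp borel (mob M))" by simp
 also have "... = (\<integral>\<^sup>+z. indicator A (mob M z) \<partial>hyp)" by (subst nn_integral_distr) auto
 also have "... = (\<integral>\<^sup>+z. indicator A z \<partial>hyp)" by (rule nn_integral_hyp_mob[OF _ assms]) auto
 finally show "emeasure (distr hyp borel (mob M)) A = emeasure hyp A" by simp
qed simp

lemma integral_hyp_mob:
 fixes f :: "complex => real"
 assumes [measurable]: "f \<in> borel_measurable borel" and "M \<in> mats n" "n > 0"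
 shows "(\<integral>z. f (mob M z) \<partial>hyp) = (\<integral>z. f z \<partial>hyp)"
 by (subst (2) distr_hyp_mob[OF assms(2,3), symmetric], subst integral_distr) auto

lemma AE_hyp_mob_adj:
 assumes "M \<in> mats n" "n > 0"
 shows "AE z in hyp. mob (adj M) (mob M z) = z"
 using AE_hyp by eventually_elim (use mob_adj[OF assms] in auto)

text \<open>Invariance of the measure and the substitution of \<open>adj M\<close> for
  \<open>M\<close> move the sum over matrices from one factor to the other. Determinant 1 gives
  unfolding, general determinant the self-adjointness of the Hecke operators.\<close>

lemma nn_integral_mats_swap:
 assumes P [measurable]: "P \<in> borel_measurable borel" and R [measurable]: "R \<in> borel_measurable borel" and n: "n > 0"
 shows "(\<integral>\<^sup>+M. \<integral>\<^sup>+z. P z * R (mob M z) \<partial>hyp \<partial>count_space (mats n))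
 = (\<integral>\<^sup>+z. R z * (\<integral>\<^sup>+M. P (mob M z) \<partial>count_space (mats n)) \<partial>hyp)"
proof -
 have "(\<integral>\<^sup>+z. P z * R (mob M z) \<partial>hyp) = (\<integral>\<^sup>+z. R z * P (mob (adj M) z) \<partial>hyp)" if M: "M \<in> mats n" for M
 proof -
 have "(\<integral>\<^sup>+z. P z * R (mob M z) \<partial>hyp) = (\<integral>\<^sup>+z. P (mob (adj M) (mob M z)) * R (mob M z) \<partial>hyp)"
 by (rule nn_integral_cong_AE) (use AE_hyp_mob_adj[OF M n] in eventually_elim, auto)
 also have "... = (\<integral>\<^sup>+z. P (mob (adj M) z) * R z \<partial>hyp)"
 by (rule nn_integral_hyp_mob[OF _ M n]) measurable
 finally show ?thesis by (simp add: mult.commute)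
 qed
 hence "(\<integral>\<^sup>+M. \<integral>\<^sup>+z. P z * R (mob M z) \<partial>hyp \<partial>count_space (mats n))
 = (\<integral>\<^sup>+M. \<integral>\<^sup>+z. R z * P (mob (adj M) z) \<partial>hyp \<partial>count_space (mats n))"
 by (intro nn_integral_cong_simp) (simp add: simp_implies_def)
 also have "... = (\<integral>\<^sup>+M. \<integral>\<^sup>+z. R z * P (mob M z) \<partial>hyp \<partial>count_space (mats n))"
 by (rule nn_integral_bij_count_space[OF bij_betw_adj])
 also have "... = (\<integral>\<^sup>+z. \<integral>\<^sup>+M. R z * P (mob M z) \<partial>count_space (mats n) \<partial>hyp)"
 by (rule nn_integral_count_space_nn_integral[symmetric]) (auto intro!: borel_measurable_times)
 finally show ?thesis by (simp add: nn_integral_cmult)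
qed

lemma integral_mats_swap:
 fixes P R :: "complex => real"
 assumes P [measurable]: "P \<in> borel_measurable borel" and R [measurable]: "R \<in> borel_measurable borel" and n: "n > 0"
 and fin: "(\<integral>\<^sup>+z. norm (R z) * (\<integral>\<^sup>+M. norm (P (mob M z)) \<partial>count_space (mats n)) \<partial>hyp) < \<infinity>"
 shows "(\<integral>z. P z * (\<integral>M. R (mob M z) \<partial>count_space (mats n)) \<partial>hyp)
 = (\<integral>z. R z * (\<integral>M. P (mob M z) \<partial>count_space (mats n)) \<partial>hyp)"
 and "integrable hyp (%z. P z * (\<integral>M. R (mob M z) \<partial>count_space (mats n)))"
proof -
 have F1: "(\<integral>\<^sup>+M. \<integral>\<^sup>+z. norm (P z * R (mob M z)) \<partial>hyp \<partial>count_space (mats n)) < \<infinity>"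
 using fin nn_integral_mats_swap[of "%z. norm (P z)" "%z. norm (R z)", OF _ _ n]
 by (simp add: abs_mult ennreal_mult')
 have F2: "(\<integral>\<^sup>+M. \<integral>\<^sup>+z. norm (R z * P (mob M z)) \<partial>hyp \<partial>count_space (mats n)) < \<infinity>"
 proof -
 have "(\<integral>\<^sup>+M. \<integral>\<^sup>+z. norm (R z * P (mob M z)) \<partial>hyp \<partial>count_space (mats n))
 = (\<integral>\<^sup>+z. \<integral>\<^sup>+M. norm (R z * P (mob M z)) \<partial>count_space (mats n) \<partial>hyp)"
 by (rule nn_integral_count_space_nn_integral[symmetric]) auto
 thus ?thesis using fin by (simp add: abs_mult ennreal_mult' nn_integral_cmult)
 qed
 have c: "countable (mats n)" by simp
 have "(\<integral>z. P z * (\<integral>M. R (mob M z) \<partial>count_space (mats n)) \<partial>hyp) = (\<integral>z. \<integral>M. P z * R (mob M z) \<partial>count_space (mats n) \<partial>hyp)"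
 by simp
 also have "... = (\<integral>M. \<integral>z. P z * R (mob M z) \<partial>hyp \<partial>count_space (mats n))"
 by (rule integral_count_space_swap(3)[OF sigma_finite_hyp c _ F1]) measurable
 also have "... = (\<integral>M. \<integral>z. R z * P (mob (adj M) z) \<partial>hyp \<partial>count_space (mats n))"
 proof (rule Bochner_Integration.integral_cong[OF refl])
 fix M assume "M \<in> space (count_space (mats n))"
 hence M: "M \<in> mats n" by simp
 have "(\<integral>z. P z * R (mob M z) \<partial>hyp) = (\<integral>z. P (mob (adj M) (mob M z)) * R (mob M z) \<partial>hyp)"
 by (rule integral_cong_AE) (measurable, use AE_hyp_mob_adj[OF M n] in eventually_elim, auto)
 also have "... = (\<integral>z. P (mob (adj M) z) * R z \<partial>hyp)"
 by (rule integral_hyp_mob[OF _ M n]) measurable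
 finally show "(\<integral>z. P z * R (mob M z) \<partial>hyp) = (\<integral>z. R z * P (mob (adj M) z) \<partial>hyp)" by (simp add: mult.commute)
 qed
 also have "... = (\<integral>M. \<integral>z. R z * P (mob M z) \<partial>hyp \<partial>count_space (mats n))"
 by (rule integral_bij_count_space[OF bij_betw_adj])
 also have "... = (\<integral>z. \<integral>M. R z * P (mob M z) \<partial>count_space (mats n) \<partial>hyp)"
 by (rule integral_count_space_swap(3)[OF sigma_finite_hyp c _ F2, symmetric]) measurable
 finally show "(\<integral>z. P z * (\<integral>M. R (mob M z) \<partial>count_space (mats n)) \<partial>hyp)
 = (\<integral>z. R z * (\<integral>M. P (mob M z) \<partial>count_space (mats n)) \<partial>hyp)" by simp
 show "integrable hyp (%z. P z * (\<integral>M. R (mob M z) \<partial>count_space (mats n)))"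
 using integral_count_space_swap(1)[OF sigma_finite_hyp c _ F1] by simp
qed

lemma qform_mob:
 assumes M: "(a, b, c, d) \<in> mats 1" and z: "Im z > 0"
 shows "qform (mob (a, b, c, d) z) (c', d') = qform z (c' * a + d' * c, c' * b + d' * d)"
proof -
 have nz: "of_int c * z + of_int d ~= 0"
 using mob_denom_nonzero[OF z] bottom_row_nonzero[OF M] by auto
 have "of_int c' * mob (a, b, c, d) z + of_int d' = (of_int (c' * a + d' * c) * z + of_int (c' * b + d' * d)) / (of_int c * z + of_int d)"
 using nz by (simp add: field_simps)
 thus ?thesis
 using nz z Im_mob[OF M _ z] by (simp add: qform_def norm_divide power_divide del: mob_simp)
qed

lemma inverse_Im_mob:
 assumes M: "(a, b, c, d) \<in> mats 1" and z: "Im z > 0"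
 shows "(real m)^2 / Im (mob (a, b, c, d) z) = qform z (int m * c, int m * d)"
proof -
 have "of_int (int m * c) * z + of_int (int m * d) = of_nat m * (of_int c * z + of_int d)"
 by (simp add: algebra_simps)
 thus ?thesis using Im_mob[OF M _ z]
 by (simp add: qform_def norm_mult power_mult_distrib del: mob_simp)
qed

lemma mats_one_bottom_row:
 assumes "coprime c (d :: int)"
 obtains a b where "(a, b, c, d) \<in> mats 1"
proof -
 obtain x y where "x * c + y * d = 1" using bezout_int[of c d] assms by (auto simp: coprime_iff_gcd_eq_1)
 hence "(y, - x, c, d) \<in> mats 1" by (simp add: mats_def algebra_simps)
 thus ?thesis using that by blast
qed

lemma mob_shift:
 assumes M: "(a, b, c, d) \<in> mats 1" and z: "Im z > 0"
 shows "(a + j * c, b + j * d, c, d) \<in> mats 1" "mob (a + j * c, b + j * d, c, d) z = mob (a, b, c, d) z + of_int j"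
proof -
 show "(a + j * c, b + j * d, c, d) \<in> mats 1" using M by (simp add: mats_def algebra_simps)
 have nz: "of_int c * z + of_int d ~= 0"
 using mob_denom_nonzero[OF z] bottom_row_nonzero[OF M] by auto
 thus "mob (a + j * c, b + j * d, c, d) z = mob (a, b, c, d) z + of_int j"
 by (simp add: field_simps)
qed

section \<open>Reduction theory and bottom rows of unimodular matrices\<close>

definition strip :: "complex set" where
 "strip = {z. 0 <= Re z \<and> Re z < 1}"

lemma measurable_strip [measurable]: "strip \<in> sets borel"
 unfolding strip_def by measurable

text \<open>A shortest nonzero vector of the form is primitive, hence the bottom row of some M. At w
  = M z its minimality says |c w + d| >= 1 for all nonzero (c, d); testing (1, 0) or (1, -1),
  according to the half of the strip that contains w, gives (Im w)^2 >= 3/4.\<close>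

lemma reduction:
 assumes z: "Im z > 0"
 obtains M where "M \<in> mats 1" "Im (mob M z) >= 1/2" "mob M z \<in> strip"
proof -
 \<comment> \<open>Only finitely many vectors are as short as (0, 1), so a shortest one
   exists.\<close>
 define A where "A = {p. p ~= (0, 0) \<and> qform z p <= qform z (0, 1)}"
 have finA: "finite A"
 proof -
 define C where "C = (1 + 2 * \<bar>Re z\<bar>\<^sup>2) / Im z + 2 * Im z"
 have C: "C >= 0" using z by (simp add: C_def)
 define B where "B = \<lceil>C * qform z (0, 1)\<rceil>"
 have "A \<subseteq> {-B..B} \<times> {-B..B}"
 proof
 fix p assume "p \<in> A"
 hence "\<bar>real_of_int (fst p)\<bar> + \<bar>real_of_int (snd p)\<bar> <= C * qform z (0, 1)"
 using qform_lower[OF z order_refl order_refl order_refl, of p] mult_left_mono[OF _ C, of "qform z p" "qform z (0, 1)"]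
 by (auto simp: A_def C_def)
 also have "... <= real_of_int B" by (simp add: B_def)
 finally have "real_of_int (\<bar>fst p\<bar> + \<bar>snd p\<bar>) <= real_of_int B" by simp
 hence "\<bar>fst p\<bar> + \<bar>snd p\<bar> <= B" by (simp only: of_int_le_iff)
 thus "p \<in> {-B..B} \<times> {-B..B}" by (cases p) auto
 qed
 thus ?thesis by (rule finite_subset) auto
 qed
 have "(0, 1) \<in> A" by (auto simp: A_def)
 then obtain p where p: "p \<in> A" "!!p'. p' \<in> A ==> qform z p <= qform z p'"
 using finA by (metis (no_types, lifting) arg_min_least arg_min_if_finite(1) empty_iff)
 have min: "qform z p <= qform z p'" if "p' ~= (0, 0)" for p'
 proof (cases "p' \<in> A")
 case False
 hence "qform z (0, 1) <= qform z p'" using that by (simp add: A_def)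
 thus ?thesis using p(2)[OF \<open>(0, 1) \<in> A\<close>] by linarith
 qed (rule p(2))
 obtain c d where pcd: "p = (c, d)" by (cases p)
 have cd: "(c, d) ~= (0, 0)" using p(1) by (auto simp: A_def pcd)
 have q0: "qform z p > 0" using mob_denom_nonzero[OF z cd] z by (simp add: qform_def pcd)
 \<comment> \<open>Dividing by a common factor g would give a nonzero vector whose value is smaller
   by g^2.\<close>
 have cop: "coprime c d"
 proof -
 define g where "g = gcd c d"
 have g: "g > 0" using cd by (auto simp: g_def)
 obtain c' d' where c': "c = g * c'" "d = g * d'" unfolding g_def by (metis dvdE gcd_dvd1 gcd_dvd2)
 have "(c', d') ~= (0, 0)" using cd c' by auto
 from min[OF this] have le: "qform z p <= qform z (c', d')" .
 have "of_int c * z + of_int d = of_int g * (of_int c' * z + of_int d')" using c' by (simp add: algebra_simps)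
 hence eq: "qform z p = (real_of_int g)^2 * qform z (c', d')" by (simp add: qform_def pcd norm_mult power_mult_distrib)
 have "qform z (c', d') > 0" using mob_denom_nonzero[OF z \<open>(c', d') ~= (0, 0)\<close>] z by (simp add: qform_def)
 hence "(real_of_int g)^2 <= 1" using le eq by simp
 hence "real_of_int g <= 1" using g by (simp add: abs_square_le_1)
 hence "g = 1" using g by simp
 thus ?thesis by (simp add: g_def coprime_iff_gcd_eq_1)
 qed
 then obtain a0 b0 where M0: "(a0, b0, c, d) \<in> mats 1" by (rule mats_one_bottom_row)
 define j where "j = - \<lfloor>Re (mob (a0, b0, c, d) z)\<rfloor>"
 define M where "M = (a0 + j * c, b0 + j * d, c, d)"
 have M: "M \<in> mats 1" using mob_shift(1)[OF M0 z] by (simp add: M_def)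
 define w where "w = mob M z"
 have "w = mob (a0, b0, c, d) z + of_int j" unfolding w_def M_def by (rule mob_shift(2)[OF M0 z])
 hence "Re w = frac (Re (mob (a0, b0, c, d) z))" by (simp add: j_def frac_def)
 hence ws: "w \<in> strip" by (simp add: strip_def frac_lt_1)
 have Imw: "Im w > 0" unfolding w_def using Im_mob_pos[OF M _ z] by simp
 have q1: "qform z p = 1 / Im w"
 using inverse_Im_mob[of "a0 + j * c" "b0 + j * d" c d z 1] M z by (simp add: M_def w_def pcd del: mob_simp)
 have "qform w (c', d') >= 1 / Im w" if "(c', d') ~= (0, 0)" for c' d'
 proof -
 let ?a = "a0 + j * c" and ?b = "b0 + j * d"
 have "(c' * ?a + d' * c, c' * ?b + d' * d) ~= (0, 0)"
 proof
 assume "(c' * ?a + d' * c, c' * ?b + d' * d) = (0, 0)"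
 hence e: "c' * ?a + d' * c = 0" "c' * ?b + d' * d = 0" by auto
 have det: "?a * d - ?b * c = 1" using M by (simp add: M_def mats_def)
 have "c' = c' * (?a * d - ?b * c)" using det by simp
 also have "... = d * (c' * ?a + d' * c) - c * (c' * ?b + d' * d)" by (simp add: algebra_simps)
 finally have "c' = 0" using e by simp
 moreover have "d' = d' * (?a * d - ?b * c)" using det by simp
 hence "d' = ?a * (c' * ?b + d' * d) - ?b * (c' * ?a + d' * c)" by (simp add: algebra_simps)
 hence "d' = 0" using e by simp
 ultimately show False using that by simp
 qed
 from min[OF this] show ?thesis
 using qform_mob[of ?a ?b c d z c' d'] M z q1 by (simp add: M_def w_def del: mob_simp)
 qed
 hence n1: "(cmod (of_int c' * w + of_int d'))^2 >= 1" if "(c', d') ~= (0, 0)" for c' d'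
 using that[THEN \<open>!!c' d'. (c', d') ~= (0, 0) ==> qform w (c', d') >= 1 / Im w\<close>] Imw
 by (simp add: qform_def divide_le_cancel)
 have "(Im w)^2 >= 3/4"
 proof (cases "Re w <= 1/2")
 case True
 have "(Re w)^2 <= (1/2)^2" using True ws by (intro power_mono) (auto simp: strip_def)
 thus ?thesis using n1[of 1 0] by (simp add: cmod_power2 power_divide)
 next
 case False
 have "(1 - Re w)^2 <= (1/2)^2" using False ws by (intro power_mono) (auto simp: strip_def)
 moreover have "(Re w - 1)^2 = (1 - Re w)^2" by (simp add: power2_commute)
 ultimately show ?thesis using n1[of 1 "-1"] by (simp add: cmod_power2 power_divide)
 qed
 hence "Im w >= 1/2"
 proof -
 have "\<not> Im w < 1/2"
 proof
 assume "Im w < 1/2"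
 hence "(Im w)^2 <= (1/2)^2" using Imw by (intro power_mono) auto
 thus False using \<open>(Im w)\<^sup>2 >= 3/4\<close> by (simp add: power_divide)
 qed
 thus ?thesis by simp
 qed
 thus ?thesis using that[OF M] ws by (simp add: w_def)
qed

text \<open>A nonzero pair is a positive multiple of a unique primitive pair; the matrices with that
  bottom row differ by integer translations, exactly one of which lands in the strip. M and -M count
  separately, so both signs of a pair occur.\<close>

lemma bij_betw_bottom_rows:
 assumes z: "Im z > 0"
 shows "bij_betw (%(m, (a, b, c, d)). (int m * c, int m * d)) ({1..} \<times> {M \<in> mats 1. mob M z \<in> strip}) (UNIV - {(0, 0)})"
 unfolding bij_betw_def
proof
 have cop: "coprime c d" if "(a, b, c, d) \<in> mats 1" for a b c d
 proof (rule coprimeI)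
 fix g assume "g dvd c" "g dvd d"
 hence "g dvd a * d - b * c" by simp
 thus "is_unit g" using that by (simp add: mats_def)
 qed
 show "inj_on (%(m, (a, b, c, d)). (int m * c, int m * d)) ({1..} \<times> {M \<in> mats 1. mob M z \<in> strip})"
 proof (rule inj_onI, clarify)
 fix m m' :: nat and a b c d a' b' c' d'
 assume m: "1 <= m" "1 <= m'" and M: "(a, b, c, d) \<in> mats 1" "(a', b', c', d') \<in> mats 1"
 and s: "mob (a, b, c, d) z \<in> strip" "mob (a', b', c', d') z \<in> strip"
 and eq: "int m * c = int m' * c'" "int m * d = int m' * d'"
 have "int m = gcd (int m * c) (int m * d)" using cop[OF M(1)] by (simp add: gcd_mult_distrib_int[symmetric] coprime_iff_gcd_eq_1)
 moreover have "int m' = gcd (int m' * c') (int m' * d')" using cop[OF M(2)] by (simp add: gcd_mult_distrib_int[symmetric] coprime_iff_gcd_eq_1)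
 ultimately have mm: "m = m'" using eq by simp
 hence cd: "c = c'" "d = d'" using eq m by auto
 have det: "a * d - b * c = 1" "a' * d - b' * c = 1" using M cd by (auto simp: mats_def)
 \<comment> \<open>Two unimodular matrices with the same bottom row differ by a translation on the
   left; \<open>j\<close> is its offset, read off the two determinant equations.\<close>
 define j where "j = a' * b - a * b'"
 have "a + (- j) * c = a' * (a * d - b * c) - a * (a' * d - b' * c) + a"  unfolding j_def by (simp add: algebra_simps)
 hence a: "a' = a + (- j) * c" using det by simp
 have "b + (- j) * d = b' * (a * d - b * c) - b * (a' * d - b' * c) + b" unfolding j_def by (simp add: algebra_simps)
 hence b: "b' = b + (- j) * d" using det by simp
 have "mob (a', b', c', d') z = mob (a, b, c, d) z + of_int (- j)"
 using mob_shift(2)[OF M(1) z, of "- j"] a b cd by (simp del: mob_simp)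
 hence "Re (mob (a', b', c', d') z) = Re (mob (a, b, c, d) z) - real_of_int j" by (simp del: mob_simp)
 hence "\<bar>real_of_int j\<bar> < 1" using s by (auto simp: strip_def simp del: mob_simp)
 hence "j = 0" by linarith
 thus "m = m' \<and> (a, b, c, d) = (a', b', c', d')" using mm a b cd by simp
 qed
 show "(%(m, (a, b, c, d)). (int m * c, int m * d)) ` ({1..} \<times> {M \<in> mats 1. mob M z \<in> strip}) = UNIV - {(0, 0)}"
 proof (intro equalityI subsetI)
 fix p assume "p \<in> (%(m, (a, b, c, d)). (int m * c, int m * d)) ` ({1..} \<times> {M \<in> mats 1. mob M z \<in> strip})"
 thus "p \<in> UNIV - {(0, 0)}" using bottom_row_nonzero[of _ _ _ _ 1] by auto
 next
 fix p assume p: "p \<in> UNIV - {(0 :: int, 0 :: int)}"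
 obtain c0 d0 where pcd: "p = (c0, d0)" by (cases p)
 define g where "g = gcd c0 d0"
 have g: "g > 0" using p pcd by (auto simp: g_def)
 obtain c d where c: "c0 = g * c" "d0 = g * d" "coprime c d"
 using p pcd unfolding g_def by (metis Diff_iff gcd_coprime_exists gcd_eq_0_iff insertI1 mult.commute)
 obtain a b where M: "(a, b, c, d) \<in> mats 1" using mats_one_bottom_row[OF c(3)] .
 define j where "j = - \<lfloor>Re (mob (a, b, c, d) z)\<rfloor>"
 have "mob (a + j * c, b + j * d, c, d) z \<in> strip"
 unfolding mob_shift(2)[OF M z] using floor_correct[of "Re (mob (a, b, c, d) z)"]
 by (simp add: strip_def j_def del: mob_simp) linarith
 hence "(nat g, (a + j * c, b + j * d, c, d)) \<in> {1..} \<times> {M \<in> mats 1. mob M z \<in> strip}"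
 using g mob_shift(1)[OF M z, of j] by auto
 moreover have "p = (%(m, (a, b, c, d)). (int m * c, int m * d)) (nat g, (a + j * c, b + j * d, c, d))"
 using c g by (simp add: pcd)
 ultimately show "p \<in> (%(m, (a, b, c, d)). (int m * c, int m * d)) ` ({1..} \<times> {M \<in> mats 1. mob M z \<in> strip})"
 by blast
 qed
qed

definition sc :: "nat => int \<times> int \<times> int \<times> int => int \<times> int" where
 "sc m M = (int m * fst (snd (snd M)), int m * snd (snd (snd M)))"

lemma bij_betw_sc:
 assumes z: "Im z > 0"
 shows "bij_betw (%(m, M). sc m M) ({1..} \<times> {M \<in> mats 1. mob M z \<in> strip}) (UNIV - {(0, 0)})"
proof -
 have "(%(m, M). sc m M) = (%(m, (a, b, c, d)). (int m * c, int m * d))"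
 by (auto simp: fun_eq_iff sc_def)
 thus ?thesis using bij_betw_bottom_rows[OF z] by simp
qed

lemma nn_integral_unfold_rows:
 assumes z: "Im z > 0"
 shows "(\<integral>\<^sup>+M. \<integral>\<^sup>+m. indicator strip (mob M z) * \<phi> (sc m M) \<partial>count_space {1..} \<partial>count_space (mats 1))
 = (\<integral>\<^sup>+p. \<phi> p \<partial>count_space (UNIV - {(0, 0)}))"
proof -
 let ?G = "{M \<in> mats 1. mob M z \<in> strip}"
 have "(\<integral>\<^sup>+p. \<phi> p \<partial>count_space (UNIV - {(0, 0)})) = (\<integral>\<^sup>+x. \<phi> (case x of (m, M) => sc m M) \<partial>count_space ({1..} \<times> ?G))"
 by (rule nn_integral_bij_count_space[OF bij_betw_sc[OF z], symmetric])
 also have "... = (\<integral>\<^sup>+x. indicator ({1..} \<times> ?G) x * \<phi> (case x of (m, M) => sc m M) \<partial>count_space UNIV)"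
 by (subst nn_integral_count_space_indicator) (auto simp: mult.commute)
 also have "... = (\<integral>\<^sup>+M. \<integral>\<^sup>+m. indicator {1..} m * indicator ?G M * \<phi> (sc m M) \<partial>count_space UNIV \<partial>count_space UNIV)"
 by (subst nn_integral_snd_count_space[symmetric]) (auto intro!: nn_integral_cong simp: indicator_def)
 also have "... = (\<integral>\<^sup>+M. (\<integral>\<^sup>+m. indicator ?G M * \<phi> (sc m M) * indicator {1..} m \<partial>count_space UNIV) * indicator (mats 1) M \<partial>count_space UNIV)"
 by (intro nn_integral_cong) (auto simp: indicator_def intro!: nn_integral_cong)
 also have "... = (\<integral>\<^sup>+M. \<integral>\<^sup>+m. indicator ?G M * \<phi> (sc m M) \<partial>count_space {1..} \<partial>count_space (mats 1))"
 by (simp add: nn_integral_count_space_indicator)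
 also have "... = (\<integral>\<^sup>+M. \<integral>\<^sup>+m. indicator strip (mob M z) * \<phi> (sc m M) \<partial>count_space {1..} \<partial>count_space (mats 1))"
 by (intro nn_integral_cong) (auto simp: indicator_def)
 finally show ?thesis ..
qed

lemma integral_unfold_rows:
 fixes \<phi> :: "int \<times> int => real"
 assumes z: "Im z > 0" and \<phi>: "integrable (count_space (UNIV - {(0, 0)})) \<phi>"
 shows "(\<integral>m. \<integral>M. indicator strip (mob M z) * \<phi> (sc m M) \<partial>count_space (mats 1) \<partial>count_space {1..})
 = (\<integral>p. \<phi> p \<partial>count_space (UNIV - {(0, 0)}))"
proof -
 let ?G = "{M \<in> mats 1. mob M z \<in> strip}"
 let ?A = "{1::nat..} \<times> mats 1"
 let ?f = "%x. \<phi> (case x of (m, M) => sc m M)"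
 have sub: "{1..} \<times> ?G \<subseteq> ?A" by auto
 have i: "integrable (count_space ({1..} \<times> ?G)) ?f"
 using \<phi> by (subst integrable_bij_count_space[OF bij_betw_sc[OF z]])
 hence i2: "integrable (count_space ?A) (%x. indicator ({1..} \<times> ?G) x *\<^sub>R ?f x)"
 by (simp only: integral_count_space_indicator(2)[OF sub])
 have "(\<integral>m. \<integral>M. indicator ({1..} \<times> ?G) (m, M) *\<^sub>R ?f (m, M) \<partial>count_space (mats 1) \<partial>count_space {1..})
 = (\<integral>x. indicator ({1..} \<times> ?G) x *\<^sub>R ?f x \<partial>count_space ?A)"
 by (rule integral_count_space_Times[OF _ _ i2]) auto
 also have "... = (\<integral>x. ?f x \<partial>count_space ({1..} \<times> ?G))"
 by (rule integral_count_space_indicator(1)[OF sub])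
 also have "... = (\<integral>p. \<phi> p \<partial>count_space (UNIV - {(0, 0)}))"
 by (rule integral_bij_count_space[OF bij_betw_sc[OF z]])
 also have "(\<integral>m. \<integral>M. indicator ({1..} \<times> ?G) (m, M) *\<^sub>R ?f (m, M) \<partial>count_space (mats 1) \<partial>count_space {1..})
 = (\<integral>m. \<integral>M. indicator strip (mob M z) * \<phi> (sc m M) \<partial>count_space (mats 1) \<partial>count_space {1..})"
 by (intro Bochner_Integration.integral_cong refl) (auto simp: indicator_def)
 finally show ?thesis .
qed

lemma qform_zero [simp]: "qform z (0, 0) = 0"
 by (simp add: qform_def)

lemma theta_minus_one:
 assumes z: "Im z > 0" and t: "t > 0"
 shows "integrable (count_space (UNIV - {(0, 0)})) (%p. exp (- (pi * t) * qform z p))"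
 and "(\<integral>p. exp (- (pi * t) * qform z p) \<partial>count_space (UNIV - {(0, 0)})) = theta t z - 1"
 and "theta t z > 1"
proof -
 let ?f = "%p. exp (- (pi * t) * qform z p)"
 have i: "integrable (count_space UNIV) ?f" using z t by (intro integrable_exp_qform) auto
 have sub: "UNIV - {(0, 0)} \<subseteq> (UNIV :: (int \<times> int) set)" by simp
 have i2: "integrable (count_space UNIV) (%p. indicator (UNIV - {(0, 0)}) p *\<^sub>R ?f p)"
 by (rule Bochner_Integration.integrable_bound[OF i]) (auto simp: indicator_def)
 thus i3: "integrable (count_space (UNIV - {(0, 0)})) ?f"
 by (simp only: integral_count_space_indicator(2)[OF sub])
 have "theta t z = (\<integral>p. indicator {(0, 0)} p *\<^sub>R 1 + indicator (UNIV - {(0, 0)}) p *\<^sub>R ?f p \<partial>count_space UNIV)"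
 unfolding theta_def by (intro Bochner_Integration.integral_cong) (auto simp: indicator_def)
 also have "... = 1 + (\<integral>p. indicator (UNIV - {(0, 0)}) p *\<^sub>R ?f p \<partial>count_space UNIV)"
 using i2 by (subst Bochner_Integration.integral_add) auto
 finally have eq: "theta t z = 1 + (\<integral>p. indicator (UNIV - {(0, 0)}) p *\<^sub>R ?f p \<partial>count_space UNIV)" .
 thus "(\<integral>p. ?f p \<partial>count_space (UNIV - {(0, 0)})) = theta t z - 1"
 by (simp only: integral_count_space_indicator(1)[OF sub])
 \<comment> \<open>The single vector (0, 1) already makes the sum over nonzero pairs
   positive.\<close>
 have "?f (0, 1) = (\<integral>p. indicator {(0 :: int, 1 :: int)} p *\<^sub>R ?f (0, 1) \<partial>count_space UNIV)" by simp
 also have "... <= (\<integral>p. indicator (UNIV - {(0, 0)}) p *\<^sub>R ?f p \<partial>count_space UNIV)"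
 proof (rule integral_mono[OF _ i2])
 show "integrable (count_space UNIV) (%p. indicator {(0 :: int, 1 :: int)} p *\<^sub>R ?f (0, 1))"
 by (subst integral_count_space_indicator(2)[OF subset_UNIV]) (simp add: integrable_count_space)
 qed (auto simp: indicator_def)
 finally show "theta t z > 1" using eq by (smt (verit) exp_gt_zero)
qed

lemma theta_mob:
 assumes M: "M \<in> mats 1" and z: "Im z > 0"
 shows "theta t (mob M z) = theta t z"
proof -
 obtain a b c d where Md: "M = (a, b, c, d)" by (cases M)
 have det: "a * d - b * c = 1" using M by (simp add: Md mats_def)
 have "bij (%p. (fst p * a + snd p * c, fst p * b + snd p * d))"
 proof (rule bij_betw_byWitness[where f' = "%p. (fst p * d - snd p * c, snd p * a - fst p * b)"])
 have "(x * a + y * c) * d - (x * b + y * d) * c = x * (a * d - b * c)"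
 "(x * b + y * d) * a - (x * a + y * c) * b = y * (a * d - b * c)"
 "(x * d - y * c) * a + (y * a - x * b) * c = x * (a * d - b * c)"
 "(x * d - y * c) * b + (y * a - x * b) * d = y * (a * d - b * c)" for x y
 by (simp_all add: algebra_simps)
 thus "\<forall>p\<in>UNIV. (fst (fst p * a + snd p * c, fst p * b + snd p * d) * d - snd (fst p * a + snd p * c, fst p * b + snd p * d) * c,
 snd (fst p * a + snd p * c, fst p * b + snd p * d) * a - fst (fst p * a + snd p * c, fst p * b + snd p * d) * b) = p"
 "\<forall>p\<in>UNIV. (fst (fst p * d - snd p * c, snd p * a - fst p * b) * a + snd (fst p * d - snd p * c, snd p * a - fst p * b) * c,
 fst (fst p * d - snd p * c, snd p * a - fst p * b) * b + snd (fst p * d - snd p * c, snd p * a - fst p * b) * d) = p"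
 using det by auto
 qed auto
 from integral_bij_count_space[OF this, of "%p. exp (- (pi * t) * qform z p)"]
 show ?thesis unfolding theta_def Md
 using qform_mob[of a b c d z] M z by (simp add: Md split_beta' flip: qform_mob del: mob_simp)
qed

section \<open>A partition of unity for the modular group, and unfolding\<close>

text \<open>A substitute for the indicator of a fundamental domain. Summed over the group, the
  numerator unfolds to the theta sum over nonzero pairs, while the denominator is invariant; so the
  translates add up to 1 (\<open>sum_rho\<close>).\<close>

definition rho :: "complex => real" where
 "rho z = indicator strip z * (\<integral>m. exp (- pi * ((real m)^2 / Im z)) \<partial>count_space {1..}) / (theta 1 z - 1)"

lemma measurable_qform [measurable]: "(%z. qform z p) \<in> borel_measurable borel"
 unfolding qform_def by measurable

lemma measurable_theta [measurable]: "theta t \<in> borel_measurable borel"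
 unfolding theta_def[abs_def] by (rule borel_measurable_integral_count_space) auto

lemma measurable_rho [measurable]: "rho \<in> borel_measurable borel"
proof -
 have [measurable]: "(%z. \<integral>m. exp (- pi * ((real m)^2 / Im z)) \<partial>count_space {1..}) \<in> borel_measurable borel"
 by (rule borel_measurable_integral_count_space) auto
 show ?thesis unfolding rho_def[abs_def] by measurable
qed

lemma rho_nonneg: "Im z > 0 ==> rho z >= 0"
 unfolding rho_def using theta_minus_one(3)[of z 1]
 by (intro divide_nonneg_nonneg mult_nonneg_nonneg integral_nonneg_AE) auto

lemma summable_exp_square:
 assumes "y > 0"
 shows "integrable (count_space {1..}) (%m::nat. exp (- pi * ((real m)^2 / y)))"
proof -
 let ?z = "Complex 0 y"
 have q: "qform ?z (0, int m) = (real m)^2 / y" for m using assms by (simp add: qform_Complex)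
 have "integrable (count_space UNIV) (%p. indicator ((%m. (0, int m)) ` {1..}) p *\<^sub>R exp (- (pi * 1) * qform ?z p))"
 by (rule Bochner_Integration.integrable_bound[OF integrable_exp_qform[of ?z "pi * 1"]])
 (use assms in \<open>auto simp: indicator_def\<close>)
 hence "integrable (count_space ((%m. (0, int m)) ` {1..})) (%p. exp (- (pi * 1) * qform ?z p))"
 by (simp only: integral_count_space_indicator(2)[OF subset_UNIV])
 moreover have "bij_betw (%m. (0 :: int, int m)) {1..} ((%m. (0, int m)) ` {1..})"
 by (auto simp: bij_betw_def inj_on_def)
 ultimately show ?thesis
 using integrable_bij_count_space[of "%m. (0 :: int, int m)" "{1..}" "(%m. (0, int m)) ` {1..}" "%p. exp (- (pi * 1) * qform ?z p)"]
 by (simp add: q)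
qed

lemma sum_rho:
 assumes z: "Im z > 0"
 shows "(\<integral>\<^sup>+M. rho (mob M z) \<partial>count_space (mats 1)) = 1"
 and "(\<integral>M. rho (mob M z) \<partial>count_space (mats 1)) = 1"
proof -
 define T where "T = theta 1 z - 1"
 have T: "T > 0" using theta_minus_one(3)[OF z, of 1] by (simp add: T_def)
 have eq: "ennreal (rho (mob M z)) = (\<integral>\<^sup>+m. indicator strip (mob M z) * ennreal (exp (- (pi * 1) * qform z (sc m M)) / T) \<partial>count_space {1..})"
 if M: "M \<in> mats 1" for M
 proof -
 obtain a b c d where Md: "M = (a, b, c, d)" by (cases M)
 have q: "(real m)^2 / Im (mob M z) = qform z (sc m M)" for m
 using inverse_Im_mob[of a b c d z m] M z by (simp add: Md sc_def del: mob_simp)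
 have i: "integrable (count_space {1..}) (%m. exp (- (pi * 1) * qform z (sc m M)))"
 using summable_exp_square[OF Im_mob_pos[OF M _ z]] by (simp add: q)
 have "rho (mob M z) = indicator strip (mob M z) * (\<integral>m. exp (- (pi * 1) * qform z (sc m M)) / T \<partial>count_space {1..})"
 unfolding rho_def q theta_mob[OF M z] by (simp add: T_def)
 also have "ennreal ... = indicator strip (mob M z) * ennreal (\<integral>m. exp (- (pi * 1) * qform z (sc m M)) / T \<partial>count_space {1..})"
 by (auto simp: indicator_def)
 also have "ennreal (\<integral>m. exp (- (pi * 1) * qform z (sc m M)) / T \<partial>count_space {1..}) = (\<integral>\<^sup>+m. ennreal (exp (- (pi * 1) * qform z (sc m M)) / T) \<partial>count_space {1..})"
 using i T by (intro nn_integral_eq_integral[symmetric] integrable_divide) auto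
 finally show ?thesis by (simp add: nn_integral_cmult)
 qed
 have "(\<integral>\<^sup>+M. rho (mob M z) \<partial>count_space (mats 1)) = (\<integral>\<^sup>+M. \<integral>\<^sup>+m. indicator strip (mob M z) * ennreal (exp (- (pi * 1) * qform z (sc m M)) / T) \<partial>count_space {1..} \<partial>count_space (mats 1))"
 by (rule nn_integral_cong) (simp add: eq del: mult_1_right)
 also have "... = (\<integral>\<^sup>+p. ennreal (exp (- (pi * 1) * qform z p) / T) \<partial>count_space (UNIV - {(0, 0)}))"
 by (rule nn_integral_unfold_rows[OF z])
 also have "... = ennreal (\<integral>p. exp (- (pi * 1) * qform z p) / T \<partial>count_space (UNIV - {(0, 0)}))"
 using theta_minus_one(1)[OF z, of 1] T by (intro nn_integral_eq_integral integrable_divide) auto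
 also have "(\<integral>p. exp (- (pi * 1) * qform z p) / T \<partial>count_space (UNIV - {(0, 0)})) = 1"
 using theta_minus_one(2)[OF z, of 1] T by (simp add: T_def)
 finally show 1: "(\<integral>\<^sup>+M. rho (mob M z) \<partial>count_space (mats 1)) = 1" by simp
 have "(\<integral>M. rho (mob M z) \<partial>count_space (mats 1)) = enn2real (\<integral>\<^sup>+M. rho (mob M z) \<partial>count_space (mats 1))"
 using z by (intro integral_eq_nn_integral) (auto intro!: AE_I2 rho_nonneg Im_mob_pos simp del: mob_simp simp: AE_count_space)
 thus "(\<integral>M. rho (mob M z) \<partial>count_space (mats 1)) = 1" using 1 by simp
qed

lemma nn_integral_fold:
 assumes [measurable]: "R \<in> borel_measurable borel"
 shows "(\<integral>\<^sup>+z. R z * (\<integral>\<^sup>+M. norm (rho (mob M z)) \<partial>count_space (mats 1)) \<partial>hyp) = (\<integral>\<^sup>+z. R z \<partial>hyp)"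
proof (rule nn_integral_cong_AE)
 show "AE z in hyp. R z * (\<integral>\<^sup>+M. norm (rho (mob M z)) \<partial>count_space (mats 1)) = R z"
 using AE_hyp
 proof eventually_elim
 case (elim z)
 have "(\<integral>\<^sup>+M. norm (rho (mob M z)) \<partial>count_space (mats 1)) = (\<integral>\<^sup>+M. rho (mob M z) \<partial>count_space (mats 1))"
 using elim by (intro nn_integral_cong) (auto simp: rho_nonneg Im_mob_pos[of _ 1] simp del: mob_simp)
 thus ?case using sum_rho(1)[OF elim] by simp
 qed
qed

lemma norm_integral_le_nn_integral:
 fixes f :: "'a => 'b::{banach,second_countable_topology}"
 shows "ennreal (norm (\<integral>x. f x \<partial>M)) <= (\<integral>\<^sup>+x. norm (f x) \<partial>M)"
 by (cases "integrable M f") (auto simp: integral_norm_bound_ennreal not_integrable_integral_eq)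

text \<open>The sum of the translates of \<open>rho\<close>, which is 1, is inserted into the strip
  integral; the group sum is moved to the other factor, and the pairs (m, M) with M z in the strip
  are collected into nonzero lattice points. Assumption \<open>eq\<close> says that the integrand
  sees such a pair only through m times the bottom row.\<close>

lemma unfolding_identity:
 fixes r :: "nat => complex => real" and \<phi> :: "complex => int \<times> int => real"
 assumes r [measurable]: "!!m. r m \<in> borel_measurable borel"
 and eq: "!!z m M. Im z > 0 ==> m >= 1 ==> M \<in> mats 1 ==> r m (mob M z) = \<phi> z (sc m M)"
 and m\<phi>: "!!p. (%z. \<phi> z p) \<in> borel_measurable borel"
 and \<phi>: "!!z. Im z > 0 ==> integrable (count_space (UNIV - {(0, 0)})) (\<phi> z)"
 and fin: "(\<integral>\<^sup>+m. \<integral>\<^sup>+z. norm (indicator strip z * r m z) \<partial>hyp \<partial>count_space {1..}) < \<infinity>"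
 shows "(\<integral>m. \<integral>z. indicator strip z * r m z \<partial>hyp \<partial>count_space {1..}) = (\<integral>z. rho z * (\<integral>p. \<phi> z p \<partial>count_space (UNIV - {(0, 0)})) \<partial>hyp)"
 and "integrable hyp (%z. rho z * (\<integral>p. \<phi> z p \<partial>count_space (UNIV - {(0, 0)})))"
proof -
 define R where "R = (%m z. indicator strip z * r m z)"
 have R [measurable]: "R m \<in> borel_measurable borel" for m unfolding R_def by measurable
 have fin1: "(\<integral>\<^sup>+z. norm (R m z) \<partial>hyp) < \<infinity>" if "m >= 1" for m
 proof -
 have "(\<integral>\<^sup>+z. norm (R m z) \<partial>hyp) = (\<integral>\<^sup>+m'. (\<integral>\<^sup>+z. norm (R m z) \<partial>hyp) * indicator {m} m' \<partial>count_space {1..})"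
 using that by (subst nn_integral_cmult_indicator) auto
 also have "... <= (\<integral>\<^sup>+m. \<integral>\<^sup>+z. norm (R m z) \<partial>hyp \<partial>count_space {1..})"
 by (intro nn_integral_mono) (auto simp: indicator_def)
 finally show ?thesis using fin unfolding R_def by (simp add: le_less_trans)
 qed
 have one: "(\<integral>z. R m z \<partial>hyp) = (\<integral>z. rho z * (\<integral>M. R m (mob M z) \<partial>count_space (mats 1)) \<partial>hyp)" if "m >= 1" for m
 proof -
 have "(\<integral>z. rho z * (\<integral>M. R m (mob M z) \<partial>count_space (mats 1)) \<partial>hyp) = (\<integral>z. R m z * (\<integral>M. rho (mob M z) \<partial>count_space (mats 1)) \<partial>hyp)"
 using fin1[OF that] nn_integral_fold[of "%z. norm (R m z)"] by (intro integral_mats_swap(1)) auto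
 also have "... = (\<integral>z. R m z \<partial>hyp)"
 proof (rule integral_cong_AE)
 show "AE z in hyp. R m z * (\<integral>M. rho (mob M z) \<partial>count_space (mats 1)) = R m z"
 using AE_hyp by eventually_elim (simp only: sum_rho(2) mult_1_right)
 have "(%z. \<integral>M. rho (mob M z) \<partial>count_space (mats 1)) \<in> borel_measurable borel"
 by (rule borel_measurable_integral_count_space) auto
 thus "(%z. R m z * (\<integral>M. rho (mob M z) \<partial>count_space (mats 1))) \<in> borel_measurable hyp" by measurable
 qed measurable
 finally show ?thesis ..
 qed
 have mR [measurable]: "(%z. \<integral>M. R m (mob M z) \<partial>count_space (mats 1)) \<in> borel_measurable borel" for m
 by (rule borel_measurable_integral_count_space) auto
 have F: "(\<integral>\<^sup>+m. \<integral>\<^sup>+z. norm (rho z * (\<integral>M. R m (mob M z) \<partial>count_space (mats 1))) \<partial>hyp \<partial>count_space {1..}) < \<infinity>"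
 proof -
 have "(\<integral>\<^sup>+z. norm (rho z * (\<integral>M. R m (mob M z) \<partial>count_space (mats 1))) \<partial>hyp) <= (\<integral>\<^sup>+z. norm (R m z) \<partial>hyp)" for m
 proof -
 have "(\<integral>\<^sup>+z. norm (rho z * (\<integral>M. R m (mob M z) \<partial>count_space (mats 1))) \<partial>hyp)
 <= (\<integral>\<^sup>+z. \<integral>\<^sup>+M. ennreal (norm (rho z)) * norm (R m (mob M z)) \<partial>count_space (mats 1) \<partial>hyp)"
 by (intro nn_integral_mono)
 (simp add: norm_mult ennreal_mult' nn_integral_cmult mult_left_mono norm_integral_le_nn_integral del: mob_simp real_norm_def)
 also have "... = (\<integral>\<^sup>+M. \<integral>\<^sup>+z. ennreal (norm (rho z)) * norm (R m (mob M z)) \<partial>hyp \<partial>count_space (mats 1))"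
 by (rule nn_integral_count_space_nn_integral) auto
 also have "... = (\<integral>\<^sup>+z. norm (R m z) * (\<integral>\<^sup>+M. norm (rho (mob M z)) \<partial>count_space (mats 1)) \<partial>hyp)"
 by (rule nn_integral_mats_swap) auto
 also have "... = (\<integral>\<^sup>+z. norm (R m z) \<partial>hyp)" by (rule nn_integral_fold) auto
 finally show ?thesis .
 qed
 hence "(\<integral>\<^sup>+m. \<integral>\<^sup>+z. norm (rho z * (\<integral>M. R m (mob M z) \<partial>count_space (mats 1))) \<partial>hyp \<partial>count_space {1..})
 <= (\<integral>\<^sup>+m. \<integral>\<^sup>+z. norm (R m z) \<partial>hyp \<partial>count_space {1..})" by (rule nn_integral_mono)
 thus ?thesis using fin unfolding R_def by (simp add: le_less_trans)
 qed
 have ptw: "AE z in hyp. (\<integral>m. rho z * (\<integral>M. R m (mob M z) \<partial>count_space (mats 1)) \<partial>count_space {1..}) = rho z * (\<integral>p. \<phi> z p \<partial>count_space (UNIV - {(0, 0)}))"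
 using AE_hyp
 proof eventually_elim
 case (elim z)
 have "(\<integral>m. \<integral>M. R m (mob M z) \<partial>count_space (mats 1) \<partial>count_space {1..}) = (\<integral>m. \<integral>M. indicator strip (mob M z) * \<phi> z (sc m M) \<partial>count_space (mats 1) \<partial>count_space {1..})"
 by (intro Bochner_Integration.integral_cong refl) (simp add: R_def eq[OF elim] del: mob_simp)
 also have "... = (\<integral>p. \<phi> z p \<partial>count_space (UNIV - {(0, 0)}))"
 by (rule integral_unfold_rows[OF elim \<phi>[OF elim]])
 finally show ?case by simp
 qed
 have m1: "(%z. \<integral>m. rho z * (\<integral>M. R m (mob M z) \<partial>count_space (mats 1)) \<partial>count_space {1..}) \<in> borel_measurable hyp"
 by (rule borel_measurable_integral_count_space) auto
 have int: "integrable hyp (%z. \<integral>m. rho z * (\<integral>M. R m (mob M z) \<partial>count_space (mats 1)) \<partial>count_space {1..})"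
 by (rule integral_count_space_swap(1)[OF sigma_finite_hyp _ _ F]) auto
 have m2: "(%z. rho z * (\<integral>p. \<phi> z p \<partial>count_space (UNIV - {(0, 0)}))) \<in> borel_measurable hyp"
 using borel_measurable_integral_count_space[of "UNIV - {(0, 0)}" "%p z. \<phi> z p" borel] m\<phi> by measurable
 show "integrable hyp (%z. rho z * (\<integral>p. \<phi> z p \<partial>count_space (UNIV - {(0, 0)})))"
 using int integrable_cong_AE[OF m1 m2 ptw] by simp
 have "(\<integral>m. \<integral>z. R m z \<partial>hyp \<partial>count_space {1..}) = (\<integral>m. \<integral>z. rho z * (\<integral>M. R m (mob M z) \<partial>count_space (mats 1)) \<partial>hyp \<partial>count_space {1..})"
 by (rule Bochner_Integration.integral_cong[OF refl]) (simp add: one del: mob_simp)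
 also have "... = (\<integral>z. \<integral>m. rho z * (\<integral>M. R m (mob M z) \<partial>count_space (mats 1)) \<partial>count_space {1..} \<partial>hyp)"
 by (rule integral_count_space_swap(3)[OF sigma_finite_hyp _ _ F, symmetric]) auto
 also have "... = (\<integral>z. rho z * (\<integral>p. \<phi> z p \<partial>count_space (UNIV - {(0, 0)})) \<partial>hyp)"
 by (rule integral_cong_AE[OF m1 m2 ptw])
 finally show "(\<integral>m. \<integral>z. indicator strip z * r m z \<partial>hyp \<partial>count_space {1..}) = (\<integral>z. rho z * (\<integral>p. \<phi> z p \<partial>count_space (UNIV - {(0, 0)})) \<partial>hyp)"
 by (simp only: R_def)
qed

text \<open>Every orbit meets the part Im z >= 1/2 of the strip, so the total mass of
  \<open>rho\<close> is at most the hyperbolic area of that part, which is 2.\<close>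

lemma rho_integrable: "integrable hyp rho"
proof -
 define S where "S = strip \<inter> {z. Im z >= 1/2}"
 have S [measurable]: "S \<in> sets borel" unfolding S_def by measurable
 have "(\<integral>\<^sup>+z. norm (rho z) \<partial>hyp) <= (\<integral>\<^sup>+z. norm (rho z) * (\<integral>\<^sup>+M. indicator S (mob M z) \<partial>count_space (mats 1)) \<partial>hyp)"
 proof (rule nn_integral_mono_AE)
 show "AE z in hyp. ennreal (norm (rho z)) <= ennreal (norm (rho z)) * (\<integral>\<^sup>+M. indicator S (mob M z) \<partial>count_space (mats 1))"
 using AE_hyp
 proof eventually_elim
 case (elim z)
 obtain M0 where M0: "M0 \<in> mats 1" "Im (mob M0 z) >= 1/2" "mob M0 z \<in> strip" using reduction[OF elim] .
 have "1 = (\<integral>\<^sup>+M. indicator {M0} M \<partial>count_space (mats 1))" using M0 by simp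
 also have "... <= (\<integral>\<^sup>+M. indicator S (mob M z) \<partial>count_space (mats 1))"
 using M0 by (intro nn_integral_mono) (auto simp: indicator_def S_def simp del: mob_simp)
 finally show ?case using mult_left_mono[of 1 "\<integral>\<^sup>+M. indicator S (mob M z) \<partial>count_space (mats 1)" "ennreal (norm (rho z))"]
 by (simp del: mob_simp)
 qed
 qed
 also have "... = (\<integral>\<^sup>+z. \<integral>\<^sup>+M. ennreal (norm (rho z)) * indicator S (mob M z) \<partial>count_space (mats 1) \<partial>hyp)"
 by (simp add: nn_integral_cmult del: mob_simp)
 also have "... = (\<integral>\<^sup>+M. \<integral>\<^sup>+z. ennreal (norm (rho z)) * indicator S (mob M z) \<partial>hyp \<partial>count_space (mats 1))"
 by (rule nn_integral_count_space_nn_integral) auto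
 also have "... = (\<integral>\<^sup>+z. indicator S z * (\<integral>\<^sup>+M. norm (rho (mob M z)) \<partial>count_space (mats 1)) \<partial>hyp)"
 by (rule nn_integral_mats_swap) auto
 also have "... = (\<integral>\<^sup>+z. indicator S z \<partial>hyp)" by (rule nn_integral_fold) auto
 also have "... = (\<integral>\<^sup>+et. \<integral>\<^sup>+s. indicator S (hpt s et) \<partial>lborel \<partial>lborel)" by (rule nn_integral_hyp) auto
 also have "... <= (\<integral>\<^sup>+et. ennreal (exp (- et)) * indicator {ln (1/2)..} et \<partial>lborel)"
 proof (rule nn_integral_mono)
 fix et :: real
 have "(\<integral>\<^sup>+s. indicator S (hpt s et) \<partial>lborel) <= (\<integral>\<^sup>+s. indicator {0..exp (- et)} s * indicator {ln (1/2)..} et \<partial>lborel)"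
 proof (rule nn_integral_mono)
 fix s :: real
 have "s \<in> {0..exp (- et)} \<and> et \<in> {ln (1/2)..}" if "hpt s et \<in> S"
 proof -
 have "0 <= s * exp et" "s * exp et < 1" "1/2 <= exp et" using that by (auto simp: S_def strip_def)
 moreover from this(3) have "ln (1/2) <= et" using ln_le_cancel_iff[of "1/2" "exp et"] by simp
 ultimately show ?thesis by (auto simp: exp_minus field_simps zero_le_mult_iff)
 qed
 thus "indicator S (hpt s et) <= indicator {0..exp (- et)} s * (indicator {ln (1/2)..} et :: ennreal)"
 by (auto simp: indicator_def)
 qed
 also have "... = ennreal (exp (- et)) * indicator {ln (1/2)..} et" by (subst nn_integral_multc) auto
 finally show "(\<integral>\<^sup>+s. indicator S (hpt s et) \<partial>lborel) <= ennreal (exp (- et)) * indicator {ln (1/2)..} et" .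
 qed
 also have "... = ennreal (0 - - exp (- ln (1/2)))"
 proof (rule nn_integral_FTC_atLeast)
 show "((%et::real. - exp (- et)) \<longlongrightarrow> 0) at_top" by real_asymp
 qed (auto intro!: derivative_eq_intros)
 also have "... < \<infinity>" by simp
 finally show ?thesis by (simp add: integrable_iff_bounded)
qed

section \<open>Fourier expansion, Hecke eigenvalues and coefficient bounds\<close>

text \<open>Unconditional convergence of complex terms is absolute, which turns the Fourier
  expansion of a form into an integral over \<open>count_space\<close>.\<close>

lemma has_sum_integral_count_space:
 fixes f :: "'a => complex"
 assumes "(f has_sum s) A"
 shows "integrable (count_space A) f" "(\<integral>x. f x \<partial>count_space A) = s"
proof -
 have "f summable_on A" using assms by (rule has_sum_imp_summable)
 hence "(%x. norm (f x)) summable_on A" by (simp only: summable_on_iff_abs_summable_on_complex)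
 hence *: "Infinite_Set_Sum.abs_summable_on f A" by (simp only: abs_summable_equivalent)
 thus "integrable (count_space A) f" by (simp add: Infinite_Set_Sum.abs_summable_on_def)
 show "(\<integral>x. f x \<partial>count_space A) = s"
 using infsetsum_infsum[OF *] infsumI[OF assms] by (simp add: infsetsum_def)
qed

lemma integral_int_split:
 fixes f :: "int => 'b::{banach,second_countable_topology}"
 assumes f: "integrable (count_space (UNIV - {0})) f"
 shows "integrable (count_space {1..}) (%n. f (int n))" "integrable (count_space {1..}) (%n. f (- int n))"
 "(\<integral>n. f n \<partial>count_space (UNIV - {0})) = (\<integral>n. f (int n) + f (- int n) \<partial>count_space {1..})"
proof -
 let ?P = "{n::int. n > 0}" and ?N = "{n::int. n < 0}"
 have sub: "?P \<subseteq> UNIV - {0}" "?N \<subseteq> UNIV - {0}" by auto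
 have iP: "integrable (count_space (UNIV - {0})) (%n. indicator ?P n *\<^sub>R f n)"
 and iN: "integrable (count_space (UNIV - {0})) (%n. indicator ?N n *\<^sub>R f n)"
 by (rule Bochner_Integration.integrable_bound[OF f]; auto simp: indicator_def)+
 have bP: "bij_betw int {1..} ?P" by (rule bij_betwI[where g = nat]) auto
 have bN: "bij_betw (%n. - int n) {1..} ?N" by (rule bij_betwI[where g = "%n. nat (- n)"]) auto
 show p: "integrable (count_space {1..}) (%n. f (int n))"
 using iP unfolding integral_count_space_indicator(2)[OF sub(1)] by (simp only: integrable_bij_count_space[OF bP])
 show n: "integrable (count_space {1..}) (%n. f (- int n))"
 using iN unfolding integral_count_space_indicator(2)[OF sub(2)] by (simp only: integrable_bij_count_space[OF bN])
 have "(\<integral>n. f n \<partial>count_space (UNIV - {0})) = (\<integral>n. indicator ?P n *\<^sub>R f n + indicator ?N n *\<^sub>R f n \<partial>count_space (UNIV - {0}))"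
 by (intro Bochner_Integration.integral_cong) (auto simp: indicator_def)
 also have "... = (\<integral>n. f n \<partial>count_space ?P) + (\<integral>n. f n \<partial>count_space ?N)"
 using iP iN by (simp add: integral_count_space_indicator(1)[OF sub(1)] integral_count_space_indicator(1)[OF sub(2)])
 also have "... = (\<integral>n. f (int n) \<partial>count_space {1..}) + (\<integral>n. f (- int n) \<partial>count_space {1..})"
 by (simp only: integral_bij_count_space[OF bP] integral_bij_count_space[OF bN])
 finally show "(\<integral>n. f n \<partial>count_space (UNIV - {0})) = (\<integral>n. f (int n) + f (- int n) \<partial>count_space {1..})"
 using p n by simp
qed

text \<open>The coefficient of frequency \<open>k\<close> of an absolutely convergent exponential sum whose frequencies
 are \<open>\<omega> n \<in> \<int>\<close>, possibly with repetitions.\<close>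

lemma fourier_coefficient:
 fixes a :: "int => complex" and \<omega> :: "int => int"
 assumes a: "integrable (count_space A) a"
 shows "(\<integral>x. indicator {0..<1} x *\<^sub>R ((\<integral>n. a n * cis (2 * pi * real_of_int (\<omega> n) * x) \<partial>count_space A) * cis (- (2 * pi * real_of_int k * x))) \<partial>lborel)
 = (\<integral>n. (if \<omega> n = k then a n else 0) \<partial>count_space A)"
 and "integrable lborel (%x. indicator {0..<1} x *\<^sub>R ((\<integral>n. a n * cis (2 * pi * real_of_int (\<omega> n) * x) \<partial>count_space A) * cis (- (2 * pi * real_of_int k * x))))"
proof -
 let ?f = "%n x. indicator {0..<1} x *\<^sub>R (a n * cis (2 * pi * real_of_int (\<omega> n - k) * x))"
 have nf: "(\<integral>\<^sup>+x. norm (?f n x) \<partial>lborel) = ennreal (norm (a n))" for n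
 proof -
 have "(\<integral>\<^sup>+x. norm (?f n x) \<partial>lborel) = (\<integral>\<^sup>+x. ennreal (norm (a n)) * indicator {0..<1::real} x \<partial>lborel)"
 by (intro nn_integral_cong) (auto simp: norm_mult indicator_def)
 also have "... = ennreal (norm (a n)) * emeasure lborel {0..<1::real}" by (subst nn_integral_cmult_indicator) auto
 finally show ?thesis by simp
 qed
 have fin: "(\<integral>\<^sup>+n. \<integral>\<^sup>+x. norm (?f n x) \<partial>lborel \<partial>count_space A) < \<infinity>"
 unfolding nf using a by (simp add: integrable_iff_bounded)
 have eq: "indicator {0..<1} x *\<^sub>R ((\<integral>n. a n * cis (2 * pi * real_of_int (\<omega> n) * x) \<partial>count_space A) * cis (- (2 * pi * real_of_int k * x)))
 = (\<integral>n. ?f n x \<partial>count_space A)" for x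
 proof -
 have *: "(\<integral>n. ?f n x \<partial>count_space A) = (\<integral>n. indicator {0..<1} x *\<^sub>R (a n * cis (2 * pi * real_of_int (\<omega> n) * x) * cis (- (2 * pi * real_of_int k * x))) \<partial>count_space A)"
 by (intro Bochner_Integration.integral_cong refl) (simp add: cis_mult mult.assoc algebra_simps)
 show ?thesis unfolding * by simp
 qed
 show "integrable lborel (%x. indicator {0..<1} x *\<^sub>R ((\<integral>n. a n * cis (2 * pi * real_of_int (\<omega> n) * x) \<partial>count_space A) * cis (- (2 * pi * real_of_int k * x))))"
 unfolding eq by (rule integral_count_space_swap(1)[OF lborel.sigma_finite_measure_axioms _ _ fin]) auto
 have "(\<integral>x. \<integral>n. ?f n x \<partial>count_space A \<partial>lborel) = (\<integral>n. \<integral>x. ?f n x \<partial>lborel \<partial>count_space A)"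
 by (rule integral_count_space_swap(3)[OF lborel.sigma_finite_measure_axioms _ _ fin]) auto
 also have "... = (\<integral>n. (if \<omega> n = k then a n else 0) \<partial>count_space A)"
 proof (intro Bochner_Integration.integral_cong refl)
 fix n
 have c: "continuous_on {0..1} (%x. a n * cis (2 * pi * real_of_int (\<omega> n - k) * x))" by (intro continuous_intros)
 have "(\<integral>x. ?f n x \<partial>lborel) = integral {0..1} (%x. a n * cis (2 * pi * real_of_int (\<omega> n - k) * x))"
 by (rule integral_unit_interval(1)[OF c, symmetric])
 also have "... = a n * (if \<omega> n - k = 0 then 1 else 0)" by (simp only: integral_mult_right integral_cis_period)
 finally show "(\<integral>x. ?f n x \<partial>lborel) = (if \<omega> n = k then a n else 0)" by auto
 qed
 finally show "(\<integral>x. indicator {0..<1} x *\<^sub>R ((\<integral>n. a n * cis (2 * pi * real_of_int (\<omega> n) * x) \<partial>count_space A) * cis (- (2 * pi * real_of_int k * x))) \<partial>lborel)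
 = (\<integral>n. (if \<omega> n = k then a n else 0) \<partial>count_space A)" unfolding eq .
qed

lemma sum_cis_roots:
 assumes "d > 0"
 shows "(\<Sum>b<d. cis (2 * pi * real_of_int m * (real b / real d))) = (if int d dvd m then of_nat d else 0)"
proof -
 define w where "w = cis (2 * pi * real_of_int m / real d)"
 have pw: "cis (2 * pi * real_of_int m * (real b / real d)) = w ^ b" for b
 unfolding w_def Complex.DeMoivre by (rule arg_cong[where f = cis]) simp
 have wd: "w ^ d = 1"
 using assms cis_multiple_2pi[of "real_of_int m"] by (simp add: w_def Complex.DeMoivre)
 have w1: "w = 1 \<longleftrightarrow> int d dvd m"
 proof
 assume "w = 1"
 hence "cos (2 * pi * real_of_int m / real d) = 1" by (simp add: w_def complex_eq_iff)
 then obtain j :: int where "2 * pi * real_of_int m / real d = j * 2 * pi" by (auto simp: cos_one_2pi_int)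
 hence "real_of_int m = real_of_int (j * int d)" using assms by (simp add: field_simps)
 hence "m = j * int d" by (simp only: of_int_eq_iff)
 thus "int d dvd m" by simp
 next
 assume "int d dvd m"
 then obtain j where "m = int d * j" by auto
 hence "2 * pi * real_of_int m / real d = 2 * pi * real_of_int j" using assms by simp
 thus "w = 1" unfolding w_def using cis_multiple_2pi[of "real_of_int j"] by simp
 qed
 show ?thesis
 proof (cases "w = 1")
 case False
 hence "(\<Sum>b<d. w ^ b) = 0" using geometric_sum[of w d] wd by simp
 thus ?thesis unfolding pw using False w1 by simp
 next
 case True
 thus ?thesis unfolding pw using w1 by simp
 qed
qed

context normalized_hecke_maass_cusp_form
begin

definition cf :: "real => int => real" where
 "cf y n = sqrt y * lam n * Kb u (2 * pi * \<bar>real_of_int n\<bar> * y)"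

lemma expansion:
 assumes y: "y > 0"
 shows "integrable (count_space (UNIV - {0})) (%n. complex_of_real (cf y n))"
 and "f (Complex x y) = (\<integral>n. complex_of_real (cf y n) * cis (2 * pi * real_of_int n * x) \<partial>count_space (UNIV - {0}))"
proof -
 have *: "((%n. complex_of_real (cf y n) * cis (2 * pi * real_of_int n * x)) has_sum f (Complex x y)) (UNIV - {0})" for x
 using fourier[OF y, of x] by (simp add: cf_def macdonald_K_eq cis_conv_exp mult_ac)
 show "f (Complex x y) = (\<integral>n. complex_of_real (cf y n) * cis (2 * pi * real_of_int n * x) \<partial>count_space (UNIV - {0}))"
 using has_sum_integral_count_space(2)[OF *] by simp
 show "integrable (count_space (UNIV - {0})) (%n. complex_of_real (cf y n))"
 using has_sum_integral_count_space(1)[OF *[of 0]] by simp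
qed

lemma invariant: "M \<in> mats 1 ==> Im z > 0 ==> f (mob M z) = f z"
 using modular by (cases M) (auto simp: mats_def upper_half_plane_def)

text \<open>The dilation by \<open>j\<close> prepares the comparison with the Hecke operator, whose
  expansion is read off over several periods.\<close>

lemma coefficient:
 fixes j :: nat
 assumes y: "y > 0" and k: "k ~= 0" and that: "j >= 1"
 shows "(\<integral>x. indicator {0..<1} x *\<^sub>R (f (Complex (real j * x) y) * cis (- (2 * pi * real_of_int (int j * k) * x))) \<partial>lborel) = cf y k"
proof -
 have "f (Complex (real j * x) y) = (\<integral>n. complex_of_real (cf y n) * cis (2 * pi * real_of_int (int j * n) * x) \<partial>count_space (UNIV - {0}))" for x
 using expansion(2)[OF y, of "real j * x"] by (simp add: mult_ac)
 hence "(\<integral>x. indicator {0..<1} x *\<^sub>R (f (Complex (real j * x) y) * cis (- (2 * pi * real_of_int (int j * k) * x))) \<partial>lborel)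
 = (\<integral>n. (if int j * n = int j * k then complex_of_real (cf y n) else 0) \<partial>count_space (UNIV - {0}))"
 using fourier_coefficient(1)[OF expansion(1)[OF y], of "%n. int j * n" "int j * k"] by simp
 also have "... = (\<integral>n. indicator {k} n *\<^sub>R complex_of_real (cf y n) \<partial>count_space (UNIV - {0}))"
 using that by (intro Bochner_Integration.integral_cong) (auto simp: indicator_def)
 also have "... = complex_of_real (cf y k)"
 using k by (subst integral_count_space_indicator(1)) (auto simp: lebesgue_integral_count_space_finite)
 finally show ?thesis .
qed

text \<open>Over \<open>n\<close> periods every summand of the Hecke operator has a Fourier expansion, so that the \<open>k\<close>-th
 coefficient (\<open>k = \<plusminus>1\<close>) can be computed termwise before summing over \<open>b\<close>.\<close>

lemma hecke_coefficient:
 assumes n: "n >= 1" and y: "y > 0" and k: "k = 1 \<or> k = -1"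
 shows "(\<integral>x. indicator {0..<1} x *\<^sub>R (hecke_op n f (Complex (real n * x) y) * cis (- (2 * pi * real_of_int (int n * k) * x))) \<partial>lborel)
 = sqrt y * lam (int n * k) * Kb u (2 * pi * y)"
proof -
 let ?e = "%x. cis (- (2 * pi * real_of_int (int n * k) * x))"
 let ?g = "%d b x. indicator {0..<1} x *\<^sub>R (f ((of_nat (n div d) * Complex (real n * x) y + of_nat b) / of_nat d) * ?e x)"
 let ?a = "%d b m. complex_of_real (cf (real (n div d) * y / real d) m) * cis (2 * pi * real_of_int m * (real b / real d))"
 have fin: "finite {d. d dvd n}" using n by simp
 have single: "integrable lborel (?g d b) \<and> (\<integral>x. ?g d b x \<partial>lborel) =
 (\<integral>m. (if m * int (n div d) = int d * k then ?a d b m else 0) \<partial>count_space (UNIV - {0}))" if d: "d dvd n" for d b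
 proof -
 define a where "a = n div d"
 have n': "n = a * d" and d0: "d > 0" and a0: "a > 0" using d n by (auto simp: a_def)
 have y': "real a * y / real d > 0" using a0 d0 y by simp
 have z: "(of_nat a * Complex (real n * x) y + of_nat b) / of_nat d = Complex (real a * real a * x + real b / real d) (real a * y / real d)" for x
 using d0 by (simp add: complex_eq_iff n' Re_divide_of_nat Im_divide_of_nat field_simps)
 have fx: "f ((of_nat a * Complex (real n * x) y + of_nat b) / of_nat d)
 = (\<integral>m. ?a d b m * cis (2 * pi * real_of_int (m * int a * int a) * x) \<partial>count_space (UNIV - {0}))" for x
 unfolding z expansion(2)[OF y'] a_def[symmetric]
 by (intro Bochner_Integration.integral_cong refl) (simp add: cis_mult mult.assoc algebra_simps)
 have ia: "integrable (count_space (UNIV - {0})) (?a d b)"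
 by (rule Bochner_Integration.integrable_bound[OF expansion(1)[OF y']]) (auto simp: norm_mult a_def)
 have iff: "m * int a * int a = int n * k \<longleftrightarrow> m * int a = int d * k" for m
 using a0 by (auto simp: n' mult_ac)
 show ?thesis
 using fourier_coefficient[OF ia, of "%m. m * int a * int a" "int n * k"] unfolding fx[unfolded a_def] a_def[symmetric] fx iff by simp
 qed
 have "(\<integral>x. indicator {0..<1} x *\<^sub>R (hecke_op n f (Complex (real n * x) y) * ?e x) \<partial>lborel)
 = (\<integral>x. (\<Sum>d | d dvd n. \<Sum>b<d. ?g d b x) / of_real (sqrt (real n)) \<partial>lborel)"
 by (intro Bochner_Integration.integral_cong refl) (simp add: hecke_op_def sum_distrib_right scaleR_sum_right sum_divide_distrib)
 also have "... = (\<Sum>d | d dvd n. \<Sum>b<d. (\<integral>x. ?g d b x \<partial>lborel)) / of_real (sqrt (real n))"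
 proof -
 have i1: "integrable lborel (?g d b)" if "d dvd n" for d b by (rule single[OF that, THEN conjunct1])
 have "(\<integral>x. (\<Sum>d | d dvd n. \<Sum>b<d. ?g d b x) \<partial>lborel) = (\<Sum>d | d dvd n. \<integral>x. (\<Sum>b<d. ?g d b x) \<partial>lborel)"
 by (rule Bochner_Integration.integral_sum, rule Bochner_Integration.integrable_sum, rule i1) (rule CollectD)
 also have "... = (\<Sum>d | d dvd n. \<Sum>b<d. (\<integral>x. ?g d b x \<partial>lborel))"
 by (rule sum.cong[OF refl], rule Bochner_Integration.integral_sum, rule i1) (rule CollectD)
 finally show ?thesis by (simp only: integral_divide_zero)
 qed
 also have "(\<Sum>d | d dvd n. \<Sum>b<d. (\<integral>x. ?g d b x \<partial>lborel)) = (\<Sum>d | d dvd n. if d = n then of_nat n * complex_of_real (cf (y / real n) (int n * k)) else 0)"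
 proof (rule sum.cong[OF refl])
 fix d assume "d \<in> {d. d dvd n}"
 hence d: "d dvd n" by simp
 define a where "a = n div d"
 have n': "n = a * d" and d0: "d > 0" and a0: "a > 0" using d n by (auto simp: a_def)
 have i: "integrable (count_space (UNIV - {0})) (%m. if m * int (n div d) = int d * k then ?a d b m else 0)" for b
 proof -
 have "integrable (count_space (UNIV - {0})) (%m. complex_of_real (cf (real (n div d) * y / real d) m))"
 using a0 d0 y by (intro expansion(1)) (simp add: a_def)
 thus ?thesis by (rule Bochner_Integration.integrable_bound) (auto simp: norm_mult)
 qed
 have "(\<Sum>b<d. (\<integral>x. ?g d b x \<partial>lborel)) = (\<Sum>b<d. (\<integral>m. (if m * int (n div d) = int d * k then ?a d b m else 0) \<partial>count_space (UNIV - {0})))"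
 using single[OF d] by simp
 also have "... = (\<integral>m. (\<Sum>b<d. if m * int (n div d) = int d * k then ?a d b m else 0) \<partial>count_space (UNIV - {0}))"
 using i by (simp add: Bochner_Integration.integral_sum)
 also have "... = (\<integral>m. (if d = n then indicator {int n * k} m *\<^sub>R (of_nat n * complex_of_real (cf (y / real n) (int n * k))) else 0) \<partial>count_space (UNIV - {0}))"
 proof (intro Bochner_Integration.integral_cong refl)
 fix m :: int
 have s: "(\<Sum>b<d. ?a d b m) = complex_of_real (cf (real a * y / real d) m) * (if int d dvd m then of_nat d else 0)"
 using sum_cis_roots[OF d0, of m] by (simp add: a_def flip: sum_distrib_left)
 \<comment> \<open>The frequency forces m a = d k, and the sum over b annihilates every m not
   divisible by d. Hence a divides k = 1 or k = -1, and only d = n survives.\<close>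
 have key: "m * int a = int d * k \<and> int d dvd m \<longleftrightarrow> d = n \<and> m = int n * k"
 proof
 assume *: "m * int a = int d * k \<and> int d dvd m"
 then obtain m' where m': "m = int d * m'" by auto
 hence "m' * int a = k" using * d0 by auto
 hence "int a dvd k" by auto
 hence "int a dvd 1" using k by auto
 hence "a = 1" using a0 by auto
 thus "d = n \<and> m = int n * k" using * n' by auto
 next
 assume "d = n \<and> m = int n * k"
 moreover from this have "a = 1" using n' d0 by auto
 ultimately show "m * int a = int d * k \<and> int d dvd m" by auto
 qed
 show "(\<Sum>b<d. if m * int (n div d) = int d * k then ?a d b m else 0)
 = (if d = n then indicator {int n * k} m *\<^sub>R (of_nat n * complex_of_real (cf (y / real n) (int n * k))) else 0)"
 proof (cases "m * int a = int d * k")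
 case True
 hence "(\<Sum>b<d. if m * int (n div d) = int d * k then ?a d b m else 0) = (\<Sum>b<d. ?a d b m)"
 by (intro sum.cong refl) (simp add: a_def)
 also note s
 finally have S: "(\<Sum>b<d. if m * int (n div d) = int d * k then ?a d b m else 0)
 = complex_of_real (cf (real a * y / real d) m) * (if int d dvd m then of_nat d else 0)" .
 show ?thesis
 proof (cases "int d dvd m")
 case dvd: True
 hence "d = n" "m = int n * k" using key True by auto
 moreover from this have "a = 1" using n' d0 by auto
 ultimately show ?thesis unfolding S using n by (simp add: mult.commute)
 next
 case False
 hence "\<not> (d = n \<and> m = int n * k)" using key by blast
 thus ?thesis unfolding S using False by (auto simp: indicator_def)
 qed
 next
 case False
 hence "(\<Sum>b<d. if m * int (n div d) = int d * k then ?a d b m else 0) = 0"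
 by (intro sum.neutral) (simp add: a_def)
 moreover have "\<not> (d = n \<and> m = int n * k)" using key False by blast
 ultimately show ?thesis by (auto simp: indicator_def)
 qed
 qed
 also have "... = (if d = n then of_nat n * complex_of_real (cf (y / real n) (int n * k)) else 0)"
 proof (cases "d = n")
 case True
 have "int n * k ~= 0" using n k by auto
 hence "(\<integral>m. indicator {int n * k} m *\<^sub>R (of_nat n * complex_of_real (cf (y / real n) (int n * k))) \<partial>count_space (UNIV - {0}))
 = of_nat n * complex_of_real (cf (y / real n) (int n * k))"
 by (subst integral_count_space_indicator(1)) (auto simp: lebesgue_integral_count_space_finite)
 thus ?thesis using True by simp
 qed simp
 finally show "(\<Sum>b<d. (\<integral>x. ?g d b x \<partial>lborel)) = (if d = n then of_nat n * complex_of_real (cf (y / real n) (int n * k)) else 0)" .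
 qed
 also have "... = of_nat n * complex_of_real (cf (y / real n) (int n * k))"
 using fin by (subst sum.delta) auto
 finally have "(\<integral>x. indicator {0..<1} x *\<^sub>R (hecke_op n f (Complex (real n * x) y) * ?e x) \<partial>lborel)
 = complex_of_real (real n * cf (y / real n) (int n * k) / sqrt (real n))" by simp
 also have "real n * cf (y / real n) (int n * k) / sqrt (real n) = sqrt y * lam (int n * k) * Kb u (2 * pi * y)"
 proof -
 have 1: "\<bar>real_of_int (int n * k)\<bar> = real n" using k by auto
 have "real n * sqrt (y / real n) / sqrt (real n) = sqrt y"
 using n real_sqrt_mult_self[of "real n"] by (simp add: real_sqrt_divide field_simps)
 moreover have "real n * (sqrt (y / real n) * X) / sqrt (real n) = (real n * sqrt (y / real n) / sqrt (real n)) * X" for X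
 by simp
 ultimately have 2: "real n * (sqrt (y / real n) * X) / sqrt (real n) = sqrt y * X" for X
 by (simp only:)
 have 3: "2 * pi * real n * (y / real n) = 2 * pi * y" using n by simp
 show ?thesis unfolding cf_def 1 3 mult.assoc[of "sqrt (y / real n)"] 2 by simp
 qed
 finally show ?thesis by simp
qed

lemma Kb_positive_point: obtains y where "y > 0" "Kb u (2 * pi * y) > 0"
proof -
 define y where "y = (u^2 + 1) / (2 * pi)"
 have "Kb u (2 * pi * y) >= exp (- 2 * (2 * pi * y)) / 2"
 by (rule Kb_lower) (auto simp: y_def add_nonneg_pos)
 hence "Kb u (2 * pi * y) > 0" by (smt (verit) exp_gt_zero half_gt_zero)
 moreover have "y > 0" by (auto simp: y_def add_nonneg_pos)
 ultimately show ?thesis using that by blast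
qed

text \<open>The coefficients of T_n f and of f at the frequencies 1 and -1 are compared at a height
  where the Bessel factor is positive. Frequency 1 and the normalisation identify the eigenvalue;
  frequency -1 then gives the relation between coefficients of opposite index.\<close>

lemma hecke_eigenvalue:
 assumes n: "n >= 1"
 shows "Im z > 0 ==> hecke_op n f z = of_real (lam (int n)) * f z"
 and "lam (- int n) = lam (- 1) * lam (int n)"
proof -
 obtain \<mu> where \<mu>: "!!z. Im z > 0 ==> hecke_op n f z = \<mu> * f z"
 using hecke_eigenform[OF n] by (auto simp: upper_half_plane_def)
 obtain y where y: "y > 0" "Kb u (2 * pi * y) > 0" using Kb_positive_point .
 have eq: "complex_of_real (lam (int n * k)) = \<mu> * complex_of_real (lam k)" if k: "k = 1 \<or> k = -1" for k :: int
 proof -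
 have "complex_of_real (sqrt y * lam (int n * k) * Kb u (2 * pi * y))
 = (\<integral>x. indicator {0..<1} x *\<^sub>R (hecke_op n f (Complex (real n * x) y) * cis (- (2 * pi * real_of_int (int n * k) * x))) \<partial>lborel)"
 by (rule hecke_coefficient[OF n y(1) k, symmetric])
 also have "... = (\<integral>x. \<mu> * (indicator {0..<1} x *\<^sub>R (f (Complex (real n * x) y) * cis (- (2 * pi * real_of_int (int n * k) * x)))) \<partial>lborel)"
 using y by (intro Bochner_Integration.integral_cong refl) (simp add: \<mu> mult.assoc)
 also have "... = \<mu> * complex_of_real (cf y k)"
 using coefficient[OF y(1), of k n] n k by (simp only: integral_mult_right_zero) auto
 also have "cf y k = sqrt y * lam k * Kb u (2 * pi * y)" using k by (auto simp: cf_def)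
 finally have "complex_of_real (sqrt y * Kb u (2 * pi * y)) * complex_of_real (lam (int n * k)) = complex_of_real (sqrt y * Kb u (2 * pi * y)) * (\<mu> * complex_of_real (lam k))"
 by (simp add: mult_ac)
 thus ?thesis using y by (simp only: mult_cancel_left of_real_eq_0_iff) simp
 qed
 have m: "\<mu> = of_real (lam (int n))" using eq[of 1] normalized by simp
 show "hecke_op n f z = of_real (lam (int n)) * f z" if "Im z > 0" using \<mu>[OF that] m by simp
 have "complex_of_real (lam (- int n)) = complex_of_real (lam (- 1) * lam (int n))" using eq[of "-1"] m by (simp add: mult.commute)
 thus "lam (- int n) = lam (- 1) * lam (int n)" by (simp only: of_real_eq_iff)
qed

text \<open>At a fixed height each term of the expansion is bounded by the sum of all absolute
  values, and the Bessel factor is bounded below once 2 pi |n| y >= u^2. The finitely many remaining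
  n go into the constant.\<close>

lemma lam_exp_bound: "\<exists>C\<ge>0. \<forall>n. n ~= 0 --> \<bar>lam n\<bar> <= C * exp (pi / 2 * \<bar>real_of_int n\<bar>)"
proof -
 \<comment> \<open>Height 1/8 makes the growth rate pi / 2, which the decay exp (- pi |n|) available
   at height 1/2 in \<open>bounded_form\<close> still beats.\<close>
 define y where "y = (1/8 :: real)"
 define S where "S = (\<integral>n. norm (complex_of_real (cf y n)) \<partial>count_space (UNIV - {0}))"
 define N where "N = \<lceil>2 * u^2\<rceil>"
 have S: "\<bar>cf y n\<bar> <= S" if "n ~= 0" for n
 proof -
 have i: "integrable (count_space (UNIV - {0})) (%n. norm (complex_of_real (cf y n)))"
 using expansion(1)[of y] by (intro integrable_norm) (simp add: y_def)
 have "\<bar>cf y n\<bar> = (\<integral>m. indicator {n} m *\<^sub>R \<bar>cf y n\<bar> \<partial>count_space (UNIV - {0}))"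
 using that by (subst integral_count_space_indicator(1)) (auto simp: lebesgue_integral_count_space_finite)
 also have "... <= S" unfolding S_def
 proof (rule integral_mono[OF _ i])
 show "integrable (count_space (UNIV - {0})) (%m. indicator {n} m *\<^sub>R \<bar>cf y n\<bar>)"
 using that by (subst integral_count_space_indicator(2)) (auto simp: integrable_count_space)
 qed (auto simp: indicator_def)
 finally show ?thesis .
 qed
 have S0: "S >= 0" unfolding S_def by (intro integral_nonneg_AE) auto
 define C where "C = 2 * S / sqrt y + (\<Sum>n\<in>{-N..N}. \<bar>lam n\<bar>)"
 have C0: "C >= 0" using S0 unfolding C_def by (intro add_nonneg_nonneg sum_nonneg divide_nonneg_nonneg) (auto simp: y_def)
 show ?thesis
 proof (intro exI[of _ C] conjI allI impI C0)
 fix n :: int assume n: "n ~= 0"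
 show "\<bar>lam n\<bar> <= C * exp (pi / 2 * \<bar>real_of_int n\<bar>)"
 proof (cases "n \<in> {-N..N}")
 case True
 hence "\<bar>lam n\<bar> <= (\<Sum>n\<in>{-N..N}. \<bar>lam n\<bar>)" by (intro member_le_sum) auto
 moreover have "2 * S / sqrt y >= 0" using S0 by (simp add: y_def)
 ultimately have "\<bar>lam n\<bar> <= C" by (simp add: C_def)
 moreover have "C * 1 <= C * exp (pi / 2 * \<bar>real_of_int n\<bar>)" using C0 by (intro mult_left_mono) auto
 ultimately show ?thesis by simp
 next
 case False
 hence "\<bar>real_of_int n\<bar> >= 2 * u^2" unfolding N_def by (auto simp: abs_if) linarith+
 moreover have "2 * pi * \<bar>real_of_int n\<bar> * y >= \<bar>real_of_int n\<bar> / 2" using pi_gt3 mult_right_mono[of 2 pi "\<bar>real_of_int n\<bar>"] by (simp add: y_def)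
 ultimately have "u^2 <= 2 * pi * \<bar>real_of_int n\<bar> * y" by linarith
 moreover have "2 * pi * \<bar>real_of_int n\<bar> * y > 0" using n by (simp add: y_def)
 ultimately have K: "Kb u (2 * pi * \<bar>real_of_int n\<bar> * y) >= exp (- 2 * (2 * pi * \<bar>real_of_int n\<bar> * y)) / 2"
 by (intro Kb_lower)
 define E where "E = exp (- (pi / 2 * \<bar>real_of_int n\<bar>))"
 have KE: "Kb u (2 * pi * \<bar>real_of_int n\<bar> * y) >= E / 2" using K by (simp add: y_def E_def)
 have E: "E > 0" by (simp add: E_def)
 have "sqrt y * \<bar>lam n\<bar> * (E / 2) <= sqrt y * \<bar>lam n\<bar> * Kb u (2 * pi * \<bar>real_of_int n\<bar> * y)"
 using KE by (intro mult_left_mono) (auto simp: y_def)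
 also have "... = \<bar>cf y n\<bar>" using KE E by (simp add: cf_def abs_mult y_def)
 also have "... <= S" by (rule S[OF n])
 finally have "\<bar>lam n\<bar> * E <= 2 * S / sqrt y" by (simp add: y_def field_simps)
 also have "... <= C" unfolding C_def by (simp add: sum_nonneg)
 finally have "\<bar>lam n\<bar> * E <= C" .
 thus ?thesis by (simp add: E_def exp_minus field_simps)
 qed
 qed
qed

text \<open>At height at least 1/2 the expansion is dominated by a convergent series, and
  \<open>reduction\<close> moves every point there.\<close>

lemma bounded_form: "\<exists>B. \<forall>z. Im z > 0 --> cmod (f z) <= B"
proof -
 obtain C where C: "C >= 0" "!!n. n ~= 0 ==> \<bar>lam n\<bar> <= C * exp (pi / 2 * \<bar>real_of_int n\<bar>)" using lam_exp_bound by auto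
 let ?g = "%n. C * exp (- (pi / 2) * \<bar>real_of_int n\<bar>)"
 have ig: "integrable (count_space (UNIV - {0})) ?g"
 proof -
 have "integrable (count_space UNIV) (%n. indicator (UNIV - {0}) n *\<^sub>R ?g n)"
 by (rule Bochner_Integration.integrable_bound[OF integrable_mult_right[OF integrable_exp_abs_int[of "pi / 2"], of C]])
 (auto simp: indicator_def)
 thus ?thesis by (simp only: integral_count_space_indicator(2)[OF subset_UNIV])
 qed
 define B where "B = (\<integral>n. ?g n \<partial>count_space (UNIV - {0}))"
 have hi: "cmod (f (Complex x y)) <= B" if y: "y >= 1/2" for x y
 proof -
 have y0: "y > 0" using y by simp
 have "cmod (f (Complex x y)) <= (\<integral>n. cmod (complex_of_real (cf y n) * cis (2 * pi * real_of_int n * x)) \<partial>count_space (UNIV - {0}))"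
 unfolding expansion(2)[OF y0] by (rule integral_norm_bound)
 also have "... <= B" unfolding B_def
 proof (rule integral_mono[OF _ ig])
 show "integrable (count_space (UNIV - {0})) (%n. cmod (complex_of_real (cf y n) * cis (2 * pi * real_of_int n * x)))"
 using integrable_norm[OF expansion(1)[OF y0]] by (simp add: norm_mult)
 fix n :: int assume "n \<in> space (count_space (UNIV - {0}))"
 hence n: "n ~= 0" by simp
 define a where "a = \<bar>real_of_int n\<bar>"
 have a: "a >= 1" using n by (simp add: a_def)
 have "sqrt y * \<bar>Kb u (2 * pi * a * y)\<bar> <= sqrt y * (sqrt (2 * pi / (2 * pi * a * y)) * exp (- (2 * pi * a * y)))"
 using a y by (intro mult_left_mono Kb_bound) auto
 also have "... = sqrt (1 / a) * exp (- (2 * pi * a * y))"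
 using y0 a by (simp add: real_sqrt_divide real_sqrt_mult field_simps)
 also have "... <= 1 * exp (- (pi * a))"
 proof (intro mult_mono)
 show "sqrt (1 / a) <= 1" using a by simp
 have "pi * a * 1 <= pi * a * (2 * y)" using y a by (intro mult_left_mono) auto
 thus "exp (- (2 * pi * a * y)) <= exp (- (pi * a))" by (simp add: mult_ac)
 qed (use a in auto)
 finally have K: "sqrt y * \<bar>Kb u (2 * pi * a * y)\<bar> <= exp (- (pi * a))" by simp
 have "\<bar>cf y n\<bar> = \<bar>lam n\<bar> * (sqrt y * \<bar>Kb u (2 * pi * a * y)\<bar>)" using y0 by (simp add: cf_def a_def abs_mult)
 also have "... <= (C * exp (pi / 2 * a)) * exp (- (pi * a))"
 using C(2)[OF n] K C(1) y0 by (intro mult_mono) (auto simp: a_def)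
 also have "... = ?g n" by (simp add: a_def mult.assoc flip: exp_add)
 finally show "cmod (complex_of_real (cf y n) * cis (2 * pi * real_of_int n * x)) <= ?g n" by (simp add: norm_mult)
 qed
 finally show ?thesis .
 qed
 show ?thesis
 proof (intro exI[of _ B] allI impI)
 fix z assume z: "Im z > 0"
 obtain M where M: "M \<in> mats 1" "Im (mob M z) >= 1/2" using reduction[OF z] by blast
 show "cmod (f z) <= B" using hi[OF M(2), of "Re (mob M z)"] invariant[OF M(1) z] by (simp del: mob_simp)
 qed
qed

text \<open>Let \<open>B\<close> be the exact supremum of |f|. The Hecke sum has at most n^2 terms,
  so |lam n| |f| <= n^2 B at every point; taking the supremum on the left cancels \<open>B\<close>
  and makes the bound independent of the form.\<close>

lemma lam_bound:
 assumes n: "n >= 1"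
 shows "\<bar>lam (int n)\<bar> <= (real n)^2"
proof -
 obtain B0 where B0: "!!z. Im z > 0 ==> cmod (f z) <= B0" using bounded_form by blast
 define B where "B = (SUP z\<in>{z. Im z > 0}. cmod (f z))"
 have bdd: "bdd_above ((%z. cmod (f z)) ` {z. Im z > 0})" using B0 by (intro bdd_aboveI[of _ B0]) auto
 have le: "cmod (f z) <= B" if "Im z > 0" for z unfolding B_def using that bdd by (intro cSUP_upper) auto
 \<comment> \<open>The first coefficient is 1, so the form does not vanish identically and
   \<open>B\<close> is positive.\<close>
 obtain z0 where z0: "Im z0 > 0" "f z0 ~= 0"
 proof (rule ccontr)
 assume "\<not> thesis"
 hence zero: "f z = 0" if "Im z > 0" for z using that \<open>!!z0. \<lbrakk>Im z0 > 0; f z0 ~= 0\<rbrakk> \<Longrightarrow> thesis\<close> by blast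
 obtain y where y: "y > 0" "Kb u (2 * pi * y) > 0" using Kb_positive_point .
 have "complex_of_real (cf y 1) = 0" using coefficient[OF y(1), of 1 1] zero y by simp
 thus False using y normalized by (simp add: cf_def)
 qed
 have Bpos: "B > 0" using le[OF z0(1)] z0(2) by (meson less_le_trans zero_less_norm_iff)
 have "\<bar>lam (int n)\<bar> * cmod (f z) <= (real n)^2 * B" if z: "Im z > 0" for z
 proof -
 have pt: "Im ((of_nat (n div d) * z + of_nat b) / of_nat d) > 0" if "d dvd n" for d b
 proof -
 have "d > 0" "n div d > 0" using that n by (auto simp: dvd_div_eq_0_iff intro!: Nat.gr0I)
 thus ?thesis using z by (simp add: Im_divide_of_nat)
 qed
 have "\<bar>lam (int n)\<bar> * cmod (f z) = cmod (hecke_op n f z)" using hecke_eigenvalue(1)[OF n z] by (simp add: norm_mult)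
 also have "... = cmod (\<Sum>d | d dvd n. \<Sum>b<d. f ((of_nat (n div d) * z + of_nat b) / of_nat d)) / sqrt (real n)"
 by (simp add: hecke_op_def norm_divide)
 also have "... <= cmod (\<Sum>d | d dvd n. \<Sum>b<d. f ((of_nat (n div d) * z + of_nat b) / of_nat d)) / 1"
 using n by (intro divide_left_mono) auto
 also have "... <= (\<Sum>d | d dvd n. \<Sum>b<d. B)"
 unfolding div_by_1 using le pt by (intro order_trans[OF norm_sum] sum_mono) auto
 also have "... = (\<Sum>d | d dvd n. real d * B)" by simp
 also have "... <= (\<Sum>d | d dvd n. real n * B)"
 using n Bpos by (intro sum_mono mult_right_mono) (auto intro: dvd_imp_le)
 also have "... <= (\<Sum>d\<in>{1..n}. real n * B)"
 proof (rule sum_mono2)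
 show "{d. d dvd n} \<subseteq> {1..n}" using n by (auto intro: dvd_imp_le simp: Suc_le_eq dvd_pos_nat)
 qed (use Bpos in auto)
 also have "... = (real n)^2 * B" by (simp add: power2_eq_square)
 finally show ?thesis .
 qed
 hence "cmod (f z) * \<bar>lam (int n)\<bar> <= (real n)^2 * B" if "Im z > 0" for z using that by (simp add: mult.commute)
 hence *: "\<bar>lam (int n)\<bar> > 0 ==> cmod (f z) <= (real n)^2 * B / \<bar>lam (int n)\<bar>" if "Im z > 0" for z
 using that by (simp add: pos_le_divide_eq)
 show ?thesis
 proof (cases "lam (int n) = 0")
 case False
 hence "B <= (real n)^2 * B / \<bar>lam (int n)\<bar>" unfolding B_def using * z0(1)
 by (intro cSUP_least) (auto simp: B_def)
 thus ?thesis using Bpos False by (simp add: field_simps)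
 qed auto
qed

end

section \<open>Splitting a form by parity\<close>

text \<open>The even (\<open>cs = cos\<close>) and odd (\<open>cs = sin\<close>) parts of a form, as real functions.\<close>

locale rform =
 fixes cs :: "real => real" and u :: real and lam :: "nat => real" and F :: "complex => real"
 assumes cs: "cs = cos \<or> cs = sin"
 and inv: "!!M z. M \<in> mats 1 ==> Im z > 0 ==> F (mob M z) = F z"
 and fourier: "!!x y. y > 0 ==> F (Complex x y) =
 (\<integral>n. sqrt y * lam n * Kb u (2 * pi * real n * y) * cs (2 * pi * real n * x) \<partial>count_space {1..})"
 and lam1: "lam 1 = 1"
 and lam_le: "!!n. n >= 1 ==> \<bar>lam n\<bar> <= (real n)^2"
 and hecke: "!!n z. n >= 1 ==> Im z > 0 ==>
 (\<Sum>d | d dvd n. \<Sum>b<d. F ((of_nat (n div d) * z + of_nat b) / of_nat d)) = sqrt (real n) * lam n * F z"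
 and differentiable: "!!z. Im z > 0 ==> F differentiable (at z)"

context normalized_hecke_maass_cusp_form
begin

definition Cpart :: "complex => real" where
 "Cpart z = (\<integral>n. cf (Im z) (int n) * cos (2 * pi * real n * Re z) \<partial>count_space {1..})"

definition Spart :: "complex => real" where
 "Spart z = (\<integral>n. cf (Im z) (int n) * sin (2 * pi * real n * Re z) \<partial>count_space {1..})"

text \<open>The frequencies n and -n combine to cosines and sines because lam (- n) = lam (- 1) lam
  n, and reflection in the imaginary axis changes the sign of the sines. \<open>lam (- 1)\<close>
  stays a parameter: a form having both parts is not excluded at this point.\<close>

lemma form_parts:
 assumes z: "Im z > 0"
 shows "f z = of_real ((1 + lam (- 1)) * Cpart z) + \<i> * of_real ((1 - lam (- 1)) * Spart z)"
 and "f (- cnj z) = of_real ((1 + lam (- 1)) * Cpart z) - \<i> * of_real ((1 - lam (- 1)) * Spart z)"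
proof -
 define y where "y = Im z"
 have y: "y > 0" using z by (simp add: y_def)
 define \<epsilon> where "\<epsilon> = lam (- 1)"
 have neg: "cf y (- int n) = \<epsilon> * cf y (int n)" if "n >= 1" for n
 using hecke_eigenvalue(2)[OF that] by (simp add: cf_def \<epsilon>_def)
 have ic: "integrable (count_space {1..}) (%n. complex_of_real (cf y (int n)))"
 using integral_int_split(1)[OF expansion(1)[OF y]] .
 hence ic': "integrable (count_space {1..}) (%n. cf y (int n))" by (simp only: complex_of_real_integrable_eq)
 have icos: "integrable (count_space {1..}) (%n. cf y (int n) * cos (2 * pi * real n * x))" for x
 by (rule Bochner_Integration.integrable_bound[OF ic']) (auto simp: abs_mult mult_left_le)
 have isin: "integrable (count_space {1..}) (%n. cf y (int n) * sin (2 * pi * real n * x))" for x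
 by (rule Bochner_Integration.integrable_bound[OF ic']) (auto simp: abs_mult mult_left_le)
 have gen: "f (Complex x y) = of_real ((1 + \<epsilon>) * (\<integral>n. cf y (int n) * cos (2 * pi * real n * x) \<partial>count_space {1..}))
 + \<i> * of_real ((1 - \<epsilon>) * (\<integral>n. cf y (int n) * sin (2 * pi * real n * x) \<partial>count_space {1..}))" for x
 proof -
 have i: "integrable (count_space (UNIV - {0})) (%n. complex_of_real (cf y n) * cis (2 * pi * real_of_int n * x))"
 by (rule Bochner_Integration.integrable_bound[OF expansion(1)[OF y]]) (auto simp: norm_mult)
 have "f (Complex x y) = (\<integral>n. complex_of_real (cf y (int n)) * cis (2 * pi * real_of_int (int n) * x)
 + complex_of_real (cf y (- int n)) * cis (2 * pi * real_of_int (- int n) * x) \<partial>count_space {1..})"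
 unfolding expansion(2)[OF y] by (rule integral_int_split(3)[OF i])
 also have "... = (\<integral>n. complex_of_real ((1 + \<epsilon>) * (cf y (int n) * cos (2 * pi * real n * x)))
 + \<i> * complex_of_real ((1 - \<epsilon>) * (cf y (int n) * sin (2 * pi * real n * x))) \<partial>count_space {1..})"
 by (intro Bochner_Integration.integral_cong refl) (simp add: neg complex_eq_iff algebra_simps)
 also have "... = (\<integral>n. complex_of_real ((1 + \<epsilon>) * (cf y (int n) * cos (2 * pi * real n * x))) \<partial>count_space {1..})
 + (\<integral>n. \<i> * complex_of_real ((1 - \<epsilon>) * (cf y (int n) * sin (2 * pi * real n * x))) \<partial>count_space {1..})"
 by (intro Bochner_Integration.integral_add integrable_mult_right)
 (simp_all only: complex_of_real_integrable_eq, (intro integrable_mult_right icos isin)+)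
 finally show ?thesis
 by (simp only: integral_complex_of_real integral_mult_right_zero)
 qed
 have zc: "z = Complex (Re z) y" "- cnj z = Complex (- Re z) y" by (simp_all add: complex_eq_iff y_def)
 show "f z = of_real ((1 + lam (- 1)) * Cpart z) + \<i> * of_real ((1 - lam (- 1)) * Spart z)"
 using gen[of "Re z"] zc(1) by (simp add: Cpart_def Spart_def \<epsilon>_def y_def)
 show "f (- cnj z) = of_real ((1 + lam (- 1)) * Cpart z) - \<i> * of_real ((1 - lam (- 1)) * Spart z)"
 using gen[of "- Re z"] zc(2) by (simp add: Cpart_def Spart_def \<epsilon>_def y_def)
qed

text \<open>Reflection conjugates the modular group into itself, changing the signs of b and
  c.\<close>

lemma reflected_invariant:
 assumes "M \<in> mats 1" "Im z > 0"
 shows "f (- cnj (mob M z)) = f (- cnj z)"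
proof -
 obtain a b c d where M: "M = (a, b, c, d)" by (cases M)
 have "- cnj (mob M z) = mob (a, - b, - c, d) (- cnj z)" by (simp add: M minus_divide_left)
 moreover have "(a, - b, - c, d) \<in> mats 1" using assms by (simp add: M mats_def)
 ultimately show ?thesis using invariant[of "(a, - b, - c, d)" "- cnj z"] assms by simp
qed

lemma translate_form: "Im z > 0 ==> f (z + 1) = f z"
 using invariant[of "(1, 1, 0, 1)" z] by (simp add: mats_def)

text \<open>Reflection replaces b by -b; translation invariance makes the summand periodic in b
  modulo d, so the sum is merely permuted.\<close>

lemma hecke_op_reflected:
 assumes n: "n >= 1" and z: "Im z > 0"
 shows "hecke_op n (%z. f (- cnj z)) z = of_real (lam (int n)) * f (- cnj z)"
proof -
 define w where "w = - cnj z"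
 have w: "Im w > 0" using z by (simp add: w_def)
 have "(\<Sum>b<d. f (- cnj ((of_nat (n div d) * z + of_nat b) / of_nat d))) = (\<Sum>b<d. f ((of_nat (n div d) * w + of_nat b) / of_nat d))"
 if d: "d dvd n" for d
 proof -
 define a where "a = n div d"
 have d0: "d > 0" and a0: "a > 0" using d n by (auto simp: a_def dvd_div_eq_0_iff intro!: Nat.gr0I)
 define G where "G = (%b::int. f ((of_nat a * w + of_int b) / of_nat d))"
 have per: "G (b + int d) = G b" for b
 proof -
 have "(of_nat a * w + of_int (b + int d)) / of_nat d = (of_nat a * w + of_int b) / of_nat d + 1"
 using d0 by (simp add: field_simps)
 thus ?thesis unfolding G_def using w a0 d0 by (simp only:) (rule translate_form, simp add: Im_divide_of_nat)
 qed
 have "- cnj ((of_nat a * z + of_nat b) / of_nat d) = (of_nat a * w + of_int (- int b)) / of_nat d" for b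
 using d0 by (simp add: w_def field_simps)
 hence "(\<Sum>b<d. f (- cnj ((of_nat a * z + of_nat b) / of_nat d))) = (\<Sum>b<d. G (- int b))"
 by (simp only: G_def)
 also have "... = (\<Sum>b<d. G (int b))"
 proof (rule sum.reindex_bij_witness[where i = "%b. if b = 0 then 0 else d - b" and j = "%b. if b = 0 then 0 else d - b"])
 fix b assume "b \<in> {..<d}"
 hence b: "b < d" by simp
 show "G (int (if b = 0 then 0 else d - b)) = G (- int b)"
 using per[of "- int b"] b by (simp add: of_nat_diff)
 qed (use d0 in auto)
 also have "... = (\<Sum>b<d. f ((of_nat a * w + of_nat b) / of_nat d))" by (simp add: G_def)
 finally show ?thesis by (simp add: a_def)
 qed
 hence "hecke_op n (%z. f (- cnj z)) z = hecke_op n f w" by (simp add: hecke_op_def)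
 thus ?thesis using hecke_eigenvalue(1)[OF n w] by (simp add: w_def)
qed

text \<open>As a combination of \<open>f\<close> and its reflection, a part inherits invariance,
  Hecke relations and differentiability. Its coefficients are those of \<open>f\<close>, so
  \<open>lam_bound\<close> carries over unchanged.\<close>

lemma rform_part:
 assumes cs: "cs = cos \<or> cs = sin"
 and eq: "!!z. Im z > 0 ==> complex_of_real (F z) = \<alpha> * (f z + \<beta> * f (- cnj z))"
 and F: "!!z. F z = (\<integral>n. cf (Im z) (int n) * cs (2 * pi * real n * Re z) \<partial>count_space {1..})"
 shows "rform cs u (%n. lam (int n)) F"
proof
 show "cs = cos \<or> cs = sin" by fact
 show "F (mob M z) = F z" if "M \<in> mats 1" "Im z > 0" for M z
 proof -
 have "complex_of_real (F (mob M z)) = complex_of_real (F z)"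
 using eq[OF Im_mob_pos[OF that(1) _ that(2)]] eq[OF that(2)] invariant[OF that] reflected_invariant[OF that] by (simp del: mob_simp)
 thus ?thesis by (simp only: of_real_eq_iff)
 qed
 show "F (Complex x y) = (\<integral>n. sqrt y * lam (int n) * Kb u (2 * pi * real n * y) * cs (2 * pi * real n * x) \<partial>count_space {1..})" for x y
 unfolding F by (simp add: cf_def)
 show "lam (int 1) = 1" using normalized by simp
 show "\<bar>lam (int n)\<bar> <= (real n)^2" if "n >= 1" for n by (rule lam_bound[OF that])
 show "(\<Sum>d | d dvd n. \<Sum>b<d. F ((of_nat (n div d) * z + of_nat b) / of_nat d)) = sqrt (real n) * lam (int n) * F z"
 if n: "n >= 1" and z: "Im z > 0" for n z
 proof -
 let ?w = "%d b. (of_nat (n div d) * z + of_nat b) / of_nat d"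
 have pt: "Im (?w d b) > 0" if "d dvd n" for d b
 proof -
 have "d > 0" "n div d > 0" using that n by (auto simp: dvd_div_eq_0_iff intro!: Nat.gr0I)
 thus ?thesis using z by (simp add: Im_divide_of_nat)
 qed
 have "complex_of_real (\<Sum>d | d dvd n. \<Sum>b<d. F (?w d b)) = (\<Sum>d | d dvd n. \<Sum>b<d. \<alpha> * (f (?w d b) + \<beta> * f (- cnj (?w d b))))"
 unfolding of_real_sum by (intro sum.cong refl eq pt) auto
 also have "... = \<alpha> * ((\<Sum>d | d dvd n. \<Sum>b<d. f (?w d b)) + \<beta> * (\<Sum>d | d dvd n. \<Sum>b<d. f (- cnj (?w d b))))"
 by (simp only: sum.distrib sum_distrib_left distrib_left)
 also have "(\<Sum>d | d dvd n. \<Sum>b<d. f (?w d b)) = of_real (sqrt (real n)) * (of_real (lam (int n)) * f z)"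
 using hecke_eigenvalue(1)[OF n z] n by (simp add: hecke_op_def field_simps)
 also have "(\<Sum>d | d dvd n. \<Sum>b<d. f (- cnj (?w d b))) = of_real (sqrt (real n)) * (of_real (lam (int n)) * f (- cnj z))"
 using hecke_op_reflected[OF n z] n by (simp only: hecke_op_def) (simp add: field_simps)
 also have "\<alpha> * (of_real (sqrt (real n)) * (of_real (lam (int n)) * f z) + \<beta> * (of_real (sqrt (real n)) * (of_real (lam (int n)) * f (- cnj z))))
 = of_real (sqrt (real n)) * of_real (lam (int n)) * (\<alpha> * (f z + \<beta> * f (- cnj z)))"
 by (simp add: algebra_simps)
 also have "... = complex_of_real (sqrt (real n) * lam (int n) * F z)" using eq[OF z] by simp
 finally show ?thesis by (simp only: of_real_eq_iff)
 qed
 show "F differentiable (at z)" if z: "Im z > 0" for z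
 proof -
 have op: "open upper_half_plane" and fd: "f differentiable_on upper_half_plane"
 using smooth unfolding smooth_on_open_def by (auto dest!: spec[of _ "[]"])
 have df: "f differentiable (at w)" if "Im w > 0" for w
 using fd op that by (auto simp: differentiable_on_eq_differentiable_at upper_half_plane_def)
 obtain D1 D0 where D1: "(f has_derivative D1) (at z)" and D0: "(f has_derivative D0) (at (- cnj z))"
 using df[of z] df[of "- cnj z"] z by (auto simp: differentiable_def)
 have "((%z. - cnj z) has_derivative (%h. - cnj h)) (at z)"
 by (intro has_derivative_minus bounded_linear_imp_has_derivative bounded_linear_cnj)
 from has_derivative_compose[OF this D0] obtain D2 where D2: "((%z. f (- cnj z)) has_derivative D2) (at z)" ..
 note D = D1 D2
 have dg: "((%z. Re (\<alpha> * (f z + \<beta> * f (- cnj z)))) has_derivative (%h. Re (\<alpha> * (D1 h + \<beta> * D2 h)))) (at z)"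
 by (intro has_derivative_Re has_derivative_mult_right has_derivative_add D)
 have "Re (\<alpha> * (f w + \<beta> * f (- cnj w))) = F w" if "w \<in> {z. Im z > 0}" for w
 using eq[of w] that by (metis Re_complex_of_real mem_Collect_eq)
 hence "(F has_derivative (%h. Re (\<alpha> * (D1 h + \<beta> * D2 h)))) (at z)"
 using has_derivative_transform_within_open[OF dg, of "{z. Im z > 0}" F] z by (simp add: open_halfspace_Im_gt)
 thus ?thesis by (rule differentiableI)
 qed
qed

text \<open>The cosine part enters \<open>f\<close> with the factor 1 + lam (- 1), so it can be
  solved for as soon as this factor is nonzero.\<close>

lemma rform_even: "lam (- 1) ~= - 1 ==> rform cos u (%n. lam (int n)) Cpart"
proof -
 assume a: "lam (- 1) ~= - 1"
 hence "1 + lam (- 1) ~= 0" by linarith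
 hence nz: "complex_of_real (1 + lam (- 1)) ~= 0" by (simp only: of_real_eq_0_iff not_False_eq_True)
 show ?thesis
 proof (rule rform_part[where \<alpha> = "1 / (2 * of_real (1 + lam (- 1)))" and \<beta> = 1])
 show "complex_of_real (Cpart z) = 1 / (2 * of_real (1 + lam (- 1))) * (f z + 1 * f (- cnj z))" if "Im z > 0" for z
 proof -
 have "c = 1 / (2 * e) * ((e * c + x) + 1 * (e * c - x))" if "e ~= 0" for c e x :: complex
 using that by simp
 from this[OF nz] show ?thesis
 unfolding form_parts[OF that] of_real_mult[of "1 + lam (- 1)" "Cpart z"] .
 qed
 qed (auto simp: Cpart_def)
qed

lemma rform_odd: "lam (- 1) ~= 1 ==> rform sin u (%n. lam (int n)) Spart"
proof -
 assume a: "lam (- 1) ~= 1"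
 hence "1 - lam (- 1) ~= 0" by linarith
 hence nz: "complex_of_real (1 - lam (- 1)) ~= 0" by (simp only: of_real_eq_0_iff not_False_eq_True)
 show ?thesis
 proof (rule rform_part[where \<alpha> = "1 / (2 * \<i> * of_real (1 - lam (- 1)))" and \<beta> = "- 1"])
 show "complex_of_real (Spart z) = 1 / (2 * \<i> * of_real (1 - lam (- 1))) * (f z + (- 1) * f (- cnj z))" if "Im z > 0" for z
 proof -
 have "c = 1 / (2 * \<i> * e) * ((x + \<i> * (e * c)) + (- 1) * (x - \<i> * (e * c)))" if "e ~= 0" for c e x :: complex
 using that by simp
 from this[OF nz] show ?thesis
 unfolding form_parts[OF that] of_real_mult[of "1 - lam (- 1)" "Spart z"] .
 qed
 qed (auto simp: Spart_def)
qed

end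

section \<open>Uniform series bounds and integrals over the strip\<close>

lemma power_exp_le_fact: "X >= 0 ==> X ^ k * exp (- X) <= fact k" for X :: real
proof -
 assume X: "X >= 0"
 have "(\<Sum>i\<in>{k}. X ^ i /\<^sub>R fact i) <= exp X"
 unfolding exp_def using X by (intro sum_le_suminf summable_exp_generic) (auto intro!: divide_nonneg_nonneg)
 hence "X ^ k <= fact k * exp X" by (simp add: field_simps)
 hence "X ^ k * exp (- X) <= fact k * exp X * exp (- X)" by (intro mult_right_mono) auto
 thus ?thesis by (simp add: mult.assoc flip: exp_add)
qed

lemma integrable_inverse_squares: "integrable (count_space {1..}) (%n::nat. 1 / (real n)^2)"
proof -
 have "summable (%n::nat. norm (indicator {1..} n *\<^sub>R (1 / (real n)^2)))"
 by (rule summable_comparison_test'[OF inverse_power_summable[of 2, where 'a = real]])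
 (auto simp: indicator_def inverse_eq_divide)
 hence "integrable (count_space UNIV) (%n::nat. indicator {1..} n *\<^sub>R (1 / (real n)^2))"
 by (simp add: integrable_count_space_nat_iff)
 thus ?thesis by (simp only: integral_count_space_indicator(2)[OF subset_UNIV])
qed

definition zeta2 :: real where "zeta2 = (\<integral>n. 1 / (real n)^2 \<partial>count_space {1..})"

lemma zeta2_nonneg: "zeta2 >= 0"
 unfolding zeta2_def by (intro integral_nonneg_AE) auto

text \<open>Two spare powers of n buy the convergent factor 1 / n^2, at the cost of a power of 1 /
  y.\<close>

lemma power_exp_inverse_square:
 fixes a y :: real
 assumes "a > 0" "y > 0" "n >= 1"
 shows "real n ^ j * exp (- (a * real n * y)) <= fact (j + 2) / (a * y) ^ (j + 2) * (1 / (real n)^2)"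
proof -
 have "(a * real n * y) ^ (j + 2) * exp (- (a * real n * y)) <= fact (j + 2)"
 using assms by (intro power_exp_le_fact) auto
 also have "(a * real n * y) ^ (j + 2) = (a * y) ^ (j + 2) * real n ^ j * (real n)^2"
 by (simp add: power_mult_distrib power_add power2_eq_square mult_ac)
 finally show ?thesis using assms by (simp add: field_simps)
qed

lemma exp_series:
 fixes a y :: real
 assumes "a > 0" "y > 0"
 shows "integrable (count_space {1..}) (%n. real n ^ j * exp (- (a * real n * y)))"
 and "(\<integral>n. real n ^ j * exp (- (a * real n * y)) \<partial>count_space {1..}) <= fact (j + 2) / (a * y) ^ (j + 2) * zeta2"
proof -
 let ?c = "fact (j + 2) / (a * y) ^ (j + 2)"
 have ic: "integrable (count_space {1..}) (%n. ?c * (1 / (real n)^2))"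
 by (intro integrable_mult_right integrable_inverse_squares)
 show i: "integrable (count_space {1..}) (%n. real n ^ j * exp (- (a * real n * y)))"
 proof (rule Bochner_Integration.integrable_bound[OF ic])
 show "AE n in count_space {1..}. norm (real n ^ j * exp (- (a * real n * y))) <= norm (?c * (1 / (real n)^2))"
 proof (rule AE_I2)
 fix n :: nat assume "n \<in> space (count_space {1..})"
 hence "real n ^ j * exp (- (a * real n * y)) <= ?c * (1 / (real n)^2)" by (intro power_exp_inverse_square assms) simp
 thus "norm (real n ^ j * exp (- (a * real n * y))) <= norm (?c * (1 / (real n)^2))"
 unfolding real_norm_def by (intro order_trans[OF _ abs_ge_self]) simp
 qed
 qed simp
 have "(\<integral>n. real n ^ j * exp (- (a * real n * y)) \<partial>count_space {1..}) <= (\<integral>n. ?c * (1 / (real n)^2) \<partial>count_space {1..})"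
 by (rule integral_mono[OF i ic]) (use power_exp_inverse_square[OF assms] in auto)
 thus "(\<integral>n. real n ^ j * exp (- (a * real n * y)) \<partial>count_space {1..}) <= ?c * zeta2"
 unfolding zeta2_def by (simp only: integral_mult_right_zero)
qed

text \<open>In the variable exp (- et) this is Euler's integral for Gamma k, finite for k >= 1. It
  enters through its finiteness, sign and scaling behaviour.\<close>

definition Eint :: "nat => real" where
 "Eint k = (\<integral>et. exp (- real k * et) * exp (- exp (- et)) \<partial>lborel)"

lemma Eint_base: "integrable lborel (%et::real. exp (- et) * exp (- exp (- et) / 2))"
proof -
 have "set_integrable lborel (einterval (-\<infinity>) \<infinity>) (%et::real. exp (- et) * exp (- exp (- et) / 2))"
 proof (rule interval_integral_FTC_nonneg(1)[where F = "%et. 2 * exp (- exp (- et) / 2)" and A = 0 and B = 2])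
 show "((%et. 2 * exp (- exp (- et) / 2)) has_real_derivative exp (- et) * exp (- exp (- et) / 2)) (at et)" for et :: real
 by (auto intro!: derivative_eq_intros)
 have "((%et::real. 2 * exp (- exp (- et) / 2)) \<longlongrightarrow> 0) at_bot" by real_asymp
 thus "(((%et::real. 2 * exp (- exp (- et) / 2)) \<circ> real_of_ereal) \<longlongrightarrow> 0) (at_right (- \<infinity>))"
 by (simp add: ereal_tendsto_simps)
 have "((%et::real. 2 * exp (- exp (- et) / 2)) \<longlongrightarrow> 2) at_top" by real_asymp
 thus "(((%et::real. 2 * exp (- exp (- et) / 2)) \<circ> real_of_ereal) \<longlongrightarrow> 2) (at_left \<infinity>)"
 by (simp add: ereal_tendsto_simps)
 qed (auto intro!: continuous_intros)
 thus ?thesis by (simp add: set_integrable_def)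
qed

lemma integrable_Eint:
 assumes k: "k >= 1" and a: "a > 0"
 shows "integrable lborel (%et::real. exp (- real k * et) * exp (- (a * exp (- et))))"
 and "(\<integral>et. exp (- real k * et) * exp (- (a * exp (- et))) \<partial>lborel) = Eint k / a ^ k"
proof -
 have i1: "integrable lborel (%et::real. exp (- real k * et) * exp (- exp (- et)))"
 proof (rule Bochner_Integration.integrable_bound)
 show "integrable lborel (%et::real. fact (k - 1) * 2 ^ (k - 1) * (exp (- et) * exp (- exp (- et) / 2)))"
 by (intro integrable_mult_right Eint_base)
 show "AE et in lborel. norm (exp (- real k * et) * exp (- exp (- et))) <= norm (fact (k - 1) * 2 ^ (k - 1) * (exp (- et) * exp (- exp (- et) / 2)))"
 proof (rule AE_I2)
 fix et :: real
 define X where "X = exp (- et)"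
 have X: "X > 0" by (simp add: X_def)
 have "exp (- real k * et) = X ^ k" by (simp add: X_def flip: exp_of_nat_mult)
 also have "... = X ^ (k - 1) * X" using k by (metis Suc_diff_1 Suc_le_eq One_nat_def power_Suc2)
 finally have "exp (- real k * et) * exp (- X) = X * (X ^ (k - 1) * exp (- (1 * X)))" by simp
 also have "... <= X * (fact (k - 1) * (2 / 1) ^ (k - 1) * exp (- (1 / 2 * X)))"
 using X by (intro mult_left_mono power_exp_le) auto
 finally show "norm (exp (- real k * et) * exp (- exp (- et))) <= norm (fact (k - 1) * 2 ^ (k - 1) * (exp (- et) * exp (- exp (- et) / 2)))"
 by (simp add: X_def mult_ac)
 qed
 qed auto
 have eq: "exp (- real k * et) * exp (- (a * exp (- et))) = a ^ k * 1 / a ^ k * (exp (- real k * et) * exp (- (a * exp (- et))))" for et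
 using a by simp
 have sh: "exp (- real k * (- ln a + 1 * et)) * exp (- exp (- (- ln a + 1 * et))) = a ^ k * (exp (- real k * et) * exp (- (a * exp (- et))))" for et
 proof -
 have "exp (- real k * (- ln a + 1 * et)) = exp (real k * ln a) * exp (- real k * et)" by (simp add: algebra_simps flip: exp_add)
 also have "exp (real k * ln a) = a ^ k" using a by (simp add: exp_of_nat_mult)
 finally have 1: "exp (- real k * (- ln a + 1 * et)) = a ^ k * exp (- real k * et)" .
 have "exp (- (- ln a + 1 * et)) = exp (ln a) * exp (- et)" by (simp flip: exp_add)
 hence 2: "exp (- (- ln a + 1 * et)) = a * exp (- et)" using a by simp
 show ?thesis unfolding 1 2 by simp
 qed
 have "integrable lborel (%et. a ^ k * (exp (- real k * et) * exp (- (a * exp (- et)))))"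
 using lborel_integrable_real_affine[OF i1, of 1 "- ln a"] unfolding sh by simp
 thus "integrable lborel (%et::real. exp (- real k * et) * exp (- (a * exp (- et))))"
 using a by (simp add: integrable_mult_left_iff)
 have "Eint k = a ^ k * (\<integral>et. exp (- real k * et) * exp (- (a * exp (- et))) \<partial>lborel)"
 unfolding Eint_def using lborel_integral_real_affine[of 1 "%et. exp (- real k * et) * exp (- exp (- et))" "- ln a"]
 unfolding sh by simp
 thus "(\<integral>et. exp (- real k * et) * exp (- (a * exp (- et))) \<partial>lborel) = Eint k / a ^ k" using a by simp
qed

lemma Eint_nonneg: "Eint k >= 0"
 unfolding Eint_def by (intro integral_nonneg_AE) auto

text \<open>With x = s exp et the invariant measure becomes exp (- et) dx d(et), and the strip
  becomes 0 <= x < 1.\<close>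

lemma nn_integral_strip:
 assumes [measurable]: "R \<in> borel_measurable borel"
 shows "(\<integral>\<^sup>+z. indicator strip z * R z \<partial>hyp) = (\<integral>\<^sup>+et. ennreal (exp (- et)) * (\<integral>\<^sup>+x. indicator {0..<1} x * R (Complex x (exp et)) \<partial>lborel) \<partial>lborel)"
proof -
 have [measurable]: "(%x. Complex x y) \<in> borel_measurable borel" for y
 unfolding Complex_eq by measurable
 have "(\<integral>\<^sup>+z. indicator strip z * R z \<partial>hyp) = (\<integral>\<^sup>+et. \<integral>\<^sup>+s. indicator strip (hpt s et) * R (hpt s et) \<partial>lborel \<partial>lborel)"
 by (rule nn_integral_hyp) measurable
 also have "... = (\<integral>\<^sup>+et. ennreal (exp (- et)) * (\<integral>\<^sup>+x. indicator {0..<1} x * R (Complex x (exp et)) \<partial>lborel) \<partial>lborel)"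
 proof (rule nn_integral_cong)
 fix et :: real
 have h: "hpt (0 + exp (- et) * x) et = Complex x (exp et)" for x
 by (simp add: hpt_def mult.assoc mult.commute[of x] flip: exp_add)
 have "(\<integral>\<^sup>+s. indicator strip (hpt s et) * R (hpt s et) \<partial>lborel) = ennreal \<bar>exp (- et)\<bar> * (\<integral>\<^sup>+x. indicator strip (hpt (0 + exp (- et) * x) et) * R (hpt (0 + exp (- et) * x) et) \<partial>lborel)"
 by (rule nn_integral_real_affine) auto
 also have "... = ennreal (exp (- et)) * (\<integral>\<^sup>+x. indicator {0..<1} x * R (Complex x (exp et)) \<partial>lborel)"
 unfolding h by (simp, intro arg_cong2[where f = "(*)"] nn_integral_cong refl) (auto simp: strip_def indicator_def)
 finally show "(\<integral>\<^sup>+s. indicator strip (hpt s et) * R (hpt s et) \<partial>lborel) = ennreal (exp (- et)) * (\<integral>\<^sup>+x. indicator {0..<1} x * R (Complex x (exp et)) \<partial>lborel)" .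
 qed
 finally show ?thesis .
qed

lemma integral_strip:
 fixes R :: "complex => real"
 assumes [measurable]: "R \<in> borel_measurable borel" and int: "integrable hyp (%z. indicator strip z * R z)"
 shows "(\<integral>z. indicator strip z * R z \<partial>hyp) = (\<integral>et. exp (- et) * (\<integral>x. indicator {0..<1} x * R (Complex x (exp et)) \<partial>lborel) \<partial>lborel)"
proof -
 let ?h = "%(s, et). hpt s et"
 have i: "integrable (lborel \<Otimes>\<^sub>M lborel) (%(s, et). indicator strip (hpt s et) * R (hpt s et))"
 using int unfolding hyp_def by (subst (asm) integrable_distr_eq) (auto simp: lborel_prod borel_prod[symmetric] case_prod_unfold)
 have "(\<integral>z. indicator strip z * R z \<partial>hyp) = (\<integral>p. (case p of (s, et) => indicator strip (hpt s et) * R (hpt s et)) \<partial>(lborel \<Otimes>\<^sub>M lborel))"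
 unfolding hyp_def by (subst integral_distr) (auto simp: lborel_prod borel_prod[symmetric] case_prod_unfold)
 also have "... = (\<integral>et. \<integral>s. indicator strip (hpt s et) * R (hpt s et) \<partial>lborel \<partial>lborel)"
 using lborel_pair.integral_snd[OF i] by simp
 also have "... = (\<integral>et. exp (- et) * (\<integral>x. indicator {0..<1} x * R (Complex x (exp et)) \<partial>lborel) \<partial>lborel)"
 proof (rule Bochner_Integration.integral_cong[OF refl])
 fix et :: real
 have h: "hpt (0 + exp (- et) * x) et = Complex x (exp et)" for x
 by (simp add: hpt_def mult.assoc mult.commute[of x] flip: exp_add)
 have "(\<integral>s. indicator strip (hpt s et) * R (hpt s et) \<partial>lborel) = \<bar>exp (- et)\<bar> *\<^sub>R (\<integral>x. indicator strip (hpt (0 + exp (- et) * x) et) * R (hpt (0 + exp (- et) * x) et) \<partial>lborel)"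
 by (rule lborel_integral_real_affine) simp
 also have "... = exp (- et) * (\<integral>x. indicator {0..<1} x * R (Complex x (exp et)) \<partial>lborel)"
 unfolding h by (simp, intro Bochner_Integration.integral_cong refl) (auto simp: strip_def indicator_def)
 finally show "(\<integral>s. indicator strip (hpt s et) * R (hpt s et) \<partial>lborel) = exp (- et) * (\<integral>x. indicator {0..<1} x * R (Complex x (exp et)) \<partial>lborel)" .
 qed
 finally show ?thesis .
qed

lemma integral_cos_period: "integral {0..1} (%x. cos (2 * pi * real_of_int n * x)) = (if n = 0 then 1 else 0)"
proof -
 have "(%x. cis (2 * pi * real_of_int n * x)) integrable_on {0..1}"
 by (intro integrable_continuous_interval continuous_intros)
 from integral_linear[OF this bounded_linear_Re] show ?thesis
 by (simp add: integral_cis_period comp_def)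
qed

text \<open>Product-to-sum formulas leave the frequencies n - m and n + m. The latter never vanishes
  for positive n and m, so cosines and sines have the same norm.\<close>

lemma trig_orthogonality:
 assumes cs: "cs = cos \<or> cs = sin" and nm: "n >= 1" "m >= 1"
 shows "integral {0..1} (%x. cs (2 * pi * real n * x) * cs (2 * pi * real m * x)) = (if n = m then 1/2 else 0)"
proof -
 define s :: real where "s = (if cs = cos then 1 else - 1)"
 have ne: "cos ~= (sin :: real => real)" by (metis cos_zero sin_zero zero_neq_one)
 have eq: "cs (2 * pi * real n * x) * cs (2 * pi * real m * x)
 = 1/2 * cos (2 * pi * real_of_int (int n - int m) * x) + s / 2 * cos (2 * pi * real_of_int (int n + int m) * x)" for x
 using cs ne by (auto simp: s_def cos_add cos_diff algebra_simps)
 have i: "(%x. c * cos (2 * pi * real_of_int k * x)) integrable_on {0..1}" for c and k :: int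
 by (intro integrable_continuous_interval continuous_intros)
 have "integral {0..1} (%x. cs (2 * pi * real n * x) * cs (2 * pi * real m * x))
 = 1/2 * integral {0..1} (%x. cos (2 * pi * real_of_int (int n - int m) * x)) + s / 2 * integral {0..1} (%x. cos (2 * pi * real_of_int (int n + int m) * x))"
 unfolding eq by (subst Henstock_Kurzweil_Integration.integral_add[OF i i]) (simp only: integral_mult_right)
 also have "... = (if n = m then 1/2 else 0)"
 unfolding integral_cos_period using nm by auto
 finally show ?thesis .
qed

text \<open>Orthogonality requires the same function \<open>cs\<close> in both series. Mixed parity
  is brought into this form later by differentiating a sine series, which gives a cosine
  series.\<close>

lemma parseval:
 fixes p q :: "nat => real"
 assumes cs: "cs = cos \<or> cs = sin"
 and p: "integrable (count_space {1..}) p" and q: "integrable (count_space {1..}) q"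
 shows "(\<integral>x. indicator {0..<1} x * ((\<integral>n. p n * cs (2 * pi * real n * x) \<partial>count_space {1..}) * (\<integral>m. q m * cs (2 * pi * real m * x) \<partial>count_space {1..})) \<partial>lborel)
 = (\<integral>n. p n * q n \<partial>count_space {1..}) / 2"
proof -
 let ?A = "{1::nat..}"
 have cs1: "\<bar>cs x\<bar> <= 1" for x using cs by auto
 have [measurable]: "cs \<in> borel_measurable borel" using cs by auto
 have csc: "continuous_on X (%x. cs (c * x))" for X c using cs by (auto intro!: continuous_intros)
 have sums: "integrable (count_space ?A) (%n. p n * cs (2 * pi * real n * x))" "integrable (count_space ?A) (%n. q n * cs (2 * pi * real n * x))" for x
 by (rule Bochner_Integration.integrable_bound[OF p] Bochner_Integration.integrable_bound[OF q]; auto simp: abs_mult intro!: mult_left_le cs1)+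
 define Q where "Q = (%x. \<integral>m. q m * cs (2 * pi * real m * x) \<partial>count_space ?A)"
 have Qm [measurable]: "Q \<in> borel_measurable borel" unfolding Q_def
 by (rule borel_measurable_integral_count_space) auto
 define q1 where "q1 = (\<integral>m. \<bar>q m\<bar> \<partial>count_space ?A)"
 have Qb: "\<bar>Q x\<bar> <= q1" for x
 proof -
 have "\<bar>Q x\<bar> <= (\<integral>m. \<bar>q m * cs (2 * pi * real m * x)\<bar> \<partial>count_space ?A)" unfolding Q_def by (rule integral_abs_bound)
 also have "... <= q1" unfolding q1_def
 by (rule integral_mono[OF integrable_abs[OF sums(2)] integrable_abs[OF q]]) (auto simp: abs_mult intro!: mult_left_le cs1)
 finally show ?thesis .
 qed
 have q10: "q1 >= 0" unfolding q1_def by (intro integral_nonneg_AE) auto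
 let ?f = "%n x. indicator {0..<1} x * (p n * cs (2 * pi * real n * x) * Q x)"
 have fin: "(\<integral>\<^sup>+n. \<integral>\<^sup>+x. norm (?f n x) \<partial>lborel \<partial>count_space ?A) < \<infinity>"
 proof -
 have "(\<integral>\<^sup>+x. norm (?f n x) \<partial>lborel) <= ennreal (\<bar>p n\<bar> * q1)" for n
 proof -
 have "(\<integral>\<^sup>+x. norm (?f n x) \<partial>lborel) <= (\<integral>\<^sup>+x. ennreal (\<bar>p n\<bar> * q1) * indicator {0..<1::real} x \<partial>lborel)"
 proof (rule nn_integral_mono)
 fix x :: real
 have "\<bar>p n\<bar> * \<bar>cs (2 * pi * real n * x)\<bar> * \<bar>Q x\<bar> <= \<bar>p n\<bar> * q1"
 using Qb[of x] cs1[of "2 * pi * real n * x"] by (intro mult_mono mult_left_le) auto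
 thus "ennreal (norm (?f n x)) <= ennreal (\<bar>p n\<bar> * q1) * indicator {0..<1} x"
 by (auto simp: indicator_def abs_mult intro!: ennreal_leI)
 qed
 also have "... = ennreal (\<bar>p n\<bar> * q1) * emeasure lborel {0..<1::real}" by (subst nn_integral_cmult_indicator) auto
 finally show ?thesis by simp
 qed
 hence "(\<integral>\<^sup>+n. \<integral>\<^sup>+x. norm (?f n x) \<partial>lborel \<partial>count_space ?A) <= (\<integral>\<^sup>+n. ennreal (\<bar>p n\<bar> * q1) \<partial>count_space ?A)"
 by (rule nn_integral_mono)
 also have "... < \<infinity>"
 proof -
 have "integrable (count_space ?A) (%n. \<bar>p n\<bar> * q1)" using p by (intro integrable_mult_left integrable_abs)
 from nn_integral_eq_integral[OF this] show ?thesis using q10 by simp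
 qed
 finally show ?thesis .
 qed
 have inner: "(\<integral>x. indicator {0..<1} x * (cs (2 * pi * real n * x) * Q x) \<partial>lborel) = q n / 2" if n: "n >= 1" for n
 proof -
 let ?g = "%m x. indicator {0..<1} x * (cs (2 * pi * real n * x) * (q m * cs (2 * pi * real m * x)))"
 have fin': "(\<integral>\<^sup>+m. \<integral>\<^sup>+x. norm (?g m x) \<partial>lborel \<partial>count_space ?A) < \<infinity>"
 proof -
 have "(\<integral>\<^sup>+x. norm (?g m x) \<partial>lborel) <= ennreal \<bar>q m\<bar>" for m
 proof -
 have "(\<integral>\<^sup>+x. norm (?g m x) \<partial>lborel) <= (\<integral>\<^sup>+x. ennreal \<bar>q m\<bar> * indicator {0..<1::real} x \<partial>lborel)"
 proof (rule nn_integral_mono)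
 fix x :: real
 have "\<bar>cs (2 * pi * real n * x)\<bar> * (\<bar>q m\<bar> * \<bar>cs (2 * pi * real m * x)\<bar>) <= 1 * \<bar>q m\<bar>"
 by (intro mult_mono mult_left_le cs1) auto
 thus "ennreal (norm (?g m x)) <= ennreal \<bar>q m\<bar> * indicator {0..<1} x"
 by (auto simp: indicator_def abs_mult intro!: ennreal_leI)
 qed
 also have "... = ennreal \<bar>q m\<bar> * emeasure lborel {0..<1::real}" by (subst nn_integral_cmult_indicator) auto
 finally show ?thesis by simp
 qed
 hence "(\<integral>\<^sup>+m. \<integral>\<^sup>+x. norm (?g m x) \<partial>lborel \<partial>count_space ?A) <= (\<integral>\<^sup>+m. ennreal \<bar>q m\<bar> \<partial>count_space ?A)"
 by (rule nn_integral_mono)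
 also have "... < \<infinity>" using q by (simp add: integrable_iff_bounded)
 finally show ?thesis .
 qed
 have "(\<integral>x. indicator {0..<1} x * (cs (2 * pi * real n * x) * Q x) \<partial>lborel) = (\<integral>x. \<integral>m. ?g m x \<partial>count_space ?A \<partial>lborel)"
 unfolding Q_def by simp
 also have "... = (\<integral>m. \<integral>x. ?g m x \<partial>lborel \<partial>count_space ?A)"
 by (rule integral_count_space_swap(3)[OF lborel.sigma_finite_measure_axioms _ _ fin']) auto
 also have "... = (\<integral>m. indicator {n} m *\<^sub>R (q n / 2) \<partial>count_space ?A)"
 proof (rule Bochner_Integration.integral_cong[OF refl])
 fix m assume "m \<in> space (count_space ?A)"
 hence m: "m >= 1" by simp
 have c: "continuous_on {0..1} (%x. q m * (cs (2 * pi * real n * x) * cs (2 * pi * real m * x)))"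
 by (intro continuous_intros csc)
 have "(\<integral>x. ?g m x \<partial>lborel) = integral {0..1} (%x. q m * (cs (2 * pi * real n * x) * cs (2 * pi * real m * x)))"
 unfolding integral_unit_interval(1)[OF c] by (simp add: mult_ac)
 also have "... = q m * (if n = m then 1/2 else 0)"
 by (simp only: integral_mult_right trig_orthogonality[OF cs n m])
 finally show "(\<integral>x. ?g m x \<partial>lborel) = indicator {n} m *\<^sub>R (q n / 2)" by (auto simp: indicator_def)
 qed
 also have "... = q n / 2" using n by (subst integral_count_space_indicator(1)) (auto simp: lebesgue_integral_count_space_finite)
 finally show ?thesis .
 qed
 have "(\<integral>x. indicator {0..<1} x * ((\<integral>n. p n * cs (2 * pi * real n * x) \<partial>count_space ?A) * Q x) \<partial>lborel)
 = (\<integral>x. \<integral>n. ?f n x \<partial>count_space ?A \<partial>lborel)" by simp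
 also have "... = (\<integral>n. \<integral>x. ?f n x \<partial>lborel \<partial>count_space ?A)"
 by (rule integral_count_space_swap(3)[OF lborel.sigma_finite_measure_axioms _ _ fin]) auto
 also have "... = (\<integral>n. p n * q n / 2 \<partial>count_space ?A)"
 proof (rule Bochner_Integration.integral_cong[OF refl])
 fix n assume "n \<in> space (count_space ?A)"
 hence n: "n >= 1" by simp
 have "(\<integral>x. ?f n x \<partial>lborel) = (\<integral>x. p n * (indicator {0..<1} x * (cs (2 * pi * real n * x) * Q x)) \<partial>lborel)"
 by (intro Bochner_Integration.integral_cong refl) (simp add: mult_ac)
 thus "(\<integral>x. ?f n x \<partial>lborel) = p n * q n / 2" by (simp only: integral_mult_right_zero inner[OF n] times_divide_eq_right)
 qed
 finally show ?thesis unfolding Q_def by simp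
qed

lemma Kint_measurable [measurable]: "Kint j u \<in> borel_measurable borel"
proof -
 have "(%y. \<integral>t. indicator {0..} t * (cosh t ^ j * exp (- (y * cosh t)) * cos (u * t)) \<partial>lborel) \<in> borel_measurable borel"
 by (rule lborel.borel_measurable_lebesgue_integral) measurable
 thus ?thesis by (simp add: Kint_def[abs_def])
qed

lemma integrable_mult_bounded:
 fixes p c :: "'a => real"
 assumes "integrable (count_space A) p" "!!n. \<bar>c n\<bar> <= 1"
 shows "integrable (count_space A) (%n. p n * c n)"
proof (rule Bochner_Integration.integrable_bound[OF assms(1)])
 show "AE n in count_space A. norm (p n * c n) <= norm (p n)"
 using assms(2) by (intro AE_I2) (simp add: abs_mult mult_left_le)
qed simp

section \<open>The differential of a real form\<close>

context rform
begin

definition T :: "nat => real => real" where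
 "T n y = sqrt y * lam n * Kb u (2 * pi * real n * y)"

definition T' :: "nat => real => real" where
 "T' n y = lam n * (Kb u (2 * pi * real n * y) / (2 * sqrt y) - sqrt y * (2 * pi * real n) * Kint 1 u (2 * pi * real n * y))"

definition cs' :: "real => real" where
 "cs' = (if cs = cos then (%x. - sin x) else cos)"

lemma sin_neq_cos: "sin ~= (cos :: real => real)"
 by (metis cos_zero sin_zero zero_neq_one)

lemma cs_deriv: "(cs has_real_derivative cs' x) (at x)"
 using cs sin_neq_cos by (auto simp: cs'_def intro!: derivative_eq_intros)

lemma abs_cs_le: "\<bar>cs x\<bar> <= 1" "\<bar>cs' x\<bar> <= 1"
 using cs by (auto simp: cs'_def)

lemma cs_measurable [measurable]: "cs \<in> borel_measurable borel" "cs' \<in> borel_measurable borel"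
 using cs by (auto simp: cs'_def)

lemma T_measurable [measurable]: "T n \<in> borel_measurable borel" "T' n \<in> borel_measurable borel"
 unfolding T_def[abs_def] T'_def[abs_def] by measurable

lemma F_series: "y > 0 ==> F (Complex x y) = (\<integral>n. T n y * cs (2 * pi * real n * x) \<partial>count_space {1..})"
 using fourier[of y x] by (simp add: T_def)

lemma T_bound:
 assumes y: "y > 0" and n: "n >= 1"
 shows "\<bar>T n y\<bar> <= real n ^ 2 * exp (- (2 * pi * real n * y))"
proof -
 have "sqrt y * \<bar>Kb u (2 * pi * real n * y)\<bar> <= sqrt y * (sqrt (2 * pi / (2 * pi * real n * y)) * exp (- (2 * pi * real n * y)))"
 using n y by (intro mult_left_mono Kb_bound) auto
 also have "... = sqrt (1 / real n) * exp (- (2 * pi * real n * y))"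
 using y n by (simp add: real_sqrt_divide real_sqrt_mult field_simps)
 also have "... <= 1 * exp (- (2 * pi * real n * y))" using n by (intro mult_right_mono) auto
 finally have K: "sqrt y * \<bar>Kb u (2 * pi * real n * y)\<bar> <= exp (- (2 * pi * real n * y))" by simp
 have "\<bar>T n y\<bar> = \<bar>lam n\<bar> * (sqrt y * \<bar>Kb u (2 * pi * real n * y)\<bar>)" using y by (simp add: T_def abs_mult)
 also have "... <= (real n)^2 * exp (- (2 * pi * real n * y))" using lam_le[OF n] K y by (intro mult_mono) auto
 finally show ?thesis .
qed

lemma T_deriv:
 assumes y: "y > 0" and n: "n >= 1"
 shows "(T n has_real_derivative T' n y) (at y)"
proof -
 have Y: "2 * pi * real n * y > 0" using y n by simp
 have "((%y. Kb u (2 * pi * real n * y)) has_real_derivative (- Kint (Suc 0) u (2 * pi * real n * y)) * (2 * pi * real n)) (at y)"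
 by (rule DERIV_chain2[where f = "Kb u" and g = "%y. 2 * pi * real n * y", OF Kint_has_derivative[OF Y]]) (auto intro!: derivative_eq_intros)
 thus ?thesis unfolding T_def[abs_def] T'_def
 using y by (auto intro!: derivative_eq_intros simp: field_simps)
qed

text \<open>The bound for \<open>Kint 1\<close> costs half of the exponent, hence pi in place of the
  2 pi of \<open>T_bound\<close>. Differentiation costs a factor 1 / y, the factor n from the inner
  derivative being offset by 1 / n in the Bessel bound.\<close>

lemma T'_bound:
 assumes y: "y > 0" and n: "n >= 1"
 shows "\<bar>T' n y\<bar> <= 4 / y * (real n ^ 2 * exp (- (pi * real n * y)))"
proof -
 define E where "E = exp (- (pi * real n * y))"
 have n1: "real n >= 1" using n by simp
 have Y: "2 * pi * real n * y > 0" using y n by simp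
 have sq: "sqrt y > 0" using y by simp
 have e1: "exp (- (2 * pi * real n * y)) <= E" using y n by (simp add: E_def)
 have "\<bar>Kb u (2 * pi * real n * y)\<bar> <= sqrt (1 / (real n * y)) * E"
 proof -
 have "2 * pi / (2 * pi * real n * y) = 1 / (real n * y)" by simp
 hence "\<bar>Kb u (2 * pi * real n * y)\<bar> <= sqrt (1 / (real n * y)) * exp (- (2 * pi * real n * y))"
 using Kb_bound[OF Y, of u] by (simp only:)
 also have "... <= sqrt (1 / (real n * y)) * E" using e1 y n1 by (intro mult_left_mono) auto
 finally show ?thesis .
 qed
 also have "... <= sqrt (1 / y) * E"
 using y n1 by (intro mult_right_mono real_sqrt_le_mono) (auto simp: E_def field_simps)
 finally have K0: "\<bar>Kb u (2 * pi * real n * y)\<bar> <= E / sqrt y" by (simp add: real_sqrt_divide)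
 have A: "\<bar>Kb u (2 * pi * real n * y) / (2 * sqrt y)\<bar> <= E / y"
 proof -
 have "\<bar>Kb u (2 * pi * real n * y) / (2 * sqrt y)\<bar> <= (E / sqrt y) / (2 * sqrt y)"
 proof -
 have "\<bar>Kb u (2 * pi * real n * y) / (2 * sqrt y)\<bar> = \<bar>Kb u (2 * pi * real n * y)\<bar> / (2 * sqrt y)" using sq by (simp add: abs_divide)
 also have "... <= (E / sqrt y) / (2 * sqrt y)" by (rule divide_right_mono[OF K0]) (use sq in simp)
 finally show ?thesis .
 qed
 also have "... = E / y / 2" using y by (simp add: field_simps)
 also have "... <= E / y"
 proof -
 have half: "x / 2 <= x" if "x >= 0" for x :: real using that by simp
 have "E / y >= 0" using y by (simp add: E_def)
 from half[OF this] show ?thesis .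
 qed
 finally show ?thesis .
 qed
 have "\<bar>Kint 1 u (2 * pi * real n * y)\<bar> <= 1 / (pi * real n * y) * (sqrt (2 / (real n * y)) * E)"
 using Kint_bound[OF Y, of 1 u] by (simp add: E_def mult_ac)
 also have "... <= 1 / (pi * real n * y) * ((3/2) / sqrt y * E)"
 proof (intro mult_left_mono mult_right_mono)
 have "sqrt (2 / (real n * y)) <= sqrt ((3/2)^2 / y)"
 proof (rule real_sqrt_le_mono)
 have "2 / (real n * y) <= 2 / y" using y n1 by (intro divide_left_mono) auto
 also have "... <= (3/2)^2 / y" using y by (intro divide_right_mono) (auto simp: power2_eq_square)
 finally show "2 / (real n * y) <= (3/2)^2 / y" .
 qed
 thus "sqrt (2 / (real n * y)) <= (3/2) / sqrt y" by (simp add: real_sqrt_divide)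
 qed (use y n in \<open>auto simp: E_def\<close>)
 finally have K1: "\<bar>Kint 1 u (2 * pi * real n * y)\<bar> <= 1 / (pi * real n * y) * ((3/2) / sqrt y * E)" .
 have B: "\<bar>sqrt y * (2 * pi * real n) * Kint 1 u (2 * pi * real n * y)\<bar> <= 3 * (E / y)"
 proof -
 have "\<bar>sqrt y * (2 * pi * real n) * Kint 1 u (2 * pi * real n * y)\<bar> = sqrt y * (2 * pi * real n) * \<bar>Kint 1 u (2 * pi * real n * y)\<bar>"
 using y by (simp add: abs_mult)
 also have "... <= sqrt y * (2 * pi * real n) * (1 / (pi * real n * y) * ((3/2) / sqrt y * E))"
 using K1 y by (intro mult_left_mono) auto
 also have "... = 3 * (E / y)" using y n by (simp add: field_simps)
 finally show ?thesis .
 qed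
 have "\<bar>T' n y\<bar> <= \<bar>lam n\<bar> * (E / y + 3 * (E / y))"
 unfolding T'_def abs_mult[of "lam n"] by (intro mult_left_mono order_trans[OF abs_triangle_ineq4 add_mono] A B) auto
 also have "... <= (real n)^2 * (4 * (E / y))" using lam_le[OF n] y by (intro mult_mono) (auto simp: E_def)
 finally show ?thesis by (simp add: E_def mult_ac)
qed

definition Fx :: "complex => real" where
 "Fx z = (\<integral>n. T n (Im z) * (2 * pi * real n) * cs' (2 * pi * real n * Re z) \<partial>count_space {1..})"

definition Fy :: "complex => real" where
 "Fy z = (\<integral>n. T' n (Im z) * cs (2 * pi * real n * Re z) \<partial>count_space {1..})"

lemma integrable_T: "y > 0 ==> integrable (count_space {1..}) (%n. T n y)"
 by (rule Bochner_Integration.integrable_bound[OF exp_series(1)[of "2 * pi" y 2]])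
 (use T_bound in \<open>auto intro!: AE_I2\<close>)

lemma integrable_Tn:
 assumes y: "y > 0"
 shows "integrable (count_space {1..}) (%n. T n y * (2 * pi * real n))"
proof (rule Bochner_Integration.integrable_bound[OF integrable_mult_right[OF exp_series(1)[of "2 * pi" y 3], of "2 * pi"]])
 show "AE n in count_space {1..}. norm (T n y * (2 * pi * real n)) <= norm (2 * pi * (real n ^ 3 * exp (- (2 * pi * real n * y))))"
 proof (rule AE_I2)
 fix n :: nat assume "n \<in> space (count_space {1..})"
 hence n: "n >= 1" by simp
 have "\<bar>T n y\<bar> * (2 * pi * real n) <= (real n ^ 2 * exp (- (2 * pi * real n * y))) * (2 * pi * real n)"
 using T_bound[OF y n] by (intro mult_right_mono) auto
 thus "norm (T n y * (2 * pi * real n)) <= norm (2 * pi * (real n ^ 3 * exp (- (2 * pi * real n * y))))"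
 by (simp add: abs_mult power2_eq_square power3_eq_cube mult_ac)
 qed
qed (use y in auto)

lemma integrable_T':
 assumes y: "y > 0"
 shows "integrable (count_space {1..}) (%n. T' n y)"
proof (rule Bochner_Integration.integrable_bound[OF integrable_mult_right[OF exp_series(1)[of pi y 2], of "4 / y"]])
 show "AE n in count_space {1..}. norm (T' n y) <= norm (4 / y * (real n ^ 2 * exp (- (pi * real n * y))))"
 proof (rule AE_I2)
 fix n :: nat assume "n \<in> space (count_space {1..})"
 hence n: "n >= 1" by simp
 show "norm (T' n y) <= norm (4 / y * (real n ^ 2 * exp (- (pi * real n * y))))"
 using T'_bound[OF y n] y by (simp add: abs_mult)
 qed
qed (use y in auto)

definition FB :: real where
 "FB = fact 4 / (2 * pi) ^ 4 * zeta2"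

text \<open>A crude power of 1 / Im z is enough, because the strip integrals carry a factor exp (- a
  / Im z).\<close>

lemma F_bound:
 assumes z: "Im z > 0"
 shows "\<bar>F z\<bar> <= FB / (Im z) ^ 4"
proof -
 define x y where "x = Re z" and "y = Im z"
 have y: "y > 0" and zc: "z = Complex x y" using z by (auto simp: x_def y_def)
 have "\<bar>F z\<bar> <= (\<integral>n. \<bar>T n y * cs (2 * pi * real n * x)\<bar> \<partial>count_space {1..})"
 unfolding zc F_series[OF y] by (rule integral_abs_bound)
 also have "... <= (\<integral>n. real n ^ 2 * exp (- (2 * pi * real n * y)) \<partial>count_space {1..})"
 proof (rule integral_mono)
 show "integrable (count_space {1..}) (%n. \<bar>T n y * cs (2 * pi * real n * x)\<bar>)"
 by (intro integrable_abs integrable_mult_bounded integrable_T y abs_cs_le)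
 show "integrable (count_space {1..}) (%n. real n ^ 2 * exp (- (2 * pi * real n * y)))"
 using exp_series(1)[of "2 * pi" y 2] y by simp
 fix n :: nat assume "n \<in> space (count_space {1..})"
 hence "\<bar>T n y\<bar> <= real n ^ 2 * exp (- (2 * pi * real n * y))" using T_bound[OF y, of n] by simp
 thus "\<bar>T n y * cs (2 * pi * real n * x)\<bar> <= real n ^ 2 * exp (- (2 * pi * real n * y))"
 unfolding abs_mult using abs_cs_le(1)[of "2 * pi * real n * x"] mult_left_le[of "\<bar>cs (2 * pi * real n * x)\<bar>" "\<bar>T n y\<bar>"] by linarith
 qed
 also have "... <= fact (2 + 2) / (2 * pi * y) ^ (2 + 2) * zeta2" using y by (intro exp_series(2)) auto
 also have "... = FB / (Im z) ^ 4" by (simp add: FB_def y_def power_mult_distrib)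
 finally show ?thesis .
qed

lemma F_bounded: "\<exists>B. \<forall>z. Im z > 0 --> \<bar>F z\<bar> <= B"
proof (intro exI allI impI)
 fix z assume z: "Im z > 0"
 obtain M where M: "M \<in> mats 1" "Im (mob M z) >= 1/2" using reduction[OF z] by blast
 have p: "Im (mob M z) > 0" using M(2) by linarith
 have "(1/2) ^ 4 <= Im (mob M z) ^ 4" using M(2) by (intro power_mono) auto
 hence "FB / Im (mob M z) ^ 4 <= FB / (1/2) ^ 4"
 using p zeta2_nonneg by (intro divide_left_mono) (auto simp: FB_def)
 thus "\<bar>F z\<bar> <= FB / (1/2) ^ 4" using F_bound[OF p] inv[OF M(1) z] by linarith
qed

lemma F_has_derivative_x:
 assumes y: "y > 0"
 shows "((%x. F (Complex x y)) has_real_derivative Fx (Complex x y)) (at x)"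
proof -
 have "((%x. \<integral>n. T n y * cs (2 * pi * real n * x) \<partial>count_space {1..}) has_real_derivative
 (\<integral>n. T n y * (2 * pi * real n) * cs' (2 * pi * real n * x) \<partial>count_space {1..})) (at x)"
 proof (rule has_real_derivative_integral(1)[where e = 1 and g = "%n. \<bar>T n y * (2 * pi * real n)\<bar>"])
 show "integrable (count_space {1..}) (%n. \<bar>T n y * (2 * pi * real n)\<bar>)"
 by (rule integrable_abs[OF integrable_Tn[OF y]])
 fix s assume "\<bar>s - x\<bar> < 1"
 show "integrable (count_space {1..}) (%n. T n y * cs (2 * pi * real n * s))"
 by (intro integrable_mult_bounded integrable_T y abs_cs_le)
 fix n :: nat
 have "((%s. cs (2 * pi * real n * s)) has_real_derivative cs' (2 * pi * real n * s) * (2 * pi * real n)) (at s)"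
 by (rule DERIV_chain2[OF cs_deriv]) (auto intro!: derivative_eq_intros)
 from DERIV_cmult[OF this, of "T n y"]
 show "((%s. T n y * cs (2 * pi * real n * s)) has_real_derivative T n y * (2 * pi * real n) * cs' (2 * pi * real n * s)) (at s)"
 by (simp add: mult_ac)
 show "\<bar>T n y * (2 * pi * real n) * cs' (2 * pi * real n * s)\<bar> <= \<bar>T n y * (2 * pi * real n)\<bar>"
 unfolding abs_mult[of "T n y * (2 * pi * real n)"] by (intro mult_left_le abs_cs_le) auto
 qed auto
 thus ?thesis using y by (simp add: Fx_def F_series)
qed

lemma F_has_derivative_y:
 assumes y: "y > 0"
 shows "((%y. F (Complex x y)) has_real_derivative Fy (Complex x y)) (at y)"
proof -
 have "((%y. \<integral>n. T n y * cs (2 * pi * real n * x) \<partial>count_space {1..}) has_real_derivative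
 (\<integral>n. T' n y * cs (2 * pi * real n * x) \<partial>count_space {1..})) (at y)"
 proof (rule has_real_derivative_integral(1)[where e = "y / 2" and g = "%n. 8 / y * (real n ^ 2 * exp (- (pi * real n * (y / 2))))"])
 show "integrable (count_space {1..}) (%n. 8 / y * (real n ^ 2 * exp (- (pi * real n * (y / 2)))))"
 using y by (intro integrable_mult_right exp_series) auto
 fix s assume s: "\<bar>s - y\<bar> < y / 2"
 hence s': "s > 0" "y / 2 <= s" using y by (auto simp: abs_if split: if_splits)
 show "integrable (count_space {1..}) (%n. T n s * cs (2 * pi * real n * x))"
 by (intro integrable_mult_bounded integrable_T s'(1) abs_cs_le)
 fix n :: nat assume "n \<in> space (count_space {1..})"
 hence n: "n >= 1" by simp
 show "((%s. T n s * cs (2 * pi * real n * x)) has_real_derivative T' n s * cs (2 * pi * real n * x)) (at s)"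
 by (rule DERIV_cmult_right[OF T_deriv[OF s'(1) n]])
 have "\<bar>T' n s * cs (2 * pi * real n * x)\<bar> <= \<bar>T' n s\<bar>" unfolding abs_mult by (intro mult_left_le abs_cs_le) auto
 also have "... <= 4 / s * (real n ^ 2 * exp (- (pi * real n * s)))" by (rule T'_bound[OF s'(1) n])
 also have "... <= 4 / (y / 2) * (real n ^ 2 * exp (- (pi * real n * (y / 2))))"
 using s' y by (intro mult_mono divide_left_mono) (auto intro!: mult_left_mono)
 finally show "\<bar>T' n s * cs (2 * pi * real n * x)\<bar> <= 8 / y * (real n ^ 2 * exp (- (pi * real n * (y / 2))))" by simp
 qed (use y in auto)
 hence "((%y. \<integral>n. T n y * cs (2 * pi * real n * x) \<partial>count_space {1..}) has_real_derivative Fy (Complex x y)) (at y)"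
 by (simp add: Fy_def)
 thus ?thesis
 by (rule has_field_derivative_transform_within_open[where S = "{0<..}"]) (use y in \<open>auto simp: F_series\<close>)
qed

text \<open>The series supply the partial derivatives; that these assemble into a total derivative
  comes from the differentiability demanded in the locale.\<close>

lemma F_has_derivative:
 assumes z: "Im z > 0"
 shows "(F has_derivative (%h. Fx z * Re h + Fy z * Im h)) (at z)"
proof -
 obtain D where D: "(F has_derivative D) (at z)" using differentiable[OF z] by (auto simp: differentiable_def)
 define x y where "x = Re z" and "y = Im z"
 have y: "y > 0" and zc: "z = Complex x y" using z by (auto simp: x_def y_def)
 have lin: "bounded_linear D" using D by (rule has_derivative_bounded_linear)
 have "((%s. F (Complex s y)) has_derivative (%h. D (of_real h))) (at x)"
 proof (rule has_derivative_compose[of "%s. Complex s y" "of_real" x UNIV F D, simplified])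
 show "((%s. Complex s y) has_derivative complex_of_real) (at x)"
 unfolding Complex_eq by (auto intro!: derivative_eq_intros)
 show "(F has_derivative D) (at (Complex x y))" using D zc by simp
 qed
 moreover have "(%h. D (of_real h)) = (*) (D 1)"
 using linear_scale[OF bounded_linear.linear[OF lin], of _ 1] by (auto simp: scaleR_conv_of_real mult.commute)
 ultimately have "((%s. F (Complex s y)) has_real_derivative D 1) (at x)" by (simp add: has_field_derivative_def)
 hence 1: "D 1 = Fx z" using F_has_derivative_x[OF y, of x] DERIV_unique zc by blast
 have "((%s. F (Complex x s)) has_derivative (%h. D (\<i> * of_real h))) (at y)"
 proof (rule has_derivative_compose[of "%s. Complex x s" "%h. \<i> * of_real h" y UNIV F D, simplified])
 show "(Complex x has_derivative (%h. \<i> * complex_of_real h)) (at y)"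
 unfolding Complex_eq[abs_def] by (auto intro!: derivative_eq_intros)
 show "(F has_derivative D) (at (Complex x y))" using D zc by simp
 qed
 moreover have "(%h. D (\<i> * of_real h)) = (*) (D \<i>)"
 using linear_scale[OF bounded_linear.linear[OF lin], of _ \<i>] by (auto simp: scaleR_conv_of_real mult.commute)
 ultimately have "((%s. F (Complex x s)) has_real_derivative D \<i>) (at y)" by (simp add: has_field_derivative_def)
 hence 2: "D \<i> = Fy z" using F_has_derivative_y[OF y, of x] DERIV_unique zc by blast
 have "D h = Fx z * Re h + Fy z * Im h" for h
 proof -
 have "h = Re h *\<^sub>R 1 + Im h *\<^sub>R \<i>" by (simp add: complex_eq_iff)
 hence "D h = D (Re h *\<^sub>R 1 + Im h *\<^sub>R \<i>)" by simp
 also have "... = Re h *\<^sub>R D 1 + Im h *\<^sub>R D \<i>"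
 using bounded_linear.linear[OF lin] by (simp only: linear_add linear_scale)
 finally show ?thesis by (simp add: 1 2)
 qed
 hence "D = (%h. Fx z * Re h + Fy z * Im h)" by auto
 thus ?thesis using D by simp
qed

text \<open>Twice the Wirtinger derivative of \<open>F\<close> in z: the weight two form through
  which the invariance of the differential of \<open>F\<close> is expressed.\<close>

definition dF :: "complex => complex" where
 "dF z = Complex (Fx z) (- Fy z)"

text \<open>The chain rule for F (M z) = F z with the complex derivative M' = (c z + d)^(-2); the
  directions 1 and i give the two real components.\<close>

lemma dF_weight:
 assumes M: "(a, b, c, d) \<in> mats 1" and z: "Im z > 0"
 shows "dF (mob (a, b, c, d) z) = (of_int c * z + of_int d)^2 * dF z"
proof -
 let ?m = "mob (a, b, c, d)"
 have nz: "of_int c * z + of_int d ~= 0" using mob_denom_nonzero[OF z] bottom_row_nonzero[OF M] by auto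
 define \<kappa> where "\<kappa> = 1 / (of_int c * z + of_int d)^2"
 have det: "of_int a * of_int d - of_int b * of_int c = (1 :: complex)"
 using M by (auto simp: mats_def simp flip: of_int_mult of_int_diff)
 have "(?m has_field_derivative \<kappa>) (at z)"
 proof -
 have "((%z. (of_int a * z + of_int b) / (of_int c * z + of_int d)) has_field_derivative
 (of_int a * (of_int c * z + of_int d) - (of_int a * z + of_int b) * of_int c) / ((of_int c * z + of_int d) * (of_int c * z + of_int d))) (at z)"
 using nz by (auto intro!: derivative_eq_intros)
 also have "of_int a * (of_int c * z + of_int d) - (of_int a * z + of_int b) * of_int c = of_int a * of_int d - of_int b * of_int c"
 by (simp add: algebra_simps)
 also have "... = 1" by (rule det)
 finally show ?thesis unfolding \<kappa>_def power2_eq_square by (simp add: mob_def)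
 qed
 hence dm: "(?m has_derivative (*) \<kappa>) (at z)" by (simp add: has_field_derivative_def)
 have pm: "Im (?m z) > 0" using Im_mob_pos[OF M _ z] by simp
 have "((%z. F (?m z)) has_derivative (%h. Fx (?m z) * Re (\<kappa> * h) + Fy (?m z) * Im (\<kappa> * h))) (at z)"
 using has_derivative_compose[OF dm F_has_derivative[OF pm]] .
 hence "(F has_derivative (%h. Fx (?m z) * Re (\<kappa> * h) + Fy (?m z) * Im (\<kappa> * h))) (at z)"
 using has_derivative_transform_within_open[of "%z. F (?m z)" _ z UNIV "{z. Im z > 0}" F] z inv[OF M]
 by (simp add: open_halfspace_Im_gt del: mob_simp)
 from has_derivative_unique[OF this F_has_derivative[OF z]]
 have eq: "Fx (?m z) * Re (\<kappa> * h) + Fy (?m z) * Im (\<kappa> * h) = Fx z * Re h + Fy z * Im h" for h by (rule fun_cong)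
 have "dF z = dF (?m z) * \<kappa>"
 using eq[of 1] eq[of \<i>] by (simp add: dF_def complex_eq_iff algebra_simps del: mob_simp)
 thus ?thesis using nz by (simp add: \<kappa>_def del: mob_simp)
qed

definition dFB :: real where
 "dFB = 2 * pi * (fact 5 / (2 * pi) ^ 5 * zeta2) + 4 * (fact 4 / pi ^ 4 * zeta2)"

lemma dF_bound:
 assumes z: "Im z > 0"
 shows "cmod (dF z) <= dFB / (Im z) ^ 5"
proof -
 define x y where "x = Re z" and "y = Im z"
 have y: "y > 0" and zc: "z = Complex x y" using z by (auto simp: x_def y_def)
 have "\<bar>Fx z\<bar> <= (\<integral>n. \<bar>T n y * (2 * pi * real n) * cs' (2 * pi * real n * x)\<bar> \<partial>count_space {1..})"
 unfolding Fx_def x_def y_def by (rule integral_abs_bound)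
 also have "... <= (\<integral>n. 2 * pi * (real n ^ 3 * exp (- (2 * pi * real n * y))) \<partial>count_space {1..})"
 proof (rule integral_mono)
 show "integrable (count_space {1..}) (%n. \<bar>T n y * (2 * pi * real n) * cs' (2 * pi * real n * x)\<bar>)"
 by (intro integrable_abs integrable_mult_bounded integrable_Tn y abs_cs_le)
 show "integrable (count_space {1..}) (%n. 2 * pi * (real n ^ 3 * exp (- (2 * pi * real n * y))))"
 using exp_series(1)[of "2 * pi" y 3] y by (intro integrable_mult_right) simp
 fix n :: nat assume "n \<in> space (count_space {1..})"
 hence n: "n >= 1" by simp
 have "\<bar>T n y\<bar> * (2 * pi * real n) * \<bar>cs' (2 * pi * real n * x)\<bar> <= (real n ^ 2 * exp (- (2 * pi * real n * y))) * (2 * pi * real n) * 1"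
 using T_bound[OF y n] abs_cs_le(2) by (intro mult_mono) auto
 thus "\<bar>T n y * (2 * pi * real n) * cs' (2 * pi * real n * x)\<bar> <= 2 * pi * (real n ^ 3 * exp (- (2 * pi * real n * y)))"
 by (simp add: abs_mult power2_eq_square power3_eq_cube mult_ac)
 qed
 also have "... <= 2 * pi * (fact (3 + 2) / (2 * pi * y) ^ (3 + 2) * zeta2)"
 unfolding integral_mult_right_zero using y by (intro mult_left_mono exp_series(2)) auto
 finally have X: "\<bar>Fx z\<bar> <= 2 * pi * (fact 5 / (2 * pi) ^ 5 * zeta2) / y ^ 5" by (simp add: power_mult_distrib)
 have "\<bar>Fy z\<bar> <= (\<integral>n. \<bar>T' n y * cs (2 * pi * real n * x)\<bar> \<partial>count_space {1..})"
 unfolding Fy_def x_def y_def by (rule integral_abs_bound)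
 also have "... <= (\<integral>n. 4 / y * (real n ^ 2 * exp (- (pi * real n * y))) \<partial>count_space {1..})"
 proof (rule integral_mono)
 show "integrable (count_space {1..}) (%n. \<bar>T' n y * cs (2 * pi * real n * x)\<bar>)"
 by (intro integrable_abs integrable_mult_bounded integrable_T' y abs_cs_le)
 show "integrable (count_space {1..}) (%n. 4 / y * (real n ^ 2 * exp (- (pi * real n * y))))"
 using exp_series(1)[of pi y 2] y by (intro integrable_mult_right) simp
 fix n :: nat assume "n \<in> space (count_space {1..})"
 hence n: "n >= 1" by simp
 have "\<bar>T' n y\<bar> * \<bar>cs (2 * pi * real n * x)\<bar> <= (4 / y * (real n ^ 2 * exp (- (pi * real n * y)))) * 1"
 using T'_bound[OF y n] abs_cs_le(1) y by (intro mult_mono) auto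
 thus "\<bar>T' n y * cs (2 * pi * real n * x)\<bar> <= 4 / y * (real n ^ 2 * exp (- (pi * real n * y)))" by (simp add: abs_mult)
 qed
 also have "... <= 4 / y * (fact (2 + 2) / (pi * y) ^ (2 + 2) * zeta2)"
 unfolding integral_mult_right_zero using y by (intro mult_left_mono exp_series(2)) auto
 also have "... = 4 * (fact 4 / pi ^ 4 * zeta2) / y ^ 5"
 using y by (simp add: power_mult_distrib power4_eq_xxxx power_numeral_reduce)
 finally have Y: "\<bar>Fy z\<bar> <= 4 * (fact 4 / pi ^ 4 * zeta2) / y ^ 5" .
 have "cmod (dF z) <= \<bar>Fx z\<bar> + \<bar>Fy z\<bar>" using cmod_le[of "dF z"] by (simp add: dF_def)
 also have "... <= dFB / y ^ 5" unfolding dFB_def add_divide_distrib by (rule add_mono[OF X Y])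
 finally show ?thesis by (simp add: y_def)
qed

lemma F_measurable [measurable]: "(%z. indicator {z. Im z > 0} z * F z) \<in> borel_measurable borel"
proof -
 have m: "(%z. \<integral>n. T n (Im z) * cs (2 * pi * real n * Re z) \<partial>count_space {1..}) \<in> borel_measurable borel"
 by (rule borel_measurable_integral_count_space) auto
 have eq: "indicator {z. Im z > 0} z * F z = indicator {z. Im z > 0} z * (\<integral>n. T n (Im z) * cs (2 * pi * real n * Re z) \<partial>count_space {1..})" for z
 using F_series[of "Im z" "Re z"] by (auto simp: indicator_def)
 show ?thesis unfolding eq using m by measurable
qed

lemma dF_measurable [measurable]: "dF \<in> borel_measurable borel"
proof -
 have [measurable]: "Fx \<in> borel_measurable borel" "Fy \<in> borel_measurable borel"
 unfolding Fx_def[abs_def] Fy_def[abs_def] by (rule borel_measurable_integral_count_space; measurable)+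
 show ?thesis unfolding dF_def[abs_def] Complex_eq by measurable
qed

end

section \<open>Strip sums and their functional equations\<close>

lemma nn_integral_strip_decay:
 fixes g :: "real => real" and h :: "complex => real"
 assumes [measurable]: "h \<in> borel_measurable borel" and a: "a > 0" and B: "B >= 0" and C: "C >= 0"
 and h: "!!z. Im z > 0 ==> \<bar>h z\<bar> <= B / (Im z) ^ k"
 shows "(\<integral>\<^sup>+z. norm (indicator strip z * (C * exp (- (a / Im z)) * h z)) \<partial>hyp) <= ennreal (C * B * Eint (k + 1) / a ^ (k + 1))"
proof -
 let ?R = "%z. ennreal (norm (C * exp (- (a / Im z)) * h z))"
 have "(\<integral>\<^sup>+z. norm (indicator strip z * (C * exp (- (a / Im z)) * h z)) \<partial>hyp) = (\<integral>\<^sup>+z. indicator strip z * ?R z \<partial>hyp)"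
 by (intro nn_integral_cong) (auto simp: indicator_def)
 also have "... = (\<integral>\<^sup>+et. ennreal (exp (- et)) * (\<integral>\<^sup>+x. indicator {0..<1} x * ?R (Complex x (exp et)) \<partial>lborel) \<partial>lborel)"
 by (rule nn_integral_strip) measurable
 also have "... <= (\<integral>\<^sup>+et. ennreal (C * B * (exp (- real (k + 1) * et) * exp (- (a * exp (- et))))) \<partial>lborel)"
 proof (rule nn_integral_mono)
 fix et :: real
 have R': "?R (Complex x (exp et)) <= ennreal (C * exp (- (a * exp (- et))) * (B * exp (- real k * et)))" for x
 proof (rule ennreal_leI)
 have "\<bar>h (Complex x (exp et))\<bar> <= B / exp et ^ k" using h[of "Complex x (exp et)"] by simp
 also have "... = B * exp (- real k * et)" by (simp add: exp_minus exp_of_nat_mult divide_inverse)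
 finally have "C * exp (- (a / exp et)) * \<bar>h (Complex x (exp et))\<bar> <= C * exp (- (a / exp et)) * (B * exp (- real k * et))"
 using C by (intro mult_left_mono) auto
 thus "norm (C * exp (- (a / Im (Complex x (exp et)))) * h (Complex x (exp et))) <= C * exp (- (a * exp (- et))) * (B * exp (- real k * et))"
 using C by (simp add: abs_mult exp_minus divide_inverse)
 qed
 have "(\<integral>\<^sup>+x. indicator {0..<1} x * ?R (Complex x (exp et)) \<partial>lborel) <= (\<integral>\<^sup>+x. ennreal (C * exp (- (a * exp (- et))) * (B * exp (- real k * et))) * indicator {0..<1::real} x \<partial>lborel)"
 proof (rule nn_integral_mono)
 fix x :: real
 have "indicator {0..<1} x * ?R (Complex x (exp et)) = ?R (Complex x (exp et)) * indicator {0..<1} x" by (rule mult.commute)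
 also have "... <= ennreal (C * exp (- (a * exp (- et))) * (B * exp (- real k * et))) * indicator {0..<1} x"
 by (rule mult_right_mono[OF R']) simp
 finally show "indicator {0..<1} x * ?R (Complex x (exp et)) <= ennreal (C * exp (- (a * exp (- et))) * (B * exp (- real k * et))) * indicator {0..<1} x" .
 qed
 also have "... = ennreal (C * exp (- (a * exp (- et))) * (B * exp (- real k * et)))"
 by (subst nn_integral_cmult_indicator) auto
 finally have "ennreal (exp (- et)) * (\<integral>\<^sup>+x. indicator {0..<1} x * ?R (Complex x (exp et)) \<partial>lborel)
 <= ennreal (exp (- et)) * ennreal (C * exp (- (a * exp (- et))) * (B * exp (- real k * et)))" by (rule mult_left_mono) simp
 also have "... = ennreal (exp (- et) * (C * exp (- (a * exp (- et))) * (B * exp (- real k * et))))"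
 using B C by (subst ennreal_mult[symmetric]) auto
 also have "exp (- et) * (C * exp (- (a * exp (- et))) * (B * exp (- real k * et))) = C * B * (exp (- real (k + 1) * et) * exp (- (a * exp (- et))))"
 proof -
 have "exp (- real (k + 1) * et) = exp (- et) * exp (- real k * et)" by (simp add: algebra_simps flip: exp_add)
 thus ?thesis by (simp only:) simp
 qed
 finally show "ennreal (exp (- et)) * (\<integral>\<^sup>+x. indicator {0..<1} x * ?R (Complex x (exp et)) \<partial>lborel) <= ennreal (C * B * (exp (- real (k + 1) * et) * exp (- (a * exp (- et)))))" .
 qed
 also have "... = ennreal (\<integral>et. C * B * (exp (- real (k + 1) * et) * exp (- (a * exp (- et)))) \<partial>lborel)"
 using B C by (intro nn_integral_eq_integral integrable_mult_right integrable_Eint a) auto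
 also have "... = ennreal (C * B * Eint (k + 1) / a ^ (k + 1))"
 unfolding integral_mult_right_zero integrable_Eint(2)[OF le_add2 a] by simp
 finally show ?thesis .
qed

lemma nn_integral_inverse_square_bound:
 assumes "!!m. m >= 1 ==> f m <= ennreal (C / (real m)^2)" "C >= 0"
 shows "(\<integral>\<^sup>+m. f m \<partial>count_space {1..}) < \<infinity>"
proof -
 have "(\<integral>\<^sup>+m. f m \<partial>count_space {1..}) <= (\<integral>\<^sup>+m. ennreal (C * (1 / (real m)^2)) \<partial>count_space {1..})"
 using assms by (intro nn_integral_mono) auto
 also have "... = ennreal (\<integral>m. C * (1 / (real m)^2) \<partial>count_space {1..})"
 using assms by (intro nn_integral_eq_integral integrable_mult_right integrable_inverse_squares) auto
 finally show ?thesis by (simp add: le_less_trans)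
qed

lemma power_ge_square: "m >= 1 ==> k >= 1 ==> (real m)^2 <= ((real m)^2) ^ k"
 by (rule self_le_power) auto

text \<open>The sum over m of the strip integrals of (pi t m^2)^e exp (- pi t m^2 / y) against a
  function whose integral over 0 <= x < 1 is \<open>w y\<close>. Exponent 0 serves invariant
  functions, exponent 1 forms of weight two.\<close>

definition strip_sum :: "nat => (real => real) => real => real" where
 "strip_sum e w t = (\<integral>m. \<integral>et. exp (- et) * ((pi * t * (real m)^2) ^ e * exp (- (pi * t * (real m)^2 / exp et)) * w (exp et)) \<partial>lborel \<partial>count_space {1..})"

text \<open>The integral over the height contributes (m^2)^(-(k + 1 - e)); since e <= 1 <= k this is
  at most 1 / m^2, which gives the absolute convergence that unfolding demands.\<close>

lemma strip_sum_unfold: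
 fixes h :: "complex => real" and \<phi> :: "complex => int \<times> int => real"
 assumes hm [measurable]: "h \<in> borel_measurable borel" and t: "t > 0" and e: "e <= 1"
 and h: "!!z. Im z > 0 ==> \<bar>h z\<bar> <= B / (Im z) ^ k" and B: "B >= 0" and k: "k >= 1"
 and eq: "!!z m M. Im z > 0 ==> m >= 1 ==> M \<in> mats 1 ==>
 (pi * t * (real m)^2) ^ e * exp (- (pi * t * (real m)^2 / Im (mob M z))) * h (mob M z) = \<phi> z (sc m M)"
 and m\<phi>: "!!p. (%z. \<phi> z p) \<in> borel_measurable borel"
 and \<phi>: "!!z. Im z > 0 ==> integrable (count_space (UNIV - {(0, 0)})) (\<phi> z)"
 shows "strip_sum e (%y. \<integral>x. indicator {0..<1} x * h (Complex x y) \<partial>lborel) t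
 = (\<integral>z. rho z * (\<integral>p. \<phi> z p \<partial>count_space (UNIV - {(0, 0)})) \<partial>hyp)"
 and "integrable hyp (%z. rho z * (\<integral>p. \<phi> z p \<partial>count_space (UNIV - {(0, 0)})))"
proof -
 define r where "r = (%m z. (pi * t * (real m)^2) ^ e * exp (- (pi * t * (real m)^2 / Im z)) * h z)"
 have r [measurable]: "r m \<in> borel_measurable borel" for m unfolding r_def by measurable
 define C where "C = B * Eint (k + 1) / (pi * t) ^ (k + 1 - e)"
 have C: "C >= 0" using B t Eint_nonneg by (simp add: C_def)
 have bd: "(\<integral>\<^sup>+z. norm (indicator strip z * r m z) \<partial>hyp) <= ennreal (C / (real m)^2)" if m: "m >= 1" for m
 proof -
 let ?a = "pi * t * (real m)^2"
 have a: "?a > 0" using t m by simp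
 have "(\<integral>\<^sup>+z. norm (indicator strip z * r m z) \<partial>hyp) <= ennreal (?a ^ e * B * Eint (k + 1) / ?a ^ (k + 1))"
 unfolding r_def using a B h by (intro nn_integral_strip_decay) auto
 also have "?a ^ e * B * Eint (k + 1) / ?a ^ (k + 1) = B * Eint (k + 1) / ?a ^ (k + 1 - e)"
 proof -
 have gen: "x ^ e * B * E / x ^ (k + 1) = B * E / x ^ (k + 1 - e)" if "x > 0" for x E :: real
 proof -
 have "x ^ (k + 1) = x ^ e * x ^ (k + 1 - e)" using e by (simp flip: power_add)
 thus ?thesis using that by (simp only: mult.assoc) simp
 qed
 show ?thesis by (rule gen[OF a])
 qed
 also have "... = C / ((real m)^2) ^ (k + 1 - e)" by (simp add: C_def power_mult_distrib)
 also have "... <= C / (real m)^2"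
 using C m e k by (intro divide_left_mono power_ge_square) auto
 finally show ?thesis by (simp add: ennreal_leI order_trans)
 qed
 have fin: "(\<integral>\<^sup>+m. \<integral>\<^sup>+z. norm (indicator strip z * r m z) \<partial>hyp \<partial>count_space {1..}) < \<infinity>"
 by (rule nn_integral_inverse_square_bound[OF bd C])
 have u: "(\<integral>m. \<integral>z. indicator strip z * r m z \<partial>hyp \<partial>count_space {1..}) = (\<integral>z. rho z * (\<integral>p. \<phi> z p \<partial>count_space (UNIV - {(0, 0)})) \<partial>hyp)"
 "integrable hyp (%z. rho z * (\<integral>p. \<phi> z p \<partial>count_space (UNIV - {(0, 0)})))"
 by (rule unfolding_identity[OF r _ m\<phi> \<phi> fin]; simp add: r_def eq del: mob_simp)+
 show "integrable hyp (%z. rho z * (\<integral>p. \<phi> z p \<partial>count_space (UNIV - {(0, 0)})))" by (rule u(2))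
 have "(\<integral>z. indicator strip z * r m z \<partial>hyp) = (\<integral>et. exp (- et) * ((pi * t * (real m)^2) ^ e * exp (- (pi * t * (real m)^2 / exp et)) * (\<integral>x. indicator {0..<1} x * h (Complex x (exp et)) \<partial>lborel)) \<partial>lborel)"
 if m: "m >= 1" for m
 proof -
 have "integrable hyp (%z. indicator strip z * r m z)"
 using bd[OF m] by (simp add: integrable_iff_bounded le_less_trans)
 note st = integral_strip[OF r this]
 have rin: "(\<integral>x. indicator {0..<1} x * r m (Complex x (exp et)) \<partial>lborel)
 = (pi * t * (real m)^2) ^ e * exp (- (pi * t * (real m)^2 / exp et)) * (\<integral>x. indicator {0..<1} x * h (Complex x (exp et)) \<partial>lborel)" for et
 proof -
 have "(\<integral>x. indicator {0..<1} x * r m (Complex x (exp et)) \<partial>lborel)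
 = (\<integral>x. ((pi * t * (real m)^2) ^ e * exp (- (pi * t * (real m)^2 / exp et))) * (indicator {0..<1} x * h (Complex x (exp et))) \<partial>lborel)"
 by (rule Bochner_Integration.integral_cong[OF refl]) (simp add: r_def)
 thus ?thesis by (simp only: integral_mult_right_zero)
 qed
 show ?thesis using st unfolding rin .
 qed
 thus "strip_sum e (%y. \<integral>x. indicator {0..<1} x * h (Complex x y) \<partial>lborel) t
 = (\<integral>z. rho z * (\<integral>p. \<phi> z p \<partial>count_space (UNIV - {(0, 0)})) \<partial>hyp)"
 unfolding strip_sum_def u(1)[symmetric] by (intro Bochner_Integration.integral_cong refl) auto
qed

lemma AE_hyp_integral_cong:
 fixes f g :: "complex => real"
 assumes "integrable hyp f" "integrable hyp g" "!!z. Im z > 0 ==> f z = g z"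
 shows "(\<integral>z. f z \<partial>hyp) = (\<integral>z. g z \<partial>hyp)"
proof (rule integral_cong_AE)
 show "AE z in hyp. f z = g z" using AE_hyp by eventually_elim (rule assms(3))
qed (use assms in auto)

text \<open>The nonzero pairs sum to theta - 1, so the equation of \<open>theta\<close> leaves the
  extra term 1 / t - 1 times the integral of rho h. Up to a constant that integral is the integral
  of \<open>h\<close> over the modular surface, and \<open>orth\<close> removes it.\<close>

lemma functional_equation_weight0:
 fixes h :: "complex => real"
 assumes hm [measurable]: "h \<in> borel_measurable borel" and t: "t > 0"
 and h: "!!z. Im z > 0 ==> \<bar>h z\<bar> <= B / (Im z) ^ k" and B: "B >= 0" and k: "k >= 1"
 and inv: "!!z M. Im z > 0 ==> M \<in> mats 1 ==> h (mob M z) = h z"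
 and bdd: "!!z. Im z > 0 ==> \<bar>h z\<bar> <= B'"
 and orth: "(\<integral>z. rho z * h z \<partial>hyp) = 0"
 shows "strip_sum 0 (%y. \<integral>x. indicator {0..<1} x * h (Complex x y) \<partial>lborel) t
 = strip_sum 0 (%y. \<integral>x. indicator {0..<1} x * h (Complex x y) \<partial>lborel) (1 / t) / t"
proof -
 let ?S = "strip_sum 0 (%y. \<integral>x. indicator {0..<1} x * h (Complex x y) \<partial>lborel)"
 let ?I = "%t z. rho z * (\<integral>p. exp (- (pi * t) * qform z p) * h z \<partial>count_space (UNIV - {(0, 0)}))"
 have U: "?S t = (\<integral>z. ?I t z \<partial>hyp) \<and> integrable hyp (?I t)" if t: "t > 0" for t
 proof -
 note * = strip_sum_unfold[where e = 0, OF hm t _ h B k]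
 have "(pi * t * (real m)^2) ^ 0 * exp (- (pi * t * (real m)^2 / Im (mob M z))) * h (mob M z) = exp (- (pi * t) * qform z (sc m M)) * h z"
 if "Im z > 0" "m >= 1" "M \<in> mats 1" for z m M
 proof -
 obtain a b c d where M: "M = (a, b, c, d)" by (cases M)
 have "(real m)^2 / Im (mob M z) = qform z (sc m M)"
 using inverse_Im_mob[of a b c d z m] that by (simp add: M sc_def del: mob_simp)
 hence "pi * t * (real m)^2 / Im (mob M z) = pi * t * qform z (sc m M)" by (simp add: times_divide_eq_right[symmetric] del: times_divide_eq_right mob_simp)
 thus ?thesis using inv[OF that(1,3)] by (simp del: mob_simp)
 qed
 moreover have "integrable (count_space (UNIV - {(0, 0)})) (%p. exp (- (pi * t) * qform z p) * h z)" if "Im z > 0" for z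
 using theta_minus_one(1)[OF that t] by (rule integrable_mult_left)
 ultimately show ?thesis using *[of "%z p. exp (- (pi * t) * qform z p) * h z"] by auto
 qed
 have irh: "integrable hyp (%z. rho z * h z)"
 proof (rule Bochner_Integration.integrable_bound[OF integrable_mult_right[OF rho_integrable, of B']])
 show "AE z in hyp. norm (rho z * h z) <= norm (B' * rho z)"
 using AE_hyp
 proof eventually_elim
 case (elim z)
 have "\<bar>h z\<bar> <= \<bar>B'\<bar>" using bdd[OF elim] by linarith
 hence "\<bar>h z\<bar> * \<bar>rho z\<bar> <= \<bar>B'\<bar> * \<bar>rho z\<bar>" by (rule mult_right_mono) simp
 thus ?case by (simp add: abs_mult mult.commute)
 qed
 qed measurable
 have "?S t = (\<integral>z. ?I t z \<partial>hyp)" using U[OF t] by blast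
 also have "... = (\<integral>z. ?I (1 / t) z / t + (1 / t - 1) * (rho z * h z) \<partial>hyp)"
 proof (rule AE_hyp_integral_cong)
 show "integrable hyp (?I t)" using U[OF t] by blast
 show "integrable hyp (%z. ?I (1 / t) z / t + (1 / t - 1) * (rho z * h z))"
 using U[of "1 / t"] t irh by (intro Bochner_Integration.integrable_add integrable_divide integrable_mult_right) auto
 fix z assume z: "Im z > 0"
 have Iv: "?I s z = rho z * ((theta s z - 1) * h z)" if "s > 0" for s
 using theta_minus_one(2)[OF z that] by (simp only: integral_mult_left_zero)
 have "1 / t > 0" using t by simp
 show "?I t z = ?I (1 / t) z / t + (1 / t - 1) * (rho z * h z)"
 unfolding Iv[OF t] Iv[OF \<open>1 / t > 0\<close>] theta_functional_equation[OF z t] using t by (simp add: field_simps)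
 qed
 also have "... = (\<integral>z. ?I (1 / t) z \<partial>hyp) / t + (1 / t - 1) * (\<integral>z. rho z * h z \<partial>hyp)"
 proof -
 have i: "integrable hyp (%z. ?I (1 / t) z / t)" "integrable hyp (%z. (1 / t - 1) * (rho z * h z))"
 using U[of "1 / t"] t irh by (auto intro!: integrable_divide integrable_mult_right)
 show ?thesis unfolding Bochner_Integration.integral_add[OF i] by (simp only: integral_divide_zero integral_mult_right_zero)
 qed
 also have "... = ?S (1 / t) / t" using U[of "1 / t"] t orth by simp
 finally show ?thesis .
qed

text \<open>The pair (0, 0) is absent from \<open>theta2\<close>, so nothing is left over, unlike in
  weight 0. The factor pi t in front of the summand turns the 1 / t^3 of \<open>theta2\<close> into
  1 / t.\<close>

lemma functional_equation_weight2:
 fixes \<Omega> :: "complex => complex"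
 assumes \<Omega>m [measurable]: "\<Omega> \<in> borel_measurable borel" and t: "t > 0"
 and \<Omega>: "!!z. Im z > 0 ==> cmod (\<Omega> z) <= B / (Im z) ^ k" and B: "B >= 0" and k: "k >= 1"
 and wt: "!!z a b c d. Im z > 0 ==> (a, b, c, d) \<in> mats 1 ==> \<Omega> (mob (a, b, c, d) z) = (of_int c * z + of_int d)^2 * \<Omega> z"
 shows "strip_sum 1 (%y. \<integral>x. indicator {0..<1} x * Re (\<Omega> (Complex x y)) \<partial>lborel) t
 = strip_sum 1 (%y. \<integral>x. indicator {0..<1} x * Re (\<Omega> (Complex x y)) \<partial>lborel) (1 / t) / t"
proof -
 let ?S = "strip_sum 1 (%y. \<integral>x. indicator {0..<1} x * Re (\<Omega> (Complex x y)) \<partial>lborel)"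
 let ?th = "%t z p. (of_int (fst p) * z + of_int (snd p))\<^sup>2 * complex_of_real (exp (- (pi * t) * qform z p))"
 let ?\<phi> = "%t z p. pi * t * Re (?th t z p * \<Omega> z)"
 let ?I = "%t z. rho z * (\<integral>p. ?\<phi> t z p \<partial>count_space (UNIV - {(0, 0)}))"
 have sub: "UNIV - {(0, 0)} \<subseteq> (UNIV :: (int \<times> int) set)" by simp
 have ith: "integrable (count_space (UNIV - {(0, 0)})) (?th t z)" if "Im z > 0" "t > 0" for t z
 proof -
 have "integrable (count_space UNIV) (%p. indicator (UNIV - {(0, 0)}) p *\<^sub>R ?th t z p)"
 by (rule Bochner_Integration.integrable_bound[OF integrable_theta2[OF that]]) (auto simp: indicator_def)
 thus ?thesis by (simp only: integral_count_space_indicator(2)[OF sub])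
 qed
 have vth: "(\<integral>p. ?th t z p \<partial>count_space (UNIV - {(0, 0)})) = theta2 t z" for t z
 proof -
 have "theta2 t z = (\<integral>p. indicator (UNIV - {(0, 0)}) p *\<^sub>R ?th t z p \<partial>count_space UNIV)"
 unfolding theta2_def by (intro Bochner_Integration.integral_cong refl) (auto simp: indicator_def)
 thus ?thesis by (simp only: integral_count_space_indicator(1)[OF sub])
 qed
 have val: "(\<integral>p. ?\<phi> t z p \<partial>count_space (UNIV - {(0, 0)})) = pi * t * Re (theta2 t z * \<Omega> z)" if "Im z > 0" "t > 0" for t z
 proof -
 have "(\<integral>p. Re (?th t z p * \<Omega> z) \<partial>count_space (UNIV - {(0, 0)})) = Re (\<integral>p. ?th t z p * \<Omega> z \<partial>count_space (UNIV - {(0, 0)}))"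
 by (rule integral_Re[OF integrable_mult_left[OF ith[OF that]]])
 also have "... = Re (theta2 t z * \<Omega> z)" by (simp only: integral_mult_left_zero vth)
 finally show ?thesis by (simp only: integral_mult_right_zero)
 qed
 have U: "?S t = (\<integral>z. ?I t z \<partial>hyp) \<and> integrable hyp (?I t)" if t: "t > 0" for t
 proof -
 have hm: "(%z. Re (\<Omega> z)) \<in> borel_measurable borel" by measurable
 have hb: "\<bar>Re (\<Omega> z)\<bar> <= B / Im z ^ k" if "Im z > 0" for z using \<Omega>[OF that] abs_Re_le_cmod[of "\<Omega> z"] by linarith
 note * = strip_sum_unfold[where e = 1, OF hm t _ hb B k]
 have "(pi * t * (real m)^2) ^ 1 * exp (- (pi * t * (real m)^2 / Im (mob M z))) * Re (\<Omega> (mob M z)) = ?\<phi> t z (sc m M)"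
 if "Im z > 0" "m >= 1" "M \<in> mats 1" for z m M
 proof -
 obtain a b c d where M: "M = (a, b, c, d)" by (cases M)
 have "(real m)^2 / Im (mob M z) = qform z (sc m M)"
 using inverse_Im_mob[of a b c d z m] that by (simp add: M sc_def del: mob_simp)
 hence q: "pi * t * (real m)^2 / Im (mob M z) = pi * t * qform z (sc m M)" by (simp add: times_divide_eq_right[symmetric] del: times_divide_eq_right mob_simp)
 have W: "\<Omega> (mob M z) = (of_int c * z + of_int d)^2 * \<Omega> z" using wt[of z a b c d] that by (simp add: M)
 have "of_int (fst (sc m M)) * z + of_int (snd (sc m M)) = of_nat m * (of_int c * z + of_int d)"
 by (simp add: sc_def M algebra_simps)
 hence th: "?th t z (sc m M) * \<Omega> z = complex_of_real ((real m)^2 * exp (- (pi * t * qform z (sc m M)))) * \<Omega> (mob M z)"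
 by (simp add: power_mult_distrib W mult_ac del: mob_simp)
 have "Re (?th t z (sc m M) * \<Omega> z) = (real m)^2 * exp (- (pi * t * qform z (sc m M))) * Re (\<Omega> (mob M z))"
 unfolding th by (simp only: times_complex.simps Re_complex_of_real Im_complex_of_real mult_zero_left diff_zero)
 thus ?thesis unfolding q by (simp only: power_one_right mult.assoc)
 qed
 moreover have "integrable (count_space (UNIV - {(0, 0)})) (?\<phi> t z)" if "Im z > 0" for z
 by (intro integrable_mult_right integrable_Re integrable_mult_left ith that t)
 ultimately show ?thesis using *[of "?\<phi> t"] by auto
 qed
 have "?S t = (\<integral>z. ?I t z \<partial>hyp)" using U[OF t] by blast
 also have "... = (\<integral>z. ?I (1 / t) z / t \<partial>hyp)"
 proof (rule AE_hyp_integral_cong)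
 show "integrable hyp (?I t)" using U[OF t] by blast
 show "integrable hyp (%z. ?I (1 / t) z / t)" using U[of "1 / t"] t by (intro integrable_divide) auto
 fix z assume z: "Im z > 0"
 have "theta2 t z * \<Omega> z = of_real (1 / t ^ 3) * (theta2 (1 / t) z * \<Omega> z)"
 using theta2_functional_equation[OF z t] by (simp add: divide_inverse mult_ac)
 hence "Re (theta2 t z * \<Omega> z) = 1 / t ^ 3 * Re (theta2 (1 / t) z * \<Omega> z)" by (simp only: times_complex.simps Re_complex_of_real Im_complex_of_real mult_zero_left diff_zero)
 thus "?I t z = ?I (1 / t) z / t"
 using t val[OF z t] val[OF z, of "1 / t"] by (simp add: power3_eq_cube)
 qed
 also have "... = ?S (1 / t) / t" using U[of "1 / t"] t by simp
 finally show ?thesis .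
qed

text \<open>Termwise integration: the bound on \<open>G\<close> provides 1 / n^2, the integral over
  the height 1 / m^2, so the double series converges absolutely.\<close>

lemma strip_sum_eval:
 fixes G :: "nat => real => real"
 assumes t: "t > 0" and e: "e <= 1" and k: "k >= 1" and C: "C >= 0"
 and w: "!!y. y > 0 ==> w y = (\<integral>n. G n y \<partial>count_space {1..})"
 and Gm [measurable]: "!!n. (%et. G n (exp et)) \<in> borel_measurable borel"
 and G: "!!n y. n >= 1 ==> y > 0 ==> \<bar>G n y\<bar> <= C / ((real n)^2 * y ^ k)"
 shows "strip_sum e w t = (\<integral>(m, n). (\<integral>et. exp (- et) * ((pi * t * (real m)^2) ^ e * exp (- (pi * t * (real m)^2 / exp et)) * G n (exp et)) \<partial>lborel) \<partial>count_space ({1..} \<times> {1..}))"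
proof -
 let ?g = "%m n et. exp (- et) * ((pi * t * (real m)^2) ^ e * exp (- (pi * t * (real m)^2 / exp et)) * G n (exp et))"
 define C' where "C' = C * Eint (k + 1) / (pi * t) ^ (k + 1 - e)"
 have C': "C' >= 0" using C t Eint_nonneg by (simp add: C'_def)
 have bd: "(\<integral>\<^sup>+et. norm (?g m n et) \<partial>lborel) <= ennreal (C' / (real m)^2 * (1 / (real n)^2))" if m: "m >= 1" and n: "n >= 1" for m n
 proof -
 define a where "a = pi * t * (real m)^2"
 have a: "a > 0" using t m by (simp add: a_def)
 have "(\<integral>\<^sup>+et. norm (?g m n et) \<partial>lborel) <= (\<integral>\<^sup>+et. ennreal (a ^ e * C / (real n)^2 * (exp (- real (k + 1) * et) * exp (- (a * exp (- et))))) \<partial>lborel)"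
 proof (intro nn_integral_mono ennreal_leI)
 fix et :: real
 have "\<bar>G n (exp et)\<bar> <= C / ((real n)^2 * exp et ^ k)" using G[OF n, of "exp et"] by simp
 also have "... = C / (real n)^2 * exp (- real k * et)" by (simp add: exp_minus exp_of_nat_mult divide_inverse)
 finally have "exp (- et) * (a ^ e * exp (- (a / exp et)) * \<bar>G n (exp et)\<bar>) <= exp (- et) * (a ^ e * exp (- (a / exp et)) * (C / (real n)^2 * exp (- real k * et)))"
 using a by (intro mult_left_mono) auto
 also have "... = a ^ e * C / (real n)^2 * ((exp (- et) * exp (- real k * et)) * exp (- (a * exp (- et))))"
 by (simp add: exp_minus divide_inverse)
 also have "exp (- et) * exp (- real k * et) = exp (- real (k + 1) * et)" by (simp add: algebra_simps flip: exp_add)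
 finally show "norm (?g m n et) <= a ^ e * C / (real n)^2 * (exp (- real (k + 1) * et) * exp (- (a * exp (- et))))"
 using a by (simp add: abs_mult a_def[symmetric])
 qed
 also have "... = ennreal (\<integral>et. a ^ e * C / (real n)^2 * (exp (- real (k + 1) * et) * exp (- (a * exp (- et)))) \<partial>lborel)"
 using a C by (intro nn_integral_eq_integral integrable_mult_right integrable_Eint) auto
 also have "... = ennreal (a ^ e * C / (real n)^2 * (Eint (k + 1) / a ^ (k + 1)))"
 unfolding integral_mult_right_zero integrable_Eint(2)[OF le_add2 a] ..
 also have "a ^ e * C / (real n)^2 * (Eint (k + 1) / a ^ (k + 1)) = C * Eint (k + 1) / a ^ (k + 1 - e) * (1 / (real n)^2)"
 proof -
 have "a ^ (k + 1) = a ^ e * a ^ (k + 1 - e)" using e by (simp flip: power_add)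
 thus ?thesis using a by (simp only:) simp
 qed
 also have "C * Eint (k + 1) / a ^ (k + 1 - e) = C' / ((real m)^2) ^ (k + 1 - e)" by (simp add: C'_def a_def power_mult_distrib)
 also have "ennreal (C' / ((real m)^2) ^ (k + 1 - e) * (1 / (real n)^2)) <= ennreal (C' / (real m)^2 * (1 / (real n)^2))"
 using C' m e k by (intro ennreal_leI mult_right_mono divide_left_mono power_ge_square) auto
 finally show ?thesis .
 qed
 have inner: "(\<integral>et. exp (- et) * ((pi * t * (real m)^2) ^ e * exp (- (pi * t * (real m)^2 / exp et)) * w (exp et)) \<partial>lborel)
 = (\<integral>n. \<integral>et. ?g m n et \<partial>lborel \<partial>count_space {1..})" if m: "m >= 1" for m
 proof -
 have "(\<integral>\<^sup>+n. \<integral>\<^sup>+et. norm (?g m n et) \<partial>lborel \<partial>count_space {1..}) < \<infinity>"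
 by (rule nn_integral_inverse_square_bound[where C = "C' / (real m)^2"]) (use bd[OF m] C' in auto)
 hence "(\<integral>et. \<integral>n. ?g m n et \<partial>count_space {1..} \<partial>lborel) = (\<integral>n. \<integral>et. ?g m n et \<partial>lborel \<partial>count_space {1..})"
 by (intro integral_count_space_swap(3)[OF lborel.sigma_finite_measure_axioms]) auto
 thus ?thesis by (simp add: w)
 qed
 have i: "integrable (count_space ({1..} \<times> {1..})) (%p. case p of (m, n) => \<integral>et. ?g m n et \<partial>lborel)"
 proof -
 have "(\<integral>\<^sup>+p. norm (case p of (m, n) => \<integral>et. ?g m n et \<partial>lborel) \<partial>count_space ({1..} \<times> {1..}))
 <= (\<integral>\<^sup>+p. ennreal (norm (case p of (m, n) => C' / (real m)^2 * (1 / (real n)^2))) \<partial>count_space ({1..} \<times> {1..}))"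
 proof (rule nn_integral_mono)
 fix p :: "nat \<times> nat" assume "p \<in> space (count_space ({1..} \<times> {1..}))"
 then obtain m n where p: "p = (m, n)" "m >= 1" "n >= 1" by (cases p) auto
 have "ennreal (norm (\<integral>et. ?g m n et \<partial>lborel)) <= (\<integral>\<^sup>+et. norm (?g m n et) \<partial>lborel)" by (rule norm_integral_le_nn_integral)
 also note bd[OF p(2,3)]
 finally show "ennreal (norm (case p of (m, n) => \<integral>et. ?g m n et \<partial>lborel)) <= ennreal (norm (case p of (m, n) => C' / (real m)^2 * (1 / (real n)^2)))"
 using C' by (simp add: p(1))
 qed
 also have "... < \<infinity>"
 proof -
 have "integrable (count_space UNIV) (%(m, n). (indicator {1..} m *\<^sub>R (C' / (real m)^2)) * (indicator {1..} n *\<^sub>R (1 / (real n)^2)))"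
 by (intro integrable_count_space_prod; subst integral_count_space_indicator(2)[OF subset_UNIV])
 (use integrable_inverse_squares integrable_mult_right[OF integrable_inverse_squares, of C'] in auto)
 also have "(%(m, n). (indicator {1..} m *\<^sub>R (C' / (real m)^2)) * (indicator {1..} n *\<^sub>R (1 / (real n)^2)))
 = (%p. indicator ({1..} \<times> {1..}) p *\<^sub>R (case p of (m, n) => C' / (real m)^2 * (1 / (real n)^2)))"
 by (auto simp: fun_eq_iff indicator_def)
 finally have "integrable (count_space ({1..} \<times> {1..})) (%p. case p of (m, n) => C' / (real m)^2 * (1 / (real n)^2))"
 by (simp only: integral_count_space_indicator(2)[OF subset_UNIV])
 thus ?thesis by (simp only: integrable_iff_bounded)
 qed
 finally show ?thesis by (simp add: integrable_iff_bounded)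
 qed
 have "strip_sum e w t = (\<integral>m. \<integral>n. \<integral>et. ?g m n et \<partial>lborel \<partial>count_space {1..} \<partial>count_space {1..})"
 unfolding strip_sum_def by (rule Bochner_Integration.integral_cong[OF refl]) (rule inner, simp)
 also have "... = (\<integral>p. (case p of (m, n) => \<integral>et. ?g m n et \<partial>lborel) \<partial>count_space ({1..} \<times> {1..}))"
 using integral_count_space_Times[OF _ _ i] by simp
 finally show ?thesis .
qed

section \<open>The kernel V in the logarithmic variable\<close>

text \<open>In the variable et = ln y the Bessel equation loses its first order term:
  \<open>KA\<close> has derivative \<open>KD\<close>, and \<open>KD\<close> has derivative (Y^2 -
  u^2) \<open>KA\<close>.\<close>

definition Yv :: "real => real" where "Yv et = 2 * pi * exp et"
definition KA :: "real => real => real" where "KA u et = Kb u (Yv et)"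
definition KD :: "real => real => real" where "KD u et = - Yv et * Kint 1 u (Yv et)"

lemma Yv_pos: "Yv et > 0" by (simp add: Yv_def)

lemma Yv_deriv: "(Yv has_real_derivative Yv et) (at et)"
 unfolding Yv_def[abs_def] by (auto intro!: derivative_eq_intros)

lemma KA_deriv: "(KA u has_real_derivative KD u et) (at et)"
proof -
 have "((%et. Kb u (Yv et)) has_real_derivative (- Kint (Suc 0) u (Yv et)) * Yv et) (at et)"
 by (rule DERIV_chain2[where f = "Kb u" and g = Yv, OF Kint_has_derivative[OF Yv_pos] Yv_deriv])
 thus ?thesis by (simp add: KA_def[abs_def] KD_def mult.commute)
qed

lemma KD_deriv: "(KD u has_real_derivative ((Yv et)^2 - u\<^sup>2) * KA u et) (at et)"
proof -
 have 1: "((%et. Kint 1 u (Yv et)) has_real_derivative (- Kint (Suc 1) u (Yv et)) * Yv et) (at et)"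
 by (rule DERIV_chain2[where f = "Kint 1 u" and g = Yv, OF Kint_has_derivative[OF Yv_pos] Yv_deriv])
 have "((%et. - (Yv et * Kint 1 u (Yv et))) has_real_derivative - (Yv et * Kint 1 u (Yv et) + (- Kint (Suc 1) u (Yv et)) * Yv et * Yv et)) (at et)"
 by (intro DERIV_minus DERIV_mult Yv_deriv 1)
 also have "- (Yv et * Kint 1 u (Yv et) + (- Kint (Suc 1) u (Yv et)) * Yv et * Yv et) = (Yv et)^2 * Kint 2 u (Yv et) - Yv et * Kint 1 u (Yv et)"
 by (simp add: power2_eq_square del: One_nat_def)
 also have "... = ((Yv et)^2 - u\<^sup>2) * KA u et" unfolding KA_def by (rule Kint_ode[OF Yv_pos])
 finally show ?thesis by (simp add: KD_def[abs_def])
qed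

lemma exp_half_square: "(exp (- et / 2))^2 = exp (- et)" for et :: real
proof -
 have "(exp (- et / 2))^2 = exp (- et / 2 + - et / 2)" by (simp only: power2_eq_square exp_add)
 thus ?thesis by simp
qed

lemma exp_neg_eq_Yv: "exp (- et) = 2 * pi / Yv et"
 by (simp add: Yv_def exp_minus field_simps)

lemma KA_bound: "\<bar>KA u et\<bar> <= exp (- et / 2) * exp (- Yv et)"
proof -
 have "sqrt (2 * pi / Yv et) = exp (- et / 2)"
 proof (rule real_sqrt_unique)
 show "(exp (- et / 2))^2 = 2 * pi / Yv et" by (simp only: exp_half_square exp_neg_eq_Yv)
 qed simp
 thus ?thesis using Kb_bound[OF Yv_pos, of u et] by (simp add: KA_def)
qed

lemma KD_bound: "\<bar>KD u et\<bar> <= 3 * (exp (- et / 2) * exp (- Yv et / 2))"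
proof -
 have sq: "sqrt (4 * pi / Yv et) <= 3 / 2 * exp (- et / 2)"
 proof (rule real_le_lsqrt)
 have "(3 / 2 * exp (- et / 2))^2 = 9 / 4 * exp (- et)"
 unfolding power_mult_distrib exp_half_square by (simp add: power2_eq_square)
 moreover have "4 * pi / Yv et = 2 * exp (- et)" by (simp only: exp_neg_eq_Yv)
 moreover have "2 * exp (- et) <= 9 / 4 * exp (- et)" by (intro mult_right_mono) auto
 ultimately show "4 * pi / Yv et <= (3 / 2 * exp (- et / 2))^2" by linarith
 qed (use Yv_pos[of et] in auto)
 have "\<bar>KD u et\<bar> = Yv et * \<bar>Kint 1 u (Yv et)\<bar>" using Yv_pos[of et] by (simp add: KD_def abs_mult)
 also have "... <= Yv et * (fact 1 * (2 / Yv et) ^ 1 * (sqrt (4 * pi / Yv et) * exp (- (Yv et / 2))))"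
 using Yv_pos[of et] by (intro mult_left_mono Kint_bound) auto
 also have "... = 2 * (sqrt (4 * pi / Yv et) * exp (- (Yv et / 2)))" using Yv_pos[of et] by simp
 also have "... <= 2 * (3 / 2 * exp (- et / 2) * exp (- (Yv et / 2)))" using sq by (intro mult_left_mono mult_right_mono) auto
 finally show ?thesis by simp
qed

lemma KAKD_measurable [measurable]: "KA u \<in> borel_measurable borel" "KD u \<in> borel_measurable borel" "Yv \<in> borel_measurable borel"
 unfolding KA_def[abs_def] KD_def[abs_def] Yv_def[abs_def] by measurable

lemma exp_Yv_le_1: "exp (- Yv et) <= 1" "exp (- Yv et / 2) <= 1"
 using Yv_pos[of et] by auto

lemma KAKA_bound: "\<bar>KA u et * KA v et\<bar> <= exp (- et) * exp (- 2 * Yv et)"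
proof -
 have "\<bar>KA u et * KA v et\<bar> <= (exp (- et / 2) * exp (- Yv et)) * (exp (- et / 2) * exp (- Yv et))"
 unfolding abs_mult by (intro mult_mono KA_bound) auto
 also have "... = (exp (- et / 2))^2 * (exp (- Yv et))^2" by (simp only: power2_eq_square mult_ac)
 also have "... = exp (- et) * exp (- 2 * Yv et)" unfolding exp_half_square by (simp add: power2_eq_square flip: exp_add)
 finally show ?thesis .
qed

lemma KDKA_bound: "\<bar>KD u et * KA v et\<bar> <= 3 * exp (- et)"
proof -
 have "\<bar>KD u et * KA v et\<bar> <= (3 * (exp (- et / 2) * 1)) * (exp (- et / 2) * 1)"
 unfolding abs_mult using exp_Yv_le_1[of et]
 by (intro mult_mono order_trans[OF KD_bound] order_trans[OF KA_bound] mult_left_mono) auto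
 also have "... = 3 * (exp (- et / 2))^2" by (simp only: power2_eq_square mult_1_right mult.assoc)
 also have "... = 3 * exp (- et)" unfolding exp_half_square ..
 finally show ?thesis .
qed

text \<open>In y = exp et this is the integral of exp (- pi a / y) K_iu(2 pi y) K_iv(2 pi y) dy / y.
  Its Mellin transform in a is, up to elementary factors, the product of the four Gamma ((s +- i u
  +- i v) / 2), the archimedean factor of the Rankin-Selberg L-function.\<close>

definition VV :: "real => real => real => real" where
 "VV u v a = (\<integral>et. exp (- (pi * a * exp (- et))) * (KA u et * KA v et) \<partial>lborel)"

lemma integrable_VV:
 assumes a: "a > 0"
 shows "integrable lborel (%et. exp (- (pi * a * exp (- et))) * (KA u et * KA v et))"
proof (rule Bochner_Integration.integrable_bound[OF integrable_Eint(1)[of 1 "pi * a"]])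
 show "AE et in lborel. norm (exp (- (pi * a * exp (- et))) * (KA u et * KA v et)) <= norm (exp (- real 1 * et) * exp (- (pi * a * exp (- et))))"
 proof (rule AE_I2)
 fix et
 have "\<bar>KA u et * KA v et\<bar> <= exp (- et) * 1"
 using Yv_pos[of et] by (intro order_trans[OF KAKA_bound] mult_left_mono) auto
 hence "exp (- (pi * a * exp (- et))) * \<bar>KA u et * KA v et\<bar> <= exp (- (pi * a * exp (- et))) * (exp (- et) * 1)" by (intro mult_left_mono) auto
 thus "norm (exp (- (pi * a * exp (- et))) * (KA u et * KA v et)) <= norm (exp (- real 1 * et) * exp (- (pi * a * exp (- et))))"
 by (simp add: abs_mult mult.commute)
 qed
qed (use a in auto)

text \<open>The Wronskian of the two Bessel functions has derivative (v^2 - u^2) K_iu K_iv; one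
  integration by parts takes the derivative off the exponential. Thus the weight two construction
  for equal parity reproduces V, with a factor that degenerates when u^2 = v^2.\<close>

lemma VV_wronskian:
 assumes a: "a > 0"
 shows "(\<integral>et. pi * a * exp (- et) * exp (- (pi * a * exp (- et))) * (KA v et * KD u et - KA u et * KD v et) \<partial>lborel) = (u^2 - v\<^sup>2) * VV u v a"
 (is "?L = _")
proof -
 define b where "b = pi * a"
 have b: "b > 0" using a by (simp add: b_def)
 let ?W = "%et. KA v et * KD u et - KA u et * KD v et"
 let ?Z = "%et. exp (- (b * exp (- et))) * ?W et"
 let ?f1 = "%et. b * exp (- et) * exp (- (b * exp (- et))) * ?W et"
 let ?f2 = "%et. exp (- (b * exp (- et))) * (KA u et * KA v et)"
 have Wb: "\<bar>?W et\<bar> <= 6 * exp (- et)" for et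
 using KDKA_bound[of u et v] KDKA_bound[of v et u] abs_triangle_ineq4[of "KA v et * KD u et" "KA u et * KD v et"]
 by (simp add: mult.commute)
 have cKA: "continuous_on UNIV (KA u)" "continuous_on UNIV (KD u)" for u
 using KA_deriv KD_deriv by (auto intro!: DERIV_continuous_on[of UNIV] intro: has_field_derivative_at_within)
 have i1: "integrable lborel ?f1"
 proof (rule Bochner_Integration.integrable_bound[OF integrable_mult_right[OF integrable_Eint(1)[of 2 b], of "6 * b"]])
 show "AE et in lborel. norm (?f1 et) <= norm (6 * b * (exp (- real 2 * et) * exp (- (b * exp (- et)))))"
 proof (rule AE_I2)
 fix et
 have "norm (?f1 et) = b * exp (- et) * exp (- (b * exp (- et))) * \<bar>?W et\<bar>" using b by (simp add: abs_mult)
 also have "... <= b * exp (- et) * exp (- (b * exp (- et))) * (6 * exp (- et))" using b Wb by (intro mult_left_mono) auto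
 also have "... = 6 * b * ((exp (- et) * exp (- et)) * exp (- (b * exp (- et))))" by simp
 also have "exp (- et) * exp (- et) = exp (- real 2 * et)" by (simp flip: exp_add)
 finally show "norm (?f1 et) <= norm (6 * b * (exp (- real 2 * et) * exp (- (b * exp (- et)))))" using b by (simp add: abs_mult)
 qed
 qed (use b in auto)
 have i2: "integrable lborel ?f2" using integrable_VV[OF a, of u v] by (simp add: b_def)
 have "(\<integral>et. ?f1 et + (v^2 - u\<^sup>2) * ?f2 et \<partial>lborel) = 0"
 proof (rule integral_FTC_whole_line[where F = ?Z])
 show "(?Z has_real_derivative ?f1 et + (v^2 - u\<^sup>2) * ?f2 et) (at et)" for et
 by (auto intro!: derivative_eq_intros KA_deriv KD_deriv simp: algebra_simps)
 show "continuous_on UNIV (%et. ?f1 et + (v^2 - u\<^sup>2) * ?f2 et)" by (intro continuous_intros cKA)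
 show "integrable lborel (%et. ?f1 et + (v^2 - u\<^sup>2) * ?f2 et)"
 by (intro Bochner_Integration.integrable_add integrable_mult_right i1 i2)
 have nb: "norm (?Z et) <= exp (- (b * exp (- et))) * (6 * exp (- et))" for et
 using Wb[of et] by (simp add: abs_mult mult_left_mono)
 have l1: "((%et::real. exp (- (b * exp (- et))) * (6 * exp (- et))) \<longlongrightarrow> 0) at_bot" using b by real_asymp
 have l2: "((%et::real. exp (- (b * exp (- et))) * (6 * exp (- et))) \<longlongrightarrow> 0) at_top" using b by real_asymp
 show "(?Z \<longlongrightarrow> 0) at_bot" by (rule Lim_null_comparison[OF always_eventually[OF allI[OF nb]] l1])
 show "(?Z \<longlongrightarrow> 0) at_top" by (rule Lim_null_comparison[OF always_eventually[OF allI[OF nb]] l2])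
 qed
 hence "(\<integral>et. ?f1 et \<partial>lborel) + (v^2 - u\<^sup>2) * (\<integral>et. ?f2 et \<partial>lborel) = 0"
 unfolding Bochner_Integration.integral_add[OF i1 integrable_mult_right[OF i2]] integral_mult_right_zero .
 moreover have "(\<integral>et. ?f2 et \<partial>lborel) = VV u v a" by (simp add: VV_def b_def)
 moreover have "?L = (\<integral>et. ?f1 et \<partial>lborel)" by (simp add: b_def)
 ultimately show ?thesis by (simp add: algebra_simps)
qed

text \<open>Summing over m^2 n instead of n writes out the factor zeta (2 s) of the Rankin-Selberg
  L-function; \<open>e\<close> records the extra power that weight two with mixed parity
  produces.\<close>

definition Ssum :: "real => real => (nat => real) => nat => real => real" where
 "Ssum u v L e t = (\<integral>(m, n). L n * (real (m^2 * n)) ^ e * VV u v (t * real (m^2 * n)) \<partial>count_space ({1..} \<times> {1..}))"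

lemma KA_shift: "n >= 1 ==> Kb u (2 * pi * real n * exp et) = KA u (ln (real n) + et)"
 by (simp add: KA_def Yv_def exp_add mult.assoc)

lemma KD_shift: "n >= 1 ==> 2 * pi * real n * exp et * Kint 1 u (2 * pi * real n * exp et) = - KD u (ln (real n) + et)"
 by (simp add: KD_def Yv_def exp_add mult.assoc)

lemma integral_shift: "(\<integral>et. f (c + et) \<partial>lborel) = (\<integral>et. f et \<partial>lborel)" for f :: "real => real"
 using lborel_integral_real_affine[of 1 f c] by simp

text \<open>Translating \<open>et\<close> by ln n scales n out of the Bessel functions and merges it
  with t m^2 into a single argument.\<close>

lemma VV_shift:
 assumes "n >= 1"
 shows "(\<integral>et. exp (- (pi * t * (real m)^2 / exp et)) * (Kb u (2 * pi * real n * exp et) * Kb v (2 * pi * real n * exp et)) \<partial>lborel) = VV u v (t * real (m^2 * n))"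
proof -
 let ?f = "%et. exp (- (pi * (t * real (m^2 * n)) * exp (- et))) * (KA u et * KA v et)"
 have "(\<integral>et. exp (- (pi * t * (real m)^2 / exp et)) * (Kb u (2 * pi * real n * exp et) * Kb v (2 * pi * real n * exp et)) \<partial>lborel)
 = (\<integral>et. ?f (ln (real n) + et) \<partial>lborel)"
 proof (rule Bochner_Integration.integral_cong[OF refl])
 fix et
 have "pi * (t * real (m^2 * n)) * exp (- (ln (real n) + et)) = pi * t * (real m)^2 / exp et"
 using assms by (simp add: exp_diff exp_minus field_simps)
 thus "exp (- (pi * t * (real m)^2 / exp et)) * (Kb u (2 * pi * real n * exp et) * Kb v (2 * pi * real n * exp et)) = ?f (ln (real n) + et)"
 unfolding KA_shift[OF assms] by simp
 qed
 also have "... = VV u v (t * real (m^2 * n))" unfolding VV_def by (rule integral_shift)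
 finally show ?thesis .
qed

section \<open>Strip sums of pairs of forms\<close>

context rform
begin

text \<open>Cutting off outside the half plane gives a function measurable on the whole type, since
  the locale constrains \<open>F\<close> on the half plane only.\<close>

definition F0 :: "complex => real" where "F0 z = (if Im z > 0 then F z else 0)"

lemma F0_eq: "Im z > 0 ==> F0 z = F z"
 by (simp add: F0_def)

lemma F0_measurable [measurable]: "F0 \<in> borel_measurable borel"
proof -
 have "F0 = (%z. indicator {z. Im z > 0} z * F z)" by (auto simp: F0_def fun_eq_iff)
 thus ?thesis using F_measurable by simp
qed

lemma F0_inv: "Im z > 0 ==> M \<in> mats 1 ==> F0 (mob M z) = F0 z"
 using Im_mob_pos[of M 1 z] inv[of M z] by (simp add: F0_def del: mob_simp)

lemma FB_nonneg: "FB >= 0" and dFB_nonneg: "dFB >= 0"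
 using zeta2_nonneg by (auto simp: FB_def dFB_def)

lemma T_shift: "n >= 1 ==> T n (exp et) = exp (et / 2) * lam n * KA u (ln (real n) + et)"
 by (simp add: T_def KA_shift) (simp add: real_sqrt_unique exp_half_square[of "- et", simplified])

lemma T'_shift:
 assumes n: "n >= 1"
 shows "exp et * T' n (exp et) = exp (et / 2) * lam n * (KA u (ln (real n) + et) / 2 + KD u (ln (real n) + et))"
proof -
 have s: "sqrt (exp et) = exp (et / 2)" by (simp add: real_sqrt_unique exp_half_square[of "- et", simplified])
 have e: "exp et = exp (et / 2) * exp (et / 2)" by (simp flip: exp_add)
 have "exp et * T' n (exp et) = lam n * (KA u (ln (real n) + et) * (exp et / (2 * exp (et / 2))) - exp (et / 2) * (2 * pi * real n * exp et * Kint 1 u (2 * pi * real n * exp et)))"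
 unfolding KA_shift[OF n, symmetric] by (simp add: T'_def s algebra_simps)
 also have "exp et / (2 * exp (et / 2)) = exp (et / 2) / 2" unfolding e by simp
 finally show ?thesis unfolding KD_shift[OF n] by (simp add: algebra_simps)
qed

end

text \<open>The halves come from differentiating sqrt y and cancel in the antisymmetric
  combination.\<close>

lemma wronskian_algebra:
 fixes E a b A A' B B' :: real
 shows "(E * b * B * (E * a * (A / 2 + A')) - E * a * A * (E * b * (B / 2 + B'))) / 2 = (E * E) * (a * b / 2 * (B * A' - A * B'))"
proof -
 have "E * b * B * (E * a * (A / 2 + A')) - E * a * A * (E * b * (B / 2 + B')) = E * E * (a * b * (B * A' - A * B'))"
 by (simp add: distrib_left distrib_right right_diff_distrib left_diff_distrib)
 thus ?thesis by (simp only: times_divide_eq_right times_divide_eq_left)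
qed

locale rform_pair = f: rform c1 u lf F + g: rform c2 v lg G for c1 u lf F c2 v lg G
begin

abbreviation "L \<equiv> %n. lf n * lg n"

lemma TT_bound:
 assumes y: "y > 0" and n: "n >= 1"
 shows "\<bar>f.T n y * g.T n y\<bar> <= real n ^ 4 * exp (- (4 * pi * real n * y))"
proof -
 have "\<bar>f.T n y * g.T n y\<bar> <= (real n ^ 2 * exp (- (2 * pi * real n * y))) * (real n ^ 2 * exp (- (2 * pi * real n * y)))"
 unfolding abs_mult by (intro mult_mono f.T_bound g.T_bound y n) auto
 also have "... = (real n ^ 2 * real n ^ 2) * (exp (- (2 * pi * real n * y)) * exp (- (2 * pi * real n * y)))" by simp
 also have "exp (- (2 * pi * real n * y)) * exp (- (2 * pi * real n * y)) = exp (- (4 * pi * real n * y))" by (simp flip: exp_add)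
 also have "real n ^ 2 * real n ^ 2 = real n ^ 4" by (simp flip: power_add)
 finally show ?thesis .
qed

lemma section_weight0:
 assumes cc: "c1 = c2" and t: "t > 0"
 shows "strip_sum 0 (%y. \<integral>x. indicator {0..<1} x * (f.F0 (Complex x y) * g.F0 (Complex x y)) \<partial>lborel) t = Ssum u v L 0 t / 2"
proof -
 let ?G = "%n y. f.T n y * g.T n y / 2"
 have b: "\<bar>?G n y\<bar> <= (fact 6 / (4 * pi) ^ 6) / ((real n)^2 * y ^ 6)" if "n >= 1" "y > 0" for n y
 proof -
 have "\<bar>?G n y\<bar> <= real n ^ 4 * exp (- (4 * pi * real n * y))" using TT_bound[OF that(2,1)] by simp
 also have "... <= fact (4 + 2) / (4 * pi * y) ^ (4 + 2) * (1 / (real n)^2)"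
 using that by (intro power_exp_inverse_square) auto
 finally show ?thesis by (simp add: power_mult_distrib)
 qed
 have w: "(\<integral>x. indicator {0..<1} x * (f.F0 (Complex x y) * g.F0 (Complex x y)) \<partial>lborel) = (\<integral>n. ?G n y \<partial>count_space {1..})" if y: "y > 0" for y
 using parseval[OF f.cs f.integrable_T[OF y] g.integrable_T[OF y]] y by (simp add: f.F0_eq g.F0_eq f.F_series g.F_series cc)
 have "strip_sum 0 (%y. \<integral>x. indicator {0..<1} x * (f.F0 (Complex x y) * g.F0 (Complex x y)) \<partial>lborel) t
 = (\<integral>(m, n). (\<integral>et. exp (- et) * ((pi * t * (real m)^2) ^ 0 * exp (- (pi * t * (real m)^2 / exp et)) * ?G n (exp et)) \<partial>lborel) \<partial>count_space ({1..} \<times> {1..}))"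
 by (rule strip_sum_eval[OF t _ _ _ w _ b]) auto
 also have "... = (\<integral>p. (case p of (m, n) => L n * (real (m^2 * n)) ^ 0 * VV u v (t * real (m^2 * n))) / 2 \<partial>count_space ({1..} \<times> {1..}))"
 proof (rule Bochner_Integration.integral_cong[OF refl])
 fix p :: "nat \<times> nat" assume "p \<in> space (count_space ({1..} \<times> {1..}))"
 then obtain m n where p: "p = (m, n)" "m >= 1" "n >= 1" by auto
 have "(\<integral>et. exp (- et) * ((pi * t * (real m)^2) ^ 0 * exp (- (pi * t * (real m)^2 / exp et)) * ?G n (exp et)) \<partial>lborel)
 = (\<integral>et. L n / 2 * (exp (- (pi * t * (real m)^2 / exp et)) * (Kb u (2 * pi * real n * exp et) * Kb v (2 * pi * real n * exp et))) \<partial>lborel)"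
 by (rule Bochner_Integration.integral_cong[OF refl]) (simp add: f.T_def g.T_def exp_minus)
 also have "... = L n / 2 * VV u v (t * real (m^2 * n))" unfolding integral_mult_right_zero VV_shift[OF p(3)] ..
 finally show "(case p of (m, n) => (\<integral>et. exp (- et) * ((pi * t * (real m)^2) ^ 0 * exp (- (pi * t * (real m)^2 / exp et)) * ?G n (exp et)) \<partial>lborel))
 = (case p of (m, n) => L n * (real (m^2 * n)) ^ 0 * VV u v (t * real (m^2 * n))) / 2" by (simp add: p)
 qed
 finally show ?thesis by (simp add: Ssum_def)
qed

text \<open>The real part of F dG is F times the x-derivative of G. That derivative turns the sine
  series into a cosine series with an extra 2 pi n, so \<open>parseval\<close> applies; together
  with pi t m^2 from the strip sum it accounts for the factor m^2 n.\<close>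

lemma section_mixed:
 assumes c1: "c1 = cos" and c2: "c2 = sin" and t: "t > 0"
 shows "strip_sum 1 (%y. \<integral>x. indicator {0..<1} x * Re (of_real (f.F0 (Complex x y)) * g.dF (Complex x y)) \<partial>lborel) t = pi^2 * t * Ssum u v L 1 t"
proof -
 let ?G = "%n y. f.T n y * (g.T n y * (2 * pi * real n)) / 2"
 have c2': "g.cs' = cos" unfolding g.cs'_def using c2 g.sin_neq_cos by simp
 have b: "\<bar>?G n y\<bar> <= (pi * fact 7 / (4 * pi) ^ 7) / ((real n)^2 * y ^ 7)" if "n >= 1" "y > 0" for n y
 proof -
 have "\<bar>?G n y\<bar> = \<bar>f.T n y * g.T n y\<bar> * (pi * real n)" by (simp add: abs_mult)
 also have "... <= (real n ^ 4 * exp (- (4 * pi * real n * y))) * (pi * real n)"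
 by (intro mult_right_mono TT_bound that) auto
 also have "... = pi * (real n ^ 5 * exp (- (4 * pi * real n * y)))" by (simp add: eval_nat_numeral)
 also have "... <= pi * (fact (5 + 2) / (4 * pi * y) ^ (5 + 2) * (1 / (real n)^2))"
 using that by (intro mult_left_mono power_exp_inverse_square) auto
 finally show ?thesis by (simp add: power_mult_distrib mult.assoc mult.left_commute mult.commute)
 qed
 have w: "(\<integral>x. indicator {0..<1} x * Re (of_real (f.F0 (Complex x y)) * g.dF (Complex x y)) \<partial>lborel) = (\<integral>n. ?G n y \<partial>count_space {1..})" if y: "y > 0" for y
 unfolding integral_divide_zero using parseval[OF f.cs f.integrable_T[OF y] g.integrable_Tn[OF y]] y c2' c1 by (simp add: f.F0_eq f.F_series g.dF_def g.Fx_def)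
 have "strip_sum 1 (%y. \<integral>x. indicator {0..<1} x * Re (of_real (f.F0 (Complex x y)) * g.dF (Complex x y)) \<partial>lborel) t
 = (\<integral>(m, n). (\<integral>et. exp (- et) * ((pi * t * (real m)^2) ^ 1 * exp (- (pi * t * (real m)^2 / exp et)) * ?G n (exp et)) \<partial>lborel) \<partial>count_space ({1..} \<times> {1..}))"
 by (rule strip_sum_eval[OF t _ _ _ w _ b]) auto
 also have "... = (\<integral>p. pi\<^sup>2 * t * (case p of (m, n) => L n * (real (m^2 * n)) ^ 1 * VV u v (t * real (m^2 * n))) \<partial>count_space ({1..} \<times> {1..}))"
 proof (rule Bochner_Integration.integral_cong[OF refl])
 fix p :: "nat \<times> nat" assume "p \<in> space (count_space ({1..} \<times> {1..}))"
 then obtain m n where p: "p = (m, n)" "m >= 1" "n >= 1" by auto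
 have "(\<integral>et. exp (- et) * ((pi * t * (real m)^2) ^ 1 * exp (- (pi * t * (real m)^2 / exp et)) * ?G n (exp et)) \<partial>lborel)
 = (\<integral>et. pi\<^sup>2 * t * L n * real (m^2 * n) * (exp (- (pi * t * (real m)^2 / exp et)) * (Kb u (2 * pi * real n * exp et) * Kb v (2 * pi * real n * exp et))) \<partial>lborel)"
 by (rule Bochner_Integration.integral_cong[OF refl]) (simp add: f.T_def g.T_def exp_minus power2_eq_square)
 also have "... = pi^2 * t * L n * real (m^2 * n) * VV u v (t * real (m^2 * n))" unfolding integral_mult_right_zero VV_shift[OF p(3)] ..
 finally show "(case p of (m, n) => (\<integral>et. exp (- et) * ((pi * t * (real m)^2) ^ 1 * exp (- (pi * t * (real m)^2 / exp et)) * ?G n (exp et)) \<partial>lborel))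
 = pi^2 * t * (case p of (m, n) => L n * (real (m^2 * n)) ^ 1 * VV u v (t * real (m^2 * n)))" by (simp add: p)
 qed
 finally show ?thesis by (simp only: Ssum_def integral_mult_right_zero)
qed

lemma integrable_section:
 assumes y: "y > 0"
 shows "integrable lborel (%x. indicator {0..<1} x * (g.F0 (Complex x y) * f.Fy (Complex x y)))"
proof -
 define A where "A = g.FB / y ^ 4"
 define B where "B = f.dFB / y ^ 5"
 have A: "\<bar>g.F0 (Complex x y)\<bar> <= A" and B: "\<bar>f.Fy (Complex x y)\<bar> <= B" for x
 using g.F_bound[of "Complex x y"] f.dF_bound[of "Complex x y"] abs_Im_le_cmod[of "f.dF (Complex x y)"] y
 by (auto simp: g.F0_eq A_def B_def f.dF_def)
 have m: "(%x. Complex x y) \<in> borel_measurable borel" unfolding Complex_eq by measurable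
 have Fm: "(%x. f.Fy (Complex x y)) \<in> borel_measurable borel"
 proof -
 have "(%x. f.Fy (Complex x y)) = (%x. - Im (f.dF (Complex x y)))" by (simp add: f.dF_def)
 thus ?thesis using m by (simp add: measurable_compose[OF m f.dF_measurable])
 qed
 show ?thesis
 proof (rule Bochner_Integration.integrable_bound[of _ "%x. indicator {0..<1::real} x * (A * B)"])
 show "integrable lborel (%x. indicator {0..<1::real} x * (A * B))" by (intro integrable_mult_left integrable_real_indicator) auto
 show "(%x. indicator {0..<1} x * (g.F0 (Complex x y) * f.Fy (Complex x y))) \<in> borel_measurable lborel"
 using measurable_compose[OF m g.F0_measurable] Fm by measurable
 have "\<bar>g.F0 (Complex x y) * f.Fy (Complex x y)\<bar> <= A * B" for x
 unfolding abs_mult by (rule mult_mono[OF A B]) (use A[of x] in auto)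
 thus "AE x in lborel. norm (indicator {0..<1} x * (g.F0 (Complex x y) * f.Fy (Complex x y))) <= norm (indicator {0..<1::real} x * (A * B))"
 by (intro AE_I2) (auto simp: indicator_def intro: order_trans[OF _ abs_ge_self])
 qed
qed

lemma TT'_bound:
 assumes y: "y > 0" and n: "n >= 1"
 shows "\<bar>g.T n y * f.T' n y\<bar> <= (4 * fact 6 / (3 * pi) ^ 6) / ((real n)^2 * y ^ 7)"
proof -
 have "\<bar>g.T n y * f.T' n y\<bar> <= (real n ^ 2 * exp (- (2 * pi * real n * y))) * (4 / y * (real n ^ 2 * exp (- (pi * real n * y))))"
 unfolding abs_mult by (intro mult_mono f.T'_bound g.T_bound y n) auto
 also have "... = 4 / y * ((real n ^ 2 * real n ^ 2) * (exp (- (2 * pi * real n * y)) * exp (- (pi * real n * y))))" by simp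
 also have "exp (- (2 * pi * real n * y)) * exp (- (pi * real n * y)) = exp (- (3 * pi * real n * y))" by (simp flip: exp_add)
 also have "real n ^ 2 * real n ^ 2 = real n ^ 4" by (simp flip: power_add)
 also have "4 / y * (real n ^ 4 * exp (- (3 * pi * real n * y))) <= 4 / y * (fact (4 + 2) / (3 * pi * y) ^ (4 + 2) * (1 / (real n)^2))"
 using y n by (intro mult_left_mono power_exp_inverse_square) auto
 also have "... = (4 * fact 6 / (3 * pi) ^ 6) / ((real n)^2 * y ^ 7)"
 by (simp add: power_mult_distrib eval_nat_numeral)
 finally show ?thesis .
qed

text \<open>The factor i selects the y-derivatives, leaving G F_y - F G_y. Both series have the same
  parity, so \<open>parseval\<close> turns this into Wronskians of Bessel functions, and
  \<open>VV_wronskian\<close> restores V.\<close>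

lemma section_wronskian:
 assumes cc: "c1 = c2" and t: "t > 0"
 shows "strip_sum 1 (%y. \<integral>x. indicator {0..<1} x * Re (\<i> * (of_real (g.F0 (Complex x y)) * f.dF (Complex x y) - of_real (f.F0 (Complex x y)) * g.dF (Complex x y))) \<partial>lborel) t
 = (u^2 - v\<^sup>2) / 2 * Ssum u v L 0 t"
proof -
 interpret s: rform_pair c2 v lg G c1 u lf F by (rule rform_pair.intro[OF g.rform_axioms f.rform_axioms])
 let ?G = "%n y. (g.T n y * f.T' n y - f.T n y * g.T' n y) / 2"
 let ?w = "%y. \<integral>x. indicator {0..<1} x * Re (\<i> * (of_real (g.F0 (Complex x y)) * f.dF (Complex x y) - of_real (f.F0 (Complex x y)) * g.dF (Complex x y))) \<partial>lborel"
 have b: "\<bar>?G n y\<bar> <= (4 * fact 6 / (3 * pi) ^ 6) / ((real n)^2 * y ^ 7)" if "n >= 1" "y > 0" for n y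
 using TT'_bound[OF that(2,1)] s.TT'_bound[OF that(2,1)] abs_triangle_ineq4[of "g.T n y * f.T' n y" "f.T n y * g.T' n y"] by (simp del: fact_numeral)
 have w: "?w y = (\<integral>n. ?G n y \<partial>count_space {1..})" if y: "y > 0" for y
 proof -
 have prod: "integrable (count_space {1..}) (%n. g.T n y * f.T' n y)" "integrable (count_space {1..}) (%n. f.T n y * g.T' n y)"
 proof -
 let ?c = "4 * fact 6 / (3 * pi) ^ 6 :: real"
 have "norm (?c / y ^ 7 * (1 / (real n)^2)) = ?c / ((real n)^2 * y ^ 7)" for n using y by (simp add: mult.commute del: fact_numeral)
 thus "integrable (count_space {1..}) (%n. g.T n y * f.T' n y)" "integrable (count_space {1..}) (%n. f.T n y * g.T' n y)"
 using Bochner_Integration.integrable_bound[OF integrable_mult_right[OF integrable_inverse_squares, of "?c / y ^ 7"], of "%n. g.T n y * f.T' n y"]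
 Bochner_Integration.integrable_bound[OF integrable_mult_right[OF integrable_inverse_squares, of "?c / y ^ 7"], of "%n. f.T n y * g.T' n y"]
 TT'_bound[OF y] s.TT'_bound[OF y] by (simp_all add: AE_count_space del: fact_numeral)
 qed
 have "?w y = (\<integral>x. indicator {0..<1} x * (g.F0 (Complex x y) * f.Fy (Complex x y)) - indicator {0..<1} x * (f.F0 (Complex x y) * g.Fy (Complex x y)) \<partial>lborel)"
 by (rule Bochner_Integration.integral_cong[OF refl]) (simp add: f.dF_def g.dF_def algebra_simps)
 also have "... = (\<integral>x. indicator {0..<1} x * (g.F0 (Complex x y) * f.Fy (Complex x y)) \<partial>lborel) - (\<integral>x. indicator {0..<1} x * (f.F0 (Complex x y) * g.Fy (Complex x y)) \<partial>lborel)"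
 by (rule Bochner_Integration.integral_diff[OF integrable_section[OF y] s.integrable_section[OF y]])
 also have "... = (\<integral>n. g.T n y * f.T' n y \<partial>count_space {1..}) / 2 - (\<integral>n. f.T n y * g.T' n y \<partial>count_space {1..}) / 2"
 unfolding f.Fy_def g.Fy_def using parseval[OF f.cs g.integrable_T[OF y] f.integrable_T'[OF y]] parseval[OF f.cs f.integrable_T[OF y] g.integrable_T'[OF y]] y
 by (simp add: f.F0_eq g.F0_eq f.F_series g.F_series cc)
 also have "... = (\<integral>n. ?G n y \<partial>count_space {1..})"
 unfolding integral_divide_zero Bochner_Integration.integral_diff[OF prod] by (simp add: diff_divide_distrib)
 finally show ?thesis .
 qed
 have "strip_sum 1 ?w t
 = (\<integral>(m, n). (\<integral>et. exp (- et) * ((pi * t * (real m)^2) ^ 1 * exp (- (pi * t * (real m)^2 / exp et)) * ?G n (exp et)) \<partial>lborel) \<partial>count_space ({1..} \<times> {1..}))"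
 by (rule strip_sum_eval[OF t _ _ _ w _ b]) auto
 also have "... = (\<integral>p. (u^2 - v\<^sup>2) / 2 * (case p of (m, n) => L n * (real (m^2 * n)) ^ 0 * VV u v (t * real (m^2 * n))) \<partial>count_space ({1..} \<times> {1..}))"
 proof (rule Bochner_Integration.integral_cong[OF refl])
 fix p :: "nat \<times> nat" assume "p \<in> space (count_space ({1..} \<times> {1..}))"
 then obtain m n where p: "p = (m, n)" "m >= 1" "n >= 1" by auto
 define a where "a = t * real (m^2 * n)"
 have a: "a > 0" using p t by (simp add: a_def)
 let ?h = "%et. pi * a * exp (- et) * exp (- (pi * a * exp (- et))) * (KA v et * KD u et - KA u et * KD v et)"
 have "(\<integral>et. exp (- et) * ((pi * t * (real m)^2) ^ 1 * exp (- (pi * t * (real m)^2 / exp et)) * ?G n (exp et)) \<partial>lborel)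
 = (\<integral>et. L n / 2 * ?h (ln (real n) + et) \<partial>lborel)"
 proof (rule Bochner_Integration.integral_cong[OF refl])
 fix et
 let ?x = "ln (real n) + et"
 have e: "exp (et / 2) * exp (et / 2) = exp et" by (simp flip: exp_add)
 have "exp et * ?G n (exp et) = (g.T n (exp et) * (exp et * f.T' n (exp et)) - f.T n (exp et) * (exp et * g.T' n (exp et))) / 2" by (simp add: algebra_simps)
 also have "... = (exp (et / 2) * exp (et / 2)) * (L n / 2 * (KA v ?x * KD u ?x - KA u ?x * KD v ?x))"
 unfolding f.T'_shift[OF p(3)] g.T'_shift[OF p(3)] f.T_shift[OF p(3)] g.T_shift[OF p(3)] by (rule wronskian_algebra)
 finally have G: "?G n (exp et) = L n / 2 * (KA v ?x * KD u ?x - KA u ?x * KD v ?x)"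
 unfolding e using mult_left_cancel[OF exp_not_eq_zero] by blast
 have x: "pi * a * exp (- ?x) = pi * t * (real m)^2 * exp (- et)"
 using p(3) by (simp add: a_def exp_diff exp_minus field_simps)
 show "exp (- et) * ((pi * t * (real m)^2) ^ 1 * exp (- (pi * t * (real m)^2 / exp et)) * ?G n (exp et)) = L n / 2 * ?h ?x"
 unfolding G x power_one_right divide_real_def[of _ "exp et"] exp_minus[of et, symmetric] by (simp only: mult_ac)
 qed
 also have "... = L n / 2 * ((u^2 - v\<^sup>2) * VV u v a)"
 unfolding integral_mult_right_zero integral_shift[of ?h] VV_wronskian[OF a] ..
 finally show "(case p of (m, n) => (\<integral>et. exp (- et) * ((pi * t * (real m)^2) ^ 1 * exp (- (pi * t * (real m)^2 / exp et)) * ?G n (exp et)) \<partial>lborel))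
 = (u^2 - v\<^sup>2) / 2 * (case p of (m, n) => L n * (real (m^2 * n)) ^ 0 * VV u v (t * real (m^2 * n)))"
 unfolding p(1) prod.case a_def[symmetric] power_0 mult_1_right by (simp only: times_divide_eq_left times_divide_eq_right mult_ac)
 qed
 finally show ?thesis by (simp only: Ssum_def integral_mult_right_zero)
qed

lemma FdG_bound: "Im z > 0 ==> cmod (of_real (f.F0 z) * g.dF z) <= (f.FB * g.dFB) / Im z ^ 9"
proof -
 assume z: "Im z > 0"
 have "cmod (of_real (f.F0 z) * g.dF z) = \<bar>F z\<bar> * cmod (g.dF z)" using z by (simp add: norm_mult f.F0_eq)
 also have "... <= (f.FB / Im z ^ 4) * (g.dFB / Im z ^ 5)"
 using z f.FB_nonneg by (intro mult_mono f.F_bound g.dF_bound) auto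
 also have "... = (f.FB * g.dFB) / Im z ^ (4 + 5)" by (simp only: power_add times_divide_times_eq)
 finally show ?thesis by simp
qed

lemma FE_mixed:
 assumes c1: "c1 = cos" and c2: "c2 = sin" and t: "t > 0"
 shows "Ssum u v L 1 t = Ssum u v L 1 (1 / t) / t ^ 3"
proof -
 let ?\<Omega> = "%z. of_real (f.F0 z) * g.dF z"
 have "strip_sum 1 (%y. \<integral>x. indicator {0..<1} x * Re (?\<Omega> (Complex x y)) \<partial>lborel) t
 = strip_sum 1 (%y. \<integral>x. indicator {0..<1} x * Re (?\<Omega> (Complex x y)) \<partial>lborel) (1 / t) / t"
 proof (rule functional_equation_weight2[OF _ t FdG_bound])
 show "?\<Omega> (mob (a, b, c, d) z) = (of_int c * z + of_int d)^2 * ?\<Omega> z" if "Im z > 0" "(a, b, c, d) \<in> mats 1" for z a b c d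
 using f.F0_inv[OF that] g.dF_weight[OF that(2,1)] by (simp del: mob_simp)
 qed (use f.FB_nonneg g.dFB_nonneg in auto)
 hence "pi^2 * t * Ssum u v L 1 t = pi^2 * (1 / t) * Ssum u v L 1 (1 / t) / t"
 using section_mixed[OF c1 c2 t] section_mixed[OF c1 c2, of "1 / t"] t by simp
 thus ?thesis using t by (simp add: field_simps power3_eq_cube)
qed

text \<open>Both sides carry the same factor (u^2 - v^2) / 2, which may be cancelled because the
  eigenvalues differ.\<close>

lemma FE_wronskian:
 assumes cc: "c1 = c2" and uv: "u^2 ~= v^2" and t: "t > 0"
 shows "Ssum u v L 0 t = Ssum u v L 0 (1 / t) / t"
proof -
 interpret s: rform_pair c2 v lg G c1 u lf F by (rule rform_pair.intro[OF g.rform_axioms f.rform_axioms])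
 let ?\<Omega> = "%z. \<i> * (of_real (g.F0 z) * f.dF z - of_real (f.F0 z) * g.dF z)"
 have b: "cmod (?\<Omega> z) <= (g.FB * f.dFB + f.FB * g.dFB) / Im z ^ 9" if "Im z > 0" for z
 using FdG_bound[OF that] s.FdG_bound[OF that] norm_triangle_ineq4[of "of_real (g.F0 z) * f.dF z" "of_real (f.F0 z) * g.dF z"]
 by (simp add: norm_mult add_divide_distrib)
 have "strip_sum 1 (%y. \<integral>x. indicator {0..<1} x * Re (?\<Omega> (Complex x y)) \<partial>lborel) t
 = strip_sum 1 (%y. \<integral>x. indicator {0..<1} x * Re (?\<Omega> (Complex x y)) \<partial>lborel) (1 / t) / t"
 proof (rule functional_equation_weight2[OF _ t b])
 show "?\<Omega> (mob (a, b, c, d) z) = (of_int c * z + of_int d)^2 * ?\<Omega> z" if "Im z > 0" "(a, b, c, d) \<in> mats 1" for z a b c d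
 using f.F0_inv[OF that] g.dF_weight[OF that(2,1)] g.F0_inv[OF that] f.dF_weight[OF that(2,1)] by (simp add: algebra_simps del: mob_simp)
 qed (use f.FB_nonneg g.dFB_nonneg g.FB_nonneg f.dFB_nonneg in auto)
 hence "(u^2 - v\<^sup>2) / 2 * Ssum u v L 0 t = (u^2 - v\<^sup>2) / 2 * (Ssum u v L 0 (1 / t) / t)"
 using section_wronskian[OF cc t] section_wronskian[OF cc, of "1 / t"] t by simp
 moreover have "(u^2 - v\<^sup>2) / 2 ~= 0" using uv by simp
 ultimately show ?thesis using mult_left_cancel[of "(u^2 - v\<^sup>2) / 2"] by blast
qed

end

section \<open>Hecke correspondences and orthogonality of eigenforms\<close>

text \<open>The product of a unimodular matrix on the left with the triangular matrix of rows (n /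
  d, b) and (0, d): the Hermite normal form of a matrix of determinant n.\<close>

definition hnf :: "nat => (nat \<times> nat) \<times> int \<times> int \<times> int \<times> int => int \<times> int \<times> int \<times> int" where
 "hnf n = (%((d, b), (p, q, r, s)). (p * int (n div d), p * int b + q * int d, r * int (n div d), r * int b + s * int d))"

text \<open>The gcd of the first column recovers n / d and hence d, after which b is determined
  modulo d. Conversely, completing the first column divided by its gcd to a unimodular matrix brings
  a given matrix to triangular shape.\<close>

lemma bij_betw_hnf:
 assumes n: "n > 0"
 shows "bij_betw (hnf n) ((SIGMA d:{d. d dvd n}. {..<d}) \<times> mats 1) (mats (int n))"
 unfolding bij_betw_def
proof
 show "inj_on (hnf n) ((SIGMA d:{d. d dvd n}. {..<d}) \<times> mats 1)"
 proof (rule inj_onI)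
 fix x x' assume x: "x \<in> (SIGMA d:{d. d dvd n}. {..<d}) \<times> mats 1" and x': "x' \<in> (SIGMA d:{d. d dvd n}. {..<d}) \<times> mats 1" and e: "hnf n x = hnf n x'"
 obtain p q r s d b where X: "x = ((d, b), (p, q, r, s))" by (metis prod.collapse)
 obtain p' q' r' s' d' b' where X': "x' = ((d', b'), (p', q', r', s'))" by (metis prod.collapse)
 have d: "d dvd n" "b < d" "p * s - q * r = 1" "d' dvd n" "b' < d'" "p' * s' - q' * r' = 1"
 using x x' by (auto simp: X X' mats_def)
 define a a' where "a = n div d" and "a' = n div d'"
 have ad: "a * d = n" "a' * d' = n" using d by (auto simp: a_def a'_def)
 have apos: "a > 0" "a' > 0" using ad n by (auto intro: gr0I)
 have eq: "p * int a = p' * int a'" "r * int a = r' * int a'" "p * int b + q * int d = p' * int b' + q' * int d'" "r * int b + s * int d = r' * int b' + s' * int d'"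
 using e by (auto simp: hnf_def X X' a_def a'_def)
 have "gcd p r = 1" "gcd p' r' = 1"
 proof -
 have "gcd p r dvd p * s - q * r" "gcd p' r' dvd p' * s' - q' * r'" by (auto intro: dvd_diff)
 thus "gcd p r = 1" "gcd p' r' = 1" using d by auto
 qed
 moreover have "gcd (p * int a) (r * int a) = gcd p r * int a" "gcd (p' * int a') (r' * int a') = gcd p' r' * int a'"
 using gcd_mult_distrib_int[of "int a" p r] gcd_mult_distrib_int[of "int a'" p' r'] by (simp_all add: mult.commute)
 ultimately have aa: "a = a'" using eq by simp
 hence dd: "d = d'" using ad apos by (metis nonzero_mult_div_cancel_left not_gr_zero)
 have pr: "p = p'" "r = r'" using eq aa apos by auto
 \<comment> \<open>Multiplication by the determinant 1 lets the entrywise equations exhibit the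
   difference as a multiple of d.\<close>
 have "int b - int b' = (p * s - q * r) * (int b - int b')" using d by simp
 also have "... = s * (p * (int b - int b')) - q * (r * (int b - int b'))" by (simp add: algebra_simps)
 also have "p * (int b - int b') = (q' - q) * int d" using eq(3) pr dd by (simp add: algebra_simps)
 also have "r * (int b - int b') = (s' - s) * int d" using eq(4) pr dd by (simp add: algebra_simps)
 finally have "int b - int b' = (s * (q' - q) - q * (s' - s)) * int d" by (simp add: algebra_simps)
 hence "int d dvd int b - int b'" by simp
 moreover have "\<bar>int b - int b'\<bar> < int d" using d dd by linarith
 ultimately have bb: "b = b'" using dvd_imp_le_int[of "int b - int b'" "int d"] by force
 have "q = q'" "s = s'" using eq(3,4) pr dd bb d by auto
 thus "x = x'" by (simp add: X X' pr dd bb)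
 qed
 show "hnf n ` ((SIGMA d:{d. d dvd n}. {..<d}) \<times> mats 1) = mats (int n)"
 proof (intro equalityI subsetI)
 fix M assume "M \<in> hnf n ` ((SIGMA d:{d. d dvd n}. {..<d}) \<times> mats 1)"
 then obtain p q r s d b where M: "M = hnf n ((d, b), (p, q, r, s))" "p * s - q * r = 1" "d dvd n" by (auto simp: mats_def)
 have "p * int (n div d) * (r * int b + s * int d) - (p * int b + q * int d) * (r * int (n div d)) = (p * s - q * r) * int (n div d * d)"
 by (simp add: algebra_simps)
 thus "M \<in> mats (int n)" using M by (simp add: hnf_def mats_def)
 next
 fix M assume "M \<in> mats (int n)"
 then obtain A B C E where M: "M = (A, B, C, E)" "A * E - B * C = int n" by (auto simp: mats_def)
 define g where "g = gcd A C"
 have gn: "g dvd int n" unfolding M(2)[symmetric] g_def by (intro dvd_diff dvd_mult2 dvd_mult) auto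
 have g0: "g > 0" using M n by (auto simp: g_def intro!: gcd_pos_int)
 define a where "a = nat g"
 have a: "int a = g" using g0 by (simp add: a_def)
 have an: "a dvd n" using gn unfolding a[symmetric] by simp
 define d where "d = n div a"
 have ad: "a * d = n" using an by (simp add: d_def)
 have d0: "d > 0" using ad n by (auto intro: gr0I)
 have nd: "n div d = a" using ad d0 by auto
 obtain p r where pr: "A = p * g" "C = r * g" "coprime p r"
 using gcd_coprime_exists[of A C] g0 unfolding g_def by auto
 obtain x y where xy: "x * p + y * r = 1" using bezout_int[of p r] pr(3) by (auto simp: coprime_iff_gcd_eq_1)
 define s0 q0 where "s0 = x" and "q0 = - y"
 have det: "p * s0 - q0 * r = 1" using xy by (simp add: s0_def q0_def algebra_simps)
 \<comment> \<open>The upper right entry after removing the unimodular factor; a translation then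
   reduces it modulo d.\<close>
 define b' where "b' = s0 * B - q0 * E"
 have "int n = g * int d" using ad a by (metis of_nat_mult)
 hence "g * (p * E - r * B) = g * int d" using M(2) pr by (simp add: algebra_simps)
 hence dE: "p * E - r * B = int d" using g0 by simp
 have "p * b' + q0 * int d = (p * s0 - q0 * r) * B" "r * b' + s0 * int d = (p * s0 - q0 * r) * E"
 unfolding b'_def dE[symmetric] by (simp_all add: algebra_simps)
 hence B: "B = p * b' + q0 * int d" "E = r * b' + s0 * int d" using det by auto
 define b j where "b = nat (b' mod int d)" and "j = b' div int d"
 have b: "int b = b' mod int d" "b < d" using d0 by (auto simp: b_def nat_less_iff)
 have bj: "b' = int b + j * int d" unfolding b j_def by simp
 have "hnf n ((d, b), (p, q0 + j * p, r, s0 + j * r)) = M"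
 unfolding M hnf_def using pr a B bj by (simp add: nd algebra_simps)
 moreover have "((d, b), (p, q0 + j * p, r, s0 + j * r)) \<in> (SIGMA d:{d. d dvd n}. {..<d}) \<times> mats 1"
 using det ad b by (auto simp: mats_def algebra_simps)
 ultimately show "M \<in> hnf n ` ((SIGMA d:{d. d dvd n}. {..<d}) \<times> mats 1)" by (metis image_eqI)
 qed
qed

lemma mob_hnf:
 assumes "d > 0"
 shows "mob (hnf n ((d, b), M)) z = mob M ((of_nat (n div d) * z + of_nat b) / of_nat d)"
proof -
 obtain p q r s where M: "M = (p, q, r, s)" by (cases M)
 define w where "w = of_nat (n div d) * z + (of_nat b :: complex)"
 have e: "of_int p * (w / of_nat d) + of_int q = (of_int p * w + of_int q * of_nat d) / of_nat d" for p q
 using assms by (simp add: field_simps)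
 have "mob M (w / of_nat d) = (of_int p * w + of_int q * of_nat d) / (of_int r * w + of_int s * of_nat d)"
 unfolding M mob_simp e using assms by simp
 thus ?thesis unfolding w_def[symmetric] by (simp add: hnf_def M w_def algebra_simps)
qed

lemma nn_integral_count_space_Times:
 assumes AB: "countable A" "countable B"
 shows "(\<integral>\<^sup>+c. \<integral>\<^sup>+d. f (c, d) \<partial>count_space B \<partial>count_space A) = (\<integral>\<^sup>+p. f p \<partial>count_space (A \<times> B))"
proof -
 interpret B: sigma_finite_measure "count_space B" using AB by (intro sigma_finite_measure_count_space_countable)
 have eq: "count_space A \<Otimes>\<^sub>M count_space B = count_space (A \<times> B)"
 using AB by (subst pair_measure_countable) auto
 show ?thesis using B.nn_integral_fst[of f "count_space A"] by (simp add: eq)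
qed

text \<open>For each Hecke representative a full sum of \<open>rho\<close> over the modular group
  remains, which is 1; what is left is the Hecke operator without its normalising factor.\<close>

lemma sum_rho_hecke:
 fixes H :: "complex => real"
 assumes z: "Im z > 0" and n: "n > 0" and H: "!!z M. Im z > 0 ==> M \<in> mats 1 ==> H (mob M z) = H z"
 and bdd: "!!z. Im z > 0 ==> \<bar>H z\<bar> <= B"
 shows "(\<integral>M. rho (mob M z) * H (mob M z) \<partial>count_space (mats (int n))) = (\<Sum>d | d dvd n. \<Sum>b<d. H ((of_nat (n div d) * z + of_nat b) / of_nat d))"
 and "(\<integral>\<^sup>+M. norm (rho (mob M z) * H (mob M z)) \<partial>count_space (mats (int n))) <= ennreal (B * real (card (SIGMA d:{d. d dvd n}. {..<d})))"
proof -
 let ?D = "SIGMA d:{d. d dvd n}. {..<d}"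
 let ?w = "%p. (of_nat (n div fst p) * z + of_nat (snd p)) / of_nat (fst p)"
 let ?f = "%M. rho (mob M z) * H (mob M z)"
 have finD: "finite ?D" using n by (intro finite_SigmaI) auto
 have B: "B >= 0" using bdd[OF z] by linarith
 have w: "Im (?w p) > 0" if pD: "p \<in> ?D" for p
 proof -
 obtain d b where p: "p = (d, b)" "d dvd n" "b < d" using pD by (cases p) auto
 have "Im (?w p) = real (n div d) * Im z / real d" by (simp add: p Im_divide_of_nat)
 moreover have "n div d > 0" using p n by (simp add: div_greater_zero_iff dvd_imp_le)
 ultimately show ?thesis using z p by simp
 qed
 have ev: "?f (hnf n (p, M)) = H (?w p) * rho (mob M (?w p))" if pD: "p \<in> ?D" and M: "M \<in> mats 1" for p M
 proof -
 obtain d b where p: "p = (d, b)" "d dvd n" "b < d" using pD by (cases p) auto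
 have "mob (hnf n (p, M)) z = mob M (?w p)" unfolding p(1) using mob_hnf[of d n b M z] p(3) by simp
 thus ?thesis using H[OF w[OF pD] M] by (simp del: mob_simp)
 qed
 have "(\<integral>\<^sup>+M. norm (?f M) \<partial>count_space (mats (int n))) = (\<integral>\<^sup>+x. norm (?f (hnf n x)) \<partial>count_space (?D \<times> mats 1))"
 by (rule nn_integral_bij_count_space[OF bij_betw_hnf[OF n], symmetric])
 also have "... = (\<integral>\<^sup>+p. \<integral>\<^sup>+M. norm (?f (hnf n (p, M))) \<partial>count_space (mats 1) \<partial>count_space ?D)"
 by (rule nn_integral_count_space_Times[symmetric]) (use countable_finite[OF finD] in auto)
 also have "... <= (\<integral>\<^sup>+p. ennreal B \<partial>count_space ?D)"
 proof (rule nn_integral_mono)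
 fix p assume "p \<in> space (count_space ?D)"
 hence p: "p \<in> ?D" by simp
 have "(\<integral>\<^sup>+M. norm (?f (hnf n (p, M))) \<partial>count_space (mats 1)) <= (\<integral>\<^sup>+M. ennreal B * ennreal (rho (mob M (?w p))) \<partial>count_space (mats 1))"
 proof (rule nn_integral_mono)
 fix M :: "int \<times> int \<times> int \<times> int" assume "M \<in> space (count_space (mats 1))"
 hence M: "M \<in> mats 1" by simp
 have r: "rho (mob M (?w p)) >= 0" using Im_mob_pos[OF M _ w[OF p]] by (intro rho_nonneg) simp
 have "norm (?f (hnf n (p, M))) = \<bar>H (?w p)\<bar> * rho (mob M (?w p))" unfolding ev[OF p M] using r by (simp add: abs_mult del: mob_simp)
 also have "... <= B * rho (mob M (?w p))" by (rule mult_right_mono[OF bdd[OF w[OF p]] r])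
 finally show "ennreal (norm (?f (hnf n (p, M)))) <= ennreal B * ennreal (rho (mob M (?w p)))"
 using B r by (simp add: ennreal_mult[symmetric] ennreal_leI del: mob_simp)
 qed
 also have "... = ennreal B" by (simp add: nn_integral_cmult sum_rho(1)[OF w[OF p]] del: mob_simp)
 finally show "(\<integral>\<^sup>+M. norm (?f (hnf n (p, M))) \<partial>count_space (mats 1)) <= ennreal B" .
 qed
 also have "... = ennreal (B * real (card ?D))"
 using B finD by (simp add: nn_integral_count_space_finite ennreal_mult ennreal_of_nat_eq_real_of_nat mult.commute)
 finally show nn: "(\<integral>\<^sup>+M. norm (?f M) \<partial>count_space (mats (int n))) <= ennreal (B * real (card ?D))" .
 hence "integrable (count_space (mats (int n))) ?f" by (simp add: integrable_iff_bounded le_less_trans del: mob_simp)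
 hence i: "integrable (count_space (?D \<times> mats 1)) (%x. ?f (hnf n x))"
 using integrable_bij_count_space[OF bij_betw_hnf[OF n], of ?f] by (simp del: mob_simp)
 have "(\<integral>M. ?f M \<partial>count_space (mats (int n))) = (\<integral>x. ?f (hnf n x) \<partial>count_space (?D \<times> mats 1))"
 by (rule integral_bij_count_space[OF bij_betw_hnf[OF n], symmetric])
 also have "... = (\<integral>p. \<integral>M. ?f (hnf n (p, M)) \<partial>count_space (mats 1) \<partial>count_space ?D)"
 by (rule integral_count_space_Times[symmetric, OF _ _ i]) (use countable_finite[OF finD] in auto)
 also have "... = (\<integral>p. H (?w p) \<partial>count_space ?D)"
 proof (rule Bochner_Integration.integral_cong[OF refl])
 fix p assume "p \<in> space (count_space ?D)"
 hence p: "p \<in> ?D" by simp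
 have "(\<integral>M. ?f (hnf n (p, M)) \<partial>count_space (mats 1)) = (\<integral>M. H (?w p) * rho (mob M (?w p)) \<partial>count_space (mats 1))"
 by (rule Bochner_Integration.integral_cong[OF refl]) (simp add: ev[OF p] del: mob_simp)
 thus "(\<integral>M. ?f (hnf n (p, M)) \<partial>count_space (mats 1)) = H (?w p)" using sum_rho(2)[OF w[OF p]] by (simp only: integral_mult_right_zero)
 qed
 also have "... = (\<Sum>d | d dvd n. \<Sum>b<d. H ((of_nat (n div d) * z + of_nat b) / of_nat d))"
 using n by (simp add: lebesgue_integral_count_space_finite[OF finD] sum.Sigma split_beta)
 finally show "(\<integral>M. ?f M \<partial>count_space (mats (int n))) = (\<Sum>d | d dvd n. \<Sum>b<d. H ((of_nat (n div d) * z + of_nat b) / of_nat d))" .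
qed

context rform_pair
begin

text \<open>\<open>integral_mats_swap\<close> with the factors rho G and rho F expresses the
  self-adjointness of T_n. Its two sides are sqrt n times \<open>lf n\<close> and
  \<open>lg n\<close> respectively, multiplied by the same integral, which must then vanish.\<close>

lemma hecke_orthogonal:
 assumes n: "n >= 1" and neq: "lf n ~= lg n"
 shows "(\<integral>z. rho z * (f.F0 z * g.F0 z) \<partial>hyp) = 0"
proof -
 obtain B1 where B1: "!!z. Im z > 0 ==> \<bar>F z\<bar> <= B1" using f.F_bounded by blast
 obtain B2 where B2: "!!z. Im z > 0 ==> \<bar>G z\<bar> <= B2" using g.F_bounded by blast
 have B10: "B1 >= 0" and B20: "B2 >= 0" using B1[of \<i>] B2[of \<i>] by auto
 have b1: "\<bar>f.F0 z\<bar> <= B1" and b2: "\<bar>g.F0 z\<bar> <= B2" if "Im z > 0" for z using B1 B2 that by (auto simp: f.F0_eq g.F0_eq)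
 have n': "n > 0" "int n > 0" using n by auto
 let ?N = "B2 * real (card (SIGMA d:{d. d dvd n}. {..<d}))"
 have N: "?N >= 0" using B20 by simp
 have val: "(\<integral>M. rho (mob M z) * f.F0 (mob M z) \<partial>count_space (mats (int n))) = sqrt (real n) * lf n * f.F0 z"
 "(\<integral>M. rho (mob M z) * g.F0 (mob M z) \<partial>count_space (mats (int n))) = sqrt (real n) * lg n * g.F0 z" if z: "Im z > 0" for z
 proof -
 have im: "Im ((of_nat (n div d) * z + of_nat b) / of_nat d) > 0" if "d dvd n" for d b
 proof -
 have "d > 0" "n div d > 0" using that n' by (auto simp: div_greater_zero_iff dvd_imp_le intro: gr0I)
 thus ?thesis using z by (simp add: Im_divide_of_nat)
 qed
 have "(\<Sum>d | d dvd n. \<Sum>b<d. f.F0 ((of_nat (n div d) * z + of_nat b) / of_nat d)) = (\<Sum>d | d dvd n. \<Sum>b<d. F ((of_nat (n div d) * z + of_nat b) / of_nat d))"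
 "(\<Sum>d | d dvd n. \<Sum>b<d. g.F0 ((of_nat (n div d) * z + of_nat b) / of_nat d)) = (\<Sum>d | d dvd n. \<Sum>b<d. G ((of_nat (n div d) * z + of_nat b) / of_nat d))"
 by (intro sum.cong refl f.F0_eq g.F0_eq im; simp)+
 thus "(\<integral>M. rho (mob M z) * f.F0 (mob M z) \<partial>count_space (mats (int n))) = sqrt (real n) * lf n * f.F0 z"
 "(\<integral>M. rho (mob M z) * g.F0 (mob M z) \<partial>count_space (mats (int n))) = sqrt (real n) * lg n * g.F0 z"
 using sum_rho_hecke(1)[OF z n'(1) f.F0_inv b1] sum_rho_hecke(1)[OF z n'(1) g.F0_inv b2] f.hecke[OF n z] g.hecke[OF n z] z
 by (simp_all add: f.F0_eq g.F0_eq del: mob_simp)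
 qed
 let ?P = "%z. rho z * g.F0 z" and ?R = "%z. rho z * f.F0 z"
 have fin: "(\<integral>\<^sup>+z. norm (?R z) * (\<integral>\<^sup>+M. norm (?P (mob M z)) \<partial>count_space (mats (int n))) \<partial>hyp) < \<infinity>"
 proof -
 have "(\<integral>\<^sup>+z. norm (?R z) * (\<integral>\<^sup>+M. norm (?P (mob M z)) \<partial>count_space (mats (int n))) \<partial>hyp) <= (\<integral>\<^sup>+z. ennreal (B1 * ?N) * ennreal (norm (rho z)) \<partial>hyp)"
 proof (rule nn_integral_mono_AE, use AE_hyp in eventually_elim)
 fix z assume z: "Im z > 0"
 have "ennreal (norm (?R z)) <= ennreal (B1 * norm (rho z))"
 using mult_right_mono[OF b1[OF z] rho_nonneg[OF z]] rho_nonneg[OF z] by (intro ennreal_leI) (simp add: abs_mult mult.commute)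
 hence "ennreal (norm (?R z)) * (\<integral>\<^sup>+M. norm (?P (mob M z)) \<partial>count_space (mats (int n))) <= ennreal (B1 * norm (rho z)) * ennreal ?N"
 by (rule mult_mono[OF _ sum_rho_hecke(2)[OF z n'(1) g.F0_inv b2]]) auto
 also have "... = ennreal (B1 * ?N) * ennreal (norm (rho z))"
 using B10 N by (simp add: ennreal_mult mult_ac del: of_nat_mult)
 finally show "ennreal (norm (?R z)) * (\<integral>\<^sup>+M. norm (?P (mob M z)) \<partial>count_space (mats (int n))) <= ennreal (B1 * ?N) * ennreal (norm (rho z))" .
 qed
 also have "... = ennreal (B1 * ?N) * (\<integral>\<^sup>+z. ennreal (norm (rho z)) \<partial>hyp)"
 by (rule nn_integral_cmult) measurable
 also have "... < \<infinity>" using rho_integrable by (simp add: integrable_iff_bounded ennreal_mult_less_top)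
 finally show ?thesis .
 qed
 have sw: "(\<integral>z. ?P z * (\<integral>M. ?R (mob M z) \<partial>count_space (mats (int n))) \<partial>hyp) = (\<integral>z. ?R z * (\<integral>M. ?P (mob M z) \<partial>count_space (mats (int n))) \<partial>hyp)"
 by (rule integral_mats_swap(1)[OF _ _ n'(2) fin]) measurable
 have mF: "(%z. rho z * (f.F0 z * g.F0 z)) \<in> borel_measurable hyp"
 by (rule measurable_compose[OF _ borel_measurable_times[OF measurable_rho borel_measurable_times[OF f.F0_measurable g.F0_measurable]], of id, simplified]) simp
 have "(\<integral>z. ?P z * (\<integral>M. ?R (mob M z) \<partial>count_space (mats (int n))) \<partial>hyp) = (\<integral>z. sqrt (real n) * lf n * (rho z * (f.F0 z * g.F0 z)) \<partial>hyp)"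
 proof (rule integral_cong_AE)
 show "AE z in hyp. ?P z * (\<integral>M. ?R (mob M z) \<partial>count_space (mats (int n))) = sqrt (real n) * lf n * (rho z * (f.F0 z * g.F0 z))"
 using AE_hyp by eventually_elim (simp add: val del: mob_simp)
 qed (use mF in \<open>auto intro!: borel_measurable_times borel_measurable_integral_count_space simp del: mob_simp\<close>)
 moreover have "(\<integral>z. ?R z * (\<integral>M. ?P (mob M z) \<partial>count_space (mats (int n))) \<partial>hyp) = (\<integral>z. sqrt (real n) * lg n * (rho z * (f.F0 z * g.F0 z)) \<partial>hyp)"
 proof (rule integral_cong_AE)
 show "AE z in hyp. ?R z * (\<integral>M. ?P (mob M z) \<partial>count_space (mats (int n))) = sqrt (real n) * lg n * (rho z * (f.F0 z * g.F0 z))"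
 using AE_hyp by eventually_elim (simp add: val del: mob_simp)
 qed (use mF in \<open>auto intro!: borel_measurable_times borel_measurable_integral_count_space simp del: mob_simp\<close>)
 ultimately have "sqrt (real n) * lf n * (\<integral>z. rho z * (f.F0 z * g.F0 z) \<partial>hyp) = sqrt (real n) * lg n * (\<integral>z. rho z * (f.F0 z * g.F0 z) \<partial>hyp)"
 using sw by (simp only: integral_mult_right_zero)
 thus ?thesis using neq n by simp
qed

lemma FE_hecke:
 assumes cc: "c1 = c2" and n: "n >= 1" and neq: "lf n ~= lg n" and t: "t > 0"
 shows "Ssum u v L 0 t = Ssum u v L 0 (1 / t) / t"
proof -
 obtain B1 where B1: "!!z. Im z > 0 ==> \<bar>F z\<bar> <= B1" using f.F_bounded by blast
 obtain B2 where B2: "!!z. Im z > 0 ==> \<bar>G z\<bar> <= B2" using g.F_bounded by blast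
 let ?h = "%z. f.F0 z * g.F0 z"
 have "strip_sum 0 (%y. \<integral>x. indicator {0..<1} x * ?h (Complex x y) \<partial>lborel) t
 = strip_sum 0 (%y. \<integral>x. indicator {0..<1} x * ?h (Complex x y) \<partial>lborel) (1 / t) / t"
 proof (rule functional_equation_weight0[OF _ t _ _ _ _ _ hecke_orthogonal[OF n neq]])
 show "\<bar>?h z\<bar> <= (f.FB * g.FB) / Im z ^ 8" if z: "Im z > 0" for z
 proof -
 have "\<bar>?h z\<bar> <= (f.FB / Im z ^ 4) * (g.FB / Im z ^ 4)" unfolding abs_mult f.F0_eq[OF z] g.F0_eq[OF z]
 using z f.FB_nonneg by (intro mult_mono f.F_bound g.F_bound) auto
 also have "... = (f.FB * g.FB) / Im z ^ (4 + 4)" by (simp only: power_add times_divide_times_eq)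
 finally show ?thesis by simp
 qed
 show "?h (mob M z) = ?h z" if "Im z > 0" "M \<in> mats 1" for z M
 using f.F0_inv[OF that] g.F0_inv[OF that] by (simp del: mob_simp)
 show "\<bar>?h z\<bar> <= B1 * B2" if z: "Im z > 0" for z
 unfolding abs_mult f.F0_eq[OF z] g.F0_eq[OF z] by (rule mult_mono[OF B1[OF z] B2[OF z]]) (use B1[OF z] in auto)
 qed (use f.FB_nonneg g.FB_nonneg in auto)
 thus ?thesis using section_weight0[OF cc t] section_weight0[OF cc, of "1 / t"] t by simp
qed

end

section \<open>Polynomial differential operators applied to V\<close>

text \<open>The operator \<open>X d/dX\<close> transported through multiplication by \<open>e\<^sup>-\<^sup>X\<close>.\<close>

definition dl :: "real poly => real poly" where
 "dl p = [:0, 1:] * (pderiv p - p)"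

text \<open>With \<delta> = a d/da this stands for (\<delta> + \<gamma>)^2 + \<mu>^2. The Gamma
  factors of V predict the operators to use: the shift s -> s + 2 multiplies them, up to a constant,
  by (s^2 + (u + v)^2) (s^2 + (u - v)^2).\<close>

definition Top :: "real => real => real poly => real poly" where
 "Top \<gamma> \<mu> p = dl (dl p) + smult (2 * \<gamma>) (dl p) + smult (\<gamma>\<^sup>2 + \<mu>\<^sup>2) p"

text \<open>V with a polynomial in X inserted. The operator a d/da acts on the polynomial by
  \<open>dl\<close> (\<open>VP_deriv\<close>), so iterated operators never leave this family and
  their size can be controlled through coefficients.\<close>

definition VP :: "real => real => real poly => real => real" where
 "VP u v p a = (\<integral>et. poly p (pi * a * exp (- et)) * exp (- (pi * a * exp (- et))) * (KA u et * KA v et) \<partial>lborel)"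

lemma VP_1: "VP u v 1 a = VV u v a"
 by (simp add: VP_def VV_def)

text \<open>Induction on the polynomial with the rate \<open>c\<close> left free: each further
  factor X is paid for by half of the rate.\<close>

lemma poly_exp_bound:
 fixes p :: "real poly"
 assumes "c > 0"
 shows "\<exists>C\<ge>0. \<forall>X\<ge>0. \<bar>poly p X\<bar> <= C * exp (c * X)"
 using assms
proof (induction p arbitrary: c)
 case 0
 show ?case by (intro exI[of _ 0]) simp
next
 case (pCons a p)
 then obtain C where C: "C >= 0" "!!X. X >= 0 ==> \<bar>poly p X\<bar> <= C * exp (c / 2 * X)"
 using pCons.IH[of "c / 2"] by auto
 show ?case
 proof (intro exI conjI allI impI)
 show "\<bar>a\<bar> + 2 / c * C >= 0" using C pCons.prems by auto
 fix X :: real assume X: "X >= 0"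
 have "c / 2 * X <= exp (c / 2 * X)" using exp_ge_add_one_self[of "c / 2 * X"] by linarith
 hence X': "X <= 2 / c * exp (c / 2 * X)" using pCons.prems by (simp add: field_simps)
 have "X * \<bar>poly p X\<bar> <= (2 / c * exp (c / 2 * X)) * (C * exp (c / 2 * X))"
 using X X' C pCons.prems by (intro mult_mono C) auto
 also have "... = 2 / c * C * (exp (c / 2 * X) * exp (c / 2 * X))" by simp
 also have "exp (c / 2 * X) * exp (c / 2 * X) = exp (c * X)" by (simp flip: exp_add)
 finally have 1: "X * \<bar>poly p X\<bar> <= 2 / c * C * exp (c * X)" .
 have "\<bar>a\<bar> * 1 <= \<bar>a\<bar> * exp (c * X)" using X pCons.prems by (intro mult_left_mono) auto
 hence "\<bar>a\<bar> + X * \<bar>poly p X\<bar> <= (\<bar>a\<bar> + 2 / c * C) * exp (c * X)" using 1 by (simp add: distrib_right)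
 moreover have "\<bar>poly (pCons a p) X\<bar> <= \<bar>a\<bar> + X * \<bar>poly p X\<bar>"
 using X abs_triangle_ineq[of a "X * poly p X"] by (simp add: abs_mult)
 ultimately show "\<bar>poly (pCons a p) X\<bar> <= (\<bar>a\<bar> + 2 / c * C) * exp (c * X)" by linarith
 qed
qed

lemma poly_exp_bound_half:
 fixes p :: "real poly"
 obtains C where "C >= 0" "!!X. X >= 0 ==> \<bar>poly p X\<bar> <= C * exp (X / 2)"
 using poly_exp_bound[of "1 / 2" p] by auto

lemma poly_measurable [measurable]: "poly (p :: real poly) \<in> borel_measurable borel"
 by (intro borel_measurable_continuous_onI continuous_intros)

lemma VP_integrand_bound:
 assumes C: "!!X. X >= 0 ==> \<bar>poly p X\<bar> <= C * exp (X / 2)" and X: "X >= 0"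
 shows "\<bar>poly p X * exp (- X) * (KA u et * KA v et)\<bar> <= C * (exp (- et) * exp (- (X / 2)) * exp (- 2 * Yv et))"
proof -
 have "\<bar>poly p X * exp (- X)\<bar> = \<bar>poly p X\<bar> * exp (- X)" by (simp add: abs_mult)
 also have "... <= C * exp (X / 2) * exp (- X)" by (intro mult_right_mono C X) auto
 also have "... = C * (exp (X / 2) * exp (- X))" by simp
 also have "exp (X / 2) * exp (- X) = exp (- (X / 2))" by (simp flip: exp_add)
 finally have 1: "\<bar>poly p X * exp (- X)\<bar> <= C * exp (- (X / 2))" .
 have "\<bar>poly p X * exp (- X)\<bar> * \<bar>KA u et * KA v et\<bar> <= (C * exp (- (X / 2))) * (exp (- et) * exp (- 2 * Yv et))"
 using order_trans[OF abs_ge_zero 1] by (intro mult_mono 1 KAKA_bound) auto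
 thus ?thesis by (simp add: abs_mult mult_ac)
qed

lemma integrable_VP:
 assumes a: "a > 0"
 shows "integrable lborel (%et. poly p (pi * a * exp (- et)) * exp (- (pi * a * exp (- et))) * (KA u et * KA v et))"
proof -
 obtain C where C: "C >= 0" "!!X. X >= 0 ==> \<bar>poly p X\<bar> <= C * exp (X / 2)" using poly_exp_bound_half[of p] by blast
 show ?thesis
 proof (rule Bochner_Integration.integrable_bound[OF integrable_mult_right[OF integrable_Eint(1)[of 1 "pi * a / 2"], of C]])
 show "AE et in lborel. norm (poly p (pi * a * exp (- et)) * exp (- (pi * a * exp (- et))) * (KA u et * KA v et))
 <= norm (C * (exp (- real 1 * et) * exp (- (pi * a / 2 * exp (- et)))))"
 proof (rule AE_I2)
 fix et
 have "\<bar>poly p (pi * a * exp (- et)) * exp (- (pi * a * exp (- et))) * (KA u et * KA v et)\<bar>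
 <= C * (exp (- et) * exp (- (pi * a * exp (- et) / 2)) * exp (- 2 * Yv et))"
 using a by (intro VP_integrand_bound C) auto
 also have "... <= C * (exp (- et) * exp (- (pi * a * exp (- et) / 2)) * 1)"
 using C Yv_pos[of et] by (intro mult_left_mono) auto
 finally show "norm (poly p (pi * a * exp (- et)) * exp (- (pi * a * exp (- et))) * (KA u et * KA v et))
 <= norm (C * (exp (- real 1 * et) * exp (- (pi * a / 2 * exp (- et)))))" using C by (simp add: abs_mult)
 qed
 qed (use a in auto)
qed

definition KV :: real where "KV = 4 * Eint 1 / pi"

lemma KV_nonneg: "KV >= 0"
 using Eint_nonneg by (simp add: KV_def)

lemma exp_am_gm:
 fixes p q c :: real
 assumes p: "p >= 0" and q: "q >= 0" and c: "c^2 = 4 * (p * q)"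
 shows "exp (- (2 * p)) * exp (- q) <= exp (- c) * exp (- p)"
proof -
 have "(p + q)^2 - 4 * (p * q) = (p - q)^2" by algebra
 hence "c^2 <= (p + q)^2" unfolding c using zero_le_power2[of "p - q"] by linarith
 hence "c <= p + q" by (rule power2_le_imp_le) (use p q in simp)
 hence "- (2 * p) + - q <= - c + - p" by linarith
 thus ?thesis by (simp only: exp_add[symmetric] exp_le_cancel_iff)
qed

text \<open>The product X Y = 2 pi^2 a does not depend on the integration variable, so X / 4 + 2 Y
  >= 2 pi sqrt a by the inequality of the means. Half of X went into the polynomial, and the last
  quarter keeps the integral convergent. The bound is uniform in u and v.\<close>

lemma VP_bound:
 assumes a: "a > 0" and C: "!!X. X >= 0 ==> \<bar>poly p X\<bar> <= C * exp (X / 2)"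
 shows "\<bar>VP u v p a\<bar> <= C * (KV / a * exp (- (2 * pi * sqrt a)))"
proof -
 have C0: "C >= 0" using C[of 0] by simp
 let ?E = "exp (- (2 * pi * sqrt a))"
 let ?g = "%et. C * ?E * (exp (- real 1 * et) * exp (- (pi * a / 4 * exp (- et))))"
 have i2: "integrable lborel ?g"
 by (rule integrable_mult_right[OF integrable_Eint(1)[of 1 "pi * a / 4"]]) (use a in simp_all)
 have pw: "norm (poly p (pi * a * exp (- et)) * exp (- (pi * a * exp (- et))) * (KA u et * KA v et)) <= ?g et" for et
 proof -
 let ?X = "pi * a * exp (- et)"
 have X: "?X >= 0" using a by simp
 have "(2 * pi * sqrt a)^2 = 4 * (?X / 4 * (2 * Yv et))"
 using a by (simp add: Yv_def exp_minus power_mult_distrib power2_eq_square)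
 hence "exp (- (2 * (?X / 4))) * exp (- (2 * Yv et)) <= ?E * exp (- (?X / 4))"
 using X Yv_pos[of et] by (intro exp_am_gm) auto
 hence "exp (- (?X / 2)) * exp (- 2 * Yv et) <= ?E * exp (- (?X / 4))" by (simp add: mult.assoc)
 hence "C * (exp (- et) * (exp (- (?X / 2)) * exp (- 2 * Yv et))) <= C * (exp (- et) * (?E * exp (- (?X / 4))))"
 using C0 by (intro mult_left_mono) auto
 also have "... = ?g et" by simp
 finally have "C * (exp (- et) * exp (- (?X / 2)) * exp (- 2 * Yv et)) <= ?g et" by (simp only: mult.assoc)
 from order_trans[OF VP_integrand_bound[OF C X] this] show ?thesis unfolding real_norm_def .
 qed
 have "\<bar>VP u v p a\<bar> <= (\<integral>et. ?g et \<partial>lborel)"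
 unfolding VP_def real_norm_def[symmetric] by (rule Bochner_Integration.integral_norm_bound_integral[OF integrable_VP[OF a] i2 pw])
 also have "... = C * ?E * (Eint 1 / (pi * a / 4) ^ 1)"
 unfolding integral_mult_right_zero by (subst integrable_Eint(2)) (use a in auto)
 also have "Eint 1 / (pi * a / 4) ^ 1 = KV / a" by (simp add: KV_def)
 also have "C * ?E * (KV / a) = C * (KV / a * ?E)" by (simp only: mult_ac)
 finally show ?thesis .
qed

lemma VP_deriv:
 assumes a: "a > 0"
 shows "(VP u v p has_real_derivative VP u v (dl p) a / a) (at a)"
proof -
 obtain C where C: "C >= 0" "!!X. X >= 0 ==> \<bar>poly (dl p) X\<bar> <= C * exp (X / 2)" using poly_exp_bound_half[of "dl p"] by blast
 let ?f = "%et s. poly p (pi * s * exp (- et)) * exp (- (pi * s * exp (- et))) * (KA u et * KA v et)"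
 let ?f' = "%et s. poly (dl p) (pi * s * exp (- et)) * exp (- (pi * s * exp (- et))) * (KA u et * KA v et) / s"
 have "((%s. \<integral>et. ?f et s \<partial>lborel) has_real_derivative (\<integral>et. ?f' et a \<partial>lborel)) (at a)"
 proof (rule has_real_derivative_integral(1)[where e = "a / 2"])
 show "a / 2 > 0" using a by simp
 fix s assume s: "\<bar>s - a\<bar> < a / 2"
 hence s0: "s > 0" "a / 2 <= s" by linarith+
 show "integrable lborel (%et. ?f et s)" by (rule integrable_VP[OF s0(1)])
 fix et
 let ?X = "pi * s * exp (- et)"
 have "((%s. poly p (pi * s * exp (- et)) * exp (- (pi * s * exp (- et)))) has_real_derivative
 poly (pderiv p) ?X * (pi * exp (- et)) * exp (- ?X) + - (pi * exp (- et)) * exp (- ?X) * poly p ?X) (at s)"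
 by (auto intro!: derivative_eq_intros)
 also have "poly (pderiv p) ?X * (pi * exp (- et)) * exp (- ?X) + - (pi * exp (- et)) * exp (- ?X) * poly p ?X = poly (dl p) ?X * exp (- ?X) / s"
 proof -
 have "poly (dl p) ?X * exp (- ?X) / s = pi * exp (- et) * (poly (pderiv p) ?X - poly p ?X) * exp (- ?X)"
 using s0 by (simp add: dl_def)
 thus ?thesis by (simp only:) (simp add: algebra_simps)
 qed
 finally have "((%s. poly p (pi * s * exp (- et)) * exp (- (pi * s * exp (- et)))) has_real_derivative poly (dl p) ?X * exp (- ?X) / s) (at s)" .
 from DERIV_cmult_right[OF this] show "(?f et has_real_derivative ?f' et s) (at s)" by simp
 have "\<bar>poly (dl p) ?X * exp (- ?X) * (KA u et * KA v et)\<bar> <= C * (exp (- et) * exp (- (?X / 2)) * exp (- 2 * Yv et))"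
 using s0 by (intro VP_integrand_bound C) auto
 also have "... <= C * (exp (- et) * exp (- (pi * a / 4 * exp (- et))) * 1)"
 proof -
 have "pi * a / 4 * exp (- et) <= ?X / 2" using s0 by simp
 thus ?thesis using C Yv_pos[of et] by (intro mult_left_mono mult_mono) auto
 qed
 finally have "\<bar>?f' et s\<bar> <= (C * (exp (- et) * exp (- (pi * a / 4 * exp (- et))) * 1)) / s"
 using s0 unfolding abs_divide by (simp only: abs_of_pos divide_right_mono less_imp_le)
 also have "... <= (C * (exp (- et) * exp (- (pi * a / 4 * exp (- et))) * 1)) / (a / 2)"
 using C s0 a by (intro divide_left_mono) auto
 finally show "\<bar>?f' et s\<bar> <= (C / (a / 2)) * (exp (- real 1 * et) * exp (- (pi * a / 4 * exp (- et))))" by (simp add: mult_ac)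
 next
 show "integrable lborel (%et. (C / (a / 2)) * (exp (- real 1 * et) * exp (- (pi * a / 4 * exp (- et)))))"
 using a by (intro integrable_mult_right integrable_Eint) auto
 qed
 thus ?thesis by (simp add: VP_def[abs_def])
qed

lemma VP_add: "a > 0 ==> VP u v (p + q) a = VP u v p a + VP u v q a"
 using Bochner_Integration.integral_add[OF integrable_VP[of a p u v] integrable_VP[of a q u v]]
 unfolding VP_def poly_add distrib_right by simp

lemma VP_smult: "VP u v (smult c p) a = c * VP u v p a"
 unfolding VP_def poly_smult mult.assoc integral_mult_right_zero ..

lemma KAKD_bound: "\<bar>KA u et\<bar> <= 3 * (exp (- et / 2) * exp (- Yv et / 2))"
proof -
 have "exp (- Yv et) <= exp (- Yv et / 2)" using Yv_pos[of et] by simp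
 hence "\<bar>KA u et\<bar> <= exp (- et / 2) * exp (- Yv et / 2)" by (intro order_trans[OF KA_bound] mult_left_mono) auto
 moreover have "0 <= exp (- et / 2) * exp (- Yv et / 2)" by simp
 ultimately show ?thesis by linarith
qed

text \<open>The Bessel bounds win at one end and exp (- X) at the other, against any powers of X and
  Y; this disposes of the boundary values of \<open>Z\<close> in \<open>VP_ode\<close>.\<close>

lemma boundary_term:
 assumes a: "a > 0" and A: "!!et. \<bar>A et\<bar> <= 3 * (exp (- et / 2) * exp (- Yv et / 2))"
 and B: "!!et. \<bar>B et\<bar> <= 3 * (exp (- et / 2) * exp (- Yv et / 2))"
 and F: "F = at_top \<or> F = at_bot"
 shows "((%et. (pi * a * exp (- et)) ^ i * Yv et ^ j * exp (- (pi * a * exp (- et))) * (A et * B et)) \<longlongrightarrow> 0) F"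
proof -
 let ?K = "fact i * 2 ^ i * fact j * 9 :: real"
 have bd: "norm ((pi * a * exp (- et)) ^ i * Yv et ^ j * exp (- (pi * a * exp (- et))) * (A et * B et)) <= ?K * (exp (- (pi * a / 2 * exp (- et))) * exp (- et))" for et
 proof -
 define X where "X = pi * a * exp (- et)"
 have X: "X >= 0" using a by (simp add: X_def)
 have x: "X ^ i * exp (- X) <= fact i * 2 ^ i * exp (- (X / 2))" using power_exp_le[of 1 X i] X by simp
 have y: "Yv et ^ j * exp (- Yv et) <= fact j" using Yv_pos[of et] by (intro power_exp_le_fact) auto
 have "\<bar>A et * B et\<bar> <= (3 * (exp (- et / 2) * exp (- Yv et / 2))) * (3 * (exp (- et / 2) * exp (- Yv et / 2)))"
 unfolding abs_mult by (intro mult_mono A B) auto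
 also have "... = 9 * ((exp (- et / 2))^2 * (exp (- Yv et / 2))^2)" by (simp only: power2_eq_square) simp
 finally have ab: "\<bar>A et * B et\<bar> <= 9 * (exp (- et) * exp (- Yv et))" unfolding exp_half_square .
 have "norm (X ^ i * Yv et ^ j * exp (- X) * (A et * B et)) = (X ^ i * exp (- X)) * (Yv et ^ j * \<bar>A et * B et\<bar>)"
 using X Yv_pos[of et] by (simp add: abs_mult mult_ac)
 also have "... <= (fact i * 2 ^ i * exp (- (X / 2))) * (Yv et ^ j * (9 * (exp (- et) * exp (- Yv et))))"
 using X Yv_pos[of et] by (intro mult_mono x ab mult_left_mono) auto
 also have "... = (fact i * 2 ^ i * exp (- (X / 2))) * (9 * exp (- et) * (Yv et ^ j * exp (- Yv et)))" by simp
 also have "... <= (fact i * 2 ^ i * exp (- (X / 2))) * (9 * exp (- et) * fact j)"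
 using y by (intro mult_left_mono) auto
 finally show ?thesis unfolding X_def by (simp add: mult_ac)
 qed
 have "((%et::real. ?K * (exp (- (pi * a / 2 * exp (- et))) * exp (- et))) \<longlongrightarrow> 0) F"
 proof -
 have b: "pi * a / 2 > 0" using a by simp
 have "((%et::real. exp (- (b * exp (- et))) * exp (- et)) \<longlongrightarrow> 0) at_top" "((%et::real. exp (- (b * exp (- et))) * exp (- et)) \<longlongrightarrow> 0) at_bot"
 if "b > 0" for b using that by real_asymp+
 from this[OF b] show ?thesis using F by (auto intro!: tendsto_mult_right_zero simp only:)
 qed
 thus ?thesis by (rule Lim_null_comparison[OF always_eventually[OF allI[OF bd]]])
qed

text \<open>The polynomial identity behind \<open>VP_ode\<close>: the left side is the product rule
  applied to \<open>Z\<close>, with second derivatives of the Bessel functions already eliminated;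
  on the right only the product K_iu K_iv is left.\<close>

lemma ode_algebra:
 fixes x y u v A1 A2 D1 D2 E :: real
 shows "x * E * ((v^2 - u\<^sup>2) * (D1 * A2 - A1 * D2) + 2 * x * (D1 * D2) + (x - x\<^sup>2) * (D1 * A2 + A1 * D2)
 + (x * (1 + u^2 + v^2) - 3 * x^2 + x ^ 3 - 2 * x * y^2) * (A1 * A2))
 + E * ((v^2 - u\<^sup>2) * ((y^2 - u\<^sup>2) * A1 * A2 + D1 * D2 - (D1 * D2 + A1 * ((y^2 - v\<^sup>2) * A2)))
 + (2 * (- x) * (D1 * D2) + 2 * x * ((y^2 - u\<^sup>2) * A1 * D2 + D1 * ((y^2 - v\<^sup>2) * A2)))
 + ((- x - 2 * x * (- x)) * (D1 * A2 + A1 * D2) + (x - x\<^sup>2) * ((y^2 - u\<^sup>2) * A1 * A2 + D1 * D2 + (D1 * D2 + A1 * ((y^2 - v\<^sup>2) * A2))))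
 + ((- x * (1 + u^2 + v^2) - 3 * (2 * x * (- x)) + 3 * x^2 * (- x) - (2 * (- x) * y^2 + 2 * x * (2 * y * y))) * (A1 * A2)
 + (x * (1 + u^2 + v^2) - 3 * x^2 + x ^ 3 - 2 * x * y^2) * (D1 * A2 + A1 * D2))) = (((- x + 7 * x^2 - 6 * x ^ 3 + x ^ 4) + 2 * (u^2 + v^2) * (- x + x^2) + (u^2 - v\<^sup>2)^2) - 4 * (x^2 * y^2)) * E * (A1 * A2)"
 by algebra

text \<open>The differential equation of \<open>V\<close>: the left side minus the right side is the integral of the
 derivative of \<open>Z\<close>, found by moving \<open>d/d(et)\<close> onto \<open>K\<^sub>i\<^sub>u K\<^sub>i\<^sub>v\<close> and using that \<open>X Y\<close> does not depend on \<open>et\<close>.\<close>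

lemma VP_ode:
 assumes a: "a > 0"
 shows "VP u v (Top 0 (u + v) (Top 0 (u - v) 1)) a = 16 * pi ^ 4 * a^2 * VP u v 1 a"
proof -
 define X where "X = (%et. pi * a * exp (- et))"
 have X': "(X has_real_derivative - X et) (at et)" for et
 unfolding X_def by (auto intro!: derivative_eq_intros)
 have E': "((%et. exp (- X et)) has_real_derivative X et * exp (- X et)) (at et)" for et
 by (auto intro!: derivative_eq_intros X')
 have XY: "(X et)^2 * (Yv et)^2 = 4 * pi ^ 4 * a^2" for et
 proof -
 have "X et * Yv et = 2 * pi^2 * a" by (simp add: X_def Yv_def exp_minus power2_eq_square)
 hence "(X et * Yv et)^2 = (2 * pi^2 * a)^2" by simp
 thus ?thesis by (simp add: power_mult_distrib flip: power_mult)
 qed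
 define P where "P = Top 0 (u + v) (Top 0 (u - v) 1)"
 have P: "poly P x = (- x + 7 * x^2 - 6 * x ^ 3 + x ^ 4) + 2 * (u^2 + v^2) * (- x + x^2) + (u^2 - v\<^sup>2)^2" for x
 unfolding P_def Top_def dl_def by (simp add: pderiv_mult pderiv_add pderiv_smult pderiv_diff pderiv_pCons pderiv_minus algebra_simps power2_eq_square power3_eq_cube power4_eq_xxxx)
 define Z where "Z = (%et. exp (- X et) * ((v^2 - u\<^sup>2) * (KD u et * KA v et - KA u et * KD v et) + 2 * X et * (KD u et * KD v et)
 + (X et - (X et)\<^sup>2) * (KD u et * KA v et + KA u et * KD v et)
 + (X et * (1 + u^2 + v^2) - 3 * (X et)^2 + X et ^ 3 - 2 * X et * (Yv et)^2) * (KA u et * KA v et)))"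
 let ?z = "%et. poly P (X et) * exp (- X et) * (KA u et * KA v et) - 16 * pi ^ 4 * a^2 * (poly 1 (X et) * exp (- X et) * (KA u et * KA v et))"
 have i: "integrable lborel (%et. poly P (X et) * exp (- X et) * (KA u et * KA v et))" "integrable lborel (%et. 16 * pi ^ 4 * a^2 * (poly 1 (X et) * exp (- X et) * (KA u et * KA v et)))"
 unfolding X_def by (rule integrable_VP[OF a], rule integrable_mult_right[OF integrable_VP[OF a]])
 have cKA: "continuous_on UNIV (KA u)" for u
 using KA_deriv by (auto intro!: DERIV_continuous_on[of UNIV] intro: has_field_derivative_at_within)
 have "(\<integral>et. ?z et \<partial>lborel) = 0"
 proof (rule integral_FTC_whole_line[where F = Z])
 fix et
 define A1 A2 D1 D2 x y E where defs: "A1 = KA u et" "A2 = KA v et" "D1 = KD u et" "D2 = KD v et" "x = X et" "y = Yv et" "E = exp (- X et)"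
 let ?D = "x * E * ((v^2 - u\<^sup>2) * (D1 * A2 - A1 * D2) + 2 * x * (D1 * D2) + (x - x\<^sup>2) * (D1 * A2 + A1 * D2)
 + (x * (1 + u^2 + v^2) - 3 * x^2 + x ^ 3 - 2 * x * y^2) * (A1 * A2))
 + E * ((v^2 - u\<^sup>2) * ((y^2 - u\<^sup>2) * A1 * A2 + D1 * D2 - (D1 * D2 + A1 * ((y^2 - v\<^sup>2) * A2)))
 + (2 * (- x) * (D1 * D2) + 2 * x * ((y^2 - u\<^sup>2) * A1 * D2 + D1 * ((y^2 - v\<^sup>2) * A2)))
 + ((- x - 2 * x * (- x)) * (D1 * A2 + A1 * D2) + (x - x\<^sup>2) * ((y^2 - u\<^sup>2) * A1 * A2 + D1 * D2 + (D1 * D2 + A1 * ((y^2 - v\<^sup>2) * A2))))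
 + ((- x * (1 + u^2 + v^2) - 3 * (2 * x * (- x)) + 3 * x^2 * (- x) - (2 * (- x) * y^2 + 2 * x * (2 * y * y))) * (A1 * A2)
 + (x * (1 + u^2 + v^2) - 3 * x^2 + x ^ 3 - 2 * x * y^2) * (D1 * A2 + A1 * D2)))"
 have d1: "(Z has_real_derivative ?D) (at et)"
 unfolding Z_def defs by (rule derivative_eq_intros X' E' KA_deriv KD_deriv Yv_deriv refl)+ (simp add: mult_ac)
 have d2: "?D = (poly P x - 4 * (x^2 * y^2)) * E * (A1 * A2)"
 unfolding P by (rule ode_algebra)
 have d3: "?z et = (poly P x - 4 * (x^2 * y^2)) * E * (A1 * A2)"
 unfolding defs XY by (simp add: left_diff_distrib)
 show "(Z has_real_derivative ?z et) (at et)" using d1 unfolding d2 d3 .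
 next
 show "continuous_on UNIV ?z" unfolding X_def by (intro continuous_intros cKA)
 show "integrable lborel ?z" by (rule Bochner_Integration.integrable_diff[OF i])
 have b: "((%et. X et ^ i * Yv et ^ j * exp (- X et) * (A et * B et)) \<longlongrightarrow> 0) F"
 if "A = KA u \<or> A = KD u" "B = KA v \<or> B = KD v" "F = at_top \<or> F = at_bot" for i j A B F
 unfolding X_def by (rule boundary_term[OF a _ _ that(3)]; use that(1,2) KAKD_bound KD_bound in metis)
 have Zeq: "Z = (%et. (v^2 - u\<^sup>2) * (X et ^ 0 * Yv et ^ 0 * exp (- X et) * (KD u et * KA v et)) + (u^2 - v\<^sup>2) * (X et ^ 0 * Yv et ^ 0 * exp (- X et) * (KA u et * KD v et))
 + 2 * (X et ^ 1 * Yv et ^ 0 * exp (- X et) * (KD u et * KD v et))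
 + (X et ^ 1 * Yv et ^ 0 * exp (- X et) * (KD u et * KA v et)) + (X et ^ 1 * Yv et ^ 0 * exp (- X et) * (KA u et * KD v et))
 + (- 1) * (X et ^ 2 * Yv et ^ 0 * exp (- X et) * (KD u et * KA v et)) + (- 1) * (X et ^ 2 * Yv et ^ 0 * exp (- X et) * (KA u et * KD v et))
 + (1 + u^2 + v^2) * (X et ^ 1 * Yv et ^ 0 * exp (- X et) * (KA u et * KA v et)) + (- 3) * (X et ^ 2 * Yv et ^ 0 * exp (- X et) * (KA u et * KA v et))
 + (X et ^ 3 * Yv et ^ 0 * exp (- X et) * (KA u et * KA v et)) + (- 2) * (X et ^ 1 * Yv et ^ 2 * exp (- X et) * (KA u et * KA v et)))"
 unfolding Z_def by (rule ext) (simp add: algebra_simps)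
 have lim: "(Z \<longlongrightarrow> 0) F" if "F = at_top \<or> F = at_bot" for F
 unfolding Zeq using that by (intro tendsto_add_zero tendsto_mult_right_zero b) auto
 show "(Z \<longlongrightarrow> 0) at_bot" "(Z \<longlongrightarrow> 0) at_top" using lim by auto
 qed
 hence "VP u v P a - 16 * pi ^ 4 * a^2 * VP u v 1 a = 0"
 unfolding Bochner_Integration.integral_diff[OF i] integral_mult_right_zero by (simp add: VP_def X_def)
 thus ?thesis by (simp add: P_def)
qed

lemma dl_add: "dl (p + q) = dl p + dl q" and dl_smult: "dl (smult c p) = smult c (dl p)"
 by (simp_all add: dl_def pderiv_add pderiv_smult algebra_simps smult_diff_right)

lemma VP_Top:
 assumes "a > 0"
 shows "VP u v (Top \<gamma> \<mu> p) a = VP u v (dl (dl p)) a + 2 * \<gamma> * VP u v (dl p) a + (\<gamma>\<^sup>2 + \<mu>\<^sup>2) * VP u v p a"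
 using assms by (simp add: Top_def VP_add VP_smult)

lemma VP_transfer_dl:
 assumes eq: "!!a. a > 0 ==> VP u v p a = C * a ^ n * VP u v q a" and a: "a > 0"
 shows "VP u v (dl p) a = C * a ^ n * VP u v (dl q + smult (real n) q) a"
proof -
 have "(VP u v p has_real_derivative VP u v (dl p) a / a) (at a)" by (rule VP_deriv[OF a])
 hence 1: "((%a. C * a ^ n * VP u v q a) has_real_derivative VP u v (dl p) a / a) (at a)"
 by (rule has_field_derivative_transform_within_open[where S = "{0<..}"]) (use a eq in auto)
 have "((%a. C * a ^ n * VP u v q a) has_real_derivative C * (real n * a ^ (n - 1)) * VP u v q a + VP u v (dl q) a / a * (C * a ^ n)) (at a)"
 by (intro DERIV_mult VP_deriv a DERIV_cmult) (auto intro!: derivative_eq_intros)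
 note * = DERIV_unique[OF 1 this]
 have "VP u v (dl p) a = a * (VP u v (dl p) a / a)" using a by simp
 also have "... = a * (C * (real n * a ^ (n - 1)) * VP u v q a + VP u v (dl q) a / a * (C * a ^ n))" by (simp only: *)
 also have "... = C * (real n * (a * a ^ (n - 1))) * VP u v q a + VP u v (dl q) a * (C * a ^ n)" using a by (simp add: distrib_left mult_ac)
 also have "real n * (a * a ^ (n - 1)) = real n * a ^ n" by (cases n) auto
 finally show ?thesis using a by (simp add: VP_add VP_smult algebra_simps)
qed

text \<open>Passing a^n to the left of \<delta> = a d/da turns it into \<delta> + n, so \<gamma>
  moves to \<gamma> + n.\<close>

lemma VP_transfer:
 assumes eq: "!!a. a > 0 ==> VP u v p a = C * a ^ n * VP u v q a" and a: "a > 0"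
 shows "VP u v (Top \<gamma> \<mu> p) a = C * a ^ n * VP u v (Top (\<gamma> + real n) \<mu> q) a"
proof -
 have 1: "VP u v (dl p) a = C * a ^ n * VP u v (dl q + smult (real n) q) a" if "a > 0" for a
 by (rule VP_transfer_dl[OF eq that])
 have 2: "VP u v (dl (dl p)) a = C * a ^ n * VP u v (dl (dl q + smult (real n) q) + smult (real n) (dl q + smult (real n) q)) a" if "a > 0" for a
 by (rule VP_transfer_dl[OF 1 that])
 show ?thesis
 unfolding VP_Top[OF a] 2[OF a] 1[OF a] eq[OF a]
 using a by (simp add: dl_add dl_smult VP_add VP_smult algebra_simps power2_eq_square)
qed

text \<open>The parameter -2 k undoes the shift caused by the factor a^(2k) already collected, so
  the differential equation of V applies afresh at every step.\<close>

primrec Pprim :: "real => real => nat => real poly" where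
 "Pprim u v 0 = 1"
| "Pprim u v (Suc k) = Top (- (2 * real k)) (u + v) (Top (- (2 * real k)) (u - v) (Pprim u v k))"

text \<open>Under t -> 1 / t with the factor t^(-w) the operator \<delta> becomes -(\<delta> + w),
  which sends the parameter -2 k of \<open>Pprim\<close> to w + 2 k.\<close>

primrec Pdual :: "real => real => nat => nat => real poly" where
 "Pdual u v w 0 = 1"
| "Pdual u v w (Suc k) = Top (real w + 2 * real k) (u + v) (Top (real w + 2 * real k) (u - v) (Pdual u v w k))"

lemma VP_Pprim: "a > 0 ==> VP u v (Pprim u v k) a = (16 * pi ^ 4) ^ k * a ^ (2 * k) * VP u v 1 a"
proof (induction k arbitrary: a)
 case (Suc k)
 have "VP u v (Pprim u v (Suc k)) a = (16 * pi ^ 4) ^ k * a ^ (2 * k) * VP u v (Top (- (2 * real k) + real (2 * k)) (u + v) (Top (- (2 * real k) + real (2 * k)) (u - v) 1)) a"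
 unfolding Pprim.simps by (intro VP_transfer Suc)
 also have "... = (16 * pi ^ 4) ^ k * a ^ (2 * k) * (16 * pi ^ 4 * a^2 * VP u v 1 a)"
 using VP_ode[OF Suc.prems] by simp
 finally show ?case by (simp add: power2_eq_square mult_ac)
qed simp

section \<open>Coefficientwise majorants\<close>

text \<open>The number of operators grows with k, and bounds on values cannot be carried through
  derivatives, whereas bounds on coefficients can.\<close>

definition maj :: "real poly => real poly => bool" where
 "maj p q \<longleftrightarrow> (\<forall>i. \<bar>coeff p i\<bar> <= coeff q i)"

lemma maj_nonneg: "maj p q ==> coeff q i >= 0"
 unfolding maj_def using order_trans[OF abs_ge_zero] by blast

lemma maj_trans: "maj p q ==> maj q r ==> maj p r"
 unfolding maj_def by (meson abs_ge_self order_trans)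

lemma maj_pCons [simp]: "maj (pCons a p) (pCons b q) \<longleftrightarrow> \<bar>a\<bar> <= b \<and> maj p q"
 by (auto simp: maj_def coeff_pCons split: nat.splits)

lemma maj_0 [simp]: "maj 0 0"
 by (simp add: maj_def)

lemma maj_poly: "maj p q ==> x >= 0 ==> \<bar>poly p x\<bar> <= poly q x"
proof (induction p q rule: poly_induct2)
 case (pCons a p b q)
 hence "\<bar>a\<bar> <= b" "\<bar>poly p x\<bar> <= poly q x" by auto
 hence "\<bar>a\<bar> + x * \<bar>poly p x\<bar> <= b + x * poly q x" using pCons.prems by (intro add_mono mult_left_mono)
 moreover have "\<bar>a + x * poly p x\<bar> <= \<bar>a\<bar> + x * \<bar>poly p x\<bar>"
 using pCons.prems abs_triangle_ineq[of a "x * poly p x"] by (simp add: abs_mult)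
 ultimately show ?case by simp
qed simp

lemma maj_add: "maj p q ==> maj p' q' ==> maj (p + p') (q + q')"
 unfolding maj_def coeff_add by (meson abs_triangle_ineq add_mono order_trans)

lemma maj_minus: "maj p q ==> maj (- p) q"
 by (simp add: maj_def)

lemma maj_smult: "maj p q ==> \<bar>c\<bar> <= d ==> maj (smult c p) (smult d q)"
 unfolding maj_def coeff_smult abs_mult by (auto intro!: mult_mono)

lemma maj_mult:
 assumes "maj p q" "maj p' q'"
 shows "maj (p * p') (q * q')"
 unfolding maj_def coeff_mult
proof
 fix i
 have "\<bar>\<Sum>j\<le>i. coeff p j * coeff p' (i - j)\<bar> <= (\<Sum>j\<le>i. \<bar>coeff p j * coeff p' (i - j)\<bar>)" by (rule sum_abs)
 also have "... <= (\<Sum>j\<le>i. coeff q j * coeff q' (i - j))"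
 using assms maj_nonneg[OF assms(1)] unfolding maj_def abs_mult by (intro sum_mono mult_mono) auto
 finally show "\<bar>\<Sum>j\<le>i. coeff p j * coeff p' (i - j)\<bar> <= (\<Sum>j\<le>i. coeff q j * coeff q' (i - j))" .
qed

lemma maj_pderiv: "maj p q ==> maj (pderiv p) (pderiv q)"
 unfolding maj_def coeff_pderiv abs_mult by (auto intro!: mult_mono)

lemma maj_dl: "maj p q ==> maj (dl p) ([:0, 1:] * (pderiv q + q))"
 unfolding dl_def diff_conv_add_uminus by (intro maj_mult maj_add maj_minus maj_pderiv) auto

text \<open>Applying X d/dX to (X + B)^n gives n X (X + B)^(n - 1), which is coefficientwise at most
  n (X + B)^n.\<close>

lemma maj_linear_power:
 assumes B: "B >= 0"
 shows "maj ([:B, 1:] ^ n) ([:B, 1:] ^ n)" and "maj ([:0, 1:] * pderiv ([:B, 1:] ^ n)) (smult (real n) ([:B, 1:] ^ n))"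
proof -
 show r: "maj ([:B, 1:] ^ n) ([:B, 1:] ^ n)" for n
 using B by (induction n) (auto simp: one_pCons simp del: mult_pCons_left intro!: maj_mult)
 show "maj ([:0, 1:] * pderiv ([:B, 1:] ^ n)) (smult (real n) ([:B, 1:] ^ n))"
 proof (cases n)
 case (Suc m)
 have e: "[:0, 1:] * pderiv ([:B, 1:] ^ n) = smult (real n) ([:0, 1:] * [:B, 1:] ^ m)"
 unfolding Suc pderiv_power_Suc by (simp add: pderiv_pCons)
 have e': "smult (real n) ([:B, 1:] ^ n) = smult (real n) ([:B, 1:] * [:B, 1:] ^ m)" unfolding Suc by simp
 show ?thesis unfolding e e' using B by (intro maj_smult maj_mult r) auto
 qed (simp add: maj_def)
qed

text \<open>Each operator raises the exponent by two: the quadratic factor that arises has constant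
  term at most B^2 and linear coefficient at most 2 B, so it is majorised by (X + B)^2.\<close>

lemma maj_Top:
 assumes p: "maj p ([:B, 1:] ^ n)" and B: "real n + 1 + \<bar>\<gamma>\<bar> + \<bar>\<mu>\<bar> <= B"
 shows "maj (Top \<gamma> \<mu> p) ([:B, 1:] ^ (n + 2))"
proof -
 define q where "q = [:B, 1:] ^ n"
 have B0: "B >= 0" using B by linarith
 have q: "maj q q" "maj ([:0, 1:] * pderiv q) (smult (real n) q)" unfolding q_def using maj_linear_power[OF B0] by auto
 have X: "maj [:0, 1:] ([:0, 1:] :: real poly)" by simp
 have Xn: "maj [:0, 1:] [:real n, 1:]" by simp
 have s1: "maj ([:0, 1:] * (pderiv q + q)) ([:real n, 1:] * q)"
 proof -
 have "[:real n, 1:] * q = smult (real n) q + [:0, 1:] * q" by simp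
 thus ?thesis unfolding distrib_left using maj_add[OF q(2) maj_mult[OF X q(1)]] by (simp only:)
 qed
 have d1: "maj (dl p) ([:real n, 1:] * q)" using maj_trans[OF maj_dl[OF p] ] s1 unfolding q_def by blast
 have d2: "maj (dl (dl p)) ([:real n + 1, 1:] * [:real n, 1:] * q)"
 proof -
 have "[:0, 1:] * (pderiv ([:real n, 1:] * q) + [:real n, 1:] * q) = [:0, 1:] * q + [:real n, 1:] * ([:0, 1:] * pderiv q) + [:real n, 1:] * ([:0, 1:] * q)"
 by (simp add: pderiv_add pderiv_smult pderiv_pCons algebra_simps smult_add_right)
 moreover have "maj ([:0, 1:] * q + [:real n, 1:] * ([:0, 1:] * pderiv q) + [:real n, 1:] * ([:0, 1:] * q))
 ([:real n, 1:] * q + [:real n, 1:] * smult (real n) q + [:real n, 1:] * ([:0, 1:] * q))"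
 by (intro maj_add maj_mult q X Xn) auto
 moreover have "[:real n, 1:] * q + [:real n, 1:] * smult (real n) q + [:real n, 1:] * ([:0, 1:] * q) = [:real n + 1, 1:] * [:real n, 1:] * q"
 proof -
 have "[:real n + 1, 1:] = 1 + [:real n:] + [:0, 1:]" by (simp add: one_pCons)
 moreover have "smult (real n) q = [:real n:] * q" by simp
 ultimately show ?thesis by (simp only: distrib_left distrib_right mult_1_left mult_1_right mult_ac)
 qed
 ultimately show ?thesis using maj_trans[OF maj_dl[OF d1]] by simp
 qed
 have pq: "maj p q" using p by (simp add: q_def)
 have "maj (Top \<gamma> \<mu> p) ([:real n + 1, 1:] * [:real n, 1:] * q + smult (2 * \<bar>\<gamma>\<bar>) ([:real n, 1:] * q) + smult (\<gamma>\<^sup>2 + \<mu>\<^sup>2) q)"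
 unfolding Top_def by (intro maj_add maj_smult d1 d2 pq) (auto simp: abs_mult)
 also have "[:real n + 1, 1:] * [:real n, 1:] * q + smult (2 * \<bar>\<gamma>\<bar>) ([:real n, 1:] * q) + smult (\<gamma>\<^sup>2 + \<mu>\<^sup>2) q
 = [:(real n + 1) * real n + 2 * \<bar>\<gamma>\<bar> * real n + (\<gamma>\<^sup>2 + \<mu>\<^sup>2), 2 * real n + 1 + 2 * \<bar>\<gamma>\<bar>, 1:] * q"
 proof -
 have "[:(real n + 1) * real n + 2 * \<bar>\<gamma>\<bar> * real n + (\<gamma>\<^sup>2 + \<mu>\<^sup>2), 2 * real n + 1 + 2 * \<bar>\<gamma>\<bar>, 1:] = [:real n + 1, 1:] * [:real n, 1:] + smult (2 * \<bar>\<gamma>\<bar>) [:real n, 1:] + [:\<gamma>\<^sup>2 + \<mu>\<^sup>2:]"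
 by simp
 moreover have "smult (2 * \<bar>\<gamma>\<bar>) ([:real n, 1:] * q) = smult (2 * \<bar>\<gamma>\<bar>) [:real n, 1:] * q" "smult (\<gamma>\<^sup>2 + \<mu>\<^sup>2) q = [:\<gamma>\<^sup>2 + \<mu>\<^sup>2:] * q" by (simp_all add: smult_add_right)
 ultimately show ?thesis by (simp only: distrib_right)
 qed
 finally have 1: "maj (Top \<gamma> \<mu> p) ([:(real n + 1) * real n + 2 * \<bar>\<gamma>\<bar> * real n + (\<gamma>\<^sup>2 + \<mu>\<^sup>2), 2 * real n + 1 + 2 * \<bar>\<gamma>\<bar>, 1:] * q)" .
 have "(real n + 1) * real n + 2 * \<bar>\<gamma>\<bar> * real n + (\<gamma>\<^sup>2 + \<mu>\<^sup>2) <= B * B"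
 proof -
 have "(real n + 1) * real n + 2 * \<bar>\<gamma>\<bar> * real n + (\<gamma>\<^sup>2 + \<mu>\<^sup>2) <= (real n + 1 + \<bar>\<gamma>\<bar> + \<bar>\<mu>\<bar>) * (real n + 1 + \<bar>\<gamma>\<bar> + \<bar>\<mu>\<bar>)"
 by (simp add: algebra_simps power2_eq_square)
 also have "... <= B * B" using B by (intro mult_mono) auto
 finally show ?thesis .
 qed
 hence "maj [:(real n + 1) * real n + 2 * \<bar>\<gamma>\<bar> * real n + (\<gamma>\<^sup>2 + \<mu>\<^sup>2), 2 * real n + 1 + 2 * \<bar>\<gamma>\<bar>, 1:] [:B * B, 2 * B, 1:]"
 using B by (auto intro!: add_nonneg_nonneg mult_nonneg_nonneg)
 moreover have "[:B * B, 2 * B, 1:] * q = [:B, 1:] ^ (n + 2)"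
 unfolding q_def power_add by (simp add: power2_eq_square)
 ultimately show ?thesis using maj_trans[OF 1] maj_mult[OF _ q(1)] by metis
qed

text \<open>After k steps the majorant has degree 4 k, and the parameters used stay below w + 2 k,
  so one \<open>B\<close> linear in k, w, u and v serves all steps.\<close>

lemma maj_Pdual:
 assumes "6 * real k + real w + 1 + \<bar>u + v\<bar> + \<bar>u - v\<bar> <= B"
 shows "maj (Pdual u v w k) ([:B, 1:] ^ (4 * k))"
 using assms
proof (induction k)
 case (Suc k)
 have "maj (Pdual u v w k) ([:B, 1:] ^ (4 * k))" using Suc by auto
 hence "maj (Top (real w + 2 * real k) (u - v) (Pdual u v w k)) ([:B, 1:] ^ (4 * k + 2))"
 by (rule maj_Top) (use Suc.prems in auto)
 hence "maj (Pdual u v w (Suc k)) ([:B, 1:] ^ (4 * k + 2 + 2))"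
 unfolding Pdual.simps by (rule maj_Top) (use Suc.prems in auto)
 also have "4 * k + 2 + 2 = 4 * Suc k" by simp
 finally show ?case .
qed (simp add: one_pCons)

text \<open>From x^(4k) <= (4k)! exp x at x = (X + B) / 2; halving the sum leaves the factor exp (X
  / 2) that \<open>VP_bound\<close> tolerates.\<close>

lemma Pdual_bound:
 assumes "6 * real k + real w + 1 + \<bar>u + v\<bar> + \<bar>u - v\<bar> <= B" and X: "X >= 0"
 shows "\<bar>poly (Pdual u v w k) X\<bar> <= (fact (4 * k) * 2 ^ (4 * k) * exp (B / 2)) * exp (X / 2)"
proof -
 have B: "B >= 0" using assms by linarith
 define x where "x = (X + B) / 2"
 have x: "x >= 0" using X B by (simp add: x_def)
 have "\<bar>poly (Pdual u v w k) X\<bar> <= poly ([:B, 1:] ^ (4 * k)) X" by (rule maj_poly[OF maj_Pdual[OF assms(1)] X])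
 also have "... = (B + X) ^ (4 * k)" by simp
 also have "B + X = 2 * x" by (simp add: x_def)
 also have "(2 * x) ^ (4 * k) = 2 ^ (4 * k) * x ^ (4 * k)" by (rule power_mult_distrib)
 also have "... <= 2 ^ (4 * k) * (fact (4 * k) * exp x)"
 proof (rule mult_left_mono)
 have "x ^ (4 * k) * exp (- x) * exp x <= fact (4 * k) * exp x" by (intro mult_right_mono power_exp_le_fact x) auto
 thus "x ^ (4 * k) <= fact (4 * k) * exp x" by (simp add: mult.assoc flip: exp_add)
 qed simp
 also have "exp x = exp (B / 2) * exp (X / 2)" unfolding exp_add[symmetric] by (simp add: x_def add_divide_distrib add.commute)
 finally show ?thesis by (simp add: mult_ac)
qed

section \<open>Summation over (m, n) and positivity of V\<close>

definition lv :: "nat \<times> nat => real" where "lv x = real ((fst x)^2 * snd x)"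

abbreviation (input) "P2 \<equiv> {1::nat..} \<times> {1::nat..}"

lemma lv_ge: "x \<in> P2 ==> lv x >= 1" "x \<in> P2 ==> real (snd x) <= lv x"
proof -
 assume x: "x \<in> P2"
 hence "fst x >= 1" "snd x >= 1" by auto
 hence "1 * 1 <= (fst x)^2 * snd x" "1 * snd x <= (fst x)^2 * snd x" by (intro mult_mono; simp)+
 thus "lv x >= 1" "real (snd x) <= lv x" unfolding lv_def by (simp_all del: of_nat_mult)
qed

lemma inverse_squares_prod:
 "integrable (count_space P2) (%x. 1 / (real (fst x))^2 * (1 / (real (snd x))^2))"
 "(\<integral>x. 1 / (real (fst x))^2 * (1 / (real (snd x))^2) \<partial>count_space P2) = zeta2^2"
proof -
 let ?f = "%x. 1 / (real (fst x))^2 * (1 / (real (snd x))^2)"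
 have "integrable (count_space UNIV) (%n::nat. indicator {1..} n *\<^sub>R (1 / (real n)^2))"
 by (simp only: integral_count_space_indicator(2)[OF subset_UNIV] integrable_inverse_squares)
 from integrable_count_space_prod[OF this this]
 have "integrable (count_space UNIV) (%(m, n). (indicator {1..} m *\<^sub>R (1 / (real m)^2)) * (indicator {1..} n *\<^sub>R (1 / (real n)^2)))" .
 also have "(%(m, n). (indicator {1..} m *\<^sub>R (1 / (real m)^2)) * (indicator {1..} n *\<^sub>R (1 / (real n)^2)))
 = (%p. indicator P2 p *\<^sub>R ?f p)" by (auto simp: fun_eq_iff indicator_def)
 finally show i: "integrable (count_space P2) ?f"
 by (simp only: integral_count_space_indicator(2)[OF subset_UNIV])
 have "(\<integral>x. ?f x \<partial>count_space P2) = (\<integral>m. \<integral>n. ?f (m, n) \<partial>count_space {1..} \<partial>count_space {1..})"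
 by (rule integral_count_space_Times[OF _ _ i, symmetric]) auto
 also have "... = zeta2^2"
 unfolding fst_conv snd_conv integral_mult_right_zero zeta2_def[symmetric] integral_mult_left_zero by (simp add: power2_eq_square)
 finally show "(\<integral>x. ?f x \<partial>count_space P2) = zeta2^2" .
qed

text \<open>The exponent 14 provides sqrt l ^ 14 = l^5 l^2: the first factor pays for the weight,
  the second dominates m^2 n^2.\<close>

lemma lexp_bound:
 assumes x: "x \<in> P2" and c: "c > 0"
 shows "lv x ^ 5 * exp (- (c * sqrt (lv x))) <= fact 14 / c ^ 14 * (1 / (real (fst x))^2 * (1 / (real (snd x))^2))"
proof -
 define l where "l = lv x"
 have l: "l >= 1" using lv_ge[OF x] by (simp add: l_def)
 have "(c * sqrt l) ^ 14 * exp (- (c * sqrt l)) <= fact 14" using c l by (intro power_exp_le_fact) auto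
 also have "(c * sqrt l) ^ 14 = c ^ 14 * (l^2 * l ^ 5)"
 proof -
 have "sqrt l ^ 14 = (sqrt l ^ 2) ^ 7" by (simp flip: power_mult)
 also have "... = l ^ (2 + 5)" using l by simp
 finally show ?thesis unfolding power_mult_distrib power_add by simp
 qed
 finally have "c ^ 14 * l^2 * (l ^ 5 * exp (- (c * sqrt l))) <= fact 14" by (simp only: mult.assoc)
 hence "l ^ 5 * exp (- (c * sqrt l)) * (c ^ 14 * l^2) <= fact 14" by (simp only: mult.commute)
 moreover have "c ^ 14 * l^2 > 0" using c l by simp
 ultimately have "l ^ 5 * exp (- (c * sqrt l)) <= fact 14 / (c ^ 14 * l^2)" by (simp only: pos_le_divide_eq)
 also have "... = fact 14 / c ^ 14 * (1 / l^2)" by simp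
 also have "... <= fact 14 / c ^ 14 * (1 / (real (fst x))^2 * (1 / (real (snd x))^2))"
 proof (rule mult_left_mono)
 have 1: "real (fst x) >= 1" "real (snd x) >= 1" using x by auto
 have "(real (fst x))^2 * 1 * (real (snd x))^2 <= (real (fst x))^2 * (real (fst x))^2 * (real (snd x))^2"
 using 1 by (intro mult_right_mono mult_left_mono) auto
 also have "... = l^2" by (simp add: l_def lv_def power2_eq_square mult_ac)
 finally have "1 / l^2 <= 1 / ((real (fst x))^2 * (real (snd x))^2)" using 1 l by (intro divide_left_mono mult_pos_pos zero_less_power) auto
 thus "1 / l^2 <= 1 / (real (fst x))^2 * (1 / (real (snd x))^2)" by simp
 qed (use c in simp)
 finally show ?thesis by (simp add: l_def)
qed

lemma lexp_sum:
 assumes c: "c > 0"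
 shows "integrable (count_space P2) (%x. lv x ^ 5 * exp (- (c * sqrt (lv x))))"
 and "(\<integral>x. lv x ^ 5 * exp (- (c * sqrt (lv x))) \<partial>count_space P2) <= fact 14 / c ^ 14 * zeta2^2"
proof -
 let ?f = "%x. lv x ^ 5 * exp (- (c * sqrt (lv x)))"
 let ?g = "%x. fact 14 / c ^ 14 * (1 / (real (fst x))^2 * (1 / (real (snd x))^2))"
 have ig: "integrable (count_space P2) ?g" by (rule integrable_mult_right[OF inverse_squares_prod(1)])
 show i: "integrable (count_space P2) ?f"
 proof (rule Bochner_Integration.integrable_bound[OF ig])
 show "AE x in count_space P2. norm (?f x) <= norm (?g x)"
 proof (rule AE_I2)
 fix x assume "x \<in> space (count_space P2)"
 hence x: "x \<in> P2" by simp
 have "norm (?f x) = ?f x" using lv_ge(1)[OF x] by simp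
 also have "... <= ?g x" by (rule lexp_bound[OF x c])
 also have "... <= norm (?g x)" by (simp only: real_norm_def abs_ge_self)
 finally show "norm (?f x) <= norm (?g x)" .
 qed
 qed simp
 have "(\<integral>x. ?f x \<partial>count_space P2) <= (\<integral>x. ?g x \<partial>count_space P2)"
 by (rule integral_mono[OF i ig]) (rule lexp_bound[OF _ c], simp)
 thus "(\<integral>x. ?f x \<partial>count_space P2) <= fact 14 / c ^ 14 * zeta2^2"
 unfolding integral_mult_right_zero inverse_squares_prod(2) .
qed

text \<open>Where exp et is near sqrt a, X and Y are both of order sqrt a and both Bessel functions
  are positive by \<open>Kb_lower\<close>. Their sign is unknown only where Y < (1 + u + v)^2, and
  there X is so large that the contribution is negligible.\<close>

lemma VV_lower:
 obtains A where "A >= 1" "!!u v a. u > 0 ==> v > 0 ==> a > 0 ==> sqrt a >= A * (1 + u + v)^2 ==> VV u v a >= exp (- (17 * pi * sqrt a)) / 16"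
proof
 \<comment> \<open>The 10 makes exp (- pi^2 a / Q2) at most exp (- 17 pi r); the term with 32 makes
   the accompanying factor at most 1/16, half of the 1/8 gained on the interval
   \<open>?I\<close>.\<close>
 show "10 + 32 * Eint 1 >= 1" using Eint_nonneg[of 1] by linarith
 fix u v a :: real assume u: "u > 0" and v: "v > 0" and a: "a > 0" and big: "sqrt a >= (10 + 32 * Eint 1) * (1 + u + v)^2"
 define r where "r = sqrt a"
 have ra: "r * r = a" using a by (simp add: r_def)
 define Q2 where "Q2 = (1 + u + v)^2"
 have Q2: "Q2 >= 1" "u^2 <= Q2" "v^2 <= Q2"
 using u v power_mono[of 1 "1 + u + v" 2] power_mono[of u "1 + u + v" 2] power_mono[of v "1 + u + v" 2] by (auto simp: Q2_def)
 have E1: "Eint 1 >= 0" by (rule Eint_nonneg)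
 have r1: "r >= 10 * Q2" "r >= 10 + 32 * Eint 1"
 proof -
 have "10 * Q2 <= (10 + 32 * Eint 1) * Q2" "(10 + 32 * Eint 1) * 1 <= (10 + 32 * Eint 1) * Q2"
 using Q2 E1 by (auto intro!: mult_right_mono mult_left_mono)
 thus "r >= 10 * Q2" "r >= 10 + 32 * Eint 1" using big by (auto simp: r_def Q2_def)
 qed
 have r10: "r >= 10" using r1 E1 by linarith
 have r0: "r > 0" using r10 by linarith
 \<comment> \<open>17 = 1 + 4 * 4: on the interval X <= pi r and Y <= 4 pi r, and each of the two
   Bessel factors costs exp (- 2 Y).\<close>
 define E where "E = exp (- (17 * pi * r))"
 define D where "D = exp (- (pi^2 * a / Q2))"
 let ?I = "{ln r..ln r + 1/2}"
 let ?h = "%et. exp (- real 1 * et) * exp (- (pi * a / 2 * exp (- et)))"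
 let ?f = "%et. exp (- (pi * a * exp (- et))) * (KA u et * KA v et)"
 \<comment> \<open>A pointwise minorant: E / 4 on the interval; elsewhere the integrand is
   nonnegative or at least - D times \<open>?h\<close>.\<close>
 have pw: "indicator ?I et * (E / 4) - D * ?h et <= ?f et" for et
 proof (cases "Yv et >= Q2")
 case True
 have K: "KA u et >= exp (- 2 * Yv et) / 2" "KA v et >= exp (- 2 * Yv et) / 2"
 unfolding KA_def by (rule Kb_lower[OF Yv_pos order_trans[OF Q2(2) True]], rule Kb_lower[OF Yv_pos order_trans[OF Q2(3) True]])
 have KK: "KA u et * KA v et >= (exp (- 2 * Yv et) / 2) * (exp (- 2 * Yv et) / 2)"
 using K order_trans[OF _ K(1), of 0] by (intro mult_mono) auto
 have D0: "D * ?h et >= 0" by (simp add: D_def)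
 show ?thesis
 proof (cases "et \<in> ?I")
 case I: True
 have "exp (ln r) <= exp et" "exp et <= exp (ln r + 1/2)" using I by (simp_all only: exp_le_cancel_iff atLeastAtMost_iff)
 moreover have "exp (1/2 :: real) <= 2"
 proof (rule power2_le_imp_le)
 have "(exp (1/2 :: real))^2 = exp 1" by (simp add: power2_eq_square flip: exp_add)
 thus "(exp (1/2 :: real))^2 <= 2^2" using exp_le by simp
 qed simp
 moreover from this have "r * exp (1/2) <= r * 2" using r10 by (intro mult_left_mono) auto
 ultimately have e: "r <= exp et" "exp et <= r * 2" using r10 unfolding exp_add exp_ln[OF r0] by linarith+
 have "pi * a * exp (- et) = pi * r * (r / exp et)" by (simp add: ra[symmetric] exp_minus divide_inverse)
 also have "... <= pi * r * 1" using e r10 by (intro mult_left_mono) auto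
 finally have X: "pi * a * exp (- et) <= pi * r" by simp
 have Y: "Yv et <= 4 * (pi * r)" using e by (simp add: Yv_def)
 have "E / 4 <= exp (- (pi * a * exp (- et))) * ((exp (- 2 * Yv et) / 2) * (exp (- 2 * Yv et) / 2))"
 proof -
 have "- (17 * pi * r) <= - (pi * a * exp (- et)) + (- 2 * Yv et + - 2 * Yv et)" using X Y by linarith
 hence "E <= exp (- (pi * a * exp (- et)) + (- 2 * Yv et + - 2 * Yv et))" unfolding E_def by (simp only: exp_le_cancel_iff)
 thus ?thesis unfolding exp_add by simp
 qed
 also have "... <= ?f et" using KK by (intro mult_left_mono) auto
 finally show ?thesis using I D0 by simp
 next
 case False
 have "0 <= KA u et * KA v et" by (rule order_trans[OF _ KK]) simp
 hence "0 <= ?f et" by simp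
 moreover have "indicator ?I et * (E / 4) = 0" using False by simp
 ultimately show ?thesis using D0 by linarith
 qed
 next
 case False
 have nI: "et \<notin> ?I"
 proof
 assume "et \<in> ?I"
 hence "exp (ln r) <= exp et" by (simp only: exp_le_cancel_iff atLeastAtMost_iff)
 hence "r <= exp et" using r10 by simp
 hence "2 * 3 * r <= 2 * pi * exp et" using pi_gt3 r10 by (intro mult_mono) auto
 thus False using False r1 Q2 unfolding Yv_def by linarith
 qed
 have "\<bar>?f et\<bar> <= D * ?h et"
 proof -
 define X where "X = pi * a * exp (- et)"
 define h where "h = pi^2 * a / Q2"
 have XY: "X * Yv et = 2 * h * Q2" using Q2 by (simp add: X_def h_def Yv_def exp_minus power2_eq_square)
 have X0: "X > 0" using a by (simp add: X_def)
 have "2 * h * Q2 <= X * Q2" unfolding XY[symmetric] using False X0 by (intro mult_left_mono) auto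
 hence "2 * h <= X" using Q2 by simp
 hence "- X <= - h + - (X / 2)" by linarith
 hence "- X <= - (pi^2 * a / Q2) + - (X / 2)" by (simp only: h_def)
 hence "exp (- X) <= exp (- (pi^2 * a / Q2) + - (X / 2))" by (simp only: exp_le_cancel_iff)
 hence 1: "exp (- X) <= D * exp (- (X / 2))" by (simp only: D_def exp_add)
 have "\<bar>KA u et * KA v et\<bar> <= exp (- et) * 1" using Yv_pos[of et] by (intro order_trans[OF KAKA_bound] mult_left_mono) auto
 hence "exp (- X) * \<bar>KA u et * KA v et\<bar> <= (D * exp (- (X / 2))) * (exp (- et) * 1)" using 1 by (intro mult_mono) (auto simp: D_def)
 thus ?thesis by (simp add: abs_mult X_def mult_ac)
 qed
 hence "- (D * ?h et) <= ?f et" by linarith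
 moreover have "indicator ?I et * (E / 4) = 0" using nI by simp
 ultimately show ?thesis by linarith
 qed
 have ih: "integrable lborel ?h" using a by (intro integrable_Eint) auto
 have ii: "integrable lborel (%et. indicator ?I et * (E / 4))" by (intro integrable_mult_left integrable_real_indicator emeasure_bounded_finite) auto
 have "(\<integral>et. indicator ?I et * (E / 4) - D * ?h et \<partial>lborel) <= VV u v a"
 unfolding VV_def by (rule integral_mono[OF Bochner_Integration.integrable_diff[OF ii integrable_mult_right[OF ih]] integrable_VV[OF a] pw])
 moreover have "(\<integral>et. indicator ?I et * (E / 4) - D * ?h et \<partial>lborel) = 1/2 * (E / 4) - D * (Eint 1 / (pi * a / 2) ^ 1)"
 proof -
 have "(\<integral>et. ?h et \<partial>lborel) = Eint 1 / (pi * a / 2) ^ 1" using a by (intro integrable_Eint(2)) auto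
 moreover have "(\<integral>et. indicator ?I et * (E / 4) \<partial>lborel) = 1/2 * (E / 4)" by simp
 ultimately show ?thesis
 unfolding Bochner_Integration.integral_diff[OF ii integrable_mult_right[OF ih]] integral_mult_right_zero by (simp only:)
 qed
 moreover have "D * (Eint 1 / (pi * a / 2) ^ 1) <= E * (1/16)"
 proof (rule mult_mono)
 have "17 * pi * r <= pi^2 * a / Q2"
 proof -
 have "17 * pi * r * Q2 <= 10 * pi * pi * (r * Q2)"
 proof -
 have "17 * (pi * (r * Q2)) <= 10 * pi * (pi * (r * Q2))"
 using pi_gt3 r10 Q2 by (intro mult_right_mono) auto
 thus ?thesis by (simp only: mult_ac)
 qed
 also have "... = pi * pi * r * (10 * Q2)" by simp
 also have "... <= pi * pi * r * r" using r1 r10 by (intro mult_left_mono) auto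
 also have "... = pi^2 * a" by (simp add: ra[symmetric] power2_eq_square)
 finally show ?thesis using Q2 by (simp add: pos_le_divide_eq)
 qed
 thus "D <= E" by (simp add: D_def E_def)
 have "32 * Eint 1 <= r * 1" using r1 by linarith
 also have "... <= r * r" using r10 by (intro mult_left_mono) auto
 also have "... = 1 * a" by (simp add: ra)
 also have "... <= pi * a" using a pi_gt3 by (intro mult_right_mono) auto
 finally have "Eint 1 <= 1/16 * (pi * a / 2)" by simp
 thus "Eint 1 / (pi * a / 2) ^ 1 <= 1/16" using a by (simp only: power_one_right) (subst pos_divide_le_eq, auto)
 qed (use E1 a in \<open>auto simp: E_def\<close>)
 ultimately have "VV u v a >= 1/2 * (E / 4) - E * (1/16)" by linarith
 thus "VV u v a >= exp (- (17 * pi * sqrt a)) / 16" by (simp add: E_def r_def)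
qed

section \<open>The functional equation under the operators\<close>

text \<open>What the final argument needs to know about the forms; the exponent 4 is the product of
  two coefficient bounds n^2.\<close>

locale series =
 fixes u v :: real and L :: "nat => real" and e :: nat
 assumes L: "!!n. n >= 1 ==> \<bar>L n\<bar> <= real n ^ 4" and e: "e <= 1"
begin

definition cc :: "nat \<times> nat => real" where "cc x = L (snd x) * lv x ^ e"

definition Phi :: "real poly => real => real" where
 "Phi p t = (\<integral>x. cc x * VP u v p (t * lv x) \<partial>count_space P2)"

lemma cc_bound: "x \<in> P2 ==> \<bar>cc x\<bar> <= lv x ^ 5"
proof -
 assume x: "x \<in> P2"
 have "\<bar>cc x\<bar> = \<bar>L (snd x)\<bar> * lv x ^ e" using lv_ge(1)[OF x] by (simp add: cc_def abs_mult)
 also have "... <= lv x ^ 4 * lv x ^ 1"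
 proof (rule mult_mono)
 have "\<bar>L (snd x)\<bar> <= real (snd x) ^ 4" using x by (intro L) auto
 also have "... <= lv x ^ 4" using lv_ge(2)[OF x] by (intro power_mono) auto
 finally show "\<bar>L (snd x)\<bar> <= lv x ^ 4" .
 show "lv x ^ e <= lv x ^ 1" using lv_ge(1)[OF x] e by (intro power_increasing) auto
 qed (use lv_ge(1)[OF x] in auto)
 also have "... = lv x ^ 5" unfolding power_add[symmetric] by simp
 finally show ?thesis .
qed

lemma term_bound:
 assumes x: "x \<in> P2" and t: "t > 0" and C: "!!X. X >= 0 ==> \<bar>poly p X\<bar> <= C * exp (X / 2)"
 shows "\<bar>cc x * VP u v p (t * lv x)\<bar> <= C * KV / t * (lv x ^ 5 * exp (- (2 * pi * sqrt t * sqrt (lv x))))"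
proof -
 have C0: "C >= 0" using C[of 0] by simp
 have l: "lv x >= 1" by (rule lv_ge(1)[OF x])
 have a: "t * lv x > 0" using t l by simp
 have "KV / (t * lv x) <= KV / t" using t l KV_nonneg by (intro divide_left_mono) auto
 hence "C * (KV / (t * lv x) * exp (- (2 * pi * sqrt (t * lv x)))) <= C * (KV / t * exp (- (2 * pi * sqrt (t * lv x))))"
 using C0 by (intro mult_left_mono mult_right_mono) auto
 hence "\<bar>VP u v p (t * lv x)\<bar> <= C * (KV / t * exp (- (2 * pi * sqrt (t * lv x))))"
 using VP_bound[OF a C, where u = u and v = v] by linarith
 hence "\<bar>cc x\<bar> * \<bar>VP u v p (t * lv x)\<bar> <= lv x ^ 5 * (C * (KV / t * exp (- (2 * pi * sqrt (t * lv x)))))"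
 using l by (intro mult_mono cc_bound x) auto
 also have "... = C * KV / t * (lv x ^ 5 * exp (- (2 * pi * sqrt t * sqrt (lv x))))"
 unfolding real_sqrt_mult by (simp add: mult.assoc mult.left_commute)
 finally show ?thesis by (simp only: abs_mult)
qed

lemma integrable_Phi:
 assumes t: "t > 0"
 shows "integrable (count_space P2) (%x. cc x * VP u v p (t * lv x))"
proof -
 obtain C where C: "C >= 0" "!!X. X >= 0 ==> \<bar>poly p X\<bar> <= C * exp (X / 2)" using poly_exp_bound_half[of p] by blast
 have c: "2 * pi * sqrt t > 0" using t by simp
 show ?thesis
 proof (rule Bochner_Integration.integrable_bound[OF integrable_mult_right[OF lexp_sum(1)[OF c], of "C * KV / t"]])
 show "AE x in count_space P2. norm (cc x * VP u v p (t * lv x)) <= norm (C * KV / t * (lv x ^ 5 * exp (- (2 * pi * sqrt t * sqrt (lv x)))))"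
 proof (rule AE_I2)
 fix x assume "x \<in> space (count_space P2)"
 hence "x \<in> P2" by simp
 from order_trans[OF term_bound[OF this t C(2)] abs_ge_self]
 show "norm (cc x * VP u v p (t * lv x)) <= norm (C * KV / t * (lv x ^ 5 * exp (- (2 * pi * sqrt t * sqrt (lv x)))))"
 unfolding real_norm_def .
 qed
 qed simp
qed

lemma Phi_deriv:
 assumes t: "t > 0"
 shows "(Phi p has_real_derivative Phi (dl p) t / t) (at t)"
proof -
 obtain C where C: "C >= 0" "!!X. X >= 0 ==> \<bar>poly (dl p) X\<bar> <= C * exp (X / 2)" using poly_exp_bound_half[of "dl p"] by blast
 let ?f = "%x s. cc x * VP u v p (s * lv x)"
 let ?f' = "%x s. cc x * VP u v (dl p) (s * lv x) / s"
 have t2: "t / 2 > 0" using t by simp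
 have c: "2 * pi * sqrt (t / 2) > 0" using t by simp
 let ?g = "%x. C * KV / (t / 2) / (t / 2) * (lv x ^ 5 * exp (- (2 * pi * sqrt (t / 2) * sqrt (lv x))))"
 have "((%s. \<integral>x. ?f x s \<partial>count_space P2) has_real_derivative (\<integral>x. ?f' x t \<partial>count_space P2)) (at t)"
 proof (rule has_real_derivative_integral(1)[where e = "t / 2" and g = ?g, OF t2])
 fix s assume s: "\<bar>s - t\<bar> < t / 2"
 hence s0: "s > 0" "t / 2 <= s" by linarith+
 show "integrable (count_space P2) (%x. ?f x s)" by (rule integrable_Phi[OF s0(1)])
 fix x assume "x \<in> space (count_space P2)"
 hence x: "x \<in> P2" by simp
 have l: "lv x >= 1" by (rule lv_ge(1)[OF x])
 have sl: "s * lv x > 0" using s0 l by simp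
 have "((%s. s * lv x) has_real_derivative lv x) (at s)" by (auto intro!: derivative_eq_intros)
 from DERIV_cmult[OF DERIV_chain2[where f = "VP u v p" and g = "%s. s * lv x", OF VP_deriv[OF sl] this], of "cc x"]
 show "(?f x has_real_derivative ?f' x s) (at s)" using l by simp
 have "\<bar>?f' x s\<bar> = \<bar>cc x * VP u v (dl p) (s * lv x)\<bar> / s" using s0 by (simp add: abs_divide)
 also have "... <= (C * KV / s * (lv x ^ 5 * exp (- (2 * pi * sqrt s * sqrt (lv x))))) / s"
 using s0 by (intro divide_right_mono term_bound x C(2)) auto
 also have "... = C * KV / s / s * (lv x ^ 5 * exp (- (2 * pi * sqrt s * sqrt (lv x))))" by simp
 also have "... <= ?g x"
 proof (rule mult_mono)
 show "C * KV / s / s <= C * KV / (t / 2) / (t / 2)"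
 using s0 t C KV_nonneg by (intro frac_le) auto
 have "sqrt (t / 2) <= sqrt s" using s0 by simp
 hence "2 * pi * sqrt (t / 2) * sqrt (lv x) <= 2 * pi * sqrt s * sqrt (lv x)" using l by (intro mult_right_mono mult_left_mono) auto
 thus "lv x ^ 5 * exp (- (2 * pi * sqrt s * sqrt (lv x))) <= lv x ^ 5 * exp (- (2 * pi * sqrt (t / 2) * sqrt (lv x)))"
 using l by (intro mult_left_mono) auto
 qed (use s0 l t C KV_nonneg in auto)
 finally show "\<bar>?f' x s\<bar> <= ?g x" .
 next
 show "integrable (count_space P2) ?g" by (rule integrable_mult_right[OF lexp_sum(1)[OF c]])
 qed
 moreover have "(\<integral>x. ?f' x t \<partial>count_space P2) = Phi (dl p) t / t" unfolding Phi_def by (rule integral_divide_zero)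
 ultimately show ?thesis unfolding Phi_def[abs_def] by simp
qed

lemma Phi_add: "t > 0 ==> Phi (p + q) t = Phi p t + Phi q t"
proof -
 assume t: "t > 0"
 have "Phi (p + q) t = (\<integral>x. cc x * VP u v p (t * lv x) + cc x * VP u v q (t * lv x) \<partial>count_space P2)"
 unfolding Phi_def
 proof (rule Bochner_Integration.integral_cong[OF refl])
 fix x assume "x \<in> space (count_space P2)"
 hence "t * lv x > 0" using lv_ge(1)[of x] t by simp
 thus "cc x * VP u v (p + q) (t * lv x) = cc x * VP u v p (t * lv x) + cc x * VP u v q (t * lv x)" by (simp add: VP_add distrib_left)
 qed
 also have "... = Phi p t + Phi q t" unfolding Phi_def by (rule Bochner_Integration.integral_add[OF integrable_Phi[OF t] integrable_Phi[OF t]])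
 finally show ?thesis .
qed

lemma Phi_smult: "Phi (smult c p) t = c * Phi p t"
 unfolding Phi_def VP_smult mult.left_commute[of _ c] integral_mult_right_zero ..

text \<open>Inversion of the argument changes the sign of t d/dt and the power t^(-w) contributes w,
  so \<delta> on the left becomes -(\<delta> + w) on the right.\<close>

lemma FE_dl:
 assumes eq: "!!t. t > 0 ==> Phi p t = Phi q (1 / t) / t ^ w" and t: "t > 0"
 shows "Phi (dl p) t = Phi (smult (- 1) (dl q + smult (real w) q)) (1 / t) / t ^ w"
proof -
 have "(Phi p has_real_derivative Phi (dl p) t / t) (at t)" by (rule Phi_deriv[OF t])
 hence 1: "((%t. Phi q (1 / t) / t ^ w) has_real_derivative Phi (dl p) t / t) (at t)"
 by (rule has_field_derivative_transform_within_open[where S = "{0<..}"]) (use t eq in auto)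
 have it: "1 / t > 0" using t by simp
 have "((%t. 1 / t) has_real_derivative - (1 / t^2)) (at t)" using t by (auto intro!: derivative_eq_intros simp: power2_eq_square)
 from DERIV_chain2[where f = "Phi q" and g = "%t. 1 / t", OF Phi_deriv[OF it] this]
 have d: "((%t. Phi q (1 / t)) has_real_derivative Phi (dl q) (1 / t) / (1 / t) * - (1 / t^2)) (at t)" .
 have "((%t. Phi q (1 / t) / t ^ w) has_real_derivative
 ((Phi (dl q) (1 / t) / (1 / t) * - (1 / t^2)) * t ^ w - Phi q (1 / t) * (real w * t ^ (w - 1))) / (t ^ w * t ^ w)) (at t)"
 by (rule DERIV_divide[OF d]) (use t in \<open>auto intro!: derivative_eq_intros\<close>)
 note * = DERIV_unique[OF 1 this]
 have alg: "t * ((A * b - B * (c * d)) / D) = ((A * t) * b - B * (c * (t * d))) / D" for A b B c d D :: real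
 by (simp add: right_diff_distrib mult_ac)
 have "Phi (dl p) t = t * (Phi (dl p) t / t)" using t by simp
 also have "... = t * (((Phi (dl q) (1 / t) / (1 / t) * - (1 / t^2)) * t ^ w - Phi q (1 / t) * (real w * t ^ (w - 1))) / (t ^ w * t ^ w))" by (simp only: *)
 also have "... = ((Phi (dl q) (1 / t) / (1 / t) * - (1 / t^2) * t) * t ^ w - Phi q (1 / t) * (real w * (t * t ^ (w - 1)))) / (t ^ w * t ^ w)"
 by (rule alg)
 also have "real w * (t * t ^ (w - 1)) = real w * t ^ w" by (cases w) auto
 also have "Phi (dl q) (1 / t) / (1 / t) * - (1 / t^2) * t = - Phi (dl q) (1 / t)" using t by (simp add: power2_eq_square)
 also have "(- Phi (dl q) (1 / t) * t ^ w - Phi q (1 / t) * (real w * t ^ w)) / (t ^ w * t ^ w) = (- Phi (dl q) (1 / t) - real w * Phi q (1 / t)) / t ^ w"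
 proof -
 have "- Phi (dl q) (1 / t) * t ^ w - Phi q (1 / t) * (real w * t ^ w) = (- Phi (dl q) (1 / t) - real w * Phi q (1 / t)) * t ^ w" by (simp add: algebra_simps)
 thus ?thesis using t by simp
 qed
 finally show ?thesis unfolding Phi_smult Phi_add[OF it] by (simp add: algebra_simps)
qed

text \<open>The square absorbs the sign: (\<delta> + \<gamma>)^2 turns into (\<delta> + w -
  \<gamma>)^2.\<close>

lemma FE_Top:
 assumes eq: "!!t. t > 0 ==> Phi p t = Phi q (1 / t) / t ^ w" and t: "t > 0"
 shows "Phi (Top \<gamma> \<mu> p) t = Phi (Top (real w - \<gamma>) \<mu> q) (1 / t) / t ^ w"
proof -
 define q1 where "q1 = smult (- 1) (dl q + smult (real w) q)"
 have 1: "Phi (dl p) t = Phi q1 (1 / t) / t ^ w" if "t > 0" for t unfolding q1_def by (rule FE_dl[OF eq that])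
 have 2: "Phi (dl (dl p)) t = Phi (smult (- 1) (dl q1 + smult (real w) q1)) (1 / t) / t ^ w" by (rule FE_dl[OF 1 t])
 have it: "1 / t > 0" using t by simp
 have "Phi (Top \<gamma> \<mu> p) t = Phi (dl (dl p)) t + 2 * \<gamma> * Phi (dl p) t + (\<gamma>\<^sup>2 + \<mu>\<^sup>2) * Phi p t"
 unfolding Top_def Phi_add[OF t] Phi_smult ..
 also have "... = (Phi (smult (- 1) (dl q1 + smult (real w) q1)) (1 / t) + 2 * \<gamma> * Phi q1 (1 / t) + (\<gamma>\<^sup>2 + \<mu>\<^sup>2) * Phi q (1 / t)) / t ^ w"
 unfolding 2 1[OF t] eq[OF t] by (simp add: add_divide_distrib)
 also have "Phi (smult (- 1) (dl q1 + smult (real w) q1)) (1 / t) + 2 * \<gamma> * Phi q1 (1 / t) + (\<gamma>\<^sup>2 + \<mu>\<^sup>2) * Phi q (1 / t) = Phi (Top (real w - \<gamma>) \<mu> q) (1 / t)"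
 unfolding Top_def q1_def dl_add dl_smult Phi_add[OF it] Phi_smult by (simp add: algebra_simps power2_eq_square)
 finally show ?thesis .
qed

lemma FE_iterate:
 assumes eq: "!!t. t > 0 ==> Phi 1 t = Phi 1 (1 / t) / t ^ w"
 shows "t > 0 ==> Phi (Pprim u v k) t = Phi (Pdual u v w k) (1 / t) / t ^ w"
proof (induction k arbitrary: t)
 case 0
 show ?case unfolding Pprim.simps Pdual.simps by (rule eq[OF 0])
next
 case (Suc k)
 have s: "real w - - (2 * real k) = real w + 2 * real k" by simp
 have 1: "Phi (Top (- (2 * real k)) (u - v) (Pprim u v k)) t = Phi (Top (real w + 2 * real k) (u - v) (Pdual u v w k)) (1 / t) / t ^ w" if "t > 0" for t
 using FE_Top[OF Suc.IH that, where \<gamma> = "- (2 * real k)" and \<mu> = "u - v"] unfolding s .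
 show ?case using FE_Top[OF 1 Suc.prems, where \<gamma> = "- (2 * real k)" and \<mu> = "u + v"] unfolding s Pprim.simps Pdual.simps .
qed

end

section \<open>The contradiction from nonnegative coefficients\<close>

context series
begin

text \<open>With nonnegative coefficients up to k^8 the term \<open>x0\<close>, where a = 4 j^2,
  cannot be compensated: terms with a <= j^2 carry a weight smaller by 16^k, those between are
  nonnegative, and the tail beyond k^8 as well as the dual side are exponentially small in k^2. The
  result no longer mentions u and v.\<close>

lemma main_inequality:
 assumes FE: "!!t. t > 0 ==> Phi 1 t = Phi 1 (1 / t) / t ^ w" and w: "w <= 3" and L1: "L 1 = 1" and j: "j >= 1"
 and VL: "!!a. a > 0 ==> sqrt a >= real j ==> VV u v a >= exp (- (17 * pi * sqrt a)) / 16"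
 and uv: "\<bar>u + v\<bar> + \<bar>u - v\<bar> <= real j" and pos: "!!n. 1 <= n ==> n <= (100 * j) ^ 8 ==> L n >= 0"
 and k: "k = 100 * j"
 shows "16 ^ k * (exp (- (34 * pi * real j)) / 16) <= KV * (fact 14 * zeta2^2) * (real k ^ 28 * (1 + fact (4 * k) * exp (- (4 * (real k)^2)))
 + real k ^ 12 * (fact (4 * k) * 2 ^ (4 * k) * exp ((7 * real k + 4) / 2)) * exp (- (pi * (real k)^2)))"
proof -
 define K where "K = real k"
 have K: "K >= 100" "K = 100 * real j" using j by (simp_all add: K_def k)
 have K1: "K >= 1" "K > 0" using K by auto
 have j1: "real j >= 1" using j by simp
 \<comment> \<open>At this point the dual side decays like exp (- pi k^2), against operators of size
   about (4k)!. On the primal side the cut l = k^8 corresponds to a = k^4, with a decay of the same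
   kind.\<close>
 define t where "t = 1 / K ^ 4"
 have t: "t > 0" using K1 by (simp add: t_def)
 have st: "sqrt (t * l) = 1 / K^2 * sqrt l" for l
 proof -
 have "t = (1 / K^2)^2" by (simp add: t_def power_divide flip: power_mult)
 thus ?thesis by (simp add: real_sqrt_mult)
 qed
 define K0 where "K0 = fact 14 * zeta2^2"
 have K0: "K0 >= 0" by (simp add: K0_def)
 define Ck :: real where "Ck = fact (4 * k) * 2 ^ (4 * k) * exp ((7 * K + 4) / 2)"
 have Ck: "Ck >= 0" by (simp add: Ck_def)
 define c16 :: real where "c16 = (16 * pi ^ 4) ^ k"
 have c16: "c16 >= 1" unfolding c16_def
 proof (rule one_le_power)
 have "1 ^ 4 <= pi ^ 4" using pi_gt3 by (intro power_mono) auto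
 thus "1 <= 16 * pi ^ 4" by simp
 qed
 define U where "U = K ^ 12 * Ck * exp (- (pi * K^2)) * (KV * K0)"
 have U: "U >= 0" using K1 Ck KV_nonneg K0 by (simp add: U_def)

 have dual: "\<bar>Phi (Pdual u v w k) (K ^ 4)\<bar> <= Ck * exp (- (pi * K^2)) * (KV * K0)"
 proof -
 have K4: "K ^ 4 > 0" using K1 by simp
 have sK: "sqrt (K ^ 4) = K^2" by (rule real_sqrt_unique) (simp_all flip: power_mult)
 \<comment> \<open>The constant \<open>B\<close> of \<open>Pdual_bound\<close> becomes 7 k + 4, from
   w <= 3 and |u + v| + |u - v| <= j <= k.\<close>
 have PB: "\<bar>poly (Pdual u v w k) X\<bar> <= Ck * exp (X / 2)" if "X >= 0" for X
 unfolding Ck_def by (rule Pdual_bound[OF _ that]) (use uv w K j1 in \<open>simp add: K_def\<close>)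
 have c: "pi * K^2 > 0" using K1 by simp
 let ?g = "%x. Ck * KV * exp (- (pi * K^2)) * (lv x ^ 5 * exp (- (pi * K^2 * sqrt (lv x))))"
 have ig: "integrable (count_space P2) ?g" by (rule integrable_mult_right[OF lexp_sum(1)[OF c]])
 have pw: "norm (cc x * VP u v (Pdual u v w k) (K ^ 4 * lv x)) <= ?g x" if "x \<in> space (count_space P2)" for x
 proof -
 have x: "x \<in> P2" using that by simp
 have l: "lv x >= 1" by (rule lv_ge(1)[OF x])
 \<comment> \<open>Half of the exponent 2 pi K^2 sqrt l gives the uniform factor exp (- pi K^2), the
   other half is kept for the summation.\<close>
 have "pi * K^2 * 1 <= pi * K^2 * sqrt (lv x)" using l c by (intro mult_left_mono) auto
 hence "- (2 * pi * K^2 * sqrt (lv x)) <= - (pi * K^2) + - (pi * K^2 * sqrt (lv x))" by linarith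
 hence e: "exp (- (2 * pi * K^2 * sqrt (lv x))) <= exp (- (pi * K^2)) * exp (- (pi * K^2 * sqrt (lv x)))"
 unfolding exp_add[symmetric] by (simp only: exp_le_cancel_iff)
 have K41: "1 <= K ^ 4" using K1 by simp
 have "Ck * KV / K ^ 4 <= Ck * KV / 1" using Ck KV_nonneg K41 by (intro divide_left_mono) auto
 hence kk: "Ck * KV / K ^ 4 <= Ck * KV" by simp
 have "norm (cc x * VP u v (Pdual u v w k) (K ^ 4 * lv x)) <= Ck * KV / K ^ 4 * (lv x ^ 5 * exp (- (2 * pi * K^2 * sqrt (lv x))))"
 using term_bound[OF x K4 PB] unfolding sK real_norm_def .
 also have "... <= Ck * KV * (lv x ^ 5 * (exp (- (pi * K^2)) * exp (- (pi * K^2 * sqrt (lv x)))))"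
 using kk e l Ck KV_nonneg by (intro mult_mono mult_left_mono) auto
 also have "... = ?g x" by (simp only: mult_ac)
 finally show ?thesis .
 qed
 have "\<bar>Phi (Pdual u v w k) (K ^ 4)\<bar> <= (\<integral>x. ?g x \<partial>count_space P2)"
 proof -
 let ?f = "%x. cc x * VP u v (Pdual u v w k) (K ^ 4 * lv x)"
 have iP: "integrable (count_space P2) ?f" by (rule integrable_Phi[OF K4])
 have "norm (\<integral>x. ?f x \<partial>count_space P2) <= (\<integral>x. norm (?f x) \<partial>count_space P2)" by (rule integral_norm_bound)
 also have "... <= (\<integral>x. ?g x \<partial>count_space P2)" by (rule integral_mono[OF integrable_norm[OF iP] ig]) (rule pw)
 finally show ?thesis by (simp only: Phi_def real_norm_def)
 qed
 also have "... <= Ck * KV * exp (- (pi * K^2)) * (fact 14 / (pi * K^2) ^ 14 * zeta2^2)"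
 unfolding integral_mult_right_zero using Ck KV_nonneg by (intro mult_left_mono lexp_sum(2)[OF c]) auto
 also have "... <= Ck * KV * exp (- (pi * K^2)) * (fact 14 / 1 * zeta2^2)"
 proof -
 have "1 * 1 <= pi * K^2" using pi_gt3 K1 by (intro mult_mono) auto
 hence "1 <= (pi * K^2) ^ 14" by (intro one_le_power) simp
 thus ?thesis using Ck KV_nonneg by (intro mult_left_mono mult_right_mono divide_left_mono) auto
 qed
 also have "... = Ck * exp (- (pi * K^2)) * (KV * K0)" by (simp only: K0_def div_by_1 mult_ac)
 finally show ?thesis .
 qed
 have up: "Phi (Pprim u v k) t / c16 <= U"
 proof -
 have "Phi (Pprim u v k) t = Phi (Pdual u v w k) (1 / t) / t ^ w" by (rule FE_iterate[OF FE t])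
 also have "... = Phi (Pdual u v w k) (K ^ 4) * K ^ (4 * w)" by (simp add: t_def power_divide power_mult)
 finally have "\<bar>Phi (Pprim u v k) t\<bar> = \<bar>Phi (Pdual u v w k) (K ^ 4)\<bar> * K ^ (4 * w)" using K1 by (simp add: abs_mult)
 also have "... <= (Ck * exp (- (pi * K^2)) * (KV * K0)) * K ^ 12"
 proof (rule mult_mono[OF dual])
 show "K ^ (4 * w) <= K ^ 12" using K1 w by (intro power_increasing) auto
 qed (use Ck KV_nonneg K0 K1 in auto)
 also have "... = U" by (simp only: U_def mult_ac)
 finally have 1: "\<bar>Phi (Pprim u v k) t\<bar> <= U" .
 have "Phi (Pprim u v k) t / c16 <= \<bar>Phi (Pprim u v k) t\<bar> / 1"
 using c16 by (intro frac_le) auto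
 thus ?thesis using 1 by simp
 qed

 define \<tau> where "\<tau> = (%x. cc x * VP u v (Pprim u v k) (t * lv x) / c16)"
 have i\<tau>: "integrable (count_space P2) \<tau>" unfolding \<tau>_def by (rule integrable_divide[OF integrable_Phi[OF t]])
 have \<tau>_int: "(\<integral>x. \<tau> x \<partial>count_space P2) = Phi (Pprim u v k) t / c16" unfolding \<tau>_def Phi_def by (rule integral_divide_zero)
 have \<tau>_eq: "\<tau> x = cc x * ((t * lv x) ^ (2 * k) * VV u v (t * lv x))" if "x \<in> P2" for x
 proof -
 have "t * lv x > 0" using t lv_ge(1)[OF that] by simp
 from VP_Pprim[OF this, of u v k] show ?thesis using c16 by (simp add: \<tau>_def c16_def VP_1)
 qed

 \<comment> \<open>The largest weight a^(2k) in the range a <= j^2, where the sign of V is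
   unknown.\<close>
 define J where "J = ((real j)^2) ^ (2 * k)"
 have J1: "J >= 1" unfolding J_def using j1 by (intro one_le_power) auto
 define M where "M = 16 ^ k * J * (exp (- (34 * pi * real j)) / 16)"
 \<comment> \<open>n = 1 because the coefficient there is 1, and m = 2 j k^2 so that t m^2 is
   exactly 4 j^2.\<close>
 define x0 where "x0 = (2 * j * k^2, 1::nat)"
 have x0: "x0 \<in> P2" using j k by (simp add: x0_def)
 have lx0: "lv x0 = 4 * (real j)^2 * K ^ 4" by (simp add: x0_def lv_def K_def power_mult_distrib flip: power_mult)
 have tx0: "t * lv x0 = 4 * (real j)^2" unfolding lx0 t_def using K1 by simp
 define F4 :: real where "F4 = fact (4 * k)"
 have F4: "F4 >= 0" by (simp add: F4_def)
 \<comment> \<open>\<open>b1\<close> majorises the terms with a <= j^2 and \<open>b2\<close> those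
   with l > k^8; subtracting both at every point yields one integrable minorant of \<tau>.\<close>
 define b1 where "b1 = (%x. KV * J * (lv x ^ 5 * exp (- (2 * pi * (1 / K^2) * sqrt (lv x)))))"
 define b2 where "b2 = (%x. KV * (F4 * exp (- (4 * K^2))) * (lv x ^ 5 * exp (- (1 / K^2 * sqrt (lv x)))))"
 have low: "indicator {x0} x * M - (b1 x + b2 x) <= \<tau> x" if "x \<in> space (count_space P2)" for x
 proof -
 have x: "x \<in> P2" using that by simp
 define l where "l = lv x"
 define a where "a = t * l"
 define y where "y = sqrt a"
 have l: "l >= 1" unfolding l_def by (rule lv_ge(1)[OF x])
 have a: "a > 0" using t l by (simp add: a_def)
 have yl: "y = 1 / K^2 * sqrt l" by (simp add: y_def a_def st)
 have y0: "y >= 0" "y^2 = a" using a by (auto simp: y_def)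
 have b1: "b1 x = KV * J * (l ^ 5 * exp (- (2 * pi * y)))" by (simp add: b1_def yl l_def)
 have b2: "b2 x = KV * (F4 * exp (- (4 * K^2))) * (l ^ 5 * exp (- y))" by (simp add: b2_def yl l_def)
 have b0: "b1 x >= 0" "b2 x >= 0" unfolding b1 b2 using KV_nonneg J1 l F4 by auto
 have VB: "\<bar>VV u v a\<bar> <= KV / a * exp (- (2 * pi * y))"
 using VP_bound[OF a, where p = 1 and C = 1 and u = u and v = v] by (simp add: VP_1 y_def)
 have \<tau>x: "\<tau> x = cc x * (a ^ (2 * k) * VV u v a)" using \<tau>_eq[OF x] by (simp add: a_def l_def)
 have TB: "\<bar>\<tau> x\<bar> <= l ^ 5 * (a ^ (2 * k) * (KV / a * exp (- (2 * pi * y))))"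
 unfolding \<tau>x abs_mult
 proof (rule mult_mono)
 show "\<bar>cc x\<bar> <= l ^ 5" unfolding l_def by (rule cc_bound[OF x])
 show "\<bar>a ^ (2 * k)\<bar> * \<bar>VV u v a\<bar> <= a ^ (2 * k) * (KV / a * exp (- (2 * pi * y)))"
 proof -
 have abs: "\<bar>a ^ (2 * k)\<bar> = a ^ (2 * k)" using a by simp
 show ?thesis unfolding abs by (rule mult_left_mono[OF VB]) (use a in simp)
 qed
 qed (use l in auto)
 \<comment> \<open>Three ranges: no information on the sign of V; positive V with, by assumption,
   nonnegative coefficients; and the tail, where nothing is known about the coefficients.\<close>
 consider "a <= (real j)^2" | "a > (real j)^2" "l <= K ^ 8" | "l > K ^ 8" by linarith
 thus ?thesis
 proof cases
 case 1
 have "x ~= x0"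
 proof
 assume "x = x0"
 hence "a = 4 * (real j)^2" using tx0 by (simp add: a_def l_def)
 moreover have "(real j)^2 > 0" using j1 by simp
 ultimately show False using 1 by linarith
 qed
 \<comment> \<open>The bound KV / a for V blows up at 0; one of the 2 k powers of a absorbs
   this.\<close>
 have "a ^ (2 * k) * (KV / a) = KV * a ^ (2 * k - 1)"
 proof -
 have "2 * k = Suc (2 * k - 1)" using j k by simp
 hence "a ^ (2 * k) = a * a ^ (2 * k - 1)" by (metis power_Suc)
 thus ?thesis using a by simp
 qed
 also have "... <= KV * J"
 proof (rule mult_left_mono[OF _ KV_nonneg])
 have "a ^ (2 * k - 1) <= ((real j)^2) ^ (2 * k - 1)" using 1 a by (intro power_mono) auto
 also have "... <= J" unfolding J_def using j1 by (intro power_increasing) auto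
 finally show "a ^ (2 * k - 1) <= J" .
 qed
 finally have "l ^ 5 * (a ^ (2 * k) * (KV / a) * exp (- (2 * pi * y))) <= l ^ 5 * (KV * J * exp (- (2 * pi * y)))"
 using l by (intro mult_left_mono mult_right_mono) auto
 also have "... = b1 x" unfolding b1 by (simp only: mult_ac)
 finally have "\<bar>\<tau> x\<bar> <= b1 x" using TB by (simp only: mult.assoc)
 thus ?thesis using b0 \<open>x ~= x0\<close> by simp
 next
 case 2
 have "real (snd x) <= K ^ 8" using lv_ge(2)[OF x] 2 by (simp add: l_def)
 hence "snd x <= (100 * j) ^ 8" unfolding K_def k by (simp only: of_nat_power[symmetric] of_nat_le_iff)
 hence "L (snd x) >= 0" using x by (intro pos) auto
 hence cc0: "cc x >= 0" unfolding cc_def using l by (simp add: l_def)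
 have "real j <= sqrt a" using 2 by (intro real_le_rsqrt) simp
 from VL[OF a this] have V: "VV u v a >= exp (- (17 * pi * y)) / 16" by (simp add: y_def)
 hence V0: "VV u v a >= 0" using order_trans[of 0 "exp (- (17 * pi * y)) / 16"] by simp
 have "\<tau> x >= 0" unfolding \<tau>x using cc0 V0 a by simp
 moreover have "M <= \<tau> x" if "x = x0"
 proof -
 have a4: "a = 4 * (real j)^2" using tx0 that by (simp add: a_def l_def)
 have y2: "y = 2 * real j" unfolding y_def a4 by (simp add: real_sqrt_mult)
 have "cc x = l ^ e" unfolding cc_def l_def using that L1 by (simp add: x0_def)
 hence cc1: "cc x >= 1" using l by simp
 have "a ^ (2 * k) = 16 ^ k * J" unfolding a4 power_mult_distrib J_def by (simp add: power_mult)
 hence "M = 1 * (a ^ (2 * k) * (exp (- (17 * pi * y)) / 16))" unfolding M_def y2 by (simp add: mult_ac)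
 also have "... <= cc x * (a ^ (2 * k) * VV u v a)" using cc1 V a by (intro mult_mono mult_left_mono) auto
 finally show ?thesis by (simp only: \<tau>x)
 qed
 ultimately show ?thesis using b0 by (cases "x = x0") auto
 next
 case 3
 have "x ~= x0"
 proof
 assume "x = x0"
 hence "l = 4 * (real j)^2 * K ^ 4" using lx0 by (simp add: l_def)
 also have "... <= K ^ 4 * K ^ 4"
 proof (rule mult_right_mono)
 have "(2 * real j)^2 <= K^2" using K by (intro power_mono) auto
 also have "... <= K ^ 4" using K1 by (intro power_increasing) auto
 finally show "4 * (real j)^2 <= K ^ 4" by (simp add: power_mult_distrib)
 qed simp
 finally show False using 3 by (simp flip: power_add)
 qed
 have "K ^ 4 * K ^ 4 < K ^ 4 * a" using 3 K1 by (simp add: a_def t_def flip: power_add)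
 hence aK: "a > K ^ 4" by (rule mult_left_less_imp_less) (use K1 in simp)
 have "(K^2)^2 <= y^2" using aK y0 by (simp flip: power_mult)
 hence yK: "y >= K^2" using y0(1) by (rule power2_le_imp_le)
 have a1: "a >= 1" using aK one_le_power[OF K1(1), of 4] by linarith
 have "KV / a <= KV / 1" using a1 KV_nonneg by (intro divide_left_mono) auto
 hence "a ^ (2 * k) * (KV / a * exp (- (2 * pi * y))) <= a ^ (2 * k) * (KV * exp (- (2 * pi * y)))"
 using a by (intro mult_left_mono mult_right_mono) auto
 also have "... = KV * (y ^ (4 * k) * exp (- (2 * pi * y)))" unfolding y0(2)[symmetric] power_mult[symmetric] by (simp add: mult_ac)
 also have "... <= KV * (F4 * exp (- (4 * K^2)) * exp (- y))"
 proof (rule mult_left_mono[OF _ KV_nonneg])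
 \<comment> \<open>Of the exponent 2 pi y >= 6 y, one y pays for y^(4k), another is kept for the
   summation, and 4 y >= 4 K^2 gives the smallness.\<close>
 have "6 * y <= 2 * pi * y" using pi_gt3 y0 by (intro mult_right_mono) auto
 hence "- (2 * pi * y) <= - y + (- (4 * K^2) + - y)" using yK by linarith
 hence "exp (- (2 * pi * y)) <= exp (- y) * (exp (- (4 * K^2)) * exp (- y))" unfolding exp_add[symmetric] by (simp only: exp_le_cancel_iff)
 hence "y ^ (4 * k) * exp (- (2 * pi * y)) <= y ^ (4 * k) * (exp (- y) * (exp (- (4 * K^2)) * exp (- y)))" using y0 by (intro mult_left_mono) auto
 also have "... = (y ^ (4 * k) * exp (- y)) * (exp (- (4 * K^2)) * exp (- y))" by (simp only: mult.assoc)
 also have "... <= F4 * (exp (- (4 * K^2)) * exp (- y))" unfolding F4_def by (intro mult_right_mono power_exp_le_fact y0) auto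
 finally show "y ^ (4 * k) * exp (- (2 * pi * y)) <= F4 * exp (- (4 * K^2)) * exp (- y)" by (simp only: mult.assoc)
 qed
 finally have "l ^ 5 * (a ^ (2 * k) * (KV / a * exp (- (2 * pi * y)))) <= l ^ 5 * (KV * (F4 * exp (- (4 * K^2)) * exp (- y)))"
 using l by (intro mult_left_mono) auto
 also have "... = b2 x" unfolding b2 by (simp only: mult_ac)
 finally have "\<bar>\<tau> x\<bar> <= b2 x" using TB by linarith
 thus ?thesis using b0 \<open>x ~= x0\<close> by simp
 qed
 qed
 have c1: "2 * pi * (1 / K^2) > 0" and c2: "1 / K^2 > 0" using K1 by auto
 have ib1: "integrable (count_space P2) b1" unfolding b1_def by (rule integrable_mult_right[OF lexp_sum(1)[OF c1]])
 have ib2: "integrable (count_space P2) b2" unfolding b2_def by (rule integrable_mult_right[OF lexp_sum(1)[OF c2]])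
 have K14: "(1 / K^2) ^ 14 = 1 / K ^ 28" by (simp add: power_divide flip: power_mult)
 have s2: "(\<integral>x. b2 x \<partial>count_space P2) <= KV * (F4 * exp (- (4 * K^2))) * (K ^ 28 * K0)"
 proof -
 have "(\<integral>x. b2 x \<partial>count_space P2) <= KV * (F4 * exp (- (4 * K^2))) * (fact 14 / (1 / K^2) ^ 14 * zeta2^2)"
 unfolding b2_def integral_mult_right_zero using KV_nonneg F4 by (intro mult_left_mono lexp_sum(2)[OF c2]) auto
 also have "fact 14 / (1 / K^2) ^ 14 * zeta2^2 = K ^ 28 * K0" unfolding K14 K0_def by simp
 finally show ?thesis .
 qed
 have s1: "(\<integral>x. b1 x \<partial>count_space P2) <= KV * J * (K ^ 28 * K0)"
 proof -
 have "(\<integral>x. b1 x \<partial>count_space P2) <= KV * J * (fact 14 / (2 * pi * (1 / K^2)) ^ 14 * zeta2^2)"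
 unfolding b1_def integral_mult_right_zero using KV_nonneg J1 by (intro mult_left_mono lexp_sum(2)[OF c1]) auto
 also have "... <= KV * J * (fact 14 / (1 / K^2) ^ 14 * zeta2^2)"
 proof -
 have "1 * (1 / K^2) <= 2 * pi * (1 / K^2)" using pi_gt3 by (intro mult_right_mono) auto
 hence "(1 / K^2) ^ 14 <= (2 * pi * (1 / K^2)) ^ 14" using c2 by (intro power_mono) auto
 moreover have "0 < (2 * pi * (1 / K^2)) ^ 14 * (1 / K^2) ^ 14" by (rule mult_pos_pos[OF zero_less_power[OF c1] zero_less_power[OF c2]])
 ultimately show ?thesis using KV_nonneg J1 by (intro mult_left_mono mult_right_mono divide_left_mono) auto
 qed
 also have "fact 14 / (1 / K^2) ^ 14 * zeta2^2 = K ^ 28 * K0" unfolding K14 K0_def by simp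
 finally show ?thesis .
 qed
 have ii: "integrable (count_space P2) (%x. indicator {x0} x * M)" "(\<integral>x. indicator {x0} x * M \<partial>count_space P2) = M"
 proof -
 have "integrable (count_space P2) (indicator {x0} :: _ => real)" using x0 by (intro integrable_real_indicator) auto
 thus "integrable (count_space P2) (%x. indicator {x0} x * M)" by (rule integrable_mult_left)
 have "(\<integral>x. indicator {x0} x \<partial>count_space P2) = (1 :: real)" using x0 by (simp add: measure_count_space)
 thus "(\<integral>x. indicator {x0} x * M \<partial>count_space P2) = M" by (simp only: integral_mult_left_zero mult_1)
 qed
 have ib: "integrable (count_space P2) (%x. b1 x + b2 x)" by (rule Bochner_Integration.integrable_add[OF ib1 ib2])
 have "(\<integral>x. indicator {x0} x * M - (b1 x + b2 x) \<partial>count_space P2) <= (\<integral>x. \<tau> x \<partial>count_space P2)"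
 by (rule integral_mono[OF Bochner_Integration.integrable_diff[OF ii(1) ib] i\<tau>]) (rule low)
 hence "M - ((\<integral>x. b1 x \<partial>count_space P2) + (\<integral>x. b2 x \<partial>count_space P2)) <= U"
 unfolding Bochner_Integration.integral_diff[OF ii(1) ib] ii(2) Bochner_Integration.integral_add[OF ib1 ib2] \<tau>_int using up by linarith
 hence MM: "M <= KV * J * (K ^ 28 * K0) + KV * (F4 * exp (- (4 * K^2))) * (K ^ 28 * K0) + U" using s1 s2 by linarith
 \<comment> \<open>Since J >= 1 it may be attached to the small terms as well and then cancelled
   against the J in M.\<close>
 also have "... <= J * (KV * (K ^ 28 * K0)) + J * (KV * (F4 * exp (- (4 * K^2))) * (K ^ 28 * K0)) + J * U"
 proof -
 have le: "r <= J * r" if "r >= 0" for r using mult_right_mono[OF J1 that] by simp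
 have "KV * (F4 * exp (- (4 * K^2))) * (K ^ 28 * K0) >= 0" using KV_nonneg F4 K1 K0 by auto
 from le[OF this] le[OF U] show ?thesis by (simp only: mult.left_commute mult.assoc)
 qed
 also have "... = J * (KV * K0 * (K ^ 28 * (1 + F4 * exp (- (4 * K^2))) + K ^ 12 * Ck * exp (- (pi * K^2))))"
 unfolding U_def by (simp add: algebra_simps)
 finally have "J * (16 ^ k * (exp (- (34 * pi * real j)) / 16)) <= J * (KV * K0 * (K ^ 28 * (1 + F4 * exp (- (4 * K^2))) + K ^ 12 * Ck * exp (- (pi * K^2))))"
 unfolding M_def by (simp only: mult_ac)
 hence "16 ^ k * (exp (- (34 * pi * real j)) / 16) <= KV * K0 * (K ^ 28 * (1 + F4 * exp (- (4 * K^2))) + K ^ 12 * Ck * exp (- (pi * K^2)))"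
 using J1 by (simp only: mult_le_cancel_left_pos)
 thus ?thesis by (simp only: K0_def K_def F4_def Ck_def)
qed

end

section \<open>Choice of parameters and conclusion\<close>

text \<open>16^k is at least exp (200 j) and exp (34 pi j) at most exp (110 j), so the left side is
  at least exp (90 j) / 16. On the right the factorials are exp (O(j log j)) and are annihilated by
  exponentials in - k^2, which leaves polynomial growth.\<close>

lemma growth_comparison:
 fixes c :: real
 assumes c: "c >= 0"
 obtains J0 where "!!j k. j >= J0 ==> k = 100 * j ==>
 \<not> 16 ^ k * (exp (- (34 * pi * real j)) / 16) <= c * (real k ^ 28 * (1 + fact (4 * k) * exp (- (4 * (real k)^2)))
 + real k ^ 12 * (fact (4 * k) * 2 ^ (4 * k) * exp ((7 * real k + 4) / 2)) * exp (- (pi * (real k)^2)))"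
proof -
 \<comment> \<open>A function of a real variable that dominates the right side: (4k)! and 2^(4k) are
   replaced by exponentials, pi by 3 and k by 100 x.\<close>
 define R where "R = (%x::real. c * ((100 * x) ^ 28 * (1 + exp (400 * x * ln (400 * x)) * exp (- (4 * (100 * x)^2)))
 + (100 * x) ^ 12 * (exp (400 * x * ln (400 * x)) * exp (400 * x) * exp ((7 * (100 * x) + 4) / 2)) * exp (- (3 * (100 * x)^2))))"
 have "((%x::real. ((100 * x) ^ 28 * (1 + exp (400 * x * ln (400 * x)) * exp (- (4 * (100 * x)^2)))
 + (100 * x) ^ 12 * (exp (400 * x * ln (400 * x)) * exp (400 * x) * exp ((7 * (100 * x) + 4) / 2)) * exp (- (3 * (100 * x)^2))) / exp (90 * x)) \<longlongrightarrow> 0) at_top"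
 by real_asymp
 from tendsto_mult_left[OF this, of c] have "((%x. R x / exp (90 * x)) \<longlongrightarrow> 0) at_top" by (simp add: R_def)
 hence "\<forall>\<^sub>F x in at_top. R x / exp (90 * x) < 1 / 16" by (rule order_tendstoD) simp
 then obtain N where N: "!!x. x >= N ==> R x / exp (90 * x) < 1 / 16" by (auto simp: eventually_at_top_linorder)
 show ?thesis
 proof (rule that[of "max 1 (nat \<lceil>N\<rceil>)"])
 fix j k :: nat assume j: "j >= max 1 (nat \<lceil>N\<rceil>)" and k: "k = 100 * j"
 have jN: "real j >= N" "real j >= 1" using j by linarith+
 have kj: "real k = 100 * real j" by (simp add: k)
 have "R (real j) < exp (90 * real j) * (1 / 16)" using N[OF jN(1)] by (simp add: pos_divide_less_eq mult.commute)
 also have "... <= 16 ^ k * (exp (- (34 * pi * real j)) / 16)"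
 proof -
 have e2: "exp (2 :: real) <= 16"
 proof -
 have "exp (2 :: real) = exp 1 * exp 1" by (simp flip: exp_add)
 also have "... <= 3 * 3" by (intro mult_mono exp_le) auto
 finally show ?thesis by simp
 qed
 have "exp (200 * real j) = exp 2 ^ k" unfolding exp_of_nat_mult[symmetric] by (simp add: kj)
 also have "... <= 16 ^ k" using e2 by (intro power_mono) auto
 finally have 1: "exp (200 * real j) <= 16 ^ k" .
 have "34 * pi * real j <= 110 * real j" using pi_less_4 pi_approx jN by (intro mult_right_mono) auto
 hence 2: "exp (- (110 * real j)) <= exp (- (34 * pi * real j))" by simp
 have "exp (90 * real j) = exp (200 * real j) * exp (- (110 * real j))" by (simp flip: exp_add)
 also have "... <= 16 ^ k * exp (- (34 * pi * real j))" using 1 2 by (intro mult_mono) auto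
 finally show ?thesis by simp
 qed
 finally have lt: "R (real j) < 16 ^ k * (exp (- (34 * pi * real j)) / 16)" .
 define K where "K = real k"
 have K: "K >= 1" using jN by (simp add: K_def kj)
 have F: "fact (4 * k) <= exp (400 * real j * ln (400 * real j))"
 proof -
 have "(fact (4 * k) :: real) <= of_nat ((4 * k) ^ (4 * k))" by (rule fact_le_power)
 also have "... = exp (real (4 * k) * ln (real (4 * k)))"
 using K unfolding exp_of_nat_mult by (simp add: K_def)
 also have "real (4 * k) = 400 * real j" by (simp add: kj)
 finally show ?thesis .
 qed
 have T: "(2 :: real) ^ (4 * k) <= exp (400 * real j)"
 proof -
 have "(2 :: real) ^ (4 * k) <= exp 1 ^ (4 * k)" using exp_ge_add_one_self[of "1 :: real"] by (intro power_mono) auto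
 also have "... = exp (400 * real j)" unfolding exp_of_nat_mult[symmetric] by (simp add: kj)
 finally show ?thesis .
 qed
 have P: "exp (- (pi * K^2)) <= exp (- (3 * K^2))"
 proof -
 have "3 * K^2 <= pi * K^2" using pi_gt3 by (intro mult_right_mono) auto
 thus ?thesis by simp
 qed
 have "c * (K ^ 28 * (1 + fact (4 * k) * exp (- (4 * K^2))) + K ^ 12 * (fact (4 * k) * 2 ^ (4 * k) * exp ((7 * K + 4) / 2)) * exp (- (pi * K^2)))
 <= c * (K ^ 28 * (1 + exp (400 * real j * ln (400 * real j)) * exp (- (4 * K^2))) + K ^ 12 * (exp (400 * real j * ln (400 * real j)) * exp (400 * real j) * exp ((7 * K + 4) / 2)) * exp (- (3 * K^2)))"
 proof (rule mult_left_mono[OF add_mono c])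
 show "K ^ 28 * (1 + fact (4 * k) * exp (- (4 * K^2))) <= K ^ 28 * (1 + exp (400 * real j * ln (400 * real j)) * exp (- (4 * K^2)))"
 using mult_right_mono[OF F, of "exp (- (4 * K^2))"] K by (intro mult_left_mono add_left_mono) simp_all
 have FT: "fact (4 * k) * 2 ^ (4 * k) <= exp (400 * real j * ln (400 * real j)) * exp (400 * real j)"
 by (rule mult_mono[OF F T]) auto
 have "K ^ 12 * (fact (4 * k) * 2 ^ (4 * k) * exp ((7 * K + 4) / 2)) <= K ^ 12 * (exp (400 * real j * ln (400 * real j)) * exp (400 * real j) * exp ((7 * K + 4) / 2))"
 by (rule mult_left_mono[OF mult_right_mono[OF FT]]) (use K in auto)
 from mult_mono[OF this P] show "K ^ 12 * (fact (4 * k) * 2 ^ (4 * k) * exp ((7 * K + 4) / 2)) * exp (- (pi * K^2)) <= K ^ 12 * (exp (400 * real j * ln (400 * real j)) * exp (400 * real j) * exp ((7 * K + 4) / 2)) * exp (- (3 * K^2))"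
 using K by simp
 qed
 also have "... = R (real j)" by (simp only: R_def K_def kj)
 finally have "c * (K ^ 28 * (1 + fact (4 * k) * exp (- (4 * K^2))) + K ^ 12 * (fact (4 * k) * 2 ^ (4 * k) * exp ((7 * K + 4) / 2)) * exp (- (pi * K^2))) <= R (real j)" .
 from le_less_trans[OF this lt] show "\<not> 16 ^ k * (exp (- (34 * pi * real j)) / 16) <= c * (real k ^ 28 * (1 + fact (4 * k) * exp (- (4 * (real k)^2)))
 + real k ^ 12 * (fact (4 * k) * 2 ^ (4 * k) * exp ((7 * real k + 4) / 2)) * exp (- (pi * (real k)^2)))"
 unfolding K_def not_le .
 qed
qed

lemma VV_commute: "VV u v a = VV v u a"
 unfolding VV_def by (rule Bochner_Integration.integral_cong[OF refl]) simp

lemma Ssum_commute: "Ssum u v L e t = Ssum v u L e t"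
 unfolding Ssum_def VV_commute[of u v] ..

lemma (in series) Phi_1: "Phi 1 t = Ssum u v L e t"
 unfolding Phi_def Ssum_def cc_def lv_def VP_1 by (simp only: case_prod_unfold)

text \<open>If one form has a cosine part and the other a sine part, the mixed construction applies
  with weight 3. Otherwise \<open>lam_f (- 1)\<close> and \<open>lam_g (- 1)\<close> are equal and
  are 1 or -1, so both forms have one common parity; the Wronskian then settles u ~= v and Hecke
  orthogonality settles u = v.\<close>

lemma functional_equation:
 assumes f: "normalized_hecke_maass_cusp_form u f lam_f" and g: "normalized_hecke_maass_cusp_form v g lam_g"
 and uv: "u > 0" "v > 0" and neq: "\<exists>z\<in>upper_half_plane. f z ~= g z"
 obtains e w :: nat where "e <= 1" "w <= 3" "!!t. t > 0 ==> Ssum u v (%n. lam_f (int n) * lam_g (int n)) e t = Ssum u v (%n. lam_f (int n) * lam_g (int n)) e (1 / t) / t ^ w"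
proof -
 interpret f: normalized_hecke_maass_cusp_form u f lam_f by (rule f)
 interpret g: normalized_hecke_maass_cusp_form v g lam_g by (rule g)
 let ?L = "%n. lam_f (int n) * lam_g (int n)"
 let ?lf = "%n. lam_f (int n)" and ?lg = "%n. lam_g (int n)"
 show ?thesis
 proof (cases "lam_f (- 1) ~= - 1 \<and> lam_g (- 1) ~= 1")
 case True
 have "rform_pair cos u ?lf f.Cpart sin v ?lg g.Spart"
 using True by (intro rform_pair.intro f.rform_even g.rform_odd) auto
 note FE = rform_pair.FE_mixed[OF this refl refl]
 show ?thesis by (rule that[of 1 3]) (simp, simp, rule FE)
 next
 case F1: False
 show ?thesis
 proof (cases "lam_f (- 1) ~= 1 \<and> lam_g (- 1) ~= - 1")
 case True
 have "rform_pair cos v ?lg g.Cpart sin u ?lf f.Spart"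
 using True by (intro rform_pair.intro g.rform_even f.rform_odd) auto
 note FE = rform_pair.FE_mixed[OF this refl refl]
 have L: "(%n. ?lg n * ?lf n) = ?L" by (rule ext) (rule mult.commute)
 have "Ssum u v ?L 1 t = Ssum u v ?L 1 (1 / t) / t ^ 3" if "t > 0" for t
 using FE[OF that] unfolding L Ssum_commute[of v u] .
 note FE' = this
 show ?thesis by (rule that[of 1 3]) (simp, simp, rule FE')
 next
 case False
 hence eps: "lam_f (- 1) = lam_g (- 1)" "lam_f (- 1) = 1 \<or> lam_f (- 1) = - 1" using F1 by auto
 obtain cs F G where pair: "rform_pair cs u ?lf F cs v ?lg G"
 proof (cases "lam_f (- 1) = 1")
 case True
 have "rform_pair cos u ?lf f.Cpart cos v ?lg g.Cpart"
 using True eps by (intro rform_pair.intro g.rform_even f.rform_even) auto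
 thus ?thesis by (rule that)
 next
 case False
 have "rform_pair sin u ?lf f.Spart sin v ?lg g.Spart"
 using False eps by (intro rform_pair.intro g.rform_odd f.rform_odd) auto
 thus ?thesis by (rule that)
 qed
 show ?thesis
 proof (cases "u = v")
 case False
 hence "u^2 ~= v^2" using uv by (simp add: power2_eq_iff_nonneg)
 note FE = rform_pair.FE_wronskian[OF pair refl this]
 show ?thesis by (rule that[of 0 1]) (simp, simp, unfold power_one_right, rule FE)
 next
 case True
 \<comment> \<open>With equal u, equal coefficients of positive index and equal sign at -1, the two
   expansions coincide, which would make the forms equal.\<close>
 have "\<exists>n\<ge>1. lam_f (int n) ~= lam_g (int n)"
 proof (rule ccontr)
 assume "\<not> ?thesis"
 hence eq: "lam_f (int n) = lam_g (int n)" if "n >= 1" for n using that by auto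
 have "f.cf y (int n) = g.cf y (int n)" if "n >= 1" for n y
 unfolding f.cf_def g.cf_def using eq[OF that] True by simp
 hence "f.Cpart z = g.Cpart z" "f.Spart z = g.Spart z" for z
 unfolding f.Cpart_def g.Cpart_def f.Spart_def g.Spart_def
 by (auto intro!: Bochner_Integration.integral_cong)
 hence "f z = g z" if "Im z > 0" for z
 using f.form_parts(1)[OF that] g.form_parts(1)[OF that] eps(1) by simp
 thus False using neq by (auto simp: upper_half_plane_def)
 qed
 then obtain n where "n >= 1" "lam_f (int n) ~= lam_g (int n)" by blast
 note FE = rform_pair.FE_hecke[OF pair refl this]
 show ?thesis by (rule that[of 0 1]) (simp, simp, unfold power_one_right, rule FE)
 qed
 qed
 qed
qed

theorem theorem1p3:
 "\<exists>(c::real) (C::real). C > 0 \<and>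
 (\<forall>(u::real) (v::real) (f::complex \<Rightarrow> complex) (g::complex \<Rightarrow> complex)
 (lam_f::int \<Rightarrow> real) (lam_g::int \<Rightarrow> real).
 u > 0 \<longrightarrow> v > 0 \<longrightarrow>
 normalized_hecke_maass_cusp_form u f lam_f \<longrightarrow>
 normalized_hecke_maass_cusp_form v g lam_g \<longrightarrow>
 (\<exists>z\<in>upper_half_plane. f z \<noteq> g z) \<longrightarrow>
 (\<exists>n::nat. n > 0 \<and> lam_f (int n) * lam_g (int n) < 0) \<and>
 real (first_opposite_sign lam_f lam_g)
 \<le> C * max (exp (c * (ln (sqrt (max (sym2_conductor u) (sym2_conductor v))))\<^sup>2))
 ((1 + u + v) powr 5.34))"
proof -
 obtain A where A: "A \<ge> 1" and VL: "\<And>u v a. u > 0 \<Longrightarrow> v > 0 \<Longrightarrow> a > 0 \<Longrightarrow> sqrt a \<ge> A * (1 + u + v)\<^sup>2 \<Longrightarrow> VV u v a \<ge> exp (- (17 * pi * sqrt a)) / 16"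
 by (rule VV_lower) (rule that, assumption, blast)
 have "KV * (fact 14 * zeta2\<^sup>2) \<ge> 0" using KV_nonneg by simp
 then obtain J0 where J0: "\<And>j k. j \<ge> J0 \<Longrightarrow> k = 100 * j \<Longrightarrow>
 \<not> 16 ^ k * (exp (- (34 * pi * real j)) / 16) \<le> KV * (fact 14 * zeta2\<^sup>2) * (real k ^ 28 * (1 + fact (4 * k) * exp (- (4 * (real k)\<^sup>2)))
 + real k ^ 12 * (fact (4 * k) * 2 ^ (4 * k) * exp ((7 * real k + 4) / 2)) * exp (- (pi * (real k)\<^sup>2)))" by (rule growth_comparison) (rule that, blast)
 \<comment> \<open>Chosen so that j <= B Q^2 still holds after rounding up; \<open>A\<close> and
   \<open>J0\<close> are absolute, hence so is \<open>B\<close>.\<close>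
 define B where "B = A + 2 + real J0 + 1"
 have B: "B > 0" using A by (simp add: B_def)
 \<comment> \<open>The first factor stems from the range n <= (100 j)^8, the second from Q <= 2 S
   raised to the power 16.\<close>
 define C where "C = (100 * B) ^ 8 * 2 ^ 16"
 show ?thesis
 proof (rule exI[of _ 16], rule exI[of _ C], intro conjI allI impI)
 show "C > 0" using B by (simp add: C_def)
 fix u v :: real and f g :: "complex \<Rightarrow> complex" and lam_f lam_g :: "int \<Rightarrow> real"
 assume u: "u > 0" and v: "v > 0" and f: "normalized_hecke_maass_cusp_form u f lam_f" and g: "normalized_hecke_maass_cusp_form v g lam_g"
 and neq: "\<exists>z\<in>upper_half_plane. f z \<noteq> g z"
 define L where "L = (\<lambda>n. lam_f (int n) * lam_g (int n))"
 have "\<exists>e w. e \<le> 1 \<and> w \<le> 3 \<and> (\<forall>t>0. Ssum u v L e t = Ssum u v L e (1 / t) / t ^ w)"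
 proof (rule functional_equation[OF f g u v neq, folded L_def])
 fix e w :: nat assume a: "e \<le> 1" "w \<le> 3" "\<And>t. t > 0 \<Longrightarrow> Ssum u v L e t = Ssum u v L e (1 / t) / t ^ w"
 show ?thesis by (rule exI[of _ e], rule exI[of _ w], intro conjI allI impI) (rule a(1), rule a(2), erule a(3))
 qed
 then obtain e w where e: "e \<le> 1" and w: "w \<le> 3" and FE: "\<forall>t>0. Ssum u v L e t = Ssum u v L e (1 / t) / t ^ w" by blast
 interpret series u v L e
 proof
 fix n :: nat assume n: "n \<ge> 1"
 have "\<bar>L n\<bar> \<le> (real n)\<^sup>2 * (real n)\<^sup>2" unfolding L_def abs_mult
 by (intro mult_mono normalized_hecke_maass_cusp_form.lam_bound[OF f n] normalized_hecke_maass_cusp_form.lam_bound[OF g n]) auto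
 thus "\<bar>L n\<bar> \<le> real n ^ 4" by (simp flip: power_add)
 qed (rule e)
 define Q where "Q = 1 + u + v"
 have Q1: "Q \<ge> 1" "Q\<^sup>2 \<ge> 1" "Q \<le> Q\<^sup>2" using u v one_le_power[of Q 2] self_le_power[of Q 2] by (simp_all add: Q_def)
 \<comment> \<open>Of order Q^2 because V is known to be positive for sqrt a >= A Q^2. The summand 2
   Q^2 covers |u + v| + |u - v|, and \<open>J0\<close> the growth comparison.\<close>
 define j where "j = nat \<lceil>(A + 2) * Q\<^sup>2 + real J0\<rceil>"
 have j_ge: "real j \<ge> (A + 2) * Q\<^sup>2 + real J0" unfolding j_def by (rule real_nat_ceiling_ge)
 have AQ: "A * Q\<^sup>2 \<ge> 0" "(A + 2) * Q\<^sup>2 = A * Q\<^sup>2 + 2 * Q\<^sup>2" using A by (auto simp: distrib_right)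
 have j1: "real j \<ge> A * Q\<^sup>2" "real j \<ge> 2 * Q\<^sup>2" "real j \<ge> real J0" "real j \<ge> 1" using j_ge AQ Q1 by linarith+
 have j_le: "real j \<le> B * Q\<^sup>2"
 proof -
 have "real j \<le> (A + 2) * Q\<^sup>2 + real J0 + 1" unfolding j_def using AQ Q1 by linarith
 also have "\<dots> \<le> (A + 2) * Q\<^sup>2 + (real J0 + 1) * Q\<^sup>2"
 using mult_left_mono[OF Q1(2), of "real J0 + 1"] by simp
 also have "\<dots> = B * Q\<^sup>2" by (simp add: B_def algebra_simps)
 finally show ?thesis .
 qed
 have "\<exists>n. 1 \<le> n \<and> n \<le> (100 * j) ^ 8 \<and> L n < 0"
 proof (rule ccontr)
 assume "\<not> ?thesis"
 hence pos: "L n \<ge> 0" if "1 \<le> n" "n \<le> (100 * j) ^ 8" for n using that by force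
 have FE': "Phi 1 t = Phi 1 (1 / t) / t ^ w" if "t > 0" for t unfolding Phi_1 using FE that by blast
 have L1: "L 1 = 1"
 using normalized_hecke_maass_cusp_form.normalized[OF f] normalized_hecke_maass_cusp_form.normalized[OF g] by (simp add: L_def)
 have VL': "VV u v a \<ge> exp (- (17 * pi * sqrt a)) / 16" if "a > 0" "sqrt a \<ge> real j" for a
 using VL[OF u v that(1)] that(2) j1(1) unfolding Q_def by linarith
 have uv: "\<bar>u + v\<bar> + \<bar>u - v\<bar> \<le> real j"
 proof -
 have "\<bar>u + v\<bar> + \<bar>u - v\<bar> \<le> 2 * Q" using u v unfolding Q_def by (auto simp: abs_if)
 thus ?thesis using Q1(3) j1(2) by linarith
 qed
 have jn: "j \<ge> 1" "j \<ge> J0" using j1 by linarith+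
 from J0[OF jn(2) refl] show False by (rule notE) (rule main_inequality[OF FE' w L1 jn(1) VL' uv pos refl])
 qed
 then obtain n where n: "1 \<le> n" "n \<le> (100 * j) ^ 8" "L n < 0" by blast
 thus ex: "\<exists>n::nat. n > 0 \<and> lam_f (int n) * lam_g (int n) < 0" unfolding L_def by (intro exI[of _ n]) auto
 define S where "S = sqrt (max (sym2_conductor u) (sym2_conductor v))"
 have Sx: "3 + x \<le> S" if "x = u \<or> x = v" "x > 0" for x
 proof -
 have "(3 + x)\<^sup>2 \<le> sym2_conductor x" by (simp add: sym2_conductor_def)
 also have "\<dots> \<le> max (sym2_conductor u) (sym2_conductor v)" using that by auto
 finally show ?thesis unfolding S_def by (rule real_le_rsqrt)
 qed
 have S: "S \<ge> 3" "Q \<le> 2 * S" using Sx[of u] Sx[of v] u v by (auto simp: Q_def)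
 have "first_opposite_sign lam_f lam_g \<le> n" unfolding first_opposite_sign_def by (rule Least_le) (use n in \<open>auto simp: L_def\<close>)
 hence "real (first_opposite_sign lam_f lam_g) \<le> real n" by simp
 also have "\<dots> \<le> (100 * real j) ^ 8" using of_nat_mono[OF n(2), where 'a = real] by simp
 also have "\<dots> \<le> (100 * (B * Q\<^sup>2)) ^ 8" using j_le by (intro power_mono) auto
 also have "\<dots> = (100 * B) ^ 8 * Q ^ 16" by (simp add: power_mult_distrib flip: power_mult)
 also have "\<dots> \<le> (100 * B) ^ 8 * (2 * S) ^ 16" using S Q1 B by (intro mult_left_mono power_mono) auto
 also have "\<dots> = C * S ^ 16" by (simp add: C_def power_mult_distrib)
 \<comment> \<open>S >= 3 gives ln S >= 1, so S^16 = exp (16 ln S) is at most exp (16 (ln S)^2).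
   This is the origin of the constant 16 in the exponent.\<close>
 also have "\<dots> \<le> C * exp (16 * (ln S)\<^sup>2)"
 proof (rule mult_left_mono)
 have "exp 1 \<le> S" using exp_le S by linarith
 hence l1: "ln S \<ge> 1" using S by (subst ln_ge_iff) auto
 have "S ^ 16 = exp (real 16 * ln S)" unfolding exp_of_nat_mult using S by simp
 also have "\<dots> \<le> exp (16 * (ln S)\<^sup>2)" using self_le_power[OF l1, of 2] by simp
 finally show "S ^ 16 \<le> exp (16 * (ln S)\<^sup>2)" .
 qed (use B in \<open>simp add: C_def\<close>)
 also have "\<dots> \<le> C * max (exp (16 * (ln S)\<^sup>2)) ((1 + u + v) powr 5.34)" using B by (intro mult_left_mono) (auto simp: C_def)
 finally show "real (first_opposite_sign lam_f lam_g) \<le> C * max (exp (16 * (ln (sqrt (max (sym2_conductor u) (sym2_conductor v))))\<^sup>2)) ((1 + u + v) powr 5.34)"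
 unfolding S_def .
 qed
qed

end
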